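(* In the setting and notation of the context, let $$\mathbb F:=\mathbb R\oplus\bigoplus_{(l_1,\dots,l_i)\in M}\mathbb H_{(l_1,\dots,l_i)}.$$ Then the following operator is unitary and gives an orthogonal expansion of $L^2(\tau)$ in non-commutative multiple stochastic integrals: $$\mathbb F\ni F=(c,(f^{(l_1,\dots,l_i)})_{(l_1,\dots,l_i)\in M})\mapsto JF:=c\mathbf 1+\sum_{(l_1,\dots,l_i)\in M}\int_{T^i}f^{(l_1,\dots,l_i)}(t_1,\dots,t_i)X^{(l_1)}(dt_1)\cdots X^{(l_i)}(dt_i)\in L^2(\tau).$$ In terms of this orthogonal expansion, $$L^2(\tau)=\mathbb R\oplus\bigoplus_{(l_1,\dots,l_i)\in M}\mathbf H_{(l_1,\dots,l_i)},$$ where $\mathbb R$ denotes the space of all operators $c\mathbf 1$, $c\in\mathbb R$.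
   Context: $T$ is a locally compact, second countable Hausdorff space without isolated points; $\mathcal B_0(T)$ is the family of relatively compact Borel sets; $\sigma$ is a Radon non-atomic measure on $T$ with $\sigma(O)>0$ for every non-empty open $O$. For each $t\in T$, $\mu(t,\cdot)$ is a probability measure on $\mathbb R$; $t\mapsto\mu(t,A)$ is measurable for each Borel $A$; and for each $\Delta\in\mathcal B_0(T)$ there is $R=R(\Delta)>0$ such that $\mu(t,\cdot)$ is supported in $[-R,R]$ for all $t\in\Delta$. Put $\tilde T=T\times\mathbb R$, $\tilde\sigma(dt,ds)=\sigma(dt)\mu(t,ds)$, $\mathcal H=L^2(\tilde T,\tilde\sigma)$ (real), $\mathcal F(\mathcal H)=\mathbb R\oplus\bigoplus_{n\ge1}\mathcal H^{\otimes n}$ the full Fock space with vacuum $\Omega=(1,0,0,\dots)$. Operators on $\mathcal F(\mathcal H)$: $a^+(h)g^{(n)}=h\otimes g^{(n)}$; $a^-(h)g_1\otimes\dots\otimes g_n=(h,g_1)_{\mathcal H}\,g_2\otimes\dots\otimes g_n$; $a^0(h)g_1\otimes\dots\otimes g_n=(hg_1)\otimes g_2\otimes\dots\otimes g_n$; $a^-(h)\Omega=a^0(h)\Omega=0$. For a bounded measurable $h$ on $\tilde T$ supported in $\Delta\times\mathbb R$ with $\Delta\in\mathcal B_0(T)$ ("bounded support"), put $x(h)=a^+(h)+a^-(h)+a^0(sh)$, where $(sh)(t,s)=s\,h(t,s)$ (values of $h$ outside the supports of $\mu(t,\cdot)$ are irrelevant, so $h$ only needs to be $\tilde\sigma$-essentially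 bounded). $L^2(\tau)$ is the real Hilbert space obtained by completing the set of (non-commutative) polynomials in the operators $x(h)$, $h$ bounded continuous on $\tilde T$ with bounded support, with respect to $\|P\|_{L^2(\tau)}=\|P\Omega\|_{\mathcal F(\mathcal H)}$; the map $I:P\mapsto P\Omega$ extends to a unitary operator $I:L^2(\tau)\to\mathcal F(\mathcal H)$. Bounded operators $P$ that are polynomials in $x(h)$ with $h$ bounded measurable of bounded support are regarded as elements of $L^2(\tau)$ via $I^{-1}(P\Omega)$; in particular $c\mathbf 1$ corresponds to $c\Omega$. For each $t$, $(p^{(n)}(t,\cdot))_{n\ge0}$ are the monic orthogonal polynomials of $\mu(t,\cdot)$ (with $p^{(n)}(t,\cdot):=0$ for $n\ge N$ if $\mu(t,\cdot)$ is supported on exactly $N$ points). Put $w_l(t)=\int_{\mathbb R}\mu(t,ds)|p^{(l)}(t,s)|^2$, $\sigma^{(l)}(dt)=w_l(t)\sigma(dt)$. $M$ is the set of all multi-indices $(l_1,\dots,l_i)\in\mathbb N_0^i$, $i\in\mathbb N$. For $(l_1,\dots,l_i)\in M$: - $\mathbb H_{(l_1,\dots,l_i)}:=L^2(T^i,\sigma^{(l_1)}\otimes\dots\otimes\sigma^{(l_i)})$; - $\mathcal H_{(l_1,\dots,l_i)}\subset\mathcal H^{\otimes i}$ is the range of the isometry $\mathbb H_{(l_1,\dots,l_i)}\ni f\mapsto f(t_1,\dots,t_i)p^{(l_1)}(t_1,s_1)\cdots p^{(l_i)}(t_i,s_i)$; - $\mathbf H_{(l_1,\dots,l_i)}:=I^{-1}\mathcal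 H_{(l_1,\dots,l_i)}$. For $\Delta\in\mathcal B_0(T)$, $l\in\mathbb N_0$: $X^{(l)}(\Delta):=x(h)$ with $h(t,s)=\chi_\Delta(t)p^{(l)}(t,s)$. The multiple stochastic integral $\int_{T^i}f\,X^{(l_1)}(dt_1)\cdots X^{(l_i)}(dt_i)$, $f\in\mathbb H_{(l_1,\dots,l_i)}$, is the element of $\mathbf H_{(l_1,\dots,l_i)}$ defined as $X^{(l_1)}(\Delta_1)\cdots X^{(l_i)}(\Delta_i)$ for $f=\chi_{\Delta_1}\otimes\dots\otimes\chi_{\Delta_i}$ with $\Delta_1,\dots,\Delta_i\in\mathcal B_0(T)$, $\Delta_j\cap\Delta_{j+1}=\varnothing$ for $j=1,\dots,i-1$, and extended by linearity and isometry (continuity) to all of $\mathbb H_{(l_1,\dots,l_i)}$. *)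

theory Defs
  imports
    "HOL-Analysis.Analysis"
    "HOL-Probability.Probability_Measure"
    "HOL-Computational_Algebra.Polynomial"
    "HOL-Algebra.FiniteProduct"
begin

section \<open>Real inner product spaces given by carriers\<close>

text \<open>
  The spaces needed here depend on measures, i.e. on terms, so they cannot be types of class
  \<^class>\<open>real_inner\<close>. They are records with an explicit carrier; the fields are meaningful on the
  carrier only. The inner product may be merely positive semidefinite (see the completion below).
\<close>

record 'v ip_space =
  carr :: "'v set"
  vadd :: "'v \<Rightarrow> 'v \<Rightarrow> 'v"
  vscale :: "real \<Rightarrow> 'v \<Rightarrow> 'v"
  vzero :: "'v"
  vinner :: "'v \<Rightarrow> 'v \<Rightarrow> real"

definition vnorm :: "'v ip_space \<Rightarrow> 'v \<Rightarrow> real" where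
  "vnorm V v = sqrt (vinner V v v)"

definition vdist :: "'v ip_space \<Rightarrow> 'v \<Rightarrow> 'v \<Rightarrow> real" where
  "vdist V u v = vnorm V (vadd V u (vscale V (-1) v))"

definition vfinsum :: "'v ip_space \<Rightarrow> ('i \<Rightarrow> 'v) \<Rightarrow> 'i set \<Rightarrow> 'v" where
  "vfinsum V x F = foldD (carr V) (\<lambda>i. vadd V (x i)) (vzero V) F"

text \<open>Unconditional norm convergence of a series, as in \<^const>\<open>has_sum\<close>.\<close>

definition vhas_sum :: "'v ip_space \<Rightarrow> ('i \<Rightarrow> 'v) \<Rightarrow> 'i set \<Rightarrow> 'v \<Rightarrow> bool" where
  "vhas_sum V x I v \<longleftrightarrow> v \<in> carr V \<and> (\<forall>i\<in>I. x i \<in> carr V) \<and>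
     ((\<lambda>F. vdist V (vfinsum V x F) v) \<longlongrightarrow> 0) (finite_subsets_at_top I)"

definition vsum :: "'v ip_space \<Rightarrow> ('i \<Rightarrow> 'v) \<Rightarrow> 'i set \<Rightarrow> 'v" where
  "vsum V x I = (THE v. vhas_sum V x I v)"

definition linear_maps :: "'v ip_space \<Rightarrow> 'w ip_space \<Rightarrow> ('v \<Rightarrow> 'w) set" where
  "linear_maps V W = {A \<in> carr V \<rightarrow> carr W.
     (\<forall>u\<in>carr V. \<forall>v\<in>carr V. A (vadd V u v) = vadd W (A u) (A v)) \<and>
     (\<forall>c. \<forall>v\<in>carr V. A (vscale V c v) = vscale W c (A v))}"

text \<open>
  Bounded operators take the value \<^const>\<open>undefined\<close> off the carrier, so that they are determined by
  their values on it.
\<close>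

definition bounded_ops :: "'v ip_space \<Rightarrow> 'w ip_space \<Rightarrow> ('v \<Rightarrow> 'w) set" where
  "bounded_ops V W = {A \<in> linear_maps V W. A \<in> extensional (carr V) \<and>
     (\<exists>C. \<forall>v\<in>carr V. vnorm W (A v) \<le> C * vnorm V v)}"

definition unitary :: "'v ip_space \<Rightarrow> 'w ip_space \<Rightarrow> ('v \<Rightarrow> 'w) \<Rightarrow> bool" where
  "unitary V W U \<longleftrightarrow> U \<in> linear_maps V W \<and> bij_betw U (carr V) (carr W) \<and>
     (\<forall>u\<in>carr V. \<forall>v\<in>carr V. vinner W (U u) (U v) = vinner V u v)"

definition closed_subspace :: "'v ip_space \<Rightarrow> 'v set \<Rightarrow> bool" where
  "closed_subspace V S \<longleftrightarrow> S \<subseteq> carr V \<and> vzero V \<in> S \<and>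
     (\<forall>u\<in>S. \<forall>v\<in>S. vadd V u v \<in> S) \<and> (\<forall>c. \<forall>v\<in>S. vscale V c v \<in> S) \<and>
     (\<forall>u v. (\<forall>n::nat. u n \<in> S) \<and> v \<in> carr V \<and> (\<lambda>n. vdist V (u n) v) \<longlonglongrightarrow> 0 \<longrightarrow> v \<in> S)"

text \<open>\<open>V\<close> is the (internal) Hilbert space direct sum of the closed subspaces \<open>S k\<close>, \<open>k \<in> K\<close>.\<close>

definition orthogonal_sum :: "'v ip_space \<Rightarrow> 'k set \<Rightarrow> ('k \<Rightarrow> 'v set) \<Rightarrow> bool" where
  "orthogonal_sum V K S \<longleftrightarrow> (\<forall>k\<in>K. closed_subspace V (S k)) \<and>
     (\<forall>k\<in>K. \<forall>m\<in>K. k \<noteq> m \<longrightarrow> (\<forall>u\<in>S k. \<forall>v\<in>S m. vinner V u v = 0)) \<and>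
     (\<forall>v\<in>carr V. \<exists>x. (\<forall>k\<in>K. x k \<in> S k) \<and> vhas_sum V x K v)"

definition dsum :: "'i set \<Rightarrow> ('i \<Rightarrow> 'v ip_space) \<Rightarrow> ('i \<Rightarrow> 'v) ip_space" where
  "dsum I V = \<lparr>
     carr = {f \<in> (\<Pi>\<^sub>E i\<in>I. carr (V i)). (\<lambda>i. (vnorm (V i) (f i))\<^sup>2) summable_on I},
     vadd = (\<lambda>f g. \<lambda>i\<in>I. vadd (V i) (f i) (g i)),
     vscale = (\<lambda>c f. \<lambda>i\<in>I. vscale (V i) c (f i)),
     vzero = (\<lambda>i\<in>I. vzero (V i)),
     vinner = (\<lambda>f g. \<Sum>\<^sub>\<infinity>i\<in>I. vinner (V i) (f i) (g i)) \<rparr>"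

definition real_dsum :: "'v ip_space \<Rightarrow> (real \<times> 'v) ip_space" where
  "real_dsum V = \<lparr>
     carr = UNIV \<times> carr V,
     vadd = (\<lambda>(a, u) (b, v). (a + b, vadd V u v)),
     vscale = (\<lambda>c (a, u). (c * a, vscale V c u)),
     vzero = (0, vzero V),
     vinner = (\<lambda>(a, u) (b, v). a * b + vinner V u v) \<rparr>"

text \<open>The completion: classes of Cauchy sequences modulo sequences at distance tending to zero.\<close>

definition cauchy_seqs :: "'v ip_space \<Rightarrow> (nat \<Rightarrow> 'v) set" where
  "cauchy_seqs V = {u. (\<forall>n. u n \<in> carr V) \<and>
     (\<forall>e>0. \<exists>N. \<forall>m\<ge>N. \<forall>n\<ge>N. vdist V (u m) (u n) < e)}"

definition cauchy_class :: "'v ip_space \<Rightarrow> (nat \<Rightarrow> 'v) \<Rightarrow> (nat \<Rightarrow> 'v) set" where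
  "cauchy_class V u = {u' \<in> cauchy_seqs V. (\<lambda>n. vdist V (u' n) (u n)) \<longlonglongrightarrow> 0}"

definition rep :: "'b set \<Rightarrow> 'b" where
  "rep A = (SOME a. a \<in> A)"

definition completion :: "'v ip_space \<Rightarrow> (nat \<Rightarrow> 'v) set ip_space" where
  "completion V = \<lparr>
     carr = cauchy_class V ` cauchy_seqs V,
     vadd = (\<lambda>a b. cauchy_class V (\<lambda>n. vadd V (rep a n) (rep b n))),
     vscale = (\<lambda>c a. cauchy_class V (\<lambda>n. vscale V c (rep a n))),
     vzero = cauchy_class V (\<lambda>_. vzero V),
     vinner = (\<lambda>a b. lim (\<lambda>n. vinner V (rep a n) (rep b n))) \<rparr>"

definition completion_embed :: "'v ip_space \<Rightarrow> 'v \<Rightarrow> (nat \<Rightarrow> 'v) set" where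
  "completion_embed V v = cauchy_class V (\<lambda>_. v)"


section \<open>Square integrable functions\<close>

definition sqint :: "'x measure \<Rightarrow> ('x \<Rightarrow> real) set" where
  "sqint M = {f \<in> borel_measurable M. integrable M (\<lambda>x. (f x)\<^sup>2)}"

definition ae_class :: "'x measure \<Rightarrow> ('x \<Rightarrow> real) \<Rightarrow> ('x \<Rightarrow> real) set" where
  "ae_class M f = {g \<in> sqint M. AE x in M. g x = f x}"

definition l2 :: "'x measure \<Rightarrow> ('x \<Rightarrow> real) set ip_space" where
  "l2 M = \<lparr>
     carr = ae_class M ` sqint M,
     vadd = (\<lambda>a b. ae_class M (\<lambda>x. rep a x + rep b x)),
     vscale = (\<lambda>c a. ae_class M (\<lambda>x. c * rep a x)),
     vzero = ae_class M (\<lambda>_. 0),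
     vinner = (\<lambda>a b. \<integral>x. rep a x * rep b x \<partial>M) \<rparr>"


section \<open>The full Fock space over an $L^2$ space\<close>

text \<open>
  The \<open>n\<close>-fold Hilbert space tensor power of \<open>l2 N\<close> is realised as \<open>l2\<close> of the \<open>n\<close>-fold product
  measure, with \<open>g\<^sub>1 \<otimes> \<dots> \<otimes> g\<^sub>n\<close> the function \<open>z \<mapsto> g\<^sub>1(z\<^sub>1) \<dots> g\<^sub>n(z\<^sub>n)\<close>; coordinates are
  numbered from 0.
\<close>

type_synonym 'z fock_vec = "real \<times> (nat \<Rightarrow> ((nat \<Rightarrow> 'z) \<Rightarrow> real) set)"

definition power_measure :: "nat \<Rightarrow> 'z measure \<Rightarrow> (nat \<Rightarrow> 'z) measure" where
  "power_measure n N = PiM {..<n} (\<lambda>_. N)"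

definition fock :: "'z measure \<Rightarrow> 'z fock_vec ip_space" where
  "fock N = real_dsum (dsum {1..} (\<lambda>n. l2 (power_measure n N)))"

definition vacuum :: "'z measure \<Rightarrow> 'z fock_vec" where
  "vacuum N = (1, \<lambda>n\<in>{1..}. vzero (l2 (power_measure n N)))"

definition fock_embed :: "'z measure \<Rightarrow> nat \<Rightarrow> ((nat \<Rightarrow> 'z) \<Rightarrow> real) set \<Rightarrow> 'z fock_vec" where
  "fock_embed N n v = (0, \<lambda>k\<in>{1..}. if k = n then v else vzero (l2 (power_measure k N)))"

text \<open>The elementary tensor of a list of functions; the empty tensor is the vacuum.\<close>

definition tensor :: "'z measure \<Rightarrow> ('z \<Rightarrow> real) list \<Rightarrow> 'z fock_vec" where
  "tensor N gs = (if gs = [] then vacuum N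
     else fock_embed N (length gs)
       (ae_class (power_measure (length gs) N) (\<lambda>z. \<Prod>j<length gs. (gs ! j) (z j))))"

text \<open>
  Creation, annihilation and neutral operators: the bounded operators with the prescribed action on
  elementary tensors, the span of which is dense. These descriptions are meaningful for square
  integrable \<open>h\<close>, and for \<open>neutral\<close> if \<open>h\<close> is moreover essentially bounded.
\<close>

definition creation :: "'z measure \<Rightarrow> ('z \<Rightarrow> real) \<Rightarrow> 'z fock_vec \<Rightarrow> 'z fock_vec" where
  "creation N h = (THE A. A \<in> bounded_ops (fock N) (fock N) \<and>
     (\<forall>gs\<in>lists (sqint N). A (tensor N gs) = tensor N (h # gs)))"

definition annihilation :: "'z measure \<Rightarrow> ('z \<Rightarrow> real) \<Rightarrow> 'z fock_vec \<Rightarrow> 'z fock_vec" where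
  "annihilation N h = (THE A. A \<in> bounded_ops (fock N) (fock N) \<and>
     A (vacuum N) = vzero (fock N) \<and>
     (\<forall>g\<in>sqint N. \<forall>gs\<in>lists (sqint N).
        A (tensor N (g # gs)) =
          vscale (fock N) (vinner (l2 N) (ae_class N h) (ae_class N g)) (tensor N gs)))"

definition neutral :: "'z measure \<Rightarrow> ('z \<Rightarrow> real) \<Rightarrow> 'z fock_vec \<Rightarrow> 'z fock_vec" where
  "neutral N h = (THE A. A \<in> bounded_ops (fock N) (fock N) \<and>
     A (vacuum N) = vzero (fock N) \<and>
     (\<forall>g\<in>sqint N. \<forall>gs\<in>lists (sqint N).
        A (tensor N (g # gs)) = tensor N ((\<lambda>z. h z * g z) # gs)))"


section \<open>Algebra of operators\<close>

definition op_add :: "'v ip_space \<Rightarrow> ('v \<Rightarrow> 'v) \<Rightarrow> ('v \<Rightarrow> 'v) \<Rightarrow> 'v \<Rightarrow> 'v" where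
  "op_add V A B = (\<lambda>v\<in>carr V. vadd V (A v) (B v))"

definition op_scale :: "'v ip_space \<Rightarrow> real \<Rightarrow> ('v \<Rightarrow> 'v) \<Rightarrow> 'v \<Rightarrow> 'v" where
  "op_scale V c A = (\<lambda>v\<in>carr V. vscale V c (A v))"

definition op_one :: "'v ip_space \<Rightarrow> 'v \<Rightarrow> 'v" where
  "op_one V = (\<lambda>v\<in>carr V. v)"

definition op_mult :: "'v ip_space \<Rightarrow> ('v \<Rightarrow> 'v) \<Rightarrow> ('v \<Rightarrow> 'v) \<Rightarrow> 'v \<Rightarrow> 'v" where
  "op_mult V A B = (\<lambda>v\<in>carr V. A (B v))"

definition op_prod :: "'v ip_space \<Rightarrow> ('v \<Rightarrow> 'v) list \<Rightarrow> 'v \<Rightarrow> 'v" where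
  "op_prod V As = foldr (op_mult V) As (op_one V)"

inductive_set op_polynomials :: "'v ip_space \<Rightarrow> ('v \<Rightarrow> 'v) set \<Rightarrow> ('v \<Rightarrow> 'v) set"
  for V :: "'v ip_space" and G :: "('v \<Rightarrow> 'v) set" where
  one: "op_one V \<in> op_polynomials V G"
| generator: "A \<in> G \<Longrightarrow> A \<in> op_polynomials V G"
| scale: "A \<in> op_polynomials V G \<Longrightarrow> op_scale V c A \<in> op_polynomials V G"
| add: "A \<in> op_polynomials V G \<Longrightarrow> B \<in> op_polynomials V G \<Longrightarrow> op_add V A B \<in> op_polynomials V G"
| mult: "A \<in> op_polynomials V G \<Longrightarrow> B \<in> op_polynomials V G \<Longrightarrow> op_mult V A B \<in> op_polynomials V G"


section \<open>The underlying measures and orthogonal polynomials\<close>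

definition rel_compact_borel :: "'a::topological_space set set" where
  "rel_compact_borel = {A \<in> sets borel. compact (closure A)}"

definition radon_measure :: "'a::topological_space measure \<Rightarrow> bool" where
  "radon_measure M \<longleftrightarrow> sets M = sets borel \<and>
     (\<forall>K. compact K \<and> K \<in> sets borel \<longrightarrow> emeasure M K < \<infinity>) \<and>
     (\<forall>A\<in>sets borel. emeasure M A = (SUP K\<in>{K \<in> sets borel. compact K \<and> K \<subseteq> A}. emeasure M K))"

definition non_atomic :: "'a measure \<Rightarrow> bool" where
  "non_atomic M \<longleftrightarrow> (\<forall>A\<in>sets M. emeasure M A > 0 \<longrightarrow>
     (\<exists>B\<in>sets M. B \<subseteq> A \<and> 0 < emeasure M B \<and> emeasure M B < emeasure M A))"

definition kernel_measure ::
    "'a::topological_space measure \<Rightarrow> ('a \<Rightarrow> real measure) \<Rightarrow> ('a \<times> real) measure" where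
  "kernel_measure \<sigma> \<mu> = measure_of UNIV (sets (borel \<Otimes>\<^sub>M borel))
     (\<lambda>A. \<integral>\<^sup>+ t. emeasure (\<mu> t) {s. (t, s) \<in> A} \<partial>\<sigma>)"

definition topological_support :: "real measure \<Rightarrow> real set" where
  "topological_support \<nu> = {s. \<forall>U. open U \<and> s \<in> U \<longrightarrow> emeasure \<nu> U > 0}"

text \<open>
  A measure on the line is supported on exactly \<open>N\<close> points iff its topological support is finite
  with \<open>N\<close> elements.
\<close>

definition orth_polys :: "real measure \<Rightarrow> nat \<Rightarrow> real poly" where
  "orth_polys \<nu> = (THE p. \<forall>n.
     if finite (topological_support \<nu>) \<and> card (topological_support \<nu>) \<le> n then p n = 0
     else degree (p n) = n \<and> lead_coeff (p n) = 1 \<and>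
          (\<forall>m<n. (\<integral>s. poly (p m) s * poly (p n) s \<partial>\<nu>) = 0))"

definition weight :: "('a \<Rightarrow> real measure) \<Rightarrow> nat \<Rightarrow> 'a \<Rightarrow> real" where
  "weight \<mu> l t = (\<integral>s. \<bar>poly (orth_polys (\<mu> t) l) s\<bar>\<^sup>2 \<partial>\<mu> t)"

definition weighted_measure :: "'a measure \<Rightarrow> ('a \<Rightarrow> real measure) \<Rightarrow> nat \<Rightarrow> 'a measure" where
  "weighted_measure \<sigma> \<mu> l = density \<sigma> (\<lambda>t. ennreal (weight \<mu> l t))"


section \<open>The process and the space of its square integrable functionals\<close>

type_synonym 'a op = "('a \<times> real) fock_vec \<Rightarrow> ('a \<times> real) fock_vec"

abbreviation fock_space ::
    "'a::topological_space measure \<Rightarrow> ('a \<Rightarrow> real measure) \<Rightarrow> ('a \<times> real) fock_vec ip_space" where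
  "fock_space \<sigma> \<mu> \<equiv> fock (kernel_measure \<sigma> \<mu>)"

definition x_op :: "'a::topological_space measure \<Rightarrow> ('a \<Rightarrow> real measure) \<Rightarrow>
    ('a \<times> real \<Rightarrow> real) \<Rightarrow> 'a op" where
  "x_op \<sigma> \<mu> h = (let N = kernel_measure \<sigma> \<mu> in
     op_add (fock N) (op_add (fock N) (creation N h) (annihilation N h))
       (neutral N (\<lambda>(t, s). s * h (t, s))))"

definition test_functions :: "('a::topological_space \<times> real \<Rightarrow> real) set" where
  "test_functions = {h. continuous_on UNIV h \<and> bounded (range h) \<and>
     (\<exists>\<Delta>\<in>rel_compact_borel. \<forall>t s. t \<notin> \<Delta> \<longrightarrow> h (t, s) = 0)}"

text \<open>The polynomials in \<open>x(h)\<close> with \<open>\<langle>P, Q\<rangle> = (P\<Omega>, Q\<Omega>)\<close>, i.e. with norm \<open>\<parallel>P\<Omega>\<parallel>\<close>.\<close>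

definition polynomial_space :: "'a::topological_space measure \<Rightarrow> ('a \<Rightarrow> real measure) \<Rightarrow>
    'a op ip_space" where
  "polynomial_space \<sigma> \<mu> = (let F = fock_space \<sigma> \<mu>; \<Omega> = vacuum (kernel_measure \<sigma> \<mu>) in \<lparr>
     carr = op_polynomials F (x_op \<sigma> \<mu> ` test_functions),
     vadd = op_add F,
     vscale = op_scale F,
     vzero = op_scale F 0 (op_one F),
     vinner = (\<lambda>P Q. vinner F (P \<Omega>) (Q \<Omega>)) \<rparr>)"

definition L2_tau :: "'a::topological_space measure \<Rightarrow> ('a \<Rightarrow> real measure) \<Rightarrow>
    (nat \<Rightarrow> 'a op) set ip_space" where
  "L2_tau \<sigma> \<mu> = completion (polynomial_space \<sigma> \<mu>)"

definition I_map :: "'a::topological_space measure \<Rightarrow> ('a \<Rightarrow> real measure) \<Rightarrow>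
    (nat \<Rightarrow> 'a op) set \<Rightarrow> ('a \<times> real) fock_vec" where
  "I_map \<sigma> \<mu> = (THE U. U \<in> bounded_ops (L2_tau \<sigma> \<mu>) (fock_space \<sigma> \<mu>) \<and>
     (\<forall>P\<in>carr (polynomial_space \<sigma> \<mu>).
        U (completion_embed (polynomial_space \<sigma> \<mu>) P) = P (vacuum (kernel_measure \<sigma> \<mu>))))"

text \<open>A bounded operator \<open>P\<close> as an element \<open>I\<^sup>-\<^sup>1(P\<Omega>)\<close> of \<open>L2_tau\<close>.\<close>

definition op_element :: "'a::topological_space measure \<Rightarrow> ('a \<Rightarrow> real measure) \<Rightarrow>
    'a op \<Rightarrow> (nat \<Rightarrow> 'a op) set" where
  "op_element \<sigma> \<mu> P =
     inv_into (carr (L2_tau \<sigma> \<mu>)) (I_map \<sigma> \<mu>) (P (vacuum (kernel_measure \<sigma> \<mu>)))"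

definition const_element :: "'a::topological_space measure \<Rightarrow> ('a \<Rightarrow> real measure) \<Rightarrow>
    real \<Rightarrow> (nat \<Rightarrow> 'a op) set" where
  "const_element \<sigma> \<mu> c =
     op_element \<sigma> \<mu> (op_scale (fock_space \<sigma> \<mu>) c (op_one (fock_space \<sigma> \<mu>)))"


section \<open>Multiple stochastic integrals\<close>

definition multi_indices :: "nat list set" where
  "multi_indices = {l. l \<noteq> []}"

definition index_measure :: "'a measure \<Rightarrow> ('a \<Rightarrow> real measure) \<Rightarrow> nat list \<Rightarrow> (nat \<Rightarrow> 'a) measure" where
  "index_measure \<sigma> \<mu> l = PiM {..<length l} (\<lambda>j. weighted_measure \<sigma> \<mu> (l ! j))"

text \<open>The spaces \<open>\<bbbH>\<close>, \<open>\<H>\<close> (embedded into the Fock space) and \<open>\<^bold>H\<close> with multi-index \<open>l\<close>.\<close>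

definition index_L2 :: "'a measure \<Rightarrow> ('a \<Rightarrow> real measure) \<Rightarrow> nat list \<Rightarrow>
    ((nat \<Rightarrow> 'a) \<Rightarrow> real) set ip_space" where
  "index_L2 \<sigma> \<mu> l = l2 (index_measure \<sigma> \<mu> l)"

definition fock_subspace :: "'a::topological_space measure \<Rightarrow> ('a \<Rightarrow> real measure) \<Rightarrow> nat list \<Rightarrow>
    ('a \<times> real) fock_vec set" where
  "fock_subspace \<sigma> \<mu> l = (let i = length l; N = kernel_measure \<sigma> \<mu> in
     (\<lambda>f. fock_embed N i (ae_class (power_measure i N)
        (\<lambda>z. f (\<lambda>j\<in>{..<i}. fst (z j)) *
           (\<Prod>j<i. poly (orth_polys (\<mu> (fst (z j))) (l ! j)) (snd (z j))))))
     ` sqint (index_measure \<sigma> \<mu> l))"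

definition tau_subspace :: "'a::topological_space measure \<Rightarrow> ('a \<Rightarrow> real measure) \<Rightarrow> nat list \<Rightarrow>
    (nat \<Rightarrow> 'a op) set set" where
  "tau_subspace \<sigma> \<mu> l = {u \<in> carr (L2_tau \<sigma> \<mu>). I_map \<sigma> \<mu> u \<in> fock_subspace \<sigma> \<mu> l}"

definition X_op :: "'a::topological_space measure \<Rightarrow> ('a \<Rightarrow> real measure) \<Rightarrow> nat \<Rightarrow> 'a set \<Rightarrow> 'a op" where
  "X_op \<sigma> \<mu> l \<Delta> = x_op \<sigma> \<mu> (\<lambda>(t, s). indicator \<Delta> t * poly (orth_polys (\<mu> t) l) s)"

text \<open>
  The continuous linear extension of the prescription on products of indicators of relatively
  compact sets, neighbouring ones disjoint; the span of these products is dense.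
\<close>

definition stoch_integral :: "'a::topological_space measure \<Rightarrow> ('a \<Rightarrow> real measure) \<Rightarrow> nat list \<Rightarrow>
    ((nat \<Rightarrow> 'a) \<Rightarrow> real) set \<Rightarrow> (nat \<Rightarrow> 'a op) set" where
  "stoch_integral \<sigma> \<mu> l = (THE S. S \<in> bounded_ops (index_L2 \<sigma> \<mu> l) (L2_tau \<sigma> \<mu>) \<and>
     S ` carr (index_L2 \<sigma> \<mu> l) \<subseteq> tau_subspace \<sigma> \<mu> l \<and>
     (\<forall>\<Delta>\<in>lists rel_compact_borel. length \<Delta> = length l \<and>
        (\<forall>j. Suc j < length l \<longrightarrow> \<Delta> ! j \<inter> \<Delta> ! Suc j = {}) \<longrightarrow>
        S (ae_class (index_measure \<sigma> \<mu> l) (\<lambda>t. \<Prod>j<length l. indicator (\<Delta> ! j) (t j))) =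
        op_element \<sigma> \<mu> (op_prod (fock_space \<sigma> \<mu>) (map2 (X_op \<sigma> \<mu>) l \<Delta>))))"

definition expansion_space :: "'a measure \<Rightarrow> ('a \<Rightarrow> real measure) \<Rightarrow>
    (real \<times> (nat list \<Rightarrow> ((nat \<Rightarrow> 'a) \<Rightarrow> real) set)) ip_space" where
  "expansion_space \<sigma> \<mu> = real_dsum (dsum multi_indices (index_L2 \<sigma> \<mu>))"

definition J_map :: "'a::topological_space measure \<Rightarrow> ('a \<Rightarrow> real measure) \<Rightarrow>
    real \<times> (nat list \<Rightarrow> ((nat \<Rightarrow> 'a) \<Rightarrow> real) set) \<Rightarrow> (nat \<Rightarrow> 'a op) set" where
  "J_map \<sigma> \<mu> F = vadd (L2_tau \<sigma> \<mu>) (const_element \<sigma> \<mu> (fst F))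
     (vsum (L2_tau \<sigma> \<mu>) (\<lambda>l. stoch_integral \<sigma> \<mu> l (snd F l)) multi_indices)"

text \<open>
  The summands of the expansion are indexed by \<open>None\<close> (the constants) and by \<open>Some l\<close> for
  multi-indices \<open>l\<close>.
\<close>

definition summand_indices :: "nat list option set" where
  "summand_indices = insert None (Some ` multi_indices)"

definition summand :: "'a::topological_space measure \<Rightarrow> ('a \<Rightarrow> real measure) \<Rightarrow>
    nat list option \<Rightarrow> (nat \<Rightarrow> 'a op) set set" where
  "summand \<sigma> \<mu> k = (case k of None \<Rightarrow> range (const_element \<sigma> \<mu>) | Some l \<Rightarrow> tau_subspace \<sigma> \<mu> l)"

definition expansion_term :: "'a::topological_space measure \<Rightarrow> ('a \<Rightarrow> real measure) \<Rightarrow>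
    real \<times> (nat list \<Rightarrow> ((nat \<Rightarrow> 'a) \<Rightarrow> real) set) \<Rightarrow> nat list option \<Rightarrow> (nat \<Rightarrow> 'a op) set" where
  "expansion_term \<sigma> \<mu> F k = (case k of None \<Rightarrow> const_element \<sigma> \<mu> (fst F)
     | Some l \<Rightarrow> stoch_integral \<sigma> \<mu> l (snd F l))"

end

theory Submission
  imports Defs "HOL-Probability.Giry_Monad"
begin

text \<open>
  Since \<open>x(h) (g\<^sub>1 \<otimes> \<dots> \<otimes> g\<^sub>n)\<close> has leading term \<open>h \<otimes> g\<^sub>1 \<otimes> \<dots> \<otimes> g\<^sub>n\<close>, the vacuum is cyclic, and \<open>I\<close> is
  unitary. It therefore suffices to decompose the Fock space. The maps \<open>f \<mapsto> f p\<^sup>(\<^sup>l\<^sup>1\<^sup>)\<dots>p\<^sup>(\<^sup>l\<^sup>i\<^sup>)\<close> are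
  isometries, with orthogonal ranges because the \<open>p\<^sup>(\<^sup>l\<^sup>)(t, \<cdot>)\<close> are orthogonal in \<open>L\<^sup>2(\<mu>(t, \<cdot>))\<close>.
  Together with the vacuum the ranges are total: by the three-term recurrence the span of the functions
  \<open>f(t) p\<^sup>(\<^sup>l\<^sup>)(t, s)\<close> is invariant under multiplication by \<open>s\<close>, and polynomials are dense in
  \<open>L\<^sup>2(\<mu>(t, \<cdot>))\<close> by Weierstrass' theorem.

  If neighbouring sets among the \<open>\<Delta>\<^sub>j\<close> are disjoint, then the annihilation and neutral parts in
  \<open>X\<^sup>(\<^sup>l\<^sup>1\<^sup>)(\<Delta>\<^sub>1) \<dots> X\<^sup>(\<^sup>l\<^sup>i\<^sup>)(\<Delta>\<^sub>i) \<Omega>\<close> vanish, and what remains is the image of the indicator function of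
  \<open>\<Delta>\<^sub>1 \<times> \<dots> \<times> \<Delta>\<^sub>i\<close> under the isometry above. As \<open>\<sigma>\<close> is non-atomic, almost every point of \<open>T\<^sup>i\<close> lies in
  such a product, so that these indicator functions are total and determine the stochastic integral.
\<close>

section \<open>Inner product spaces\<close>

text \<open>\<open>creation\<close>, \<open>annihilation\<close>, \<open>neutral\<close>,
  \<open>I_map\<close> and \<open>stoch_integral\<close> are definite descriptions, so nothing can
  be said about them before existence and uniqueness are known. Uniqueness is always the same fact:
  bounded maps that agree on a set contained in no proper closed subspace are equal. The Fock space
  operators exist by one extension principle: a map on a total set that multiplies all inner
  products by a fixed constant extends to the whole space. Creation is of this kind; annihilation is
  not, and is obtained as an adjoint; multiplication in the first factor is one component of such a
  map into two copies of the Fock space. The other obstacle is the dependence of the polynomials on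
  t. Their description yields neither measurability nor uniform bounds, so they are rebuilt from the
  three-term recurrence: the coefficients become measurable functions of finitely many moments, and
  over a relatively compact set the polynomials are bounded by a constant depending on R and the
  degree only. Density in the various L^2 spaces comes down to one Dynkin class argument inside sets
  of finite measure.\<close>

lemma closed_subspaceI:
  assumes "S \<subseteq> carr V" "vzero V \<in> S"
    and "\<And>u v. u \<in> S \<Longrightarrow> v \<in> S \<Longrightarrow> vadd V u v \<in> S"
    and "\<And>c v. v \<in> S \<Longrightarrow> vscale V c v \<in> S"
    and "\<And>u v. (\<And>n::nat. u n \<in> S) \<Longrightarrow> v \<in> carr V \<Longrightarrow> (\<lambda>n. vdist V (u n) v) \<longlonglongrightarrow> 0 \<Longrightarrow> v \<in> S"
  shows "closed_subspace V S"
  unfolding closed_subspace_def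
  by (intro conjI assms(1,2) ballI allI impI assms(3,4)) (auto intro: assms(5))

lemma closed_subspaceD:
  assumes "closed_subspace V S"
  shows "v \<in> S \<Longrightarrow> v \<in> carr V" "vzero V \<in> S"
    and "u \<in> S \<Longrightarrow> v \<in> S \<Longrightarrow> vadd V u v \<in> S" "v \<in> S \<Longrightarrow> vscale V c v \<in> S"
    and "(\<And>n::nat. x n \<in> S) \<Longrightarrow> v \<in> carr V \<Longrightarrow> (\<lambda>n. vdist V (x n) v) \<longlonglongrightarrow> 0 \<Longrightarrow> v \<in> S"
  using assms unfolding closed_subspace_def by blast+

text \<open>Only closure, the rules of the inner product and definiteness are assumed; the vector
  space laws follow by testing with inner products. Definiteness is stated through
  \<open>vdist\<close>, since differences exist only as sums with the multiple by -1.\<close>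

locale inner_product_space =
  fixes V :: "'v ip_space"
  assumes add_closed [simp, intro]: "u \<in> carr V \<Longrightarrow> v \<in> carr V \<Longrightarrow> vadd V u v \<in> carr V"
    and scale_closed [simp, intro]: "u \<in> carr V \<Longrightarrow> vscale V c u \<in> carr V"
    and zero_closed [simp, intro]: "vzero V \<in> carr V"
    and inner_add_left: "u \<in> carr V \<Longrightarrow> v \<in> carr V \<Longrightarrow> w \<in> carr V \<Longrightarrow>
      vinner V (vadd V u v) w = vinner V u w + vinner V v w"
    and inner_scale_left: "u \<in> carr V \<Longrightarrow> w \<in> carr V \<Longrightarrow>
      vinner V (vscale V c u) w = c * vinner V u w"
    and inner_zero_left: "w \<in> carr V \<Longrightarrow> vinner V (vzero V) w = 0"
    and inner_sym: "u \<in> carr V \<Longrightarrow> v \<in> carr V \<Longrightarrow> vinner V u v = vinner V v u"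
    and inner_nonneg: "u \<in> carr V \<Longrightarrow> 0 \<le> vinner V u u"
    and dist_0_imp_eq: "u \<in> carr V \<Longrightarrow> v \<in> carr V \<Longrightarrow> vdist V u v = 0 \<Longrightarrow> u = v"
begin

lemma inner_add_right: "u \<in> carr V \<Longrightarrow> v \<in> carr V \<Longrightarrow> w \<in> carr V \<Longrightarrow>
    vinner V w (vadd V u v) = vinner V w u + vinner V w v"
  by (metis add_closed inner_add_left inner_sym)

lemma inner_scale_right: "u \<in> carr V \<Longrightarrow> w \<in> carr V \<Longrightarrow>
    vinner V w (vscale V c u) = c * vinner V w u"
  by (metis scale_closed inner_scale_left inner_sym)

lemma inner_zero_right: "w \<in> carr V \<Longrightarrow> vinner V w (vzero V) = 0"
  by (metis zero_closed inner_zero_left inner_sym)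

lemmas inner_simps = inner_add_left inner_add_right inner_scale_left inner_scale_right
  inner_zero_left inner_zero_right

lemma norm_sq: "u \<in> carr V \<Longrightarrow> (vnorm V u)\<^sup>2 = vinner V u u"
  by (simp add: vnorm_def inner_nonneg)

lemma norm_nonneg [simp]: "u \<in> carr V \<Longrightarrow> 0 \<le> vnorm V u"
  by (simp add: vnorm_def inner_nonneg)

lemma dist_sq: "u \<in> carr V \<Longrightarrow> v \<in> carr V \<Longrightarrow>
    (vdist V u v)\<^sup>2 = vinner V u u - 2 * vinner V u v + vinner V v v"
  by (simp add: vdist_def norm_sq inner_simps inner_sym[of v u])

lemma dist_nonneg [simp]: "u \<in> carr V \<Longrightarrow> v \<in> carr V \<Longrightarrow> 0 \<le> vdist V u v"
  by (simp add: vdist_def)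

lemma dist_self [simp]: "u \<in> carr V \<Longrightarrow> vdist V u u = 0"
  using dist_sq[of u u] by simp

lemma dist_sym: "u \<in> carr V \<Longrightarrow> v \<in> carr V \<Longrightarrow> vdist V u v = vdist V v u"
  by (rule power2_eq_imp_eq) (simp_all add: dist_sq inner_sym[of v u])

text \<open>Vectors with the same inner products have distance zero. Identities between vectors are
  proved in this way, as real arithmetic after \<open>inner_simps\<close>.\<close>

lemma eqI:
  assumes "u \<in> carr V" "v \<in> carr V" "\<And>w. w \<in> carr V \<Longrightarrow> vinner V u w = vinner V v w"
  shows "u = v"
proof -
  have "(vdist V u v)\<^sup>2 = 0"
    using assms inner_sym[OF assms(1,2)] by (simp add: dist_sq)
  then show ?thesis using assms dist_0_imp_eq by simp
qed

text \<open>The quadratic polynomial \<open>q\<close> in t is nonnegative. For a vector v of norm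
  zero it degenerates to a linear one, which is treated separately.\<close>

lemma inner_sq_le:
  assumes [simp]: "u \<in> carr V" "v \<in> carr V"
  shows "(vinner V u v)\<^sup>2 \<le> vinner V u u * vinner V v v"
proof -
  have q: "0 \<le> vinner V u u + 2 * t * vinner V u v + t * t * vinner V v v" for t
    using inner_nonneg[of "vadd V u (vscale V t v)"]
    by (simp add: inner_simps inner_sym[of v u] algebra_simps)
  show ?thesis
  proof (cases "vinner V v v = 0")
    case True
    have "vinner V u v = 0"
    proof (rule ccontr)
      assume ne: "vinner V u v \<noteq> 0"
      \<comment> \<open>At this t the linear function takes the value -1.\<close>
      show False
        using q[of "- (vinner V u u + 1) / (2 * vinner V u v)"] True ne by (simp add: field_simps)
    qed
    then show ?thesis using True by simp
  next
    case False
    then have p: "vinner V v v > 0" using inner_nonneg[of v] by simp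
    \<comment> \<open>The value of the quadratic polynomial at its minimum.\<close>
    have "0 \<le> vinner V u u - (vinner V u v)\<^sup>2 / vinner V v v"
      using q[of "- vinner V u v / vinner V v v"] p by (simp add: power2_eq_square field_simps)
    then show ?thesis using p by (simp add: field_simps)
  qed
qed

lemma abs_inner_le:
  assumes "u \<in> carr V" "v \<in> carr V"
  shows "\<bar>vinner V u v\<bar> \<le> vnorm V u * vnorm V v"
proof (rule power2_le_imp_le)
  show "\<bar>vinner V u v\<bar>\<^sup>2 \<le> (vnorm V u * vnorm V v)\<^sup>2"
    using inner_sq_le[OF assms] assms by (simp add: power_mult_distrib norm_sq)
qed (use assms in simp)

lemma norm_add_le:
  assumes "u \<in> carr V" "v \<in> carr V"
  shows "vnorm V (vadd V u v) \<le> vnorm V u + vnorm V v"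
proof (rule power2_le_imp_le)
  show "(vnorm V (vadd V u v))\<^sup>2 \<le> (vnorm V u + vnorm V v)\<^sup>2"
    using abs_inner_le[OF assms] assms
    by (simp add: norm_sq power2_sum inner_simps inner_sym[of v u])
qed (use assms in simp)

lemma dist_triangle:
  assumes [simp]: "u \<in> carr V" "v \<in> carr V" "w \<in> carr V"
  shows "vdist V u w \<le> vdist V u v + vdist V v w"
proof -
  have "vadd V u (vscale V (-1) w) = vadd V (vadd V u (vscale V (-1) v)) (vadd V v (vscale V (-1) w))"
    by (rule eqI) (simp_all add: inner_simps)
  then show ?thesis
    unfolding vdist_def using norm_add_le by simp
qed

lemma dist_dist_le:
  assumes [simp]: "u \<in> carr V" "v \<in> carr V" "u' \<in> carr V" "v' \<in> carr V"
  shows "\<bar>vdist V u v - vdist V u' v'\<bar> \<le> vdist V u u' + vdist V v v'"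
  using dist_triangle[of u u' v] dist_triangle[of u' v' v] dist_triangle[of u' u v']
    dist_triangle[of u v v'] dist_sym[of u u'] dist_sym[of v v'] by simp

text \<open>The filter is arbitrary because the lemma serves both sequences and the net of finite
  partial sums of a series.\<close>

lemma tendsto_dist:
  assumes u: "((\<lambda>n. vdist V (u n) a) \<longlongrightarrow> 0) F" and v: "((\<lambda>n. vdist V (v n) b) \<longlongrightarrow> 0) F"
    and [simp]: "a \<in> carr V" "b \<in> carr V"
    and ev: "\<forall>\<^sub>F n in F. u n \<in> carr V" "\<forall>\<^sub>F n in F. v n \<in> carr V"
  shows "((\<lambda>n. vdist V (u n) (v n)) \<longlongrightarrow> vdist V a b) F"
proof -
  have "((\<lambda>n. vdist V (u n) (v n) - vdist V a b) \<longlongrightarrow> 0) F"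
  proof (rule Lim_null_comparison)
    show "\<forall>\<^sub>F n in F. norm (vdist V (u n) (v n) - vdist V a b) \<le> vdist V (u n) a + vdist V (v n) b"
      using ev by eventually_elim (use dist_dist_le in simp)
  qed (use tendsto_add[OF u v] in simp)
  then show ?thesis by (simp add: LIM_zero_iff)
qed

text \<open>Polarisation with distances to the origin, so that convergence of inner products reduces
  to \<open>tendsto_dist\<close>.\<close>

lemma inner_eq_dist:
  assumes "u \<in> carr V" "v \<in> carr V"
  shows "vinner V u v = ((vdist V u (vzero V))\<^sup>2 + (vdist V v (vzero V))\<^sup>2 - (vdist V u v)\<^sup>2) / 2"
  using assms by (simp add: dist_sq inner_simps)

lemma tendsto_inner:
  assumes u: "((\<lambda>n. vdist V (u n) a) \<longlongrightarrow> 0) F" and v: "((\<lambda>n. vdist V (v n) b) \<longlongrightarrow> 0) F"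
    and [simp]: "a \<in> carr V" "b \<in> carr V"
    and ev: "\<forall>\<^sub>F n in F. u n \<in> carr V" "\<forall>\<^sub>F n in F. v n \<in> carr V"
  shows "((\<lambda>n. vinner V (u n) (v n)) \<longlongrightarrow> vinner V a b) F"
proof -
  have lim: "((\<lambda>n. ((vdist V (u n) (vzero V))\<^sup>2 + (vdist V (v n) (vzero V))\<^sup>2 - (vdist V (u n) (v n))\<^sup>2) / 2)
      \<longlongrightarrow> ((vdist V a (vzero V))\<^sup>2 + (vdist V b (vzero V))\<^sup>2 - (vdist V a b)\<^sup>2) / 2) F"
    using u v ev by (intro tendsto_intros tendsto_dist) simp_all
  have eq: "\<forall>\<^sub>F n in F. vinner V (u n) (v n) =
      ((vdist V (u n) (vzero V))\<^sup>2 + (vdist V (v n) (vzero V))\<^sup>2 - (vdist V (u n) (v n))\<^sup>2) / 2"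
    using ev by eventually_elim (rule inner_eq_dist)
  show ?thesis
    unfolding inner_eq_dist[OF assms(3,4)] by (rule iffD2[OF tendsto_cong[OF eq] lim])
qed

lemma tendsto_unique_dist:
  assumes "((\<lambda>n. vdist V (u n) a) \<longlongrightarrow> 0) F" "((\<lambda>n. vdist V (u n) b) \<longlongrightarrow> 0) F"
    and "a \<in> carr V" "b \<in> carr V" "\<forall>\<^sub>F n in F. u n \<in> carr V" "F \<noteq> bot"
  shows "a = b"
proof -
  have 1: "((\<lambda>n. vdist V (u n) (u n)) \<longlongrightarrow> vdist V a b) F"
    using assms by (intro tendsto_dist)
  have "((\<lambda>n. vdist V (u n) (u n)) \<longlongrightarrow> 0) F"
    by (rule tendsto_eventually) (use assms(5) in eventually_elim, simp)
  with 1 have "vdist V a b = 0"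
    using \<open>F \<noteq> bot\<close> tendsto_unique by blast
  then show ?thesis using assms dist_0_imp_eq by blast
qed

lemma tendsto_imp_cauchy:
  assumes "(\<lambda>n. vdist V (u n) a) \<longlonglongrightarrow> 0" "\<And>n. u n \<in> carr V" "a \<in> carr V"
  shows "u \<in> cauchy_seqs V"
  unfolding cauchy_seqs_def
proof (intro CollectI conjI allI impI)
  fix e :: real assume "e > 0"
  then have "\<forall>\<^sub>F n in sequentially. vdist V (u n) a < e / 2"
    using assms(1) by (intro order_tendstoD) auto
  then obtain N where N: "\<And>n. n \<ge> N \<Longrightarrow> vdist V (u n) a < e / 2"
    by (auto simp: eventually_sequentially)
  have "vdist V (u m) (u n) < e" if "m \<ge> N" "n \<ge> N" for m n
    using N[OF that(1)] N[OF that(2)] dist_triangle[of "u m" a "u n"] dist_sym[of "u n" a] assms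
    by simp
  then show "\<exists>N. \<forall>m\<ge>N. \<forall>n\<ge>N. vdist V (u m) (u n) < e" by blast
qed (use assms in simp)

lemma closed_subspace_orthogonal:
  assumes T: "T \<subseteq> carr V"
  shows "closed_subspace V {v \<in> carr V. \<forall>w\<in>T. vinner V v w = 0}"
proof (rule closed_subspaceI)
  fix u :: "nat \<Rightarrow> 'v" and v
  assume u: "\<And>n. u n \<in> {v \<in> carr V. \<forall>w\<in>T. vinner V v w = 0}"
    and v: "v \<in> carr V" "(\<lambda>n. vdist V (u n) v) \<longlonglongrightarrow> 0"
  have "vinner V v w = 0" if w: "w \<in> T" for w
  proof -
    have "(\<lambda>n. vinner V (u n) w) \<longlonglongrightarrow> vinner V v w"
      using u v w T by (intro tendsto_inner) auto
    then show ?thesis using u w by (simp add: LIMSEQ_const_iff)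
  qed
  then show "v \<in> {v \<in> carr V. \<forall>w\<in>T. vinner V v w = 0}" using v by simp
qed (use T in \<open>auto simp: inner_simps subset_iff\<close>)

end

section \<open>Total sets\<close>

text \<open>This says that the closed linear span is everything. The span is never formed:
  quantifying over closed subspaces gives an induction rule by which a property is extended from T
  as soon as it defines a closed subspace.\<close>

definition total :: "'v ip_space \<Rightarrow> 'v set \<Rightarrow> bool" where
  "total V T \<longleftrightarrow> T \<subseteq> carr V \<and> (\<forall>S. closed_subspace V S \<and> T \<subseteq> S \<longrightarrow> S = carr V)"

lemma totalD: "total V T \<Longrightarrow> closed_subspace V S \<Longrightarrow> T \<subseteq> S \<Longrightarrow> v \<in> carr V \<Longrightarrow> v \<in> S"
  by (auto simp: total_def)

lemma totalI:
  assumes "T \<subseteq> carr V" "\<And>S v. closed_subspace V S \<Longrightarrow> T \<subseteq> S \<Longrightarrow> v \<in> carr V \<Longrightarrow> v \<in> S"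
  shows "total V T"
  unfolding total_def using assms(1)
  by (auto intro: assms(2) dest: closed_subspaceD(1))

lemma total_trans:
  assumes "total V T" "T' \<subseteq> carr V" "\<And>S. closed_subspace V S \<Longrightarrow> T' \<subseteq> S \<Longrightarrow> T \<subseteq> S"
  shows "total V T'"
proof (rule totalI[OF assms(2)])
  fix S v assume "closed_subspace V S" "T' \<subseteq> S" "v \<in> carr V"
  then show "v \<in> S" using totalD[OF assms(1)] assms(3) by blast
qed

context inner_product_space begin

text \<open>The vectors orthogonal to u - v form a closed subspace that contains T.\<close>

lemma total_eqI:
  assumes T: "total V T" and u: "u \<in> carr V" "v \<in> carr V"
    and "\<And>w. w \<in> T \<Longrightarrow> vinner V u w = vinner V v w"
  shows "u = v"
proof (rule eqI[OF u])
  fix w assume "w \<in> carr V"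
  let ?d = "vadd V u (vscale V (-1) v)"
  have "w \<in> {w \<in> carr V. \<forall>z\<in>{?d}. vinner V w z = 0}"
  proof (rule totalD[OF T])
    show "closed_subspace V {w \<in> carr V. \<forall>z\<in>{?d}. vinner V w z = 0}"
      using u by (intro closed_subspace_orthogonal) simp
    show "T \<subseteq> {w \<in> carr V. \<forall>z\<in>{?d}. vinner V w z = 0}"
    proof
      fix z assume "z \<in> T"
      then have "z \<in> carr V" "vinner V u z = vinner V v z"
        using T assms by (auto simp: total_def)
      then show "z \<in> {w \<in> carr V. \<forall>z\<in>{?d}. vinner V w z = 0}"
        using u by (simp add: inner_simps inner_sym[of z])
    qed
  qed fact
  then show "vinner V u w = vinner V v w"
    using u \<open>w \<in> carr V\<close> by (simp add: inner_simps inner_sym[of w])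
qed

end

locale hilbert_space = inner_product_space +
  assumes complete: "u \<in> cauchy_seqs V \<Longrightarrow> \<exists>v\<in>carr V. (\<lambda>n. vdist V (u n) v) \<longlonglongrightarrow> 0"

section \<open>Linear maps\<close>

text \<open>The same notion as \<open>bounded_ops\<close> without the convention on values off the
  carrier, so that it also applies to maps given by plain lambda terms.\<close>

definition bounded_map :: "'v ip_space \<Rightarrow> 'w ip_space \<Rightarrow> ('v \<Rightarrow> 'w) \<Rightarrow> bool" where
  "bounded_map V W A \<longleftrightarrow> A \<in> linear_maps V W \<and> (\<exists>C. \<forall>v\<in>carr V. vnorm W (A v) \<le> C * vnorm V v)"

text \<open>Linearity need not be required, since it follows.\<close>

definition conformal :: "'v ip_space \<Rightarrow> 'w ip_space \<Rightarrow> real \<Rightarrow> ('v \<Rightarrow> 'w) \<Rightarrow> bool" where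
  "conformal V W c A \<longleftrightarrow> A \<in> carr V \<rightarrow> carr W \<and> c \<ge> 0 \<and>
     (\<forall>u\<in>carr V. \<forall>v\<in>carr V. vinner W (A u) (A v) = c * vinner V u v)"

lemma linear_maps_closed: "A \<in> linear_maps V W \<Longrightarrow> v \<in> carr V \<Longrightarrow> A v \<in> carr W"
  by (auto simp: linear_maps_def)

lemma linear_maps_add: "A \<in> linear_maps V W \<Longrightarrow> u \<in> carr V \<Longrightarrow> v \<in> carr V \<Longrightarrow>
    A (vadd V u v) = vadd W (A u) (A v)"
  by (auto simp: linear_maps_def)

lemma linear_maps_scale: "A \<in> linear_maps V W \<Longrightarrow> v \<in> carr V \<Longrightarrow>
    A (vscale V c v) = vscale W c (A v)"
  by (auto simp: linear_maps_def)

lemma bounded_map_linear: "bounded_map V W A \<Longrightarrow> A \<in> linear_maps V W"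
  by (simp add: bounded_map_def)

lemma bounded_ops_iff: "A \<in> bounded_ops V W \<longleftrightarrow> bounded_map V W A \<and> A \<in> extensional (carr V)"
  by (auto simp: bounded_ops_def bounded_map_def)

lemma conformal_closed: "conformal V W c A \<Longrightarrow> v \<in> carr V \<Longrightarrow> A v \<in> carr W"
  by (auto simp: conformal_def)

lemma conformal_inner: "conformal V W c A \<Longrightarrow> u \<in> carr V \<Longrightarrow> v \<in> carr V \<Longrightarrow>
    vinner W (A u) (A v) = c * vinner V u v"
  by (auto simp: conformal_def)

lemma bounded_map_cong:
  assumes "bounded_map V W A" "inner_product_space V" "\<And>v. v \<in> carr V \<Longrightarrow> A v = B v"
  shows "bounded_map V W B"
proof -
  interpret inner_product_space V by fact
  show ?thesis
    using assms(1,3) unfolding bounded_map_def linear_maps_def by (simp add: Pi_iff)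
qed

lemma bounded_map_restrict:
  assumes "bounded_map V W A" "inner_product_space V"
  shows "restrict A (carr V) \<in> bounded_ops V W"
  unfolding bounded_ops_iff by (auto intro: bounded_map_cong[OF assms])

lemma linear_maps_zero:
  assumes "A \<in> linear_maps V W" "inner_product_space V" "inner_product_space W"
  shows "A (vzero V) = vzero W"
proof -
  interpret V: inner_product_space V by fact
  interpret W: inner_product_space W by fact
  have "vscale V 0 (vzero V) = vzero V"
    by (rule V.eqI) (simp_all add: V.inner_simps)
  then have "A (vzero V) = vscale W 0 (A (vzero V))"
    using linear_maps_scale[OF assms(1) V.zero_closed, of 0] by simp
  also have "\<dots> = vzero W"
    by (rule W.eqI) (simp_all add: W.inner_simps linear_maps_closed[OF assms(1)])
  finally show ?thesis .
qed

lemma bounded_map_dist: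
  assumes A: "bounded_map V W A" and "inner_product_space V"
  shows "\<exists>C. \<forall>u\<in>carr V. \<forall>v\<in>carr V. vdist W (A u) (A v) \<le> C * vdist V u v"
proof -
  interpret inner_product_space V by fact
  obtain C where C: "\<And>v. v \<in> carr V \<Longrightarrow> vnorm W (A v) \<le> C * vnorm V v"
    using A by (auto simp: bounded_map_def)
  have "vdist W (A u) (A v) \<le> C * vdist V u v" if "u \<in> carr V" "v \<in> carr V" for u v
    using C[of "vadd V u (vscale V (-1) v)"] that A unfolding vdist_def
    by (simp add: linear_maps_add[OF bounded_map_linear[OF A]] linear_maps_scale[OF bounded_map_linear[OF A]])
  then show ?thesis by blast
qed

lemma bounded_map_tendsto:
  assumes A: "bounded_map V W A" and "inner_product_space V" "inner_product_space W"
    and u: "((\<lambda>n. vdist V (u n) v) \<longlongrightarrow> 0) F" "\<forall>\<^sub>F n in F. u n \<in> carr V" "v \<in> carr V"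
  shows "((\<lambda>n. vdist W (A (u n)) (A v)) \<longlongrightarrow> 0) F"
proof -
  interpret W: inner_product_space W by fact
  obtain C where C: "\<And>u v. u \<in> carr V \<Longrightarrow> v \<in> carr V \<Longrightarrow> vdist W (A u) (A v) \<le> C * vdist V u v"
    using bounded_map_dist[OF A] assms(2) by blast
  show ?thesis
  proof (rule Lim_null_comparison)
    show "\<forall>\<^sub>F n in F. norm (vdist W (A (u n)) (A v)) \<le> C * vdist V (u n) v"
      using u(2) by eventually_elim
        (use C u(3) W.dist_nonneg linear_maps_closed[OF bounded_map_linear[OF A]] in simp)
  qed (use tendsto_mult_left[OF u(1), of C] in simp)
qed

text \<open>Together with \<open>totalD\<close> this extends membership of A v in S from a total set
  to all v.\<close>

lemma closed_subspace_vimage: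
  assumes A: "bounded_map V W A" and "inner_product_space V" "inner_product_space W"
    and S: "closed_subspace W S"
  shows "closed_subspace V {v \<in> carr V. A v \<in> S}"
proof -
  interpret V: inner_product_space V by fact
  interpret W: inner_product_space W by fact
  note lin = bounded_map_linear[OF A]
  show ?thesis
  proof (rule closed_subspaceI)
    fix u :: "nat \<Rightarrow> 'a" and v
    assume u: "\<And>n. u n \<in> {v \<in> carr V. A v \<in> S}"
      and v: "v \<in> carr V" "(\<lambda>n. vdist V (u n) v) \<longlonglongrightarrow> 0"
    have "(\<lambda>n. vdist W (A (u n)) (A v)) \<longlonglongrightarrow> 0"
      using u v by (intro bounded_map_tendsto[OF A]) (simp_all add: assms)
    then have "A v \<in> S"
      using u v linear_maps_closed[OF lin] 
      by - (rule closed_subspaceD(5)[OF S, of "\<lambda>n. A (u n)"], simp_all)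
    then show "v \<in> {v \<in> carr V. A v \<in> S}" using v by simp
  next
    show "vzero V \<in> {v \<in> carr V. A v \<in> S}"
      using closed_subspaceD(2)[OF S] by (simp add: linear_maps_zero[OF lin] assms)
  qed (auto simp: linear_maps_add[OF lin] linear_maps_scale[OF lin] closed_subspaceD(3,4)[OF S])
qed

lemma closed_subspace_equalizer:
  assumes A: "bounded_map V W A" and B: "bounded_map V W B"
    and "inner_product_space V" "inner_product_space W"
  shows "closed_subspace V {v \<in> carr V. A v = B v}"
proof -
  interpret V: inner_product_space V by fact
  interpret W: inner_product_space W by fact
  note lin = bounded_map_linear[OF A] bounded_map_linear[OF B]
  show ?thesis
  proof (rule closed_subspaceI)
    fix u :: "nat \<Rightarrow> 'a" and v
    assume u: "\<And>n. u n \<in> {v \<in> carr V. A v = B v}"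
      and v: "v \<in> carr V" "(\<lambda>n. vdist V (u n) v) \<longlonglongrightarrow> 0"
    have "(\<lambda>n. vdist W (A (u n)) (A v)) \<longlonglongrightarrow> 0"
      using u v by (intro bounded_map_tendsto[OF A]) (simp_all add: assms)
    moreover have "(\<lambda>n. vdist W (A (u n)) (B v)) \<longlonglongrightarrow> 0"
      using u v bounded_map_tendsto[OF B assms(3,4), of u v sequentially] by simp
    ultimately have "A v = B v"
      using u v linear_maps_closed[OF lin(1)] linear_maps_closed[OF lin(2)]
      by (intro W.tendsto_unique_dist[of "\<lambda>n. A (u n)" _ sequentially]) simp_all
    then show "v \<in> {v \<in> carr V. A v = B v}" using v by simp
  qed (auto simp: linear_maps_zero[OF lin(1)] linear_maps_zero[OF lin(2)] assms
        linear_maps_add[OF lin(1)] linear_maps_add[OF lin(2)]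
        linear_maps_scale[OF lin(1)] linear_maps_scale[OF lin(2)])
qed

text \<open>The uniqueness half of the definite descriptions of operators. Extensionality turns
  agreement on the carrier into equality of functions.\<close>

lemma bounded_ops_eqI:
  assumes A: "A \<in> bounded_ops V W" and B: "B \<in> bounded_ops V W"
    and "inner_product_space V" "inner_product_space W"
    and T: "total V T" "\<And>v. v \<in> T \<Longrightarrow> A v = B v"
  shows "A = B"
proof -
  have "v \<in> {v \<in> carr V. A v = B v}" if "v \<in> carr V" for v
  proof (rule totalD[OF T(1) _ _ that])
    show "closed_subspace V {v \<in> carr V. A v = B v}"
      using assms by (intro closed_subspace_equalizer) (auto simp: bounded_ops_iff)
  qed (use T in \<open>auto simp: total_def\<close>)
  then show ?thesis
    using A B by (auto simp: bounded_ops_iff intro!: extensionalityI)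
qed

text \<open>The squared distance between A (u + v) and A u + A v expands into inner products of
  images. These are c times the inner products of u, v and u + v, and the sum is c times zero.
  Multiples are handled likewise.\<close>

lemma conformal_bounded:
  assumes A: "conformal V W c A" and "inner_product_space V" "inner_product_space W"
  shows "bounded_map V W A"
proof -
  interpret V: inner_product_space V by fact
  interpret W: inner_product_space W by fact
  note cl = conformal_closed[OF A] and inn = conformal_inner[OF A]
  have add: "A (vadd V u v) = vadd W (A u) (A v)" if "u \<in> carr V" "v \<in> carr V" for u v
  proof -
    have "(vdist W (A (vadd V u v)) (vadd W (A u) (A v)))\<^sup>2 = 0"
      using that by (simp add: W.dist_sq cl W.inner_simps) (simp add: inn V.inner_simps V.inner_sym[of v u] algebra_simps)
    then show ?thesis using W.dist_0_imp_eq cl that by simp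
  qed
  have scale: "A (vscale V a v) = vscale W a (A v)" if "v \<in> carr V" for a v
  proof -
    have "(vdist W (A (vscale V a v)) (vscale W a (A v)))\<^sup>2 = 0"
      using that by (simp add: W.dist_sq cl W.inner_simps) (simp add: inn V.inner_simps algebra_simps)
    then show ?thesis using W.dist_0_imp_eq cl that by simp
  qed
  have "vnorm W (A v) \<le> sqrt c * vnorm V v" if "v \<in> carr V" for v
    using that by (simp add: vnorm_def inn real_sqrt_mult)
  then show ?thesis
    unfolding bounded_map_def linear_maps_def using add scale cl by auto
qed

lemma conformal_dist:
  assumes A: "conformal V W c A" and "inner_product_space V" "inner_product_space W"
    and [simp]: "u \<in> carr V" "v \<in> carr V"
  shows "vdist W (A u) (A v) = sqrt c * vdist V u v"
proof -
  interpret V: inner_product_space V by fact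
  interpret W: inner_product_space W by fact
  have "c \<ge> 0" using A by (simp add: conformal_def)
  then show ?thesis
    by - (rule power2_eq_imp_eq,
      simp_all add: W.dist_sq V.dist_sq conformal_closed[OF A] conformal_inner[OF A] power_mult_distrib algebra_simps)
qed

text \<open>A convergent sequence of images is Cauchy, and since c > 0 so is the sequence of
  preimages; completeness of V provides a preimage of the limit.\<close>

lemma closed_subspace_range:
  assumes A: "conformal V W c A" and c: "c > 0" and "hilbert_space V" "inner_product_space W"
  shows "closed_subspace W (A ` carr V)"
proof -
  interpret V: hilbert_space V by fact
  interpret W: inner_product_space W by fact
  note bd = conformal_bounded[OF A V.inner_product_space_axioms W.inner_product_space_axioms]
  note lin = bounded_map_linear[OF bd]
  show ?thesis
  proof (rule closed_subspaceI)
    fix u :: "nat \<Rightarrow> 'b" and w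
    assume w: "\<And>n. u n \<in> A ` carr V" "w \<in> carr W" "(\<lambda>n. vdist W (u n) w) \<longlonglongrightarrow> 0"
    have "\<forall>n. \<exists>v. v \<in> carr V \<and> u n = A v"
      using w(1) by (simp add: image_iff Bex_def)
    then obtain v where v: "\<And>n. v n \<in> carr V" "\<And>n. u n = A (v n)"
      by metis
    have "u n \<in> carr W" for n
      using v linear_maps_closed[OF lin] by simp
    then have "u \<in> cauchy_seqs W"
      using w by (intro W.tendsto_imp_cauchy)
    have "v \<in> cauchy_seqs V"
      unfolding cauchy_seqs_def
    proof (intro CollectI conjI allI impI)
      fix e :: real assume "e > 0"
      then obtain N where "\<forall>m\<ge>N. \<forall>n\<ge>N. vdist W (u m) (u n) < sqrt c * e"
        using \<open>u \<in> cauchy_seqs W\<close> c unfolding cauchy_seqs_def mem_Collect_eq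
        by (metis mult_pos_pos real_sqrt_gt_zero)
      then show "\<exists>N. \<forall>m\<ge>N. \<forall>n\<ge>N. vdist V (v m) (v n) < e"
        using v c by (auto simp: conformal_dist[OF A V.inner_product_space_axioms W.inner_product_space_axioms])
    qed (use v in simp)
    then obtain z where z: "z \<in> carr V" "(\<lambda>n. vdist V (v n) z) \<longlonglongrightarrow> 0"
      using V.complete by blast
    have "(\<lambda>n. vdist W (u n) (A z)) \<longlonglongrightarrow> 0"
      unfolding v(2) using z v
      by (intro bounded_map_tendsto[OF bd V.inner_product_space_axioms W.inner_product_space_axioms]) simp_all
    then have "A z = w"
      using w(2,3) z \<open>\<And>n. u n \<in> carr W\<close> linear_maps_closed[OF lin]
      by (intro W.tendsto_unique_dist[of u _ sequentially]) simp_all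
    then show "w \<in> A ` carr V" using z by blast
  next
    show "vzero W \<in> A ` carr V"
      using linear_maps_zero[OF lin V.inner_product_space_axioms W.inner_product_space_axioms] by (metis V.zero_closed image_eqI)
    show "A ` carr V \<subseteq> carr W"
      using linear_maps_closed[OF lin] by blast
    show "vadd W u v \<in> A ` carr V" if "u \<in> A ` carr V" "v \<in> A ` carr V" for u v
      using that by (auto simp flip: linear_maps_add[OF lin])
    show "vscale W c v \<in> A ` carr V" if "v \<in> A ` carr V" for c v
      using that by (auto simp flip: linear_maps_scale[OF lin])
  qed
qed

lemma conformal_inj:
  assumes A: "conformal V W c A" and c: "c > 0" and "inner_product_space V" "inner_product_space W"
  shows "inj_on A (carr V)"
proof (rule inj_onI)
  interpret V: inner_product_space V by fact
  interpret W: inner_product_space W by fact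
  fix u v assume uv: "u \<in> carr V" "v \<in> carr V" "A u = A v"
  then have "sqrt c * vdist V u v = 0"
    using conformal_dist[OF A, of u v] conformal_closed[OF A] assms by simp
  then show "u = v" using c uv V.dist_0_imp_eq by simp
qed

text \<open>The range is closed because V is complete, and it contains a total set, so it is all of
  W.\<close>

lemma unitaryI:
  assumes A: "conformal V W 1 A" and "hilbert_space V" "inner_product_space W"
    and T: "total W T" "T \<subseteq> A ` carr V"
  shows "unitary V W A"
proof -
  interpret V: hilbert_space V by fact
  interpret W: inner_product_space W by fact
  have "A ` carr V = carr W"
    using T closed_subspace_range[OF A] assms by (simp add: total_def)
  then show ?thesis
    using A conformal_inj[OF A] bounded_map_linear[OF conformal_bounded[OF A]]
      V.inner_product_space_axioms W.inner_product_space_axioms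
    by (simp add: unitary_def bij_betw_def conformal_def)
qed

lemma unitary_conformal: "unitary V W U \<Longrightarrow> conformal V W 1 U"
  by (auto simp: unitary_def conformal_def linear_maps_def)

section \<open>Finite and infinite sums\<close>

context inner_product_space begin

text \<open>The condition under which \<open>foldD\<close>, and with it \<open>vfinsum\<close>, does
  not depend on the order of the summands.\<close>

lemma vadd_left_commute:
  "u \<in> carr V \<Longrightarrow> v \<in> carr V \<Longrightarrow> w \<in> carr V \<Longrightarrow>
    vadd V u (vadd V v w) = vadd V v (vadd V u w)"
  by (rule eqI) (simp_all add: inner_simps)

lemma vfinsum_empty [simp]: "vfinsum V x {} = vzero V"
  by (simp add: vfinsum_def)

lemma
  assumes "finite F" "\<And>k. k \<in> F \<Longrightarrow> x k \<in> carr V"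
  shows vfinsum_closed [simp]: "vfinsum V x F \<in> carr V"
    and vfinsum_insert: "k \<notin> F \<Longrightarrow> x k \<in> carr V \<Longrightarrow>
      vfinsum V x (insert k F) = vadd V (x k) (vfinsum V x F)"
proof -
  have L: "LCD {k. x k \<in> carr V} (carr V) (\<lambda>i. vadd V (x i))"
    by standard (auto intro: vadd_left_commute)
  show "vfinsum V x F \<in> carr V"
    unfolding vfinsum_def using LCD.foldD_closed[OF L] assms by auto
  show "vfinsum V x (insert k F) = vadd V (x k) (vfinsum V x F)" if "k \<notin> F" "x k \<in> carr V"
    unfolding vfinsum_def using LCD.foldD_insert[OF L] assms that by auto
qed

lemma vfinsum_inner:
  assumes "finite F" "\<And>k. k \<in> F \<Longrightarrow> x k \<in> carr V" "w \<in> carr V"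
  shows "vinner V (vfinsum V x F) w = (\<Sum>k\<in>F. vinner V (x k) w)"
  using assms by (induction F rule: finite_induct) (simp_all add: inner_simps vfinsum_insert)

lemma vfinsum_in_subspace:
  assumes S: "closed_subspace V S" and "finite F" "\<And>k. k \<in> F \<Longrightarrow> x k \<in> S"
  shows "vfinsum V x F \<in> S"
  using assms(2,3)
proof (induction F rule: finite_induct)
  case (insert k F)
  then have "x k \<in> S" "\<And>m. m \<in> F \<Longrightarrow> x m \<in> carr V"
    by (auto intro: closed_subspaceD(1)[OF S])
  then show ?case
    using insert closed_subspaceD(3)[OF S] closed_subspaceD(1)[OF S] by (simp add: vfinsum_insert)
qed (use closed_subspaceD(2)[OF S] in simp)

lemma eventually_vfinsum_closed:
  assumes "\<And>k. k \<in> K \<Longrightarrow> x k \<in> carr V"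
  shows "\<forall>\<^sub>F F in finite_subsets_at_top K. vfinsum V x F \<in> carr V"
  using assms by (intro eventually_finite_subsets_at_top_weakI vfinsum_closed) auto

lemma vhas_sum_unique: "vhas_sum V x K u \<Longrightarrow> vhas_sum V x K v \<Longrightarrow> u = v"
  unfolding vhas_sum_def
  by (rule tendsto_unique_dist[of "vfinsum V x" _ "finite_subsets_at_top K"])
    (auto intro: eventually_vfinsum_closed)

lemma vsum_eq: "vhas_sum V x K v \<Longrightarrow> vsum V x K = v"
  unfolding vsum_def using vhas_sum_unique by blast

lemma vhas_sum_inner:
  assumes "vhas_sum V x K u" "w \<in> carr V"
  shows "((\<lambda>k. vinner V (x k) w) has_sum vinner V u w) K"
proof -
  have x: "\<And>k. k \<in> K \<Longrightarrow> x k \<in> carr V" and u: "u \<in> carr V"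
    using assms by (auto simp: vhas_sum_def)
  have "((\<lambda>F. vinner V (vfinsum V x F) w) \<longlongrightarrow> vinner V u w) (finite_subsets_at_top K)"
    using assms u by (intro tendsto_inner) (auto simp: vhas_sum_def intro: eventually_vfinsum_closed)
  moreover have "\<forall>\<^sub>F F in finite_subsets_at_top K.
      vinner V (vfinsum V x F) w = (\<Sum>k\<in>F. vinner V (x k) w)"
    using x assms by (intro eventually_finite_subsets_at_top_weakI vfinsum_inner) auto
  ultimately show ?thesis
    unfolding has_sum_def by (simp add: tendsto_cong)
qed

text \<open>Parseval's identity for two series with mutually orthogonal terms: pairing x k with the
  sum of the second series leaves only the contribution of y k.\<close>

lemma vhas_sum_inner_orthogonal:
  assumes x: "vhas_sum V x K u" and y: "vhas_sum V y K v"
    and orth: "\<And>k m. k \<in> K \<Longrightarrow> m \<in> K \<Longrightarrow> k \<noteq> m \<Longrightarrow> vinner V (x k) (y m) = 0"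
  shows "((\<lambda>k. vinner V (x k) (y k)) has_sum vinner V u v) K"
proof -
  have xc: "\<And>k. k \<in> K \<Longrightarrow> x k \<in> carr V" and yc: "\<And>k. k \<in> K \<Longrightarrow> y k \<in> carr V" and v: "v \<in> carr V"
    using x y by (auto simp: vhas_sum_def)
  have "vinner V (x k) v = vinner V (x k) (y k)" if k: "k \<in> K" for k
  proof -
    have "((\<lambda>m. vinner V (y m) (x k)) has_sum vinner V v (x k)) K"
      using vhas_sum_inner[OF y] xc k by simp
    moreover have "((\<lambda>m. vinner V (y m) (x k)) has_sum vinner V (y k) (x k)) K"
      using k orth[OF k] xc yc by (intro has_sum_finite_neutralI[of "{k}"]) (auto simp: inner_sym)
    ultimately show ?thesis
      using has_sum_unique inner_sym xc yc v k by metis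
  qed
  then show ?thesis
    using vhas_sum_inner[OF x v] by (simp cong: has_sum_cong)
qed

end

context hilbert_space begin

text \<open>For an orthogonal family, finite sums over sets differing outside of \<open>F\<^sub>0\<close> only are close
  if the tail of the sum of squares outside of \<open>F\<^sub>0\<close> is small.\<close>

lemma orthogonal_vhas_sum:
  assumes x: "\<And>k. k \<in> K \<Longrightarrow> x k \<in> carr V"
    and orth: "\<And>k m. k \<in> K \<Longrightarrow> m \<in> K \<Longrightarrow> k \<noteq> m \<Longrightarrow> vinner V (x k) (x m) = 0"
    and sm: "(\<lambda>k. vinner V (x k) (x k)) summable_on K"
  shows "\<exists>v. vhas_sum V x K v"
proof -
  let ?f = "\<lambda>k. vinner V (x k) (x k)"
  let ?s = "vfinsum V x"
  have xF: "\<And>k. k \<in> F \<Longrightarrow> x k \<in> carr V" if "F \<subseteq> K" for F using x that by blast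
  have inn: "vinner V (?s F) (?s G) = sum ?f (F \<inter> G)" if "finite F" "finite G" "F \<subseteq> K" "G \<subseteq> K" for F G
  proof -
    have "vinner V (?s F) (?s G) = (\<Sum>k\<in>F. \<Sum>m\<in>G. vinner V (x k) (x m))"
      using that xF[OF that(3)] xF[OF that(4)]
      by (subst vfinsum_inner) (auto simp: inner_sym[OF _ vfinsum_closed] vfinsum_inner inner_sym[of "x _" "x _"] intro!: sum.cong)
    also have "\<dots> = (\<Sum>k\<in>F. if k \<in> G then ?f k else 0)"
    proof (rule sum.cong[OF refl])
      fix k assume "k \<in> F"
      then have "(\<Sum>m\<in>G. vinner V (x k) (x m)) = (\<Sum>m\<in>G. if k = m then ?f k else 0)"
        using that orth by (intro sum.cong) (auto simp: subset_iff)
      then show "(\<Sum>m\<in>G. vinner V (x k) (x m)) = (if k \<in> G then ?f k else 0)"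
        using that by simp
    qed
    also have "\<dots> = sum ?f (F \<inter> G)"
      using that by (simp add: sum.If_cases Int_def)
    finally show ?thesis .
  qed
  have close: "\<exists>F0. finite F0 \<and> F0 \<subseteq> K \<and> (\<forall>F G. finite F \<and> finite G \<and> F0 \<subseteq> F \<and> F0 \<subseteq> G \<and> F \<subseteq> K \<and> G \<subseteq> K
      \<longrightarrow> vdist V (?s F) (?s G) < e)" if "e > 0" for e :: real
  proof -
    have "(?f has_sum infsum ?f K) K" using sm by simp
    then have "\<forall>\<^sub>F F in finite_subsets_at_top K. dist (sum ?f F) (infsum ?f K) < e\<^sup>2 / 4"
      unfolding has_sum_def using that by (intro tendstoD) simp_all
    then obtain F0 where "finite F0 \<and> F0 \<subseteq> K \<and>
      (\<forall>F. finite F \<and> F0 \<subseteq> F \<and> F \<subseteq> K \<longrightarrow> dist (sum ?f F) (infsum ?f K) < e\<^sup>2 / 4)"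
      unfolding eventually_finite_subsets_at_top ..
    then have F0: "finite F0" "F0 \<subseteq> K"
      "\<And>F. finite F \<Longrightarrow> F0 \<subseteq> F \<Longrightarrow> F \<subseteq> K \<Longrightarrow> dist (sum ?f F) (infsum ?f K) < e\<^sup>2 / 4"
      by simp_all
    have "vdist V (?s F) (?s G) < e"
      if FG: "finite F" "finite G" "F0 \<subseteq> F" "F0 \<subseteq> G" "F \<subseteq> K" "G \<subseteq> K" for F G
    proof (rule power2_less_imp_less)
      \<comment> \<open>By orthogonality only the common indices contribute to the mixed term. All
        three sums are within e^2/4 of the total; in the combination with coefficients 1, -2, 1 the
        total cancels, and the absolute values of the coefficients add up to 4.\<close>
      have "(vdist V (?s F) (?s G))\<^sup>2 = sum ?f F - 2 * sum ?f (F \<inter> G) + sum ?f G"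
        using FG inn[of F F] inn[of F G] inn[of G G] xF[OF FG(5)] xF[OF FG(6)]
        by (simp add: dist_sq)
      moreover have "F \<inter> G \<subseteq> K" "F0 \<subseteq> F \<inter> G" using FG by auto
      moreover have "a - 2 * b + c < d"
        if "\<bar>a - s\<bar> < d / 4" "\<bar>b - s\<bar> < d / 4" "\<bar>c - s\<bar> < d / 4" for a b c d s :: real
        using that unfolding abs_less_iff by linarith
      ultimately show "(vdist V (?s F) (?s G))\<^sup>2 < e\<^sup>2"
        using F0(3)[of F] F0(3)[of G] F0(3)[of "F \<inter> G"] FG unfolding dist_real_def by simp
    qed (use \<open>e > 0\<close> in simp)
    then show ?thesis using F0(1,2) by (intro exI[of _ F0]) simp
  qed
  have "\<forall>n::nat. \<exists>F0. finite F0 \<and> F0 \<subseteq> K \<and> (\<forall>F G. finite F \<and> finite G \<and> F0 \<subseteq> F \<and> F0 \<subseteq> G \<and> F \<subseteq> K \<and> G \<subseteq> K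
      \<longrightarrow> vdist V (?s F) (?s G) < 1 / Suc n)"
    using close by simp
  then obtain H where "\<forall>n. finite (H n) \<and> H n \<subseteq> K \<and>
      (\<forall>F G. finite F \<and> finite G \<and> H n \<subseteq> F \<and> H n \<subseteq> G \<and> F \<subseteq> K \<and> G \<subseteq> K
        \<longrightarrow> vdist V (?s F) (?s G) < 1 / Suc n)"
    by (rule choice[THEN exE])
  then have H: "\<And>n. finite (H n)" "\<And>n. H n \<subseteq> K"
    "\<And>n F G. finite F \<Longrightarrow> finite G \<Longrightarrow> H n \<subseteq> F \<Longrightarrow> H n \<subseteq> G \<Longrightarrow> F \<subseteq> K \<Longrightarrow> G \<subseteq> K \<Longrightarrow>
      vdist V (?s F) (?s G) < 1 / Suc n"
    by simp_all
  \<comment> \<open>The unions increase, so that \<open>G m\<close> and \<open>G n\<close> both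
    contain \<open>H N\<close> as soon as m and n are at least N.\<close>
  define G where "G n = (\<Union>i\<le>n. H i)" for n :: nat
  have G: "finite (G n)" "G n \<subseteq> K" "m \<le> n \<Longrightarrow> H m \<subseteq> G n" for m n
    using H(1,2) by (auto simp: G_def)
  have Gc: "?s (G n) \<in> carr V" for n
    by (intro vfinsum_closed G(1) xF[OF G(2)])
  have "(\<lambda>n. ?s (G n)) \<in> cauchy_seqs V"
    unfolding cauchy_seqs_def
  proof (intro CollectI conjI allI impI Gc)
    fix e :: real assume "e > 0"
    then obtain N :: nat where N: "1 / Suc N < e" using nat_approx_posE by blast
    have "vdist V (?s (G m)) (?s (G n)) < e" if "m \<ge> N" "n \<ge> N" for m n
      using H(3)[OF G(1) G(1) G(3)[OF that(1)] G(3)[OF that(2)] G(2) G(2)] N by linarith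
    then show "\<exists>N. \<forall>m\<ge>N. \<forall>n\<ge>N. vdist V (?s (G m)) (?s (G n)) < e" by blast
  qed
  then obtain v where v: "v \<in> carr V" "(\<lambda>n. vdist V (?s (G n)) v) \<longlonglongrightarrow> 0"
    using complete by blast
  have "((\<lambda>F. vdist V (?s F) v) \<longlongrightarrow> 0) (finite_subsets_at_top K)"
  proof (rule tendstoI)
    fix e :: real assume e: "e > 0"
    then obtain N :: nat where N: "1 / Suc N < e / 2" using nat_approx_posE[of "e/2"] by auto
    have "\<forall>\<^sub>F n in sequentially. vdist V (?s (G n)) v < e / 2"
      using v e by (intro order_tendstoD) auto
    then obtain M where M: "\<And>n. n \<ge> M \<Longrightarrow> vdist V (?s (G n)) v < e / 2"
      by (auto simp: eventually_sequentially)
    have "dist (vdist V (?s F) v) 0 < e" if "finite F" "H N \<subseteq> F" "F \<subseteq> K" for F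
    proof -
      let ?G = "G (max M N)"
      have "vdist V (?s F) (?s ?G) < e / 2"
        using H(3)[OF that(1) G(1) that(2) G(3) that(3) G(2), of "max M N"] N by simp
      moreover have "vdist V (?s ?G) v < e / 2" using M by simp
      moreover have Fc: "?s F \<in> carr V"
        by (intro vfinsum_closed that(1) xF[OF that(3)])
      moreover have "vdist V (?s F) v \<le> vdist V (?s F) (?s ?G) + vdist V (?s ?G) v"
        by (intro dist_triangle v Gc Fc)
      moreover have "0 \<le> vdist V (?s F) v"
        using Fc v by simp
      ultimately show ?thesis by simp
    qed
    then show "\<forall>\<^sub>F F in finite_subsets_at_top K. dist (vdist V (?s F) v) 0 < e"
      unfolding eventually_finite_subsets_at_top using H(1,2) by (intro exI[of _ "H N"]) simp
  qed
  then show ?thesis using x v by (auto simp: vhas_sum_def)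
qed

end

section \<open>Density, and extension of maps that preserve inner products up to a factor\<close>

lemma closed_subspace_dense:
  assumes "inner_product_space V" and D: "D \<subseteq> carr V" "vzero V \<in> D"
    and add: "\<And>u v. u \<in> D \<Longrightarrow> v \<in> D \<Longrightarrow> vadd V u v \<in> D"
    and scale: "\<And>c v. v \<in> D \<Longrightarrow> vscale V c v \<in> D"
  shows "closed_subspace V {v \<in> carr V. \<forall>e>0. \<exists>d\<in>D. vdist V d v < e}" (is "closed_subspace V ?S")
proof (rule closed_subspaceI)
  interpret inner_product_space V by fact
  note Dc = subsetD[OF D(1)]
  show "vzero V \<in> ?S"
    using D by (auto intro!: bexI[of _ "vzero V"])
  show "vadd V u v \<in> ?S" if uv: "u \<in> ?S" "v \<in> ?S" for u v
  proof -
    have "\<exists>d\<in>D. vdist V d (vadd V u v) < e" if e: "e > 0" for e :: real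
    proof -
      have "e / 2 > 0" using e by simp
      then obtain d d' where d: "d \<in> D" "vdist V d u < e / 2" "d' \<in> D" "vdist V d' v < e / 2"
        using uv by blast
      have "vadd V (vadd V d d') (vscale V (-1) (vadd V u v)) =
          vadd V (vadd V d (vscale V (-1) u)) (vadd V d' (vscale V (-1) v))"
        using d(1,3)[THEN Dc] uv by (intro eqI) (simp_all add: inner_simps)
      then have "vdist V (vadd V d d') (vadd V u v) \<le> vdist V d u + vdist V d' v"
        using norm_add_le[of "vadd V d (vscale V (-1) u)" "vadd V d' (vscale V (-1) v)"]
          d(1,3)[THEN Dc] uv by (simp add: vdist_def)
      with d add show ?thesis by (intro bexI[of _ "vadd V d d'"]) auto
    qed
    then show ?thesis using uv by simp
  qed
  show "vscale V c v \<in> ?S" if v: "v \<in> ?S" for c v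
  proof -
    have sc: "vdist V (vscale V c d) (vscale V c v) = \<bar>c\<bar> * vdist V d v" if "d \<in> carr V" for d
    proof (rule power2_eq_imp_eq)
      have "(vdist V (vscale V c d) (vscale V c v))\<^sup>2 = c\<^sup>2 * (vdist V d v)\<^sup>2"
        using that v by (simp add: dist_sq inner_simps) (simp add: algebra_simps power2_eq_square)
      then show "(vdist V (vscale V c d) (vscale V c v))\<^sup>2 = (\<bar>c\<bar> * vdist V d v)\<^sup>2"
        by (simp add: power_mult_distrib)
    qed (use that v in simp_all)
    have "\<exists>d\<in>D. vdist V d (vscale V c v) < e" if e: "e > 0" for e :: real
    proof -
      \<comment> \<open>The summand 1 avoids a division by zero for c = 0.\<close>
      have "e / (\<bar>c\<bar> + 1) > 0" using e by simp
      then obtain d where d: "d \<in> D" "vdist V d v < e / (\<bar>c\<bar> + 1)"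
        using v by blast
      have "\<bar>c\<bar> * vdist V d v \<le> (\<bar>c\<bar> + 1) * vdist V d v"
        using d(1)[THEN Dc] v by (simp add: mult_right_mono)
      also have "\<dots> < e" using d(2) by (simp add: field_simps pos_less_divide_eq)
      finally show ?thesis
        using d scale by (intro bexI[of _ "vscale V c d"]) (auto simp: sc Dc)
    qed
    then show ?thesis using v by simp
  qed
  show "v \<in> ?S" if u: "\<And>n::nat. u n \<in> ?S" and v: "v \<in> carr V" "(\<lambda>n. vdist V (u n) v) \<longlonglongrightarrow> 0" for u v
  proof -
    have "\<exists>d\<in>D. vdist V d v < e" if e: "e > 0" for e :: real
    proof -
      have "\<forall>\<^sub>F n in sequentially. vdist V (u n) v < e / 2"
        using v e by (intro order_tendstoD) auto
      then obtain n where n: "vdist V (u n) v < e / 2"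
        using eventually_sequentially by auto
      have "e / 2 > 0" using e by simp
      then obtain d where d: "d \<in> D" "vdist V d (u n) < e / 2"
        using u by blast
      have "vdist V d v \<le> vdist V d (u n) + vdist V (u n) v"
        using u[of n] v d(1)[THEN Dc] by (intro dist_triangle) auto
      then show ?thesis using n d by (intro bexI[of _ d]) auto
    qed
    then show ?thesis using v by simp
  qed
qed auto

text \<open>The closure of the linear subspace D is a closed subspace and contains the total set T.
  This is the passage from totality to approximation.\<close>

lemma total_dense:
  assumes "inner_product_space V" and D: "D \<subseteq> carr V" "vzero V \<in> D"
    and add: "\<And>u v. u \<in> D \<Longrightarrow> v \<in> D \<Longrightarrow> vadd V u v \<in> D"
    and scale: "\<And>c v. v \<in> D \<Longrightarrow> vscale V c v \<in> D"
    and T: "total V T" "T \<subseteq> D" and v: "v \<in> carr V" "e > 0"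
  shows "\<exists>d\<in>D. vdist V d v < e"
proof -
  interpret inner_product_space V by fact
  have "T \<subseteq> {v \<in> carr V. \<forall>e>0. \<exists>d\<in>D. vdist V d v < e}"
  proof
    fix t assume "t \<in> T"
    then have "t \<in> D" "t \<in> carr V" using T D by auto
    then show "t \<in> {v \<in> carr V. \<forall>e>0. \<exists>d\<in>D. vdist V d v < e}"
      by (auto intro!: bexI[of _ t])
  qed
  then have "v \<in> {v \<in> carr V. \<forall>e>0. \<exists>d\<in>D. vdist V d v < e}"
    by (intro totalD[OF T(1) closed_subspace_dense[OF assms(1) D add scale] _ v(1)])
  then show ?thesis using v by blast
qed

lemma cauchy_seqs_mono:
  assumes "u \<in> cauchy_seqs V" "\<And>n. w n \<in> carr W" "\<And>m n. vdist W (w m) (w n) = c * vdist V (u m) (u n)"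
    and c: "c \<ge> 0"
  shows "w \<in> cauchy_seqs W"
  unfolding cauchy_seqs_def
proof (intro CollectI conjI allI impI assms(2))
  fix e :: real assume "e > 0"
  then have "e / (c + 1) > 0" using c by simp
  then obtain N where N: "\<forall>m\<ge>N. \<forall>n\<ge>N. vdist V (u m) (u n) < e / (c + 1)"
    using assms(1) unfolding cauchy_seqs_def by blast
  have "vdist W (w m) (w n) < e" if "m \<ge> N" "n \<ge> N" for m n
  proof -
    have d: "vdist V (u m) (u n) < e / (c + 1)" using N that by blast
    have "c * vdist V (u m) (u n) \<le> c * (e / (c + 1))"
      using d c by (intro mult_left_mono) auto
    also have "\<dots> < e" using c \<open>e > 0\<close> by (simp add: field_simps)
    finally show ?thesis by (simp add: assms(3))
  qed
  then show "\<exists>N. \<forall>m\<ge>N. \<forall>n\<ge>N. vdist W (w m) (w n) < e" by blast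
qed

text \<open>The dense set is given by indices x with a map \<open>eV\<close>, not as a set of
  vectors. Sending \<open>eV x\<close> to \<open>eW x\<close> is well defined because agreement of
  the inner products makes distances proportional; the value at v is the limit along a chosen
  sequence of indices approximating v.\<close>

lemma conformal_extension_dense:
  assumes "inner_product_space V" "hilbert_space W"
    and X: "\<And>x. x \<in> X \<Longrightarrow> eV x \<in> carr V" "\<And>x. x \<in> X \<Longrightarrow> eW x \<in> carr W" "c \<ge> 0"
    and inn: "\<And>x y. x \<in> X \<Longrightarrow> y \<in> X \<Longrightarrow> vinner W (eW x) (eW y) = c * vinner V (eV x) (eV y)"
    and dense: "\<And>v e. v \<in> carr V \<Longrightarrow> e > 0 \<Longrightarrow> \<exists>x\<in>X. vdist V (eV x) v < e"
  shows "\<exists>A. conformal V W c A \<and> (\<forall>x\<in>X. A (eV x) = eW x)"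
proof -
  interpret V: inner_product_space V by fact
  interpret W: hilbert_space W by fact
  have dist: "vdist W (eW x) (eW y) = sqrt c * vdist V (eV x) (eV y)" if "x \<in> X" "y \<in> X" for x y
    by (rule power2_eq_imp_eq)
      (use that X in \<open>simp_all add: W.dist_sq V.dist_sq inn power_mult_distrib algebra_simps\<close>)
  have "\<exists>x. (\<forall>n::nat. x n \<in> X) \<and> (\<lambda>n. vdist V (eV (x n)) v) \<longlonglongrightarrow> 0" if v: "v \<in> carr V" for v
  proof -
    have "\<forall>n::nat. \<exists>x. x \<in> X \<and> vdist V (eV x) v < 1 / Suc n"
      using dense[OF v] by (meson of_nat_0_less_iff zero_less_Suc zero_less_divide_1_iff)
    then obtain x where x: "\<And>n. x n \<in> X" "\<And>n::nat. vdist V (eV (x n)) v < 1 / Suc n"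
      by metis
    have "(\<lambda>n. vdist V (eV (x n)) v) \<longlonglongrightarrow> 0"
    proof (rule Lim_null_comparison)
      show "\<forall>\<^sub>F n in sequentially. norm (vdist V (eV (x n)) v) \<le> 1 / Suc n"
        using x(2) X(1)[OF x(1)] v by (intro always_eventually allI) (simp add: less_imp_le)
    qed (use LIMSEQ_inverse_real_of_nat in \<open>simp add: inverse_eq_divide\<close>)
    with x show ?thesis by blast
  qed
  then obtain x where x: "\<And>v n. v \<in> carr V \<Longrightarrow> x v n \<in> X"
    "\<And>v. v \<in> carr V \<Longrightarrow> (\<lambda>n::nat. vdist V (eV (x v n)) v) \<longlonglongrightarrow> 0"
    by metis
  have "\<exists>w\<in>carr W. (\<lambda>n. vdist W (eW (x v n)) w) \<longlonglongrightarrow> 0" if v: "v \<in> carr V" for v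
  proof (rule W.complete)
    have "(\<lambda>n. eV (x v n)) \<in> cauchy_seqs V"
      using x[OF v] X v by (intro V.tendsto_imp_cauchy) auto
    then show "(\<lambda>n. eW (x v n)) \<in> cauchy_seqs W"
      by (rule cauchy_seqs_mono[where c = "sqrt c"]) (use x(1)[OF v] X dist in simp_all)
  qed
  then obtain A where A: "\<And>v. v \<in> carr V \<Longrightarrow> A v \<in> carr W"
    "\<And>v. v \<in> carr V \<Longrightarrow> (\<lambda>n. vdist W (eW (x v n)) (A v)) \<longlonglongrightarrow> 0"
    by metis
  have "vinner W (A u) (A v) = c * vinner V u v" if uv: "u \<in> carr V" "v \<in> carr V" for u v
  proof (rule LIMSEQ_unique)
    show "(\<lambda>n. vinner W (eW (x u n)) (eW (x v n))) \<longlonglongrightarrow> vinner W (A u) (A v)"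
      using uv A x X by (intro W.tendsto_inner) auto
    have "(\<lambda>n. c * vinner V (eV (x u n)) (eV (x v n))) \<longlonglongrightarrow> c * vinner V u v"
      using uv x X by (intro tendsto_mult_left V.tendsto_inner) auto
    then show "(\<lambda>n. vinner W (eW (x u n)) (eW (x v n))) \<longlonglongrightarrow> c * vinner V u v"
      using uv x inn by simp
  qed
  moreover have "A (eV y) = eW y" if y: "y \<in> X" for y
  proof (rule W.tendsto_unique_dist)
    have v: "eV y \<in> carr V" using X y by simp
    show "(\<lambda>n. vdist W (eW (x (eV y) n)) (A (eV y))) \<longlonglongrightarrow> 0" using A v by simp
    have "(\<lambda>n. sqrt c * vdist V (eV (x (eV y) n)) (eV y)) \<longlonglongrightarrow> sqrt c * 0"
      using x v by (intro tendsto_mult_left) simp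
    then show "(\<lambda>n. vdist W (eW (x (eV y) n)) (eW y)) \<longlonglongrightarrow> 0"
      using x v y dist by simp
  qed (use X y A x in auto)
  ultimately show ?thesis
    using A X unfolding conformal_def by blast
qed

text \<open>Lists of coefficients and indices serve as names for the elements of a linear span, so
  that the same formal combination can be evaluated in two spaces.\<close>

definition lin_comb :: "'v ip_space \<Rightarrow> ('e \<Rightarrow> 'v) \<Rightarrow> (real \<times> 'e) list \<Rightarrow> 'v" where
  "lin_comb V f xs = foldr (\<lambda>(c, e). vadd V (vscale V c (f e))) xs (vzero V)"

context inner_product_space begin

lemma lin_comb_closed: "f ` snd ` set xs \<subseteq> carr V \<Longrightarrow> lin_comb V f xs \<in> carr V"
  by (induction xs) (auto simp: lin_comb_def)

lemma inner_lin_comb: "f ` snd ` set xs \<subseteq> carr V \<Longrightarrow> w \<in> carr V \<Longrightarrow>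
    vinner V (lin_comb V f xs) w = (\<Sum>(c, e)\<leftarrow>xs. c * vinner V (f e) w)"
proof (induction xs)
  case (Cons a xs)
  then have "lin_comb V f xs \<in> carr V" by (intro lin_comb_closed) auto
  then show ?case using Cons by (cases a) (simp add: lin_comb_def inner_simps)
qed (simp add: lin_comb_def inner_simps)

end

text \<open>The Gram matrices of the two families agree up to the factor c; hence so do the inner
  products of formal linear combinations, and in V these are dense.\<close>

lemma conformal_extension:
  assumes V: "inner_product_space V" and W: "hilbert_space W"
    and T: "total V (eV ` T)" "\<And>x. x \<in> T \<Longrightarrow> eW x \<in> carr W" "c \<ge> 0"
    and inn: "\<And>x y. x \<in> T \<Longrightarrow> y \<in> T \<Longrightarrow> vinner W (eW x) (eW y) = c * vinner V (eV x) (eV y)"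
  shows "\<exists>A. conformal V W c A \<and> (\<forall>x\<in>T. A (eV x) = eW x)"
proof -
  interpret V: inner_product_space V by fact
  interpret W: hilbert_space W by fact
  have eV: "\<And>x. x \<in> T \<Longrightarrow> eV x \<in> carr V" using T by (auto simp: total_def)
  let ?X = "{xs. snd ` set xs \<subseteq> T}"
  have cV: "lin_comb V eV xs \<in> carr V" and cW: "lin_comb W eW xs \<in> carr W" if "xs \<in> ?X" for xs
    using that eV T(2) by (auto intro!: V.lin_comb_closed W.lin_comb_closed)
  have inn1: "vinner W (lin_comb W eW xs) (eW y) = c * vinner V (lin_comb V eV xs) (eV y)"
    if "xs \<in> ?X" "y \<in> T" for xs y
  proof -
    have "vinner W (lin_comb W eW xs) (eW y) = (\<Sum>(c, e)\<leftarrow>xs. c * vinner W (eW e) (eW y))"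
      using that T(2) by (intro W.inner_lin_comb) auto
    also have "\<dots> = (\<Sum>(a, e)\<leftarrow>xs. c * (a * vinner V (eV e) (eV y)))"
      using that by (intro arg_cong[of _ _ sum_list] map_cong) (auto simp: inn)
    also have "\<dots> = c * vinner V (lin_comb V eV xs) (eV y)"
      using that eV by (subst V.inner_lin_comb) (auto simp: sum_list_const_mult case_prod_unfold)
    finally show ?thesis .
  qed
  have inn2: "vinner W (lin_comb W eW xs) (lin_comb W eW ys) =
      c * vinner V (lin_comb V eV xs) (lin_comb V eV ys)" if "xs \<in> ?X" "ys \<in> ?X" for xs ys
  proof -
    have "vinner W (lin_comb W eW xs) (lin_comb W eW ys) =
        (\<Sum>(a, e)\<leftarrow>xs. a * vinner W (eW e) (lin_comb W eW ys))"
      using that T(2) cW by (intro W.inner_lin_comb) auto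
    also have "\<dots> = (\<Sum>(a, e)\<leftarrow>xs. c * (a * vinner V (eV e) (lin_comb V eV ys)))"
    proof (intro arg_cong[of _ _ sum_list] map_cong refl, clarify)
      fix a e assume "(a, e) \<in> set xs"
      then have "e \<in> T" using that by force
      then show "a * vinner W (eW e) (lin_comb W eW ys) = c * (a * vinner V (eV e) (lin_comb V eV ys))"
        using inn1[OF that(2), of e] cV[OF that(2)] cW[OF that(2)] eV T(2)
        by (simp add: W.inner_sym[of "eW e"] V.inner_sym[of "eV e"])
    qed
    also have "\<dots> = c * vinner V (lin_comb V eV xs) (lin_comb V eV ys)"
      using that eV cV by (subst V.inner_lin_comb) (auto simp: sum_list_const_mult case_prod_unfold)
    finally show ?thesis .
  qed
  have "\<exists>A. conformal V W c A \<and> (\<forall>xs\<in>?X. A (lin_comb V eV xs) = lin_comb W eW xs)"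
  proof (rule conformal_extension_dense[OF V W cV cW \<open>c \<ge> 0\<close> inn2])
    fix v and e :: real assume v: "v \<in> carr V" "e > 0"
    have "\<exists>d\<in>lin_comb V eV ` ?X. vdist V d v < e"
    proof (rule total_dense[OF V _ _ _ _ T(1) _ v])
      show "lin_comb V eV ` ?X \<subseteq> carr V" using cV by blast
      show "vzero V \<in> lin_comb V eV ` ?X"
        by (rule image_eqI[of _ _ "[]"]) (simp_all add: lin_comb_def)
      show "vadd V u v \<in> lin_comb V eV ` ?X" if uv: "u \<in> lin_comb V eV ` ?X" "v \<in> lin_comb V eV ` ?X" for u v
      proof -
        obtain xs ys where xs: "xs \<in> ?X" "u = lin_comb V eV xs" and ys: "ys \<in> ?X" "v = lin_comb V eV ys"
          using uv by blast
        have xsys: "xs @ ys \<in> ?X" using xs ys by auto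
        have "vadd V u v = lin_comb V eV (xs @ ys)"
        proof (rule V.eqI)
          fix w assume "w \<in> carr V"
          moreover have "eV ` snd ` set (xs @ ys) \<subseteq> carr V" using xsys eV by auto
          ultimately show "vinner V (vadd V u v) w = vinner V (lin_comb V eV (xs @ ys)) w"
            using cV[OF xs(1)] cV[OF ys(1)] xs ys
              V.inner_lin_comb[of eV xs w] V.inner_lin_comb[of eV ys w] V.inner_lin_comb[of eV "xs @ ys" w]
            by (simp add: V.inner_simps image_subset_iff ball_Un)
        qed (use cV xs ys xsys in simp_all)
        then show ?thesis using xsys by blast
      qed
      show "vscale V a u \<in> lin_comb V eV ` ?X" if u: "u \<in> lin_comb V eV ` ?X" for a u
      proof -
        obtain xs where xs: "xs \<in> ?X" "u = lin_comb V eV xs"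
          using u by blast
        let ?ys = "map (\<lambda>(b, e). (a * b, e)) xs"
        have ys: "?ys \<in> ?X" using xs by auto
        have "vscale V a u = lin_comb V eV ?ys"
        proof (rule V.eqI)
          fix w assume w: "w \<in> carr V"
          have "vinner V (lin_comb V eV ?ys) w = (\<Sum>(c, e)\<leftarrow>?ys. c * vinner V (eV e) w)"
            using ys eV w by (intro V.inner_lin_comb) auto
          also have "\<dots> = (\<Sum>(c, e)\<leftarrow>xs. a * (c * vinner V (eV e) w))"
            by (simp add: case_prod_unfold o_def mult.assoc)
          also have "\<dots> = a * vinner V (lin_comb V eV xs) w"
            using xs eV w by (subst V.inner_lin_comb) (auto simp: sum_list_const_mult case_prod_unfold)
          finally show "vinner V (vscale V a u) w = vinner V (lin_comb V eV ?ys) w"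
            using cV[OF xs(1)] xs w by (simp add: V.inner_simps)
        qed (use cV xs ys in simp_all)
        then show ?thesis using ys by blast
      qed
      show "eV ` T \<subseteq> lin_comb V eV ` ?X"
      proof
        fix u assume "u \<in> eV ` T"
        then obtain t where t: "t \<in> T" "u = eV t" by blast
        have "u = lin_comb V eV [(1, t)]"
          by (rule V.eqI) (use t eV in \<open>simp_all add: lin_comb_def V.inner_simps\<close>)
        then show "u \<in> lin_comb V eV ` ?X" using t by auto
      qed
    qed
    then show "\<exists>xs\<in>?X. vdist V (lin_comb V eV xs) v < e" by blast
  qed
  then obtain A where A: "conformal V W c A" "\<And>xs. xs \<in> ?X \<Longrightarrow> A (lin_comb V eV xs) = lin_comb W eW xs"
    by blast
  have "A (eV t) = eW t" if t: "t \<in> T" for t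
  proof -
    have "lin_comb V eV [(1, t)] = eV t"
      by (rule V.eqI) (use t eV in \<open>simp_all add: lin_comb_def V.inner_simps\<close>)
    moreover have "lin_comb W eW [(1, t)] = eW t"
      by (rule W.eqI) (use t T(2) in \<open>simp_all add: lin_comb_def W.inner_simps\<close>)
    ultimately show ?thesis using A(2)[of "[(1, t)]"] t by simp
  qed
  with A show ?thesis by blast
qed

section \<open>Riesz representation and adjoints\<close>

lemma (in hilbert_space) riesz_representation:
  assumes add: "\<And>u v. u \<in> carr V \<Longrightarrow> v \<in> carr V \<Longrightarrow> \<phi> (vadd V u v) = \<phi> u + \<phi> v"
    and scale: "\<And>c v. v \<in> carr V \<Longrightarrow> \<phi> (vscale V c v) = c * \<phi> v"
    and bound: "\<And>v. v \<in> carr V \<Longrightarrow> \<bar>\<phi> v\<bar> \<le> C * vnorm V v"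
  shows "\<exists>a\<in>carr V. \<forall>v\<in>carr V. vinner V a v = \<phi> v"
proof -
  text \<open>The representing vector minimises \<open>E\<close>; a minimising sequence is Cauchy by the parallelogram law.\<close>
  define E where "E v = vinner V v v - 2 * \<phi> v" for v
  define m where "m = Inf (E ` carr V)"
  \<comment> \<open>Completing the square: the bound on \<phi> gives E v >= ||v||^2 - 2 C ||v|| >= -
    C^2.\<close>
  have E_ge: "- C\<^sup>2 \<le> E v" if v: "v \<in> carr V" for v
  proof -
    have "0 \<le> (vnorm V v - C)\<^sup>2" by simp
    then have "2 * (C * vnorm V v) \<le> vinner V v v + C\<^sup>2"
      by (simp add: power2_diff norm_sq[OF v] algebra_simps)
    then show ?thesis
      using bound[OF v] unfolding E_def abs_le_iff by linarith
  qed
  then have bdd: "bdd_below (E ` carr V)" by (rule bdd_belowI2)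
  have m_le: "m \<le> E v" if "v \<in> carr V" for v
    unfolding m_def using that bdd by (intro cINF_lower)
  have "\<exists>v. v \<in> carr V \<and> E v < m + 1 / Suc n" for n :: nat
  proof -
    have "Inf (E ` carr V) < m + 1 / Suc n" by (simp add: m_def)
    then show ?thesis using bdd zero_closed by (subst (asm) cInf_less_iff) auto
  qed
  then obtain u where u: "\<And>n. u n \<in> carr V" "\<And>n::nat. E (u n) < m + 1 / Suc n"
    by metis
  \<comment> \<open>By the parallelogram law ||v - w||^2 = 2 E v + 2 E w - 4 E ((v + w) / 2), and
    the value at the midpoint is at least \<open>m\<close>.\<close>
  have par: "(vdist V v w)\<^sup>2 \<le> 2 * (E v - m) + 2 * (E w - m)" if "v \<in> carr V" "w \<in> carr V" for v w
    using m_le[of "vscale V (1/2) (vadd V v w)"] that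
    by (simp add: E_def dist_sq inner_simps add scale inner_sym[of w v]) argo
  have "u \<in> cauchy_seqs V"
    unfolding cauchy_seqs_def
  proof (intro CollectI conjI allI impI u)
    fix e :: real assume e: "e > 0"
    then obtain N :: nat where N: "1 / Suc N < e\<^sup>2 / 4"
      using nat_approx_posE[of "e\<^sup>2 / 4"] by auto
    have "vdist V (u k) (u n) < e" if "k \<ge> N" "n \<ge> N" for k n
    proof (rule power2_less_imp_less)
      have "1 / Suc k \<le> 1 / Suc N" "1 / Suc n \<le> 1 / Suc N"
        using that by (simp_all add: frac_le)
      then show "(vdist V (u k) (u n))\<^sup>2 < e\<^sup>2"
        using par[OF u(1) u(1), of k n] u(2)[of k] u(2)[of n] N by argo
    qed (use e in simp)
    then show "\<exists>N. \<forall>k\<ge>N. \<forall>n\<ge>N. vdist V (u k) (u n) < e" by blast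
  qed
  then obtain a where a: "a \<in> carr V" "(\<lambda>n. vdist V (u n) a) \<longlonglongrightarrow> 0"
    using complete by blast
  have "(\<lambda>n. \<phi> (u n) - \<phi> a) \<longlonglongrightarrow> 0"
  proof (rule Lim_null_comparison)
    have "\<bar>\<phi> (u n) - \<phi> a\<bar> \<le> C * vdist V (u n) a" for n
      using bound[of "vadd V (u n) (vscale V (-1) a)"] u a by (simp add: add scale vdist_def)
    then show "\<forall>\<^sub>F n in sequentially. norm (\<phi> (u n) - \<phi> a) \<le> C * vdist V (u n) a" by simp
  qed (use tendsto_mult_left[OF a(2), of C] in simp)
  then have "(\<lambda>n. \<phi> (u n)) \<longlonglongrightarrow> \<phi> a" by (simp add: LIM_zero_iff)
  then have "(\<lambda>n. E (u n)) \<longlonglongrightarrow> E a"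
    unfolding E_def using a u by (intro tendsto_intros tendsto_inner) auto
  moreover have "(\<lambda>n. m + 1 / Suc n) \<longlonglongrightarrow> m"
    using LIMSEQ_inverse_real_of_nat_add[of m] by (simp add: inverse_eq_divide)
  ultimately have Ea: "E a \<le> m"
    using u(2) by (intro LIMSEQ_le[of "\<lambda>n. E (u n)" _ "\<lambda>n. m + 1 / Suc n"]) (auto intro: less_imp_le)
  have "vinner V a v = \<phi> v" if v: "v \<in> carr V" for v
  proof -
    have q: "0 \<le> 2 * t * (vinner V a v - \<phi> v) + t * t * vinner V v v" for t
      using m_le[of "vadd V a (vscale V t v)"] Ea a v
      by (simp add: E_def inner_simps add scale inner_sym[of v a] algebra_simps)
    show ?thesis
    proof (rule ccontr)
      assume ne: "vinner V a v \<noteq> \<phi> v"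
      define d where "d = vinner V a v - \<phi> v"
      have d: "d \<noteq> 0" using ne by (simp add: d_def)
      let ?s = "vinner V v v + 1"
      have s: "?s > 0" using inner_nonneg[OF v] by simp
      \<comment> \<open>Moving from a by -r times v would lower \<open>E\<close>; the summand 1 in
        the denominator allows for vectors v of norm zero.\<close>
      define r where "r = d / ?s"
      have dr: "d = r * ?s" using s by (simp add: r_def)
      have "0 \<le> 2 * (- r) * d + (- r) * (- r) * vinner V v v"
        using q[of "- r"] unfolding d_def by simp
      also have "\<dots> = - (r * r * (vinner V v v + 2))"
        unfolding dr by (simp add: algebra_simps)
      also have "\<dots> < 0"
        using d s dr inner_nonneg[OF v] by (auto simp: zero_less_mult_iff)
      finally show False by simp
    qed
  qed
  with a show ?thesis by blast
qed

text \<open>B w is the vector that represents the functional sending v to (w, A v). The annihilation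
  operator is obtained from the creation operator in this way, since in general it does not multiply
  inner products by a constant.\<close>

lemma adjoint_exists:
  assumes A: "bounded_map V W A" and "hilbert_space V" "inner_product_space W"
  shows "\<exists>B. bounded_map W V B \<and> (\<forall>w\<in>carr W. \<forall>v\<in>carr V. vinner V (B w) v = vinner W w (A v))"
proof -
  interpret V: hilbert_space V by fact
  interpret W: inner_product_space W by fact
  note lin = bounded_map_linear[OF A] and Ac = linear_maps_closed[OF bounded_map_linear[OF A]]
  obtain C where C: "\<And>v. v \<in> carr V \<Longrightarrow> vnorm W (A v) \<le> C * vnorm V v"
    using A by (auto simp: bounded_map_def)
  have "\<exists>a\<in>carr V. \<forall>v\<in>carr V. vinner V a v = vinner W w (A v)" if w: "w \<in> carr W" for w
  proof (rule V.riesz_representation)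
    fix v assume v: "v \<in> carr V"
    have "\<bar>vinner W w (A v)\<bar> \<le> vnorm W w * vnorm W (A v)"
      using w v by (intro W.abs_inner_le Ac)
    also have "\<dots> \<le> vnorm W w * (C * vnorm V v)"
      using w v C by (intro mult_left_mono) auto
    finally show "\<bar>vinner W w (A v)\<bar> \<le> (vnorm W w * C) * vnorm V v" by simp
  qed (use w in \<open>simp_all add: linear_maps_add[OF lin] linear_maps_scale[OF lin] W.inner_simps Ac\<close>)
  then obtain B where B: "\<And>w. w \<in> carr W \<Longrightarrow> B w \<in> carr V"
    "\<And>w v. w \<in> carr W \<Longrightarrow> v \<in> carr V \<Longrightarrow> vinner V (B w) v = vinner W w (A v)"
    by metis
  have "B \<in> linear_maps W V"
    unfolding linear_maps_def
  proof (intro CollectI conjI ballI allI funcsetI)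
    show "B (vadd W u v) = vadd V (B u) (B v)" if "u \<in> carr W" "v \<in> carr W" for u v
      using that by (intro V.eqI) (simp_all add: B V.inner_simps W.inner_simps Ac)
    show "B (vscale W c v) = vscale V c (B v)" if "v \<in> carr W" for c v
      using that by (intro V.eqI) (simp_all add: B V.inner_simps W.inner_simps Ac)
  qed (rule B)
  moreover have "vnorm V (B w) \<le> \<bar>C\<bar> * vnorm W w" if w: "w \<in> carr W" for w
  proof (cases "vnorm V (B w) = 0")
    case False
    then have pos: "vnorm V (B w) > 0" using B w V.norm_nonneg by (metis less_eq_real_def)
    have "(vnorm V (B w))\<^sup>2 = vinner W w (A (B w))"
      using w B by (simp add: V.norm_sq)
    also have "\<dots> \<le> vnorm W w * vnorm W (A (B w))"
      using W.abs_inner_le[of w "A (B w)"] w B Ac by simp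
    also have "\<dots> \<le> vnorm W w * (\<bar>C\<bar> * vnorm V (B w))"
    proof (rule mult_left_mono)
      have "C * vnorm V (B w) \<le> \<bar>C\<bar> * vnorm V (B w)" using pos by (simp add: mult_right_mono)
      then show "vnorm W (A (B w)) \<le> \<bar>C\<bar> * vnorm V (B w)"
        using C[OF B(1)[OF w]] by linarith
    qed (use w in simp)
    finally show ?thesis using pos by (simp add: power2_eq_square mult_ac)
  qed (use w in simp)
  ultimately show ?thesis using B unfolding bounded_map_def by blast
qed

section \<open>Direct sums\<close>

lemma (in inner_product_space) dist_add_le:
  assumes [simp]: "u \<in> carr V" "v \<in> carr V"
  shows "vinner V (vadd V u v) (vadd V u v) \<le> 2 * vinner V u u + 2 * vinner V v v"
proof -
  have "0 \<le> (vdist V u v)\<^sup>2" by simp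
  then show ?thesis by (simp add: dist_sq inner_simps inner_sym[of v u])
qed

lemma nonneg_sums_le_imp_summable:
  fixes f :: "'i \<Rightarrow> real"
  assumes "\<And>i. i \<in> I \<Longrightarrow> f i \<ge> 0" "\<And>F. finite F \<Longrightarrow> F \<subseteq> I \<Longrightarrow> sum f F \<le> B"
  shows "f summable_on I" "infsum f I \<le> B"
proof -
  have "bdd_above (sum f ` {F. F \<subseteq> I \<and> finite F})"
    using assms(2) by (intro bdd_aboveI2[where M = B]) simp
  then show "f summable_on I"
    using assms(1) by (intro nonneg_bdd_above_summable_on) auto
  then show "infsum f I \<le> B"
    using assms(2) by (intro infsum_le_finite_sums) auto
qed

locale direct_sum =
  fixes I :: "'i set" and V :: "'i \<Rightarrow> 'v ip_space"
  assumes ips: "\<And>i. i \<in> I \<Longrightarrow> inner_product_space (V i)"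
begin

lemma dsum_carr_iff: "f \<in> carr (dsum I V) \<longleftrightarrow> f \<in> extensional I \<and> (\<forall>i\<in>I. f i \<in> carr (V i)) \<and>
    (\<lambda>i. vinner (V i) (f i) (f i)) summable_on I"
proof -
  have "(\<lambda>i. (vnorm (V i) (f i))\<^sup>2) summable_on I \<longleftrightarrow> (\<lambda>i. vinner (V i) (f i) (f i)) summable_on I"
    if "\<forall>i\<in>I. f i \<in> carr (V i)"
    using that by (intro summable_on_cong) (simp add: inner_product_space.norm_sq[OF ips])
  then show ?thesis by (auto simp: dsum_def PiE_def)
qed

lemma dsum_comp: "f \<in> carr (dsum I V) \<Longrightarrow> i \<in> I \<Longrightarrow> f i \<in> carr (V i)"
  by (simp add: dsum_carr_iff)

lemma dsum_ops:
  "vadd (dsum I V) f g = (\<lambda>i\<in>I. vadd (V i) (f i) (g i))"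
  "vscale (dsum I V) c f = (\<lambda>i\<in>I. vscale (V i) c (f i))"
  "vzero (dsum I V) = (\<lambda>i\<in>I. vzero (V i))"
  "vinner (dsum I V) f g = (\<Sum>\<^sub>\<infinity>i\<in>I. vinner (V i) (f i) (g i))"
  by (simp_all add: dsum_def)

lemma dsum_inner_summable:
  assumes "f \<in> carr (dsum I V)" "g \<in> carr (dsum I V)"
  shows "(\<lambda>i. vinner (V i) (f i) (g i)) summable_on I"
proof -
  have "(\<lambda>i. norm (vinner (V i) (f i) (g i))) summable_on I"
  proof (rule summable_on_comparison_test)
    show "(\<lambda>i. vinner (V i) (f i) (f i) + vinner (V i) (g i) (g i)) summable_on I"
      using assms by (intro summable_on_add) (simp_all add: dsum_carr_iff)
    fix i assume i: "i \<in> I"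
    interpret inner_product_space "V i" using i by (rule ips)
    have c: "f i \<in> carr (V i)" "g i \<in> carr (V i)" using assms i by (auto intro: dsum_comp)
    have "\<bar>vinner (V i) (f i) (g i)\<bar> \<le> vnorm (V i) (f i) * vnorm (V i) (g i)"
      using c by (rule abs_inner_le)
    moreover have "2 * (vnorm (V i) (f i) * vnorm (V i) (g i)) \<le> (vnorm (V i) (f i))\<^sup>2 + (vnorm (V i) (g i))\<^sup>2"
      using sum_squares_bound[of "vnorm (V i) (f i)" "vnorm (V i) (g i)"] by simp
    moreover have "0 \<le> vnorm (V i) (f i) * vnorm (V i) (g i)" using c by simp
    ultimately show "norm (vinner (V i) (f i) (g i)) \<le> vinner (V i) (f i) (f i) + vinner (V i) (g i) (g i)"
      unfolding norm_sq[OF c(1)] norm_sq[OF c(2)] real_norm_def by linarith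
  qed simp
  then show ?thesis by (rule abs_summable_summable)
qed

lemma dsum_inner_space: "inner_product_space (dsum I V)"
proof
  show "vadd (dsum I V) f g \<in> carr (dsum I V)" if "f \<in> carr (dsum I V)" "g \<in> carr (dsum I V)" for f g
  proof -
    have "(\<lambda>i. vinner (V i) (vadd (V i) (f i) (g i)) (vadd (V i) (f i) (g i))) summable_on I"
    proof (rule summable_on_comparison_test)
      show "(\<lambda>i. 2 * vinner (V i) (f i) (f i) + 2 * vinner (V i) (g i) (g i)) summable_on I"
        using that by (intro summable_on_add summable_on_cmult_right) (simp_all add: dsum_carr_iff)
      fix i assume i: "i \<in> I"
      interpret inner_product_space "V i" using i by (rule ips)
      show "vinner (V i) (vadd (V i) (f i) (g i)) (vadd (V i) (f i) (g i)) \<le>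
          2 * vinner (V i) (f i) (f i) + 2 * vinner (V i) (g i) (g i)"
        using that i by (intro dist_add_le dsum_comp)
      show "0 \<le> vinner (V i) (vadd (V i) (f i) (g i)) (vadd (V i) (f i) (g i))"
        using that i by (intro inner_nonneg add_closed dsum_comp)
    qed
    then have "(\<lambda>i. vinner (V i) (vadd (dsum I V) f g i) (vadd (dsum I V) f g i)) summable_on I"
      by (subst summable_on_cong) (simp_all add: dsum_ops)
    then show ?thesis
      using that by (auto simp: dsum_carr_iff dsum_ops inner_product_space.add_closed[OF ips])
  qed
  show "vscale (dsum I V) c f \<in> carr (dsum I V)" if f: "f \<in> carr (dsum I V)" for c f
  proof -
    have "(\<lambda>i. c\<^sup>2 * vinner (V i) (f i) (f i)) summable_on I"
      using f by (intro summable_on_cmult_right) (simp_all add: dsum_carr_iff)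
    then have "(\<lambda>i. vinner (V i) (vscale (dsum I V) c f i) (vscale (dsum I V) c f i)) summable_on I"
      using dsum_comp[OF f]
      by (subst summable_on_cong) (auto simp: dsum_ops power2_eq_square
          inner_product_space.inner_scale_left[OF ips] inner_product_space.inner_scale_right[OF ips]
          inner_product_space.scale_closed[OF ips])
    then show ?thesis
      using f by (auto simp: dsum_carr_iff dsum_ops inner_product_space.scale_closed[OF ips])
  qed
  show "vzero (dsum I V) \<in> carr (dsum I V)"
  proof -
    have "(\<lambda>i. vinner (V i) (vzero (dsum I V) i) (vzero (dsum I V) i)) summable_on I"
      by (subst summable_on_cong[where g = "\<lambda>_. 0"])
        (auto simp: dsum_ops inner_product_space.inner_zero_left[OF ips] inner_product_space.zero_closed[OF ips])
    then show ?thesis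
      by (auto simp: dsum_carr_iff dsum_ops inner_product_space.zero_closed[OF ips])
  qed
  fix f g h assume f: "f \<in> carr (dsum I V)" and g: "g \<in> carr (dsum I V)"
  show "vinner (dsum I V) f g = vinner (dsum I V) g f"
    unfolding dsum_ops using f g by (intro infsum_cong inner_product_space.inner_sym[OF ips] dsum_comp)
  show "f = g" if d: "vdist (dsum I V) f g = 0"
  proof (rule extensionalityI)
    let ?d = "\<lambda>i. (vdist (V i) (f i) (g i))\<^sup>2"
    have e: "?d i = vinner (V i) (f i) (f i) + (- 2) * vinner (V i) (f i) (g i) + vinner (V i) (g i) (g i)"
      if "i \<in> I" for i
      using inner_product_space.dist_sq[OF ips[OF that]] dsum_comp[OF f that] dsum_comp[OF g that] by simp
    have "?d summable_on I"
      by (subst summable_on_cong[OF e], assumption, intro summable_on_add summable_on_cmult_right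
          dsum_inner_summable f g)
    have eq: "vinner (V i) (vadd (V i) (f i) (vscale (V i) (-1) (g i))) (vadd (V i) (f i) (vscale (V i) (-1) (g i))) = ?d i"
      if i: "i \<in> I" for i
    proof -
      interpret inner_product_space "V i" using i by (rule ips)
      show ?thesis
        unfolding vdist_def using dsum_comp[OF f i] dsum_comp[OF g i] by (simp add: norm_sq)
    qed
    have "sqrt (\<Sum>\<^sub>\<infinity>i\<in>I. ?d i) = 0"
      using d unfolding vdist_def[of "dsum I V"] vnorm_def[of "dsum I V"] dsum_ops
      by (subst infsum_cong[OF eq[symmetric]]) (auto cong: infsum_cong)
    then have "infsum ?d I = 0" by simp
    then have "?d i = 0" if "i \<in> I" for i
      using that \<open>?d summable_on I\<close> by (intro nonneg_infsum_le_0D[of ?d I]) auto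
    then show "f i = g i" if "i \<in> I" for i
      using inner_product_space.dist_0_imp_eq[OF ips[OF that]] dsum_comp[OF f that] dsum_comp[OF g that] that
      by simp
  qed (use f g in \<open>simp_all add: dsum_carr_iff\<close>)
  show "0 \<le> vinner (dsum I V) f f"
    unfolding dsum_ops using f by (intro infsum_nonneg inner_product_space.inner_nonneg[OF ips] dsum_comp)
  show "vinner (dsum I V) (vscale (dsum I V) c f) g = c * vinner (dsum I V) f g" for c
    unfolding dsum_ops using f g
    by (subst infsum_cmult_right[symmetric])
      (auto intro!: infsum_cong dsum_inner_summable simp: inner_product_space.inner_scale_left[OF ips] dsum_comp)
  show "vinner (dsum I V) (vzero (dsum I V)) f = 0"
    unfolding dsum_ops using f
    by (intro infsum_0) (simp add: inner_product_space.inner_zero_left[OF ips] dsum_comp)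
  assume h: "h \<in> carr (dsum I V)"
  show "vinner (dsum I V) (vadd (dsum I V) f g) h = vinner (dsum I V) f h + vinner (dsum I V) g h"
    unfolding dsum_ops using f g h
    by (subst infsum_add[symmetric])
      (auto intro!: infsum_cong dsum_inner_summable simp: inner_product_space.inner_add_left[OF ips] dsum_comp)
qed

sublocale S: inner_product_space "dsum I V" by (rule dsum_inner_space)

lemma dsum_dist_sq:
  assumes f: "f \<in> carr (dsum I V)" and g: "g \<in> carr (dsum I V)"
  shows "((\<lambda>i. (vdist (V i) (f i) (g i))\<^sup>2) has_sum (vdist (dsum I V) f g)\<^sup>2) I"
proof -
  have hs: "((\<lambda>i. vinner (V i) (u i) (v i)) has_sum vinner (dsum I V) u v) I"
    if "u \<in> carr (dsum I V)" "v \<in> carr (dsum I V)" for u v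
    unfolding dsum_ops using dsum_inner_summable[OF that] by simp
  have sum: "((\<lambda>i. vinner (V i) (f i) (f i) + (- 2) * vinner (V i) (f i) (g i) + vinner (V i) (g i) (g i)) has_sum
      vinner (dsum I V) f f + (- 2) * vinner (dsum I V) f g + vinner (dsum I V) g g) I"
    by (intro has_sum_add has_sum_cmult_right hs f g)
  have terms: "vinner (V i) (f i) (f i) + (- 2) * vinner (V i) (f i) (g i) + vinner (V i) (g i) (g i) =
      (vdist (V i) (f i) (g i))\<^sup>2" if "i \<in> I" for i
    using inner_product_space.dist_sq[OF ips[OF that] dsum_comp[OF f that] dsum_comp[OF g that]] by simp
  have "(vdist (dsum I V) f g)\<^sup>2 =
      vinner (dsum I V) f f + (- 2) * vinner (dsum I V) f g + vinner (dsum I V) g g"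
    by (simp add: S.dist_sq[OF f g])
  then show ?thesis
    using iffD1[OF has_sum_cong[OF terms] sum] by simp
qed

definition dembed :: "'i \<Rightarrow> 'v \<Rightarrow> 'i \<Rightarrow> 'v" where
  "dembed i v = (\<lambda>j\<in>I. if j = i then v else vzero (V j))"

lemma dembed_closed:
  assumes "i \<in> I" "v \<in> carr (V i)"
  shows "dembed i v \<in> carr (dsum I V)"
proof -
  have "(\<lambda>j. vinner (V j) (dembed i v j) (dembed i v j)) summable_on {i}" by simp
  then have "(\<lambda>j. vinner (V j) (dembed i v j) (dembed i v j)) summable_on I"
    by (rule iffD1[OF summable_on_cong_neutral, rotated -1])
      (use assms in \<open>auto simp: dembed_def inner_product_space.inner_zero_left[OF ips] inner_product_space.zero_closed[OF ips]\<close>)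
  then show ?thesis
    using assms by (auto simp: dsum_carr_iff dembed_def inner_product_space.zero_closed[OF ips])
qed

lemma inner_dembed:
  assumes "i \<in> I" "v \<in> carr (V i)" "f \<in> carr (dsum I V)"
  shows "vinner (dsum I V) (dembed i v) f = vinner (V i) v (f i)"
proof -
  have "((\<lambda>j. vinner (V j) (dembed i v j) (f j)) has_sum vinner (V i) v (f i)) I"
    using assms by (intro has_sum_finite_neutralI[of "{i}"])
      (auto simp: dembed_def dsum_comp inner_product_space.inner_zero_left[OF ips])
  then show ?thesis unfolding dsum_ops by (rule infsumI)
qed

lemma dembed_conformal: "i \<in> I \<Longrightarrow> conformal (V i) (dsum I V) 1 (dembed i)"
  unfolding conformal_def by (auto simp: dembed_closed inner_dembed) (simp add: dembed_def)

end

lemma hilbert_space_inner: "hilbert_space V \<Longrightarrow> inner_product_space V"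
  by (simp add: hilbert_space_def)

text \<open>The components of a Cauchy sequence converge. Bounds on distances survive this limit for
  finite partial sums, and then hold for the full sum because its terms are nonnegative.\<close>

lemma dsum_hilbert:
  assumes H: "\<And>i. i \<in> I \<Longrightarrow> hilbert_space (V i)"
  shows "hilbert_space (dsum I V)"
proof -
  interpret direct_sum I V by (rule direct_sum.intro) (rule hilbert_space_inner[OF H])
  show ?thesis
  proof
    fix u assume u: "u \<in> cauchy_seqs (dsum I V)"
    then have uc: "u n \<in> carr (dsum I V)" for n by (simp add: cauchy_seqs_def)
    have le: "(\<Sum>i\<in>F. (vdist (V i) (u m i) (u n i))\<^sup>2) \<le> (vdist (dsum I V) (u m) (u n))\<^sup>2"
      if "finite F" "F \<subseteq> I" for F m n
      using dsum_dist_sq[OF uc uc, of m n] that finite_sum_le_has_sum by fastforce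
    have "\<exists>v\<in>carr (V i). (\<lambda>n. vdist (V i) (u n i) v) \<longlonglongrightarrow> 0" if i: "i \<in> I" for i
    proof -
      interpret Vi: hilbert_space "V i" using i by (rule H)
      have le1: "vdist (V i) (u m i) (u n i) \<le> vdist (dsum I V) (u m) (u n)" for m n
        using le[of "{i}" m n] i by (intro power2_le_imp_le[OF _ S.dist_nonneg]) (auto simp: uc)
      have "(\<lambda>n. u n i) \<in> cauchy_seqs (V i)"
        unfolding cauchy_seqs_def
      proof (intro CollectI conjI allI impI)
        fix e :: real assume "e > 0"
        then obtain N where "\<forall>m\<ge>N. \<forall>n\<ge>N. vdist (dsum I V) (u m) (u n) < e"
          using u unfolding cauchy_seqs_def by blast
        then show "\<exists>N. \<forall>m\<ge>N. \<forall>n\<ge>N. vdist (V i) (u m i) (u n i) < e"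
          using le1 by (intro exI[of _ N]) (meson le_less_trans)
      qed (use dsum_comp[OF uc i] in simp)
      then show ?thesis by (rule Vi.complete)
    qed
    then obtain v where v: "\<And>i. i \<in> I \<Longrightarrow> v i \<in> carr (V i)"
      "\<And>i. i \<in> I \<Longrightarrow> (\<lambda>n. vdist (V i) (u n i) (v i)) \<longlonglongrightarrow> 0"
      by metis
    let ?v = "restrict v I"
    have lim: "(\<Sum>i\<in>F. (vdist (V i) (u m i) (v i))\<^sup>2) \<le> e\<^sup>2"
      if F: "finite F" "F \<subseteq> I" and e: "\<And>n. n \<ge> N \<Longrightarrow> vdist (dsum I V) (u m) (u n) \<le> e" for F m e N
    proof (rule LIMSEQ_le_const2)
      show "(\<lambda>n. \<Sum>i\<in>F. (vdist (V i) (u m i) (u n i))\<^sup>2) \<longlonglongrightarrow> (\<Sum>i\<in>F. (vdist (V i) (u m i) (v i))\<^sup>2)"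
      proof (intro tendsto_sum tendsto_power)
        fix i assume "i \<in> F"
        then have i: "i \<in> I" using F by blast
        interpret Vi: hilbert_space "V i" using i by (rule H)
        show "(\<lambda>n. vdist (V i) (u m i) (u n i)) \<longlonglongrightarrow> vdist (V i) (u m i) (v i)"
          using v i dsum_comp[OF uc i] by (intro Vi.tendsto_dist) simp_all
      qed
      have "(\<Sum>i\<in>F. (vdist (V i) (u m i) (u n i))\<^sup>2) \<le> e\<^sup>2" if "n \<ge> N" for n
      proof -
        have "(vdist (dsum I V) (u m) (u n))\<^sup>2 \<le> e\<^sup>2"
          using e[OF that] by (intro power_mono S.dist_nonneg uc)
        then show ?thesis using le[OF F, of m n] by linarith
      qed
      then show "\<exists>N. \<forall>n\<ge>N. (\<Sum>i\<in>F. (vdist (V i) (u m i) (u n i))\<^sup>2) \<le> e\<^sup>2" by blast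
    qed
    have cauchy: "\<exists>N. \<forall>m\<ge>N. \<forall>n\<ge>N. vdist (dsum I V) (u m) (u n) < e" if "e > 0" for e
      using u that unfolding cauchy_seqs_def by blast
    have vc: "?v \<in> carr (dsum I V)"
    proof -
      obtain N where "\<forall>m\<ge>N. \<forall>n\<ge>N. vdist (dsum I V) (u m) (u n) < 1"
        using cauchy[OF zero_less_one] by blast
      then have N: "\<And>n. n \<ge> N \<Longrightarrow> vdist (dsum I V) (u N) (u n) \<le> 1" by (simp add: less_imp_le)
      have sd: "(\<lambda>i. (vdist (V i) (u N i) (v i))\<^sup>2) summable_on I"
        by (rule nonneg_sums_le_imp_summable(1)[where B = "1\<^sup>2"]) (simp, rule lim[OF _ _ N])
      have "(\<lambda>i. vinner (V i) (v i) (v i)) summable_on I"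
      proof (rule summable_on_comparison_test)
        show "(\<lambda>i. 2 * vinner (V i) (u N i) (u N i) + 2 * (vdist (V i) (u N i) (v i))\<^sup>2) summable_on I"
          using uc[of N] sd by (intro summable_on_add summable_on_cmult_right) (simp_all add: dsum_carr_iff)
        fix i assume i: "i \<in> I"
        interpret Vi: hilbert_space "V i" using i by (rule H)
        \<comment> \<open>Expanding ||2 u - v||^2 >= 0 gives ||v||^2 <= 2 ||u||^2 + 2 ||u - v||^2 in
          each component, whence square summability of the limit.\<close>
        have "0 \<le> vinner (V i) (vadd (V i) (vscale (V i) 2 (u N i)) (vscale (V i) (-1) (v i)))
            (vadd (V i) (vscale (V i) 2 (u N i)) (vscale (V i) (-1) (v i)))"
          using v i dsum_comp[OF uc i] by (intro Vi.inner_nonneg) simp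
        then show "vinner (V i) (v i) (v i) \<le> 2 * vinner (V i) (u N i) (u N i) + 2 * (vdist (V i) (u N i) (v i))\<^sup>2"
          using v i dsum_comp[OF uc i] by (simp add: Vi.dist_sq Vi.inner_simps Vi.inner_sym[of "v i" "u N i"])
        show "0 \<le> vinner (V i) (v i) (v i)" using v i by (simp add: Vi.inner_nonneg)
      qed
      then have "(\<lambda>i. vinner (V i) (?v i) (?v i)) summable_on I"
        by (subst summable_on_cong) simp_all
      then show ?thesis using v by (simp add: dsum_carr_iff)
    qed
    have "(\<lambda>n. vdist (dsum I V) (u n) ?v) \<longlonglongrightarrow> 0"
    proof (rule LIMSEQ_I)
      fix e :: real assume e: "e > 0"
      then obtain N where N: "\<And>m n. m \<ge> N \<Longrightarrow> n \<ge> N \<Longrightarrow> vdist (dsum I V) (u m) (u n) \<le> e / 2"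
        using cauchy[of "e / 2"] by (meson half_gt_zero less_imp_le)
      have "norm (vdist (dsum I V) (u m) ?v - 0) < e" if "m \<ge> N" for m
      proof -
        have "(vdist (dsum I V) (u m) ?v)\<^sup>2 = (\<Sum>\<^sub>\<infinity>i\<in>I. (vdist (V i) (u m i) (?v i))\<^sup>2)"
          by (rule infsumI[OF dsum_dist_sq[OF uc vc], symmetric])
        also have "\<dots> = (\<Sum>\<^sub>\<infinity>i\<in>I. (vdist (V i) (u m i) (v i))\<^sup>2)"
          by (intro infsum_cong) simp
        also have "\<dots> \<le> (e / 2)\<^sup>2"
          by (rule nonneg_sums_le_imp_summable(2)) (simp, rule lim[OF _ _ N[OF that]])
        finally have "vdist (dsum I V) (u m) ?v \<le> e / 2"
          by (rule power2_le_imp_le) (use e in simp)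
        then show ?thesis using e S.dist_nonneg[OF uc vc, of m] by simp
      qed
      then show "\<exists>N. \<forall>n\<ge>N. norm (vdist (dsum I V) (u n) ?v - 0) < e" by blast
    qed
    then show "\<exists>v\<in>carr (dsum I V). (\<lambda>n. vdist (dsum I V) (u n) v) \<longlonglongrightarrow> 0"
      using vc by blast
  qed
qed

text \<open>Closedness of a subspace refers to sequences, so a sequence is extracted from the net of
  finite partial sums.\<close>

lemma vhas_sum_in_closed:
  assumes "inner_product_space V" and S: "closed_subspace V S"
    and sum: "vhas_sum V x K v" and x: "\<And>k. k \<in> K \<Longrightarrow> x k \<in> S"
  shows "v \<in> S"
proof -
  interpret inner_product_space V by fact
  have lim: "((\<lambda>F. vdist V (vfinsum V x F) v) \<longlongrightarrow> 0) (finite_subsets_at_top K)" and v: "v \<in> carr V"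
    using sum by (auto simp: vhas_sum_def)
  have "\<exists>F. finite F \<and> F \<subseteq> K \<and> vdist V (vfinsum V x F) v < 1 / Suc n" for n :: nat
  proof -
    have "\<forall>\<^sub>F F in finite_subsets_at_top K. vdist V (vfinsum V x F) v < 1 / Suc n"
      using lim by (intro order_tendstoD) auto
    then show ?thesis
      unfolding eventually_finite_subsets_at_top by (metis order_refl)
  qed
  then obtain F where F: "\<And>n. finite (F n)" "\<And>n. F n \<subseteq> K"
    "\<And>n::nat. vdist V (vfinsum V x (F n)) v < 1 / Suc n"
    by metis
  have in_S: "vfinsum V x (F n) \<in> S" for n
    by (rule vfinsum_in_subspace[OF S F(1)]) (rule x[OF subsetD[OF F(2)]])
  have "(\<lambda>n. vdist V (vfinsum V x (F n)) v) \<longlonglongrightarrow> 0"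
  proof (rule Lim_null_comparison)
    show "\<forall>\<^sub>F n in sequentially. norm (vdist V (vfinsum V x (F n)) v) \<le> 1 / Suc n"
      using F(3) dist_nonneg[OF closed_subspaceD(1)[OF S in_S] v]
      by (intro always_eventually allI) (simp add: less_imp_le)
  qed (use LIMSEQ_inverse_real_of_nat in \<open>simp add: inverse_eq_divide\<close>)
  then show ?thesis
    using in_S v by - (rule closed_subspaceD(5)[OF S, of "\<lambda>n. vfinsum V x (F n)"])
qed

text \<open>Each vector is the unconditional sum of its embedded components, and these lie in S
  because the embeddings are bounded.\<close>

lemma (in direct_sum) dsum_total:
  assumes H: "\<And>i. i \<in> I \<Longrightarrow> hilbert_space (V i)" and T: "\<And>i. i \<in> I \<Longrightarrow> total (V i) (T i)"
  shows "total (dsum I V) (\<Union>i\<in>I. dembed i ` T i)"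
proof (rule totalI)
  interpret D: hilbert_space "dsum I V" by (rule dsum_hilbert[OF H])
  show "(\<Union>i\<in>I. dembed i ` T i) \<subseteq> carr (dsum I V)"
    using T by (auto simp: total_def intro!: dembed_closed)
  fix S f assume S: "closed_subspace (dsum I V) S" "(\<Union>i\<in>I. dembed i ` T i) \<subseteq> S" and f: "f \<in> carr (dsum I V)"
  have in_S: "dembed i v \<in> S" if i: "i \<in> I" and v: "v \<in> carr (V i)" for i v
  proof -
    have "v \<in> {v \<in> carr (V i). dembed i v \<in> S}"
    proof (rule totalD[OF T[OF i] _ _ v])
      show "closed_subspace (V i) {v \<in> carr (V i). dembed i v \<in> S}"
        using i by (intro closed_subspace_vimage[of _ "dsum I V"] conformal_bounded[of _ _ 1] dembed_conformal ips S
            dsum_inner_space)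
      show "T i \<subseteq> {v \<in> carr (V i). dembed i v \<in> S}"
        using S(2) T[OF i] i by (auto simp: total_def)
    qed
    then show ?thesis by simp
  qed
  have "\<exists>v. vhas_sum (dsum I V) (\<lambda>i. dembed i (f i)) I v"
  proof (rule D.orthogonal_vhas_sum)
    show "vinner (dsum I V) (dembed i (f i)) (dembed j (f j)) = 0" if "i \<in> I" "j \<in> I" "i \<noteq> j" for i j
      using that f by (subst inner_dembed)
        (auto simp: dsum_comp dembed_closed, simp add: dembed_def inner_product_space.inner_zero_right[OF ips] dsum_comp)
    have "(\<lambda>i. vinner (V i) (f i) (f i)) summable_on I" using f by (simp add: dsum_carr_iff)
    then show "(\<lambda>i. vinner (dsum I V) (dembed i (f i)) (dembed i (f i))) summable_on I"
      using f by (subst summable_on_cong[where g = "\<lambda>i. vinner (V i) (f i) (f i)"])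
        (simp_all add: inner_dembed dembed_closed dsum_comp, simp add: dembed_def)
  qed (use f in \<open>simp add: dembed_closed dsum_comp\<close>)
  then obtain v where v: "vhas_sum (dsum I V) (\<lambda>i. dembed i (f i)) I v" by blast
  then have vc: "v \<in> carr (dsum I V)" by (simp add: vhas_sum_def)
  have "f = v"
  proof (rule S.eqI[OF f vc])
    fix w assume w: "w \<in> carr (dsum I V)"
    have "((\<lambda>i. vinner (dsum I V) (dembed i (f i)) w) has_sum vinner (dsum I V) v w) I"
      using S.vhas_sum_inner[OF v w] .
    then have "((\<lambda>i. vinner (V i) (f i) (w i)) has_sum vinner (dsum I V) v w) I"
      using f w by (simp add: inner_dembed dsum_comp cong: has_sum_cong)
    then show "vinner (dsum I V) f w = vinner (dsum I V) v w"
      unfolding dsum_ops by (rule infsumI)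
  qed
  then show "f \<in> S"
    using vhas_sum_in_closed[OF dsum_inner_space S(1) v] in_S dsum_comp[OF f] by blast
qed

locale real_direct_sum = inner_product_space
begin

lemma real_dsum_ops:
  "carr (real_dsum V) = UNIV \<times> carr V"
  "vadd (real_dsum V) x y = (fst x + fst y, vadd V (snd x) (snd y))"
  "vscale (real_dsum V) c x = (c * fst x, vscale V c (snd x))"
  "vzero (real_dsum V) = (0, vzero V)"
  "vinner (real_dsum V) x y = fst x * fst y + vinner V (snd x) (snd y)"
  by (auto simp: real_dsum_def split_beta)

lemma real_dsum_dist:
  "vdist (real_dsum V) x y = sqrt ((fst x - fst y)\<^sup>2 + (vdist V (snd x) (snd y))\<^sup>2)"
  if "x \<in> carr (real_dsum V)" "y \<in> carr (real_dsum V)"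
  using that by (auto simp: vdist_def vnorm_def[of "real_dsum V"] real_dsum_ops power2_eq_square[of "_ - _"] norm_sq)

lemma real_dsum_inner_space: "inner_product_space (real_dsum V)"
proof
  fix x y assume c: "x \<in> carr (real_dsum V)" "y \<in> carr (real_dsum V)"
  show "x = y" if "vdist (real_dsum V) x y = 0"
    using that dist_0_imp_eq[of "snd x" "snd y"] c unfolding real_dsum_dist[OF c]
    by (auto simp: real_dsum_ops sum_power2_eq_zero_iff prod_eq_iff)
qed (auto simp: real_dsum_ops inner_simps inner_nonneg algebra_simps inner_sym)

end

lemma real_dsum_hilbert:
  assumes "hilbert_space V"
  shows "hilbert_space (real_dsum V)"
proof -
  interpret hilbert_space V by fact
  interpret real_direct_sum V by unfold_locales
  interpret R: inner_product_space "real_dsum V" by (rule real_dsum_inner_space)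
  show ?thesis
  proof
    fix u assume u: "u \<in> cauchy_seqs (real_dsum V)"
    then have uc: "u n \<in> carr (real_dsum V)" for n by (simp add: cauchy_seqs_def)
    have le: "\<bar>fst (u m) - fst (u n)\<bar> \<le> vdist (real_dsum V) (u m) (u n)"
      "vdist V (snd (u m)) (snd (u n)) \<le> vdist (real_dsum V) (u m) (u n)" for m n
      using uc[of m] uc[of n] unfolding real_dsum_dist[OF uc uc]
      by (auto intro!: real_le_rsqrt simp: real_dsum_ops)
    have cauchy: "\<exists>N. \<forall>m\<ge>N. \<forall>n\<ge>N. vdist (real_dsum V) (u m) (u n) < e" if "e > 0" for e
      using u that unfolding cauchy_seqs_def by blast
    have "Cauchy (\<lambda>n. fst (u n))"
      unfolding Cauchy_altdef2 dist_real_def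
    proof (intro allI impI)
      fix e :: real assume "e > 0"
      then obtain N where N: "\<forall>m\<ge>N. \<forall>n\<ge>N. vdist (real_dsum V) (u m) (u n) < e" using cauchy by blast
      then show "\<exists>N. \<forall>n\<ge>N. \<bar>fst (u n) - fst (u N)\<bar> < e"
        by (intro exI[of _ N] allI impI le_less_trans[OF le(1)]) simp
    qed
    then obtain a where a: "(\<lambda>n. fst (u n)) \<longlonglongrightarrow> a"
      using Cauchy_convergent convergent_def by blast
    have "(\<lambda>n. snd (u n)) \<in> cauchy_seqs V"
      unfolding cauchy_seqs_def
    proof (intro CollectI conjI allI impI)
      fix e :: real assume "e > 0"
      then obtain N where N: "\<forall>m\<ge>N. \<forall>n\<ge>N. vdist (real_dsum V) (u m) (u n) < e" using cauchy by blast
      then show "\<exists>N. \<forall>m\<ge>N. \<forall>n\<ge>N. vdist V (snd (u m)) (snd (u n)) < e"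
        by (intro exI[of _ N] allI impI le_less_trans[OF le(2)]) simp
    qed (use uc in \<open>auto simp: real_dsum_ops mem_Times_iff\<close>)
    then obtain v where v: "v \<in> carr V" "(\<lambda>n. vdist V (snd (u n)) v) \<longlonglongrightarrow> 0"
      using complete by blast
    have av: "(a, v) \<in> carr (real_dsum V)" using v by (simp add: real_dsum_ops)
    have "(\<lambda>n. sqrt ((fst (u n) - a)\<^sup>2 + (vdist V (snd (u n)) v)\<^sup>2)) \<longlonglongrightarrow> sqrt ((a - a)\<^sup>2 + 0\<^sup>2)"
      by (intro tendsto_intros a v)
    then have "(\<lambda>n. vdist (real_dsum V) (u n) (a, v)) \<longlonglongrightarrow> 0"
      by (simp add: real_dsum_dist[OF uc av])
    then show "\<exists>v\<in>carr (real_dsum V). (\<lambda>n. vdist (real_dsum V) (u n) v) \<longlonglongrightarrow> 0"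
      using av by blast
  qed
qed

lemma real_dsum_total:
  assumes "inner_product_space V" and T: "total V T"
  shows "total (real_dsum V) (insert (1, vzero V) (Pair 0 ` T))"
proof (rule totalI)
  interpret inner_product_space V by fact
  interpret real_direct_sum V by unfold_locales
  interpret R: inner_product_space "real_dsum V" by (rule real_dsum_inner_space)
  show "insert (1, vzero V) (Pair 0 ` T) \<subseteq> carr (real_dsum V)"
    using T by (auto simp: total_def real_dsum_ops)
  fix S x assume S: "closed_subspace (real_dsum V) S" "insert (1, vzero V) (Pair 0 ` T) \<subseteq> S"
    and x: "x \<in> carr (real_dsum V)"
  have "conformal V (real_dsum V) 1 (Pair 0)"
    by (auto simp: conformal_def real_dsum_ops)
  then have cl: "closed_subspace V {v \<in> carr V. Pair 0 v \<in> S}"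
    using S by (intro closed_subspace_vimage[of _ "real_dsum V"] conformal_bounded[of _ _ 1]) unfold_locales
  have "snd x \<in> {v \<in> carr V. Pair 0 v \<in> S}"
    by (rule totalD[OF T cl]) (use S T x in \<open>auto simp: total_def real_dsum_ops\<close>)
  then have "vadd (real_dsum V) (vscale (real_dsum V) (fst x) (1, vzero V)) (0, snd x) \<in> S"
    using S by (intro closed_subspaceD(3)[OF S(1)] closed_subspaceD(4)[OF S(1)]) auto
  also have "vadd (real_dsum V) (vscale (real_dsum V) (fst x) (1, vzero V)) (0, snd x) = x"
    using x by (intro R.eqI) (auto simp: real_dsum_ops inner_simps)
  finally show "x \<in> S" .
qed

section \<open>Unitary operators and completions\<close>

lemma unitary_closed: "unitary V W U \<Longrightarrow> v \<in> carr V \<Longrightarrow> U v \<in> carr W"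
  by (rule conformal_closed[OF unitary_conformal])

lemma unitary_inner: "unitary V W U \<Longrightarrow> u \<in> carr V \<Longrightarrow> v \<in> carr V \<Longrightarrow>
    vinner W (U u) (U v) = vinner V u v"
  by (simp add: unitary_def)

lemma unitary_inv:
  assumes U: "unitary V W U" and "inner_product_space V" "inner_product_space W"
  shows "unitary W V (inv_into (carr V) U)"
proof -
  let ?B = "inv_into (carr V) U"
  have bij: "bij_betw U (carr V) (carr W)" using U by (simp add: unitary_def)
  then have bij': "bij_betw ?B (carr W) (carr V)" by (rule bij_betw_inv_into)
  have cl: "?B w \<in> carr V" if "w \<in> carr W" for w
    using bij' that by (rule bij_betwE[THEN bspec])
  have UB: "U (?B w) = w" if "w \<in> carr W" for w
    using bij that by (rule bij_betw_inv_into_right)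
  have inn: "vinner V (?B u) (?B v) = vinner W u v" if "u \<in> carr W" "v \<in> carr W" for u v
    using unitary_inner[OF U cl[OF that(1)] cl[OF that(2)]] that by (simp add: UB)
  then have "conformal W V 1 ?B" using cl by (simp add: conformal_def)
  then have "?B \<in> linear_maps W V"
    using assms by (intro bounded_map_linear conformal_bounded)
  then show ?thesis using bij' inn by (simp add: unitary_def)
qed

lemma unitary_inv_apply:
  assumes "unitary V W U"
  shows "v \<in> carr V \<Longrightarrow> inv_into (carr V) U (U v) = v"
    and "w \<in> carr W \<Longrightarrow> U (inv_into (carr V) U w) = w"
    and "w \<in> carr W \<Longrightarrow> inv_into (carr V) U w \<in> carr V"
proof -
  have bij: "bij_betw U (carr V) (carr W)" using assms by (simp add: unitary_def)
  show "v \<in> carr V \<Longrightarrow> inv_into (carr V) U (U v) = v"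
    using bij by (rule bij_betw_inv_into_left)
  show "w \<in> carr W \<Longrightarrow> U (inv_into (carr V) U w) = w"
    using bij by (rule bij_betw_inv_into_right)
  show "w \<in> carr W \<Longrightarrow> inv_into (carr V) U w \<in> carr V"
    using bij_betwE[OF bij_betw_inv_into[OF bij]] by blast
qed

lemma total_vimage:
  assumes U: "unitary V W U" and "inner_product_space V" "inner_product_space W" and T: "total W T"
  shows "total V {v \<in> carr V. U v \<in> T}"
proof (rule totalI)
  let ?B = "inv_into (carr V) U"
  fix S v assume S: "closed_subspace V S" "{v \<in> carr V. U v \<in> T} \<subseteq> S" and v: "v \<in> carr V"
  have "closed_subspace W {w \<in> carr W. ?B w \<in> S}"
    using assms S
    by (intro closed_subspace_vimage[of _ V] conformal_bounded[of _ _ 1] unitary_conformal unitary_inv)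
  moreover have "T \<subseteq> {w \<in> carr W. ?B w \<in> S}"
  proof
    fix w assume w: "w \<in> T"
    then have "w \<in> carr W" using T by (auto simp: total_def)
    then show "w \<in> {w \<in> carr W. ?B w \<in> S}"
      using S(2) w unitary_inv_apply[OF U] by auto
  qed
  ultimately have "U v \<in> {w \<in> carr W. ?B w \<in> S}"
    by (rule totalD[OF T _ _ unitary_closed[OF U v]])
  then show "v \<in> S" using v by (simp add: unitary_inv_apply[OF U])
qed simp

text \<open>The structure is pulled back along a bijection. For the completion, whose operations
  pick representatives, only compatibility of these operations with the bijection remains to be
  checked.\<close>

lemma hilbert_space_transport:
  assumes W: "hilbert_space W" and bij: "bij_betw U (carr X) (carr W)"
    and add: "\<And>u v. u \<in> carr X \<Longrightarrow> v \<in> carr X \<Longrightarrow> vadd X u v \<in> carr X \<and> U (vadd X u v) = vadd W (U u) (U v)"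
    and scale: "\<And>c v. v \<in> carr X \<Longrightarrow> vscale X c v \<in> carr X \<and> U (vscale X c v) = vscale W c (U v)"
    and zero: "vzero X \<in> carr X" "U (vzero X) = vzero W"
    and inner: "\<And>u v. u \<in> carr X \<Longrightarrow> v \<in> carr X \<Longrightarrow> vinner X u v = vinner W (U u) (U v)"
  shows "hilbert_space X" "unitary X W U"
proof -
  interpret W: hilbert_space W by fact
  have Uc: "U v \<in> carr W" if "v \<in> carr X" for v using bij that by (rule bij_betwE[THEN bspec])
  have dist: "vdist X u v = vdist W (U u) (U v)" if "u \<in> carr X" "v \<in> carr X" for u v
    using that by (simp add: vdist_def vnorm_def add scale inner)
  have inj: "inj_on U (carr X)" and surj: "U ` carr X = carr W" using bij by (auto simp: bij_betw_def)
  interpret X: inner_product_space X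
  proof
    fix u v assume "u \<in> carr X" "v \<in> carr X"
    then show "vinner X u v = vinner X v u" using W.inner_sym Uc by (simp add: inner)
    show "u = v" if "vdist X u v = 0"
      using that dist[of u v] W.dist_0_imp_eq[OF Uc Uc, of u v] inj_onD[OF inj, of u v]
        \<open>u \<in> carr X\<close> \<open>v \<in> carr X\<close> by simp
  qed (simp_all add: add scale zero inner Uc W.inner_simps W.inner_nonneg)
  show "hilbert_space X"
  proof
    fix u assume u: "u \<in> cauchy_seqs X"
    then have uc: "u n \<in> carr X" for n by (simp add: cauchy_seqs_def)
    have "(\<lambda>n. U (u n)) \<in> cauchy_seqs W"
      by (rule cauchy_seqs_mono[OF u, where c = 1]) (simp_all add: Uc uc dist)
    then obtain w where w: "w \<in> carr W" "(\<lambda>n. vdist W (U (u n)) w) \<longlonglongrightarrow> 0"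
      using W.complete by blast
    then obtain v where v: "v \<in> carr X" "w = U v" using surj by blast
    show "\<exists>v\<in>carr X. (\<lambda>n. vdist X (u n) v) \<longlonglongrightarrow> 0"
      using w v by (intro bexI[of _ v]) (simp_all add: dist uc)
  qed
  show "unitary X W U"
    using bij Uc add scale inner by (auto simp: unitary_def linear_maps_def)
qed

section \<open>The completion realised in a given Hilbert space\<close>

text \<open>X carries the inner product pulled back along E, which is not assumed injective, so X
  may be merely semidefinite. The total set T inside the image makes the image dense; hence the
  completion of X can be identified with W.\<close>

locale pre_hilbert =
  fixes X :: "'x ip_space" and W :: "'w ip_space" and E :: "'x \<Rightarrow> 'w" and T :: "'w set"
  assumes W: "hilbert_space W"
    and E_closed: "x \<in> carr X \<Longrightarrow> E x \<in> carr W"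
    and E_add: "x \<in> carr X \<Longrightarrow> y \<in> carr X \<Longrightarrow> vadd X x y \<in> carr X \<and> E (vadd X x y) = vadd W (E x) (E y)"
    and E_scale: "x \<in> carr X \<Longrightarrow> vscale X c x \<in> carr X \<and> E (vscale X c x) = vscale W c (E x)"
    and E_zero: "vzero X \<in> carr X" "E (vzero X) = vzero W"
    and E_inner: "x \<in> carr X \<Longrightarrow> y \<in> carr X \<Longrightarrow> vinner X x y = vinner W (E x) (E y)"
    and T: "total W T" "T \<subseteq> E ` carr X"
begin

sublocale W: hilbert_space W by (rule W)

lemma dist_E: "x \<in> carr X \<Longrightarrow> y \<in> carr X \<Longrightarrow> vdist X x y = vdist W (E x) (E y)"
  by (simp add: vdist_def vnorm_def E_add E_scale E_inner)

text \<open>The Cauchy sequences in X are those whose images converge in W, and the Cauchy classes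
  are the nonempty fibres of this relation over the points of W. Questions about classes thereby
  become questions about limits.\<close>

definition lim_E :: "(nat \<Rightarrow> 'x) \<Rightarrow> 'w \<Rightarrow> bool" where
  "lim_E u w \<longleftrightarrow> (\<forall>n. u n \<in> carr X) \<and> w \<in> carr W \<and> (\<lambda>n. vdist W (E (u n)) w) \<longlonglongrightarrow> 0"

lemma lim_E_unique: "lim_E u w \<Longrightarrow> lim_E u w' \<Longrightarrow> w = w'"
  unfolding lim_E_def by (intro W.tendsto_unique_dist[of "\<lambda>n. E (u n)" _ sequentially]) (auto simp: E_closed)

lemma cauchy_seqs_iff: "u \<in> cauchy_seqs X \<longleftrightarrow> (\<exists>w. lim_E u w)"
proof
  assume u: "u \<in> cauchy_seqs X"
  then have uc: "u n \<in> carr X" for n by (simp add: cauchy_seqs_def)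
  have "(\<lambda>n. E (u n)) \<in> cauchy_seqs W"
    by (rule cauchy_seqs_mono[OF u, where c = 1]) (simp_all add: E_closed uc dist_E)
  then show "\<exists>w. lim_E u w"
    using W.complete uc unfolding lim_E_def by blast
next
  assume "\<exists>w. lim_E u w"
  then obtain w where w: "lim_E u w" by blast
  then have uc: "u n \<in> carr X" for n by (simp add: lim_E_def)
  have Eu: "(\<lambda>n. E (u n)) \<in> cauchy_seqs W"
    using w by (intro W.tendsto_imp_cauchy[of _ w]) (simp_all add: lim_E_def E_closed)
  show "u \<in> cauchy_seqs X"
    by (rule cauchy_seqs_mono[OF Eu, where c = 1]) (simp_all add: E_closed uc dist_E)
qed

lemma cauchy_class_iff:
  assumes u: "lim_E u w"
  shows "v \<in> cauchy_class X u \<longleftrightarrow> lim_E v w"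
proof
  assume "v \<in> cauchy_class X u"
  then obtain w' where w': "lim_E v w'" and d: "(\<lambda>n. vdist X (v n) (u n)) \<longlonglongrightarrow> 0"
    using cauchy_seqs_iff by (auto simp: cauchy_class_def)
  have "(\<lambda>n. vdist W (E (v n)) (E (u n))) \<longlonglongrightarrow> vdist W w' w"
    using u w' by (intro W.tendsto_dist) (auto simp: lim_E_def E_closed)
  moreover have "(\<lambda>n. vdist W (E (v n)) (E (u n))) \<longlonglongrightarrow> 0"
    using d u w' by (simp add: lim_E_def dist_E)
  ultimately have "vdist W w' w = 0" by (rule LIMSEQ_unique)
  then have "w' = w" using u w' W.dist_0_imp_eq by (auto simp: lim_E_def)
  then show "lim_E v w" using w' by simp
next
  assume v: "lim_E v w"
  have "(\<lambda>n. vdist W (E (v n)) (E (u n))) \<longlonglongrightarrow> vdist W w w"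
    using u v by (intro W.tendsto_dist) (auto simp: lim_E_def E_closed)
  then have "(\<lambda>n. vdist X (v n) (u n)) \<longlonglongrightarrow> 0"
    using u v by (simp add: lim_E_def dist_E)
  then show "v \<in> cauchy_class X u"
    using v cauchy_seqs_iff by (auto simp: cauchy_class_def)
qed

lemma cauchy_class_eq: "lim_E u w \<Longrightarrow> cauchy_class X u = {v. lim_E v w}"
  using cauchy_class_iff by blast

lemma completion_carr: "a \<in> carr (completion X) \<longleftrightarrow> (\<exists>w. a = {v. lim_E v w} \<and> a \<noteq> {})"
proof
  assume "a \<in> carr (completion X)"
  then obtain u w where "a = cauchy_class X u" "lim_E u w"
    by (auto simp: completion_def cauchy_seqs_iff)
  then show "\<exists>w. a = {v. lim_E v w} \<and> a \<noteq> {}"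
    using cauchy_class_eq by blast
next
  assume "\<exists>w. a = {v. lim_E v w} \<and> a \<noteq> {}"
  then obtain u w where a: "a = {v. lim_E v w}" "lim_E u w" by blast
  then have "a = cauchy_class X u" "u \<in> cauchy_seqs X"
    using cauchy_class_eq cauchy_seqs_iff by auto
  then show "a \<in> carr (completion X)" by (simp add: completion_def)
qed

text \<open>By \<open>cauchy_class_iff\<close> all members of a class have the same limit, so the
  choice made by \<open>rep\<close> does not matter.\<close>

definition completion_map :: "(nat \<Rightarrow> 'x) set \<Rightarrow> 'w" where
  "completion_map a = (THE w. lim_E (rep a) w)"

lemma rep_lim:
  assumes "a = {v. lim_E v w}" "a \<noteq> {}"
  shows "lim_E (rep a) w" "completion_map a = w"
proof -
  have "rep a \<in> a" using assms(2) unfolding rep_def by (simp add: some_in_eq)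
  then show l: "lim_E (rep a) w" using assms(1) by simp
  show "completion_map a = w"
    unfolding completion_map_def using l lim_E_unique by blast
qed

lemma completion_class: "lim_E u w \<Longrightarrow> cauchy_class X u \<in> carr (completion X) \<and> completion_map (cauchy_class X u) = w"
  using cauchy_class_eq completion_carr rep_lim(2) by (metis (mono_tags, lifting) empty_Collect_eq)

lemma lim_rep: "a \<in> carr (completion X) \<Longrightarrow> lim_E (rep a) (completion_map a)"
  using completion_carr rep_lim by metis

lemma dense_E:
  assumes "w \<in> carr W" "e > 0"
  shows "\<exists>x\<in>carr X. vdist W (E x) w < e"
proof -
  have "\<exists>d\<in>E ` carr X. vdist W d w < e"
  proof (rule total_dense[OF W.inner_product_space_axioms _ _ _ _ T assms])
    show "E ` carr X \<subseteq> carr W" by (auto simp: E_closed)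
    show "vzero W \<in> E ` carr X" using E_zero by (metis image_eqI)
    show "vadd W u v \<in> E ` carr X" if "u \<in> E ` carr X" "v \<in> E ` carr X" for u v
      using that E_add by (auto simp: image_iff) metis
    show "vscale W c v \<in> E ` carr X" if "v \<in> E ` carr X" for c v
      using that E_scale by (auto simp: image_iff) metis
  qed
  then show ?thesis by blast
qed

text \<open>A class is determined by its limit, and every point of W is a limit because the image of
  E is dense.\<close>

lemma completion_map_bij: "bij_betw completion_map (carr (completion X)) (carr W)"
  unfolding bij_betw_def
proof
  show "inj_on completion_map (carr (completion X))"
  proof (rule inj_onI)
    fix a b assume ab: "a \<in> carr (completion X)" "b \<in> carr (completion X)" "completion_map a = completion_map b"
    obtain w where w: "a = {v. lim_E v w}" "a \<noteq> {}" using ab completion_carr by blast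
    obtain w' where w': "b = {v. lim_E v w'}" "b \<noteq> {}" using ab completion_carr by blast
    show "a = b" using rep_lim(2)[OF w] rep_lim(2)[OF w'] w w' ab by simp
  qed
  show "completion_map ` carr (completion X) = carr W"
  proof
    show "completion_map ` carr (completion X) \<subseteq> carr W"
      using lim_rep by (auto simp: lim_E_def)
    show "carr W \<subseteq> completion_map ` carr (completion X)"
    proof
      fix w assume w: "w \<in> carr W"
      have "\<exists>x. x \<in> carr X \<and> vdist W (E x) w < 1 / Suc n" for n :: nat
        using dense_E[OF w, of "1 / Suc n"] by auto
      then obtain u where u: "\<And>n. u n \<in> carr X" "\<And>n::nat. vdist W (E (u n)) w < 1 / Suc n"
        by metis
      have "(\<lambda>n. vdist W (E (u n)) w) \<longlonglongrightarrow> 0"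
      proof (rule Lim_null_comparison)
        show "\<forall>\<^sub>F n in sequentially. norm (vdist W (E (u n)) w) \<le> 1 / Suc n"
          using u(2) E_closed[OF u(1)] w by (intro always_eventually allI) (simp add: less_imp_le)
      qed (use LIMSEQ_inverse_real_of_nat in \<open>simp add: inverse_eq_divide\<close>)
      then have "lim_E u w" using u w by (simp add: lim_E_def)
      then show "w \<in> completion_map ` carr (completion X)"
        using completion_class by (metis image_eqI)
    qed
  qed
qed

lemma completion_embed:
  assumes "x \<in> carr X"
  shows "completion_embed X x \<in> carr (completion X)" "completion_map (completion_embed X x) = E x"
proof -
  have "lim_E (\<lambda>_. x) (E x)" using assms by (simp add: lim_E_def E_closed)
  then show "completion_embed X x \<in> carr (completion X)" "completion_map (completion_embed X x) = E x"
    using completion_class by (auto simp: completion_embed_def)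
qed

lemma
  shows completion_hilbert: "hilbert_space (completion X)"
    and completion_unitary: "unitary (completion X) W completion_map"
proof -
  let ?C = "completion X" and ?U = completion_map
  have add: "vadd ?C a b \<in> carr ?C \<and> ?U (vadd ?C a b) = vadd W (?U a) (?U b)"
    if ab: "a \<in> carr ?C" "b \<in> carr ?C" for a b
  proof -
    have a: "lim_E (rep a) (?U a)" and b: "lim_E (rep b) (?U b)" using ab lim_rep by auto
    have "(\<lambda>n. vdist W (E (vadd X (rep a n) (rep b n))) (vadd W (?U a) (?U b))) \<longlonglongrightarrow> 0"
    proof (rule Lim_null_comparison)
      have "vdist W (vadd W u v) (vadd W u' v') \<le> vdist W u u' + vdist W v v'"
        if [simp]: "u \<in> carr W" "v \<in> carr W" "u' \<in> carr W" "v' \<in> carr W" for u v u' v'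
      proof -
        have "vadd W (vadd W u v) (vscale W (-1) (vadd W u' v')) =
            vadd W (vadd W u (vscale W (-1) u')) (vadd W v (vscale W (-1) v'))"
          by (rule W.eqI) (simp_all add: W.inner_simps)
        then show ?thesis unfolding vdist_def by (simp add: W.norm_add_le)
      qed
      then show "\<forall>\<^sub>F n in sequentially. norm (vdist W (E (vadd X (rep a n) (rep b n))) (vadd W (?U a) (?U b)))
          \<le> vdist W (E (rep a n)) (?U a) + vdist W (E (rep b n)) (?U b)"
        using a b by (intro always_eventually) (simp add: lim_E_def E_add E_closed)
      show "(\<lambda>n. vdist W (E (rep a n)) (?U a) + vdist W (E (rep b n)) (?U b)) \<longlonglongrightarrow> 0"
        using a b by (auto simp: lim_E_def intro: tendsto_add_zero)
    qed
    then have "lim_E (\<lambda>n. vadd X (rep a n) (rep b n)) (vadd W (?U a) (?U b))"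
      using a b by (simp add: lim_E_def E_add)
    then show ?thesis using completion_class by (simp add: completion_def)
  qed
  have scale: "vscale ?C c a \<in> carr ?C \<and> ?U (vscale ?C c a) = vscale W c (?U a)"
    if "a \<in> carr ?C" for c a
  proof -
    have a: "lim_E (rep a) (?U a)" using that lim_rep by auto
    have "(\<lambda>n. vdist W (E (vscale X c (rep a n))) (vscale W c (?U a))) \<longlonglongrightarrow> 0"
    proof (rule Lim_null_comparison)
      have "vdist W (vscale W c u) (vscale W c u') = \<bar>c\<bar> * vdist W u u'"
        if [simp]: "u \<in> carr W" "u' \<in> carr W" for u u'
      proof (rule power2_eq_imp_eq)
        have "(vdist W (vscale W c u) (vscale W c u'))\<^sup>2 = c\<^sup>2 * (vdist W u u')\<^sup>2"
          by (simp add: W.dist_sq W.inner_simps) (simp add: algebra_simps power2_eq_square)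
        then show "(vdist W (vscale W c u) (vscale W c u'))\<^sup>2 = (\<bar>c\<bar> * vdist W u u')\<^sup>2"
          by (simp add: power_mult_distrib)
      qed simp_all
      then show "\<forall>\<^sub>F n in sequentially. norm (vdist W (E (vscale X c (rep a n))) (vscale W c (?U a)))
          \<le> \<bar>c\<bar> * vdist W (E (rep a n)) (?U a)"
        using a by (intro always_eventually) (simp add: lim_E_def E_scale E_closed)
      show "(\<lambda>n. \<bar>c\<bar> * vdist W (E (rep a n)) (?U a)) \<longlonglongrightarrow> 0"
        using a by (auto simp: lim_E_def intro: tendsto_mult_right_zero)
    qed
    then have "lim_E (\<lambda>n. vscale X c (rep a n)) (vscale W c (?U a))"
      using a by (simp add: lim_E_def E_scale)
    then show ?thesis using completion_class by (simp add: completion_def)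
  qed
  have zero: "vzero ?C \<in> carr ?C" "?U (vzero ?C) = vzero W"
    using completion_embed[OF E_zero(1)] by (simp_all add: completion_embed_def completion_def E_zero)
  have inner: "vinner ?C a b = vinner W (?U a) (?U b)" if ab: "a \<in> carr ?C" "b \<in> carr ?C" for a b
  proof -
    have a: "lim_E (rep a) (?U a)" and b: "lim_E (rep b) (?U b)" using ab lim_rep by auto
    have "(\<lambda>n. vinner W (E (rep a n)) (E (rep b n))) \<longlonglongrightarrow> vinner W (?U a) (?U b)"
      using a b by (intro W.tendsto_inner) (auto simp: lim_E_def E_closed)
    then have "(\<lambda>n. vinner X (rep a n) (rep b n)) \<longlonglongrightarrow> vinner W (?U a) (?U b)"
      using a b by (simp add: lim_E_def E_inner)
    then show ?thesis by (simp add: completion_def limI)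
  qed
  show "hilbert_space ?C" "unitary ?C W ?U"
    using hilbert_space_transport[OF W completion_map_bij add scale zero inner] by auto
qed

text \<open>The description of \<open>I_map\<close> has this form. Uniqueness is tested on the
  preimage of T, which consists of embedded elements because the completion map is
  injective.\<close>

lemma completion_unique:
  "(THE U. U \<in> bounded_ops (completion X) W \<and> (\<forall>x\<in>carr X. U (completion_embed X x) = E x)) =
    restrict completion_map (carr (completion X))"
proof (rule the_equality)
  interpret C: hilbert_space "completion X" by (rule completion_hilbert)
  note ips = C.inner_product_space_axioms W.inner_product_space_axioms
  have bd: "restrict completion_map (carr (completion X)) \<in> bounded_ops (completion X) W"
    by (intro bounded_map_restrict conformal_bounded[of _ _ 1] unitary_conformal completion_unitary ips)
  then show *: "restrict completion_map (carr (completion X)) \<in> bounded_ops (completion X) W \<and>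
      (\<forall>x\<in>carr X. restrict completion_map (carr (completion X)) (completion_embed X x) = E x)"
    by (simp add: completion_embed)
  fix U assume U: "U \<in> bounded_ops (completion X) W \<and> (\<forall>x\<in>carr X. U (completion_embed X x) = E x)"
  have "total (completion X) {a \<in> carr (completion X). completion_map a \<in> T}"
    by (rule total_vimage[OF completion_unitary ips T(1)])
  then show "U = restrict completion_map (carr (completion X))"
  proof (rule bounded_ops_eqI[OF _ bd ips, rotated])
    fix a assume a: "a \<in> {a \<in> carr (completion X). completion_map a \<in> T}"
    then obtain x where x: "x \<in> carr X" "completion_map a = E x" using T(2) by blast
    then have "a = completion_embed X x"
      using inj_onD[OF bij_betw_imp_inj_on[OF completion_map_bij], of a "completion_embed X x"]
        a completion_embed[OF x(1)] by simp
    then show "U a = restrict completion_map (carr (completion X)) a"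
      using U * x by simp
  qed (use U in simp)
qed

end

section \<open>Square integrable functions\<close>

lemma sqint_measurable: "f \<in> sqint M \<Longrightarrow> f \<in> borel_measurable M"
  and sqint_integrable: "f \<in> sqint M \<Longrightarrow> integrable M (\<lambda>x. (f x)\<^sup>2)"
  by (simp_all add: sqint_def)

lemma sqint_bounded:
  assumes "f \<in> sqint M" "g \<in> borel_measurable M" "AE x in M. \<bar>g x\<bar> \<le> C * \<bar>f x\<bar>"
  shows "g \<in> sqint M"
proof -
  have "integrable M (\<lambda>x. (g x)\<^sup>2)"
  proof (rule Bochner_Integration.integrable_bound)
    show "integrable M (\<lambda>x. C\<^sup>2 * (f x)\<^sup>2)" using sqint_integrable[OF assms(1)] by simp
    show "(\<lambda>x. (g x)\<^sup>2) \<in> borel_measurable M" using assms(2) by measurable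
    show "AE x in M. norm ((g x)\<^sup>2) \<le> norm (C\<^sup>2 * (f x)\<^sup>2)"
      using assms(3)
    proof eventually_elim
      case (elim x)
      then have "\<bar>g x\<bar>\<^sup>2 \<le> (C * \<bar>f x\<bar>)\<^sup>2" by (intro power_mono) auto
      then show ?case by (simp add: power_mult_distrib)
    qed
  qed
  then show ?thesis using assms(2) by (simp add: sqint_def)
qed

lemma sqint_zero [simp]: "(\<lambda>x. 0) \<in> sqint M"
  by (simp add: sqint_def)

lemma sqint_scale: "f \<in> sqint M \<Longrightarrow> (\<lambda>x. c * f x) \<in> sqint M"
  by (rule sqint_bounded[of f _ _ "\<bar>c\<bar>"])
    (auto simp: abs_mult intro: borel_measurable_times sqint_measurable)

lemma sqint_add:
  assumes "f \<in> sqint M" "g \<in> sqint M"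
  shows "(\<lambda>x. f x + g x) \<in> sqint M"
proof -
  have "integrable M (\<lambda>x. (f x + g x)\<^sup>2)"
  proof (rule Bochner_Integration.integrable_bound)
    show "integrable M (\<lambda>x. 2 * (f x)\<^sup>2 + 2 * (g x)\<^sup>2)" using assms by (simp add: sqint_integrable)
    show "(\<lambda>x. (f x + g x)\<^sup>2) \<in> borel_measurable M"
      using assms[THEN sqint_measurable] by measurable
    have "(a + b)\<^sup>2 \<le> 2 * a\<^sup>2 + 2 * b\<^sup>2" for a b :: real
      using sum_squares_bound[of a b] by (simp add: power2_sum)
    then show "AE x in M. norm ((f x + g x)\<^sup>2) \<le> norm (2 * (f x)\<^sup>2 + 2 * (g x)\<^sup>2)" by simp
  qed
  then show ?thesis using assms[THEN sqint_measurable] by (simp add: sqint_def)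
qed

lemma sqint_diff: "f \<in> sqint M \<Longrightarrow> g \<in> sqint M \<Longrightarrow> (\<lambda>x. f x - g x) \<in> sqint M"
  using sqint_add[of f M "\<lambda>x. (-1) * g x"] sqint_scale[of g M "-1"] by simp

lemma sqint_mult_integrable:
  assumes "f \<in> sqint M" "g \<in> sqint M"
  shows "integrable M (\<lambda>x. f x * g x)"
proof (rule Bochner_Integration.integrable_bound)
  show "integrable M (\<lambda>x. (f x)\<^sup>2 + (g x)\<^sup>2)" using assms by (simp add: sqint_integrable)
  show "(\<lambda>x. f x * g x) \<in> borel_measurable M"
    using assms[THEN sqint_measurable] by measurable
  have "\<bar>a * b\<bar> \<le> a\<^sup>2 + b\<^sup>2" for a b :: real
    using sum_squares_bound[of "\<bar>a\<bar>" "\<bar>b\<bar>"] mult_nonneg_nonneg[OF abs_ge_zero[of a] abs_ge_zero[of b]]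
    unfolding abs_mult power2_abs by linarith
  then show "AE x in M. norm (f x * g x) \<le> norm ((f x)\<^sup>2 + (g x)\<^sup>2)" by simp
qed

lemma sqint_indicator: "A \<in> sets M \<Longrightarrow> emeasure M A < \<infinity> \<Longrightarrow> indicator A \<in> sqint M"
proof -
  assume A: "A \<in> sets M" "emeasure M A < \<infinity>"
  have "(\<lambda>x. (indicator A x :: real)\<^sup>2) = indicator A" by (auto simp: indicator_def fun_eq_iff)
  then show "indicator A \<in> sqint M"
    using A integrable_real_indicator[of A M] by (simp add: sqint_def)
qed

lemma ae_class_self: "f \<in> sqint M \<Longrightarrow> f \<in> ae_class M f"
  by (simp add: ae_class_def)

lemma rep_ae_class:
  assumes "f \<in> sqint M"
  shows "rep (ae_class M f) \<in> sqint M" "AE x in M. rep (ae_class M f) x = f x"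
proof -
  have "rep (ae_class M f) \<in> ae_class M f"
    unfolding rep_def by (rule someI[of "\<lambda>g. g \<in> ae_class M f", OF ae_class_self[OF assms]])
  then show "rep (ae_class M f) \<in> sqint M" "AE x in M. rep (ae_class M f) x = f x"
    by (simp_all add: ae_class_def)
qed

lemma ae_class_eqI: "AE x in M. f x = g x \<Longrightarrow> ae_class M f = ae_class M g"
  unfolding ae_class_def by (auto elim: AE_mp)

lemma ae_class_eq_iff:
  assumes "f \<in> sqint M" "g \<in> sqint M"
  shows "ae_class M f = ae_class M g \<longleftrightarrow> (AE x in M. f x = g x)"
  using ae_class_eqI[of f g M] ae_class_self[OF assms(1)] by (auto simp: ae_class_def)

lemma l2_carr: "a \<in> carr (l2 M) \<longleftrightarrow> (\<exists>f\<in>sqint M. a = ae_class M f)"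
  by (auto simp: l2_def)

lemma ae_class_closed [simp]: "f \<in> sqint M \<Longrightarrow> ae_class M f \<in> carr (l2 M)"
  by (auto simp: l2_def)

lemma l2_rep:
  assumes "a \<in> carr (l2 M)"
  shows "rep a \<in> sqint M" "ae_class M (rep a) = a"
proof -
  obtain f where f: "f \<in> sqint M" "a = ae_class M f" using assms l2_carr by blast
  then show "rep a \<in> sqint M" "ae_class M (rep a) = a"
    using rep_ae_class[OF f(1)] ae_class_eqI[OF rep_ae_class(2)[OF f(1)]] by simp_all
qed

lemma l2_add:
  assumes "f \<in> sqint M" "g \<in> sqint M"
  shows "vadd (l2 M) (ae_class M f) (ae_class M g) = ae_class M (\<lambda>x. f x + g x)"
proof -
  have "AE x in M. rep (ae_class M f) x + rep (ae_class M g) x = f x + g x"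
    using rep_ae_class(2)[OF assms(1)] rep_ae_class(2)[OF assms(2)] by eventually_elim simp
  then show ?thesis by (simp add: l2_def ae_class_eqI)
qed

lemma l2_scale:
  assumes "f \<in> sqint M"
  shows "vscale (l2 M) c (ae_class M f) = ae_class M (\<lambda>x. c * f x)"
proof -
  have "AE x in M. c * rep (ae_class M f) x = c * f x"
    using rep_ae_class(2)[OF assms(1)] by eventually_elim simp
  then show ?thesis by (simp add: l2_def ae_class_eqI)
qed

lemma l2_zero: "vzero (l2 M) = ae_class M (\<lambda>x. 0)"
  by (simp add: l2_def)

lemma l2_inner:
  assumes "f \<in> sqint M" "g \<in> sqint M"
  shows "vinner (l2 M) (ae_class M f) (ae_class M g) = (\<integral>x. f x * g x \<partial>M)"
proof -
  have "(\<integral>x. rep (ae_class M f) x * rep (ae_class M g) x \<partial>M) = (\<integral>x. f x * g x \<partial>M)"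
  proof (rule integral_cong_AE)
    show "AE x in M. rep (ae_class M f) x * rep (ae_class M g) x = f x * g x"
      using rep_ae_class(2)[OF assms(1)] rep_ae_class(2)[OF assms(2)] by eventually_elim simp
  qed (use assms rep_ae_class(1)[of _ M] in \<open>simp_all add: sqint_measurable borel_measurable_times\<close>)
  then show ?thesis by (simp add: l2_def)
qed

lemma l2_dist:
  assumes "f \<in> sqint M" "g \<in> sqint M"
  shows "(vdist (l2 M) (ae_class M f) (ae_class M g))\<^sup>2 = (\<integral>x. (f x - g x)\<^sup>2 \<partial>M)"
proof -
  have "vadd (l2 M) (ae_class M f) (vscale (l2 M) (-1) (ae_class M g)) = ae_class M (\<lambda>x. f x - g x)"
    using assms sqint_scale[OF assms(2), of "-1"] by (simp add: l2_scale l2_add)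
  then show ?thesis
    using assms by (simp add: vdist_def vnorm_def l2_inner sqint_diff power2_eq_square)
qed

lemma l2_inner_product_space: "inner_product_space (l2 M)"
proof
  show "vzero (l2 M) \<in> carr (l2 M)" by (simp add: l2_zero)
  fix a b assume ab: "a \<in> carr (l2 M)" "b \<in> carr (l2 M)"
  then obtain f g where f: "f \<in> sqint M" "a = ae_class M f" and g: "g \<in> sqint M" "b = ae_class M g"
    by (auto simp: l2_carr)
  show "vadd (l2 M) a b \<in> carr (l2 M)" using f g by (simp add: l2_add sqint_add)
  show "vscale (l2 M) c a \<in> carr (l2 M)" for c using f by (simp add: l2_scale sqint_scale)
  show "vinner (l2 M) a b = vinner (l2 M) b a" using f g by (simp add: l2_inner mult.commute)
  show "0 \<le> vinner (l2 M) a a" using f by (simp add: l2_inner)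
  show "vinner (l2 M) (vzero (l2 M)) a = 0" using f by (simp add: l2_inner l2_zero)
  show "vinner (l2 M) (vscale (l2 M) c a) b = c * vinner (l2 M) a b" for c
    using f g by (simp add: l2_inner l2_scale sqint_scale mult.assoc)
  show "a = b" if "vdist (l2 M) a b = 0"
  proof -
    have "(\<integral>x. (f x - g x)\<^sup>2 \<partial>M) = 0" using that f g l2_dist[of f M g] by simp
    then have "AE x in M. (f x - g x)\<^sup>2 = 0"
      by (subst (asm) integral_nonneg_eq_0_iff_AE) (simp_all add: sqint_integrable sqint_diff f g)
    then show ?thesis using f g by (simp add: ae_class_eq_iff)
  qed
  fix d assume "d \<in> carr (l2 M)"
  then obtain h where h: "h \<in> sqint M" "d = ae_class M h" by (auto simp: l2_carr)
  show "vinner (l2 M) (vadd (l2 M) a b) d = vinner (l2 M) a d + vinner (l2 M) b d"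
    using f g h by (simp add: l2_inner l2_add sqint_add distrib_right sqint_mult_integrable)
qed

text \<open>A sequence with \<open>\<parallel>g\<^sub>k\<^sub>+\<^sub>1 - g\<^sub>k\<parallel> < 2\<^sup>-\<^sup>k\<close> converges almost everywhere, because
  \<open>\<bar>d\<bar> \<le> (2\<^sup>-\<^sup>k + 2\<^sup>k d\<^sup>2) / 2\<close> and the integrals of the right-hand sides are summable.\<close>

lemma AE_convergent_fast:
  fixes g :: "nat \<Rightarrow> 'x \<Rightarrow> real"
  assumes g: "\<And>k. g k \<in> sqint M"
    and fast: "\<And>k. (\<integral>x. (g (Suc k) x - g k x)\<^sup>2 \<partial>M) \<le> (1 / 4) ^ k"
  shows "AE x in M. convergent (\<lambda>k. g k x)"
proof -
  have gm [measurable]: "g k \<in> borel_measurable M" for k using g by (rule sqint_measurable)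
  let ?d = "\<lambda>k x. 2 ^ k * (g (Suc k) x - g k x)\<^sup>2"
  have "(\<integral>\<^sup>+x. (\<Sum>k. ennreal (?d k x)) \<partial>M) = (\<Sum>k. \<integral>\<^sup>+x. ennreal (?d k x) \<partial>M)"
    by (intro nn_integral_suminf) measurable
  also have "\<dots> \<le> (\<Sum>k. ennreal ((1 / 2) ^ k))"
  proof (intro suminf_le)
    fix k
    have "(\<integral>\<^sup>+x. ennreal (?d k x) \<partial>M) = ennreal (\<integral>x. ?d k x \<partial>M)"
      by (intro nn_integral_eq_integral) (simp_all add: sqint_integrable sqint_diff g)
    also have "(\<integral>x. ?d k x \<partial>M) \<le> 2 ^ k * (1 / 4) ^ k"
      using fast[of k] by simp
    also have "(2::real) ^ k * (1 / 4) ^ k = (1 / 2) ^ k"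
      by (simp flip: power_mult_distrib)
    finally show "(\<integral>\<^sup>+x. ennreal (?d k x) \<partial>M) \<le> ennreal ((1 / 2) ^ k)"
      by (simp add: ennreal_leI)
  qed simp_all
  also have "\<dots> = ennreal (\<Sum>k. (1 / 2) ^ k)"
    by (intro suminf_ennreal2) (simp_all add: summable_geometric)
  finally have "(\<integral>\<^sup>+x. (\<Sum>k. ennreal (?d k x)) \<partial>M) \<noteq> \<infinity>"
    by (auto simp: top_unique)
  then have "AE x in M. (\<Sum>k. ennreal (?d k x)) \<noteq> \<infinity>"
    by (intro nn_integral_PInf_AE) measurable
  then show ?thesis
  proof eventually_elim
    case (elim x)
    then have "summable (\<lambda>k. ?d k x)"
      by (intro summable_suminf_not_top) auto
    then have s: "summable (\<lambda>k. (1 / 2) ^ k + ?d k x)"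
      by (intro summable_add) (simp_all add: summable_geometric)
    have "summable (\<lambda>k. g (Suc k) x - g k x)"
    proof (rule summable_comparison_test'[OF s, of 0])
      fix k
      define y :: real where "y = \<bar>g (Suc k) x - g k x\<bar>"
      have "0 \<le> (1 - 2 ^ k * y)\<^sup>2" by simp
      then have "2 * (2 ^ k * y) \<le> 1 + (2 ^ k * y)\<^sup>2" by (simp add: power2_diff)
      moreover have "0 \<le> 2 ^ k * y" by (simp add: y_def)
      ultimately have "2 ^ k * y \<le> 1 + (2 ^ k * y)\<^sup>2"
        by linarith
      also have "\<dots> = 2 ^ k * ((1 / 2) ^ k + 2 ^ k * y\<^sup>2)"
        by (simp add: power2_eq_square algebra_simps flip: power_mult_distrib)
      finally show "norm (g (Suc k) x - g k x) \<le> (1 / 2) ^ k + ?d k x"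
        by (simp add: y_def)
    qed
    then have "convergent (\<lambda>n. \<Sum>k<n. g (Suc k) x - g k x)"
      by (simp add: summable_iff_convergent)
    then have "convergent (\<lambda>n. g n x - g 0 x)"
      by (simp only: sum_lessThan_telescope[of "\<lambda>k. g k x"])
    then have "convergent (\<lambda>n. (g n x - g 0 x) + g 0 x)"
      by (intro convergent_add convergent_const)
    then show ?case by simp
  qed
qed

text \<open>Riesz-Fischer: a rapidly converging subsequence has a limit almost everywhere, and
  Fatou's lemma bounds the distance of the members of the whole sequence to it.\<close>

lemma l2_hilbert: "hilbert_space (l2 M)"
proof -
  interpret inner_product_space "l2 M" by (rule l2_inner_product_space)
  show ?thesis
  proof
    fix u assume u: "u \<in> cauchy_seqs (l2 M)"
    then have uc: "u n \<in> carr (l2 M)" for n by (simp add: cauchy_seqs_def)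
    define f where "f n = rep (u n)" for n
    have f: "f n \<in> sqint M" "u n = ae_class M (f n)" for n using l2_rep[OF uc] by (simp_all add: f_def)
    have [measurable]: "f n \<in> borel_measurable M" for n using f by (simp add: sqint_measurable)
    have dist: "(vdist (l2 M) (u m) (u n))\<^sup>2 = (\<integral>x. (f m x - f n x)\<^sup>2 \<partial>M)" for m n
      unfolding f(2) by (rule l2_dist) (rule f)+
    have cauchy: "\<exists>N. \<forall>m\<ge>N. \<forall>n\<ge>N. vdist (l2 M) (u m) (u n) < e" if "e > 0" for e
      using u that unfolding cauchy_seqs_def by blast
    have "\<forall>k::nat. \<exists>N. \<forall>m\<ge>N. \<forall>n\<ge>N. vdist (l2 M) (u m) (u n) < (1 / 2) ^ k"
      using cauchy by simp
    then obtain N where N: "\<And>k m n. m \<ge> N k \<Longrightarrow> n \<ge> N k \<Longrightarrow> vdist (l2 M) (u m) (u n) < (1 / 2) ^ k"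
      by metis
    \<comment> \<open>\<open>r k\<close> is at least each of the thresholds \<open>N 0\<close> to
      \<open>N k\<close>, and at least k, so that the subsequence finally passes every
      index.\<close>
    define r where "r k = (\<Sum>j\<le>k. N j) + k" for k
    have rN: "N j \<le> r k" if "j \<le> k" for j k
      using member_le_sum[of j "{..k}" N] that by (simp add: r_def)
    have rk: "k \<le> r k" for k by (simp add: r_def)
    have "(\<integral>x. (f (r (Suc k)) x - f (r k) x)\<^sup>2 \<partial>M) \<le> (1 / 4) ^ k" for k
    proof -
      have "vdist (l2 M) (u (r (Suc k))) (u (r k)) \<le> (1 / 2) ^ k"
        using N[OF rN[of k "Suc k"] rN[of k k]] by simp
      then have "(vdist (l2 M) (u (r (Suc k))) (u (r k)))\<^sup>2 \<le> ((1 / 2) ^ k)\<^sup>2"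
        using uc by (intro power_mono) simp_all
      also have "((1 / 2 :: real) ^ k)\<^sup>2 = (1 / 4) ^ k"
        by (simp add: power2_eq_square flip: power_mult_distrib)
      finally show ?thesis by (simp add: dist)
    qed
    then have conv: "AE x in M. convergent (\<lambda>k. f (r k) x)"
      by (intro AE_convergent_fast f(1))
    define h where "h x = lim (\<lambda>k. f (r k) x)" for x
    have [measurable]: "h \<in> borel_measurable M" unfolding h_def by measurable
    have lim: "AE x in M. (\<lambda>k. f (r k) x) \<longlonglongrightarrow> h x"
      using conv by eventually_elim (simp add: h_def convergent_LIMSEQ_iff)
    have bound: "(\<integral>\<^sup>+x. ennreal ((f n x - h x)\<^sup>2) \<partial>M) \<le> ennreal (e\<^sup>2)"
      if e: "\<And>m. m \<ge> K \<Longrightarrow> vdist (l2 M) (u n) (u m) \<le> e" for n K e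
    proof -
      have "(\<integral>\<^sup>+x. ennreal ((f n x - h x)\<^sup>2) \<partial>M) =
          (\<integral>\<^sup>+x. liminf (\<lambda>k. ennreal ((f n x - f (r k) x)\<^sup>2)) \<partial>M)"
      proof (rule nn_integral_cong_AE)
        show "AE x in M. ennreal ((f n x - h x)\<^sup>2) = liminf (\<lambda>k. ennreal ((f n x - f (r k) x)\<^sup>2))"
          using lim
        proof eventually_elim
          case (elim x)
          then have "(\<lambda>k. ennreal ((f n x - f (r k) x)\<^sup>2)) \<longlonglongrightarrow> ennreal ((f n x - h x)\<^sup>2)"
            by (intro tendsto_ennrealI tendsto_intros)
          then show ?case by (intro lim_imp_Liminf[symmetric]) simp_all
        qed
      qed
      \<comment> \<open>Fatou's lemma.\<close>
      also have "\<dots> \<le> liminf (\<lambda>k. \<integral>\<^sup>+x. ennreal ((f n x - f (r k) x)\<^sup>2) \<partial>M)"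
        by (rule nn_integral_liminf) measurable
      also have "\<dots> \<le> ennreal (e\<^sup>2)"
      proof (rule Liminf_le)
        have "(\<integral>\<^sup>+x. ennreal ((f n x - f (r k) x)\<^sup>2) \<partial>M) \<le> ennreal (e\<^sup>2)" if "k \<ge> K" for k
        proof -
          have "(\<integral>\<^sup>+x. ennreal ((f n x - f (r k) x)\<^sup>2) \<partial>M) = ennreal (\<integral>x. (f n x - f (r k) x)\<^sup>2 \<partial>M)"
            using f by (intro nn_integral_eq_integral sqint_integrable sqint_diff) auto
          also have "\<dots> = ennreal ((vdist (l2 M) (u n) (u (r k)))\<^sup>2)" by (simp add: dist)
          also have "\<dots> \<le> ennreal (e\<^sup>2)"
            using e[of "r k"] rk[of k] that uc by (intro ennreal_leI power_mono) simp_all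
          finally show ?thesis .
        qed
        then show "\<forall>\<^sub>F k in sequentially. (\<integral>\<^sup>+x. ennreal ((f n x - f (r k) x)\<^sup>2) \<partial>M) \<le> ennreal (e\<^sup>2)"
          by (auto simp: eventually_sequentially)
      qed simp
      finally show ?thesis .
    qed
    have diff: "(\<lambda>x. f n x - h x) \<in> sqint M" if "\<And>m. m \<ge> K \<Longrightarrow> vdist (l2 M) (u n) (u m) \<le> e" for n K e
    proof -
      have "(\<integral>\<^sup>+x. ennreal ((f n x - h x)\<^sup>2) \<partial>M) < \<infinity>"
        using bound[OF that] by (rule le_less_trans) simp_all
      then have "integrable M (\<lambda>x. (f n x - h x)\<^sup>2)"
        by (intro integrableI_nonneg) simp_all
      then show ?thesis by (simp add: sqint_def)
    qed
    have h: "h \<in> sqint M"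
    proof -
      obtain K where "\<forall>m\<ge>K. \<forall>n\<ge>K. vdist (l2 M) (u m) (u n) < 1" using cauchy[OF zero_less_one] by blast
      then have "(\<lambda>x. f K x - h x) \<in> sqint M" by (intro diff[of K _ 1]) (simp add: less_imp_le)
      from sqint_diff[OF f(1)[of K] this] show ?thesis by simp
    qed
    have "(\<lambda>n. vdist (l2 M) (u n) (ae_class M h)) \<longlonglongrightarrow> 0"
    proof (rule LIMSEQ_I)
      fix e :: real assume e: "e > 0"
      then obtain K where K: "\<forall>m\<ge>K. \<forall>n\<ge>K. vdist (l2 M) (u m) (u n) < e / 2"
        using cauchy half_gt_zero by blast
      have "norm (vdist (l2 M) (u n) (ae_class M h) - 0) < e" if n: "n \<ge> K" for n
      proof -
        have b: "vdist (l2 M) (u n) (u m) \<le> e / 2" if "m \<ge> K" for m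
          using K n that by (simp add: less_imp_le)
        have "ennreal (\<integral>x. (f n x - h x)\<^sup>2 \<partial>M) = (\<integral>\<^sup>+x. ennreal ((f n x - h x)\<^sup>2) \<partial>M)"
          by (intro nn_integral_eq_integral[symmetric] sqint_integrable sqint_diff f h) simp
        also have "\<dots> \<le> ennreal ((e / 2)\<^sup>2)" using b by (rule bound)
        finally have "(\<integral>x. (f n x - h x)\<^sup>2 \<partial>M) \<le> (e / 2)\<^sup>2" by (subst (asm) ennreal_le_iff) simp_all
        then have "(vdist (l2 M) (u n) (ae_class M h))\<^sup>2 \<le> (e / 2)\<^sup>2"
          unfolding f(2) by (subst l2_dist) (simp_all add: f h)
        then have "vdist (l2 M) (u n) (ae_class M h) \<le> e / 2"
          by (rule power2_le_imp_le) (use e in simp)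
        then show ?thesis using e uc[of n] h by simp
      qed
      then show "\<exists>K. \<forall>n\<ge>K. norm (vdist (l2 M) (u n) (ae_class M h) - 0) < e" by blast
    qed
    then show "\<exists>v\<in>carr (l2 M). (\<lambda>n. vdist (l2 M) (u n) v) \<longlonglongrightarrow> 0"
      using h by (intro bexI[of _ "ae_class M h"]) simp_all
  qed
qed

section \<open>Closed subspaces of an L^2 space described by functions\<close>

locale l2_subspace =
  fixes M :: "'x measure" and S
  assumes S: "closed_subspace (l2 M) S"
begin

sublocale l2: inner_product_space "l2 M" by (rule l2_inner_product_space)

text \<open>Limit theorems of integration apply to functions and not to classes, so S is replaced by
  the set of its representatives.\<close>

definition funs :: "('x \<Rightarrow> real) set" where
  "funs = {f \<in> sqint M. ae_class M f \<in> S}"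

lemma funs_sqint: "f \<in> funs \<Longrightarrow> f \<in> sqint M"
  by (simp add: funs_def)

lemma funs_zero: "(\<lambda>x. 0) \<in> funs"
  using closed_subspaceD(2)[OF S] by (simp add: funs_def l2_zero)

lemma funs_add: "f \<in> funs \<Longrightarrow> g \<in> funs \<Longrightarrow> (\<lambda>x. f x + g x) \<in> funs"
  using closed_subspaceD(3)[OF S, of "ae_class M f" "ae_class M g"] by (simp add: funs_def l2_add sqint_add)

lemma funs_scale: "f \<in> funs \<Longrightarrow> (\<lambda>x. c * f x) \<in> funs"
  using closed_subspaceD(4)[OF S, of "ae_class M f" c] by (simp add: funs_def l2_scale sqint_scale)

lemma funs_diff: "f \<in> funs \<Longrightarrow> g \<in> funs \<Longrightarrow> (\<lambda>x. f x - g x) \<in> funs"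
  using funs_add[of f "\<lambda>x. (-1) * g x"] funs_scale[of g "-1"] by simp

lemma funs_sum: "(\<And>i. i \<in> I \<Longrightarrow> f i \<in> funs) \<Longrightarrow> (\<lambda>x. \<Sum>i\<in>I. f i x) \<in> funs"
  by (induction I rule: infinite_finite_induct) (simp_all add: funs_zero funs_add)

lemma funs_AE:
  assumes "f \<in> funs" "g \<in> borel_measurable M" "AE x in M. g x = f x"
  shows "g \<in> funs"
proof -
  have "g \<in> sqint M"
    by (rule sqint_bounded[of f M g 1]) (use assms in \<open>auto simp: funs_def\<close>)
  then show ?thesis using assms ae_class_eqI[OF assms(3)] by (simp add: funs_def)
qed

lemma funs_limit:
  assumes f: "\<And>n. f n \<in> funs" and g: "g \<in> sqint M"
    and lim: "(\<lambda>n. \<integral>x. (f n x - g x)\<^sup>2 \<partial>M) \<longlonglongrightarrow> 0"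
  shows "g \<in> funs"
proof -
  have "(\<lambda>n. sqrt (\<integral>x. (f n x - g x)\<^sup>2 \<partial>M)) \<longlonglongrightarrow> sqrt 0"
    using lim by (rule tendsto_real_sqrt)
  moreover have "sqrt (\<integral>x. (f n x - g x)\<^sup>2 \<partial>M) = vdist (l2 M) (ae_class M (f n)) (ae_class M g)" for n
    using f[of n] g l2_dist[of "f n" M g] by (intro real_sqrt_unique) (simp_all add: funs_def)
  ultimately have "(\<lambda>n. vdist (l2 M) (ae_class M (f n)) (ae_class M g)) \<longlonglongrightarrow> 0" by simp
  then have "ae_class M g \<in> S"
    using f g by - (rule closed_subspaceD(5)[OF S, of "\<lambda>n. ae_class M (f n)"], simp_all add: funs_def)
  then show ?thesis using g by (simp add: funs_def)
qed

lemma funs_dominated_limit: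
  assumes f: "\<And>n. f n \<in> funs" and w: "w \<in> sqint M" and g: "g \<in> borel_measurable M"
    and bound: "\<And>n. AE x in M. \<bar>f n x\<bar> \<le> \<bar>w x\<bar>" and lim: "AE x in M. (\<lambda>n. f n x) \<longlonglongrightarrow> g x"
  shows "g \<in> funs"
proof (rule funs_limit[OF f])
  note [measurable] = g sqint_measurable[OF w] sqint_measurable[OF funs_sqint[OF f]]
  have bound': "AE x in M. \<forall>n. \<bar>f n x\<bar> \<le> \<bar>w x\<bar>" using bound by (simp add: AE_all_countable)
  have gw: "AE x in M. \<bar>g x\<bar> \<le> \<bar>w x\<bar>"
    using lim bound'
  proof eventually_elim
    case (elim x)
    then show ?case
      by (intro LIMSEQ_le_const2[OF tendsto_rabs]) auto
  qed
  then show "g \<in> sqint M"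
    by (intro sqint_bounded[OF w g, of 1]) simp
  have "(\<lambda>n. \<integral>x. (f n x - g x)\<^sup>2 \<partial>M) \<longlonglongrightarrow> (\<integral>x. 0 \<partial>M)"
  proof (rule integral_dominated_convergence)
    \<comment> \<open>Both f n and g are bounded by w in absolute value, so the square of their
      difference is at most 4 w^2.\<close>
    show "integrable M (\<lambda>x. 4 * (w x)\<^sup>2)" using w by (simp add: sqint_integrable)
    show "AE x in M. (\<lambda>n. (f n x - g x)\<^sup>2) \<longlonglongrightarrow> 0"
      using lim
    proof eventually_elim
      case (elim x)
      then have "(\<lambda>n. (f n x - g x)\<^sup>2) \<longlonglongrightarrow> (g x - g x)\<^sup>2" by (intro tendsto_intros)
      then show ?case by simp
    qed
    show "AE x in M. norm ((f n x - g x)\<^sup>2) \<le> 4 * (w x)\<^sup>2" for n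
      using bound' gw
    proof eventually_elim
      case (elim x)
      then have "\<bar>f n x - g x\<bar> \<le> 2 * \<bar>w x\<bar>"
        using spec[OF elim(1), of n] by linarith
      then have "\<bar>f n x - g x\<bar>\<^sup>2 \<le> (2 * \<bar>w x\<bar>)\<^sup>2" by (intro power_mono) auto
      then show ?case by (simp add: power_mult_distrib)
    qed
  qed simp_all
  then show "(\<lambda>n. \<integral>x. (f n x - g x)\<^sup>2 \<partial>M) \<longlonglongrightarrow> 0" by simp
qed

text \<open>Intersecting with a set U of finite measure keeps all indicators square integrable and
  turns complements into differences from the indicator of U. The sets A for which the indicator of
  A \<inter> U belongs to \<open>funs\<close> thus form a Dynkin class.\<close>

lemma funs_indicator_dynkin:
  assumes E: "Int_stable E" "E \<subseteq> Pow (space M)" "sets M = sigma_sets (space M) E"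
    and U: "U \<in> sets M" "emeasure M U < \<infinity>" "indicator U \<in> funs"
    and basic: "\<And>B. B \<in> E \<Longrightarrow> indicator (B \<inter> U) \<in> funs"
    and A: "A \<in> sets M"
  shows "indicator (A \<inter> U) \<in> funs"
proof -
  have "A \<in> sigma_sets (space M) E" using A E by simp
  with E(1,2) show ?thesis
  proof (induction rule: sigma_sets_induct_disjoint)
    case (basic A)
    then show ?case by (rule assms(7))
  next
    case empty
    then show ?case using funs_zero by simp
  next
    case (compl A)
    have "(indicator ((space M - A) \<inter> U) :: _ \<Rightarrow> real) = (\<lambda>x. indicator U x - indicator (A \<inter> U) x)"
      using sets.sets_into_space[OF U(1)] by (auto simp: indicator_def fun_eq_iff)
    then show ?case using funs_diff[OF U(3) compl.IH] by simp
  next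
    case (union A)
    have Am: "A i \<in> sets M" for i using union.hyps(2) E by auto
    show ?case
    proof (rule funs_dominated_limit)
      show "(\<lambda>x. \<Sum>i<n. indicator (A i \<inter> U) x) \<in> funs" for n
        using union.IH by (rule funs_sum)
      show "indicator U \<in> sqint M" using U by (intro sqint_indicator)
      show "indicator (\<Union> (range A) \<inter> U) \<in> borel_measurable M" using Am U by measurable
      have dis: "disjoint_family (\<lambda>i. A i \<inter> U)"
        using union.hyps(1) by (auto simp: disjoint_family_on_def)
      have sums: "(\<lambda>i. indicator (A i \<inter> U) x :: real) sums indicator (\<Union>i. A i \<inter> U) x" for x
        using dis by (intro indicator_sums) (auto simp: disjoint_family_on_def)
      have eq: "(\<Union>i. A i \<inter> U) = \<Union> (range A) \<inter> U" by auto
      show "AE x in M. (\<lambda>n. \<Sum>i<n. indicator (A i \<inter> U) x) \<longlonglongrightarrow> (indicator (\<Union> (range A) \<inter> U) x :: real)"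
        using sums by (simp add: sums_def eq)
      have "(\<Sum>i<n. indicator (A i \<inter> U) x :: real) \<le> indicator U x" for x n
      proof -
        have "(\<Sum>i<n. indicator (A i \<inter> U) x :: real) \<le> (\<Sum>i. indicator (A i \<inter> U) x)"
          using sums[of x] by (intro sum_le_suminf) (auto simp: sums_iff)
        also have "\<dots> = indicator (\<Union> (range A) \<inter> U) x"
          using sums[of x] by (simp add: sums_iff eq)
        also have "\<dots> \<le> indicator U x" by (auto simp: indicator_def)
        finally show ?thesis .
      qed
      then show "AE x in M. \<bar>\<Sum>i<n. indicator (A i \<inter> U) x\<bar> \<le> \<bar>indicator U x :: real\<bar>" for n
        by (simp add: sum_nonneg)
    qed
  qed
qed

text \<open>Indicators give simple functions cut off to finite unions of the \<open>U k\<close>.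
  These approximate f and are dominated by 2 |f|.\<close>

lemma funs_eq_sqint:
  assumes U: "\<And>k::nat. U k \<in> sets M" "\<And>k. emeasure M (U k) < \<infinity>" "AE x in M. x \<in> (\<Union>k. U k)"
    and ind: "\<And>A k. A \<in> sets M \<Longrightarrow> indicator (A \<inter> U k) \<in> funs"
  shows "funs = sqint M" "S = carr (l2 M)"
proof -
  define W where "W n = (\<Union>k<n. U k)" for n
  have Wm [measurable]: "W n \<in> sets M" for n unfolding W_def using U(1) by auto
  have indW: "indicator (A \<inter> W n) \<in> funs" if "A \<in> sets M" for A n
    using that
  proof (induction n arbitrary: A)
    case 0
    then show ?case using funs_zero by (simp add: W_def)
  next
    case (Suc n)
    \<comment> \<open>Since the \<open>U k\<close> may overlap, only the part of \<open>U n\<close>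
      not yet covered is added.\<close>
    have "(indicator (A \<inter> W (Suc n)) :: _ \<Rightarrow> real) = (\<lambda>x. indicator (A \<inter> W n) x + indicator ((A - W n) \<inter> U n) x)"
      by (auto simp: indicator_def fun_eq_iff W_def less_Suc_eq)
    then show ?case using Suc ind[of "A - W n" n] funs_add by simp
  qed
  have all: "f \<in> funs" if f: "f \<in> sqint M" for f
  proof -
    note [measurable] = sqint_measurable[OF f]
    obtain s where s: "\<And>i. simple_function M (s i)" "\<And>x. x \<in> space M \<Longrightarrow> (\<lambda>i. s i x) \<longlonglongrightarrow> f x"
      "\<And>i x. x \<in> space M \<Longrightarrow> \<bar>s i x\<bar> \<le> 2 * \<bar>f x\<bar>"
      using borel_measurable_implies_sequence_metric[OF sqint_measurable[OF f], of 0]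
      unfolding dist_real_def diff_0_right by metis
    note [measurable] = borel_measurable_simple_function[OF s(1)]
    show ?thesis
    proof (rule funs_dominated_limit[of "\<lambda>i x. s i x * indicator (W i) x"])
      show "(\<lambda>x. s i x * indicator (W i) x) \<in> funs" for i
      proof (rule funs_AE)
        show "(\<lambda>x. \<Sum>y\<in>s i ` space M. y * indicator ((s i -` {y} \<inter> space M) \<inter> W i) x) \<in> funs"
          by (intro funs_sum funs_scale indW simple_functionD(2)[OF s(1)])
        show "AE x in M. s i x * indicator (W i) x =
            (\<Sum>y\<in>s i ` space M. y * indicator ((s i -` {y} \<inter> space M) \<inter> W i) x)"
        proof (rule AE_I2)
          fix x assume x: "x \<in> space M"
          have "(\<Sum>y\<in>s i ` space M. y * indicator ((s i -` {y} \<inter> space M) \<inter> W i) x) =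
              (\<Sum>y\<in>s i ` space M. if y = s i x then y * indicator (W i) x else 0)"
            using x by (intro sum.cong) (auto simp: indicator_def)
          also have "\<dots> = s i x * indicator (W i) x"
            using x simple_functionD(1)[OF s(1)] by simp
          finally show "s i x * indicator (W i) x =
            (\<Sum>y\<in>s i ` space M. y * indicator ((s i -` {y} \<inter> space M) \<inter> W i) x)" by simp
        qed
      qed measurable
      show "(\<lambda>x. 2 * f x) \<in> sqint M" using f by (rule sqint_scale)
      show "f \<in> borel_measurable M" by measurable
      show "AE x in M. \<bar>s i x * indicator (W i) x\<bar> \<le> \<bar>2 * f x\<bar>" for i
        using s(3) by (intro AE_I2) (auto simp: indicator_def abs_mult)
      show "AE x in M. (\<lambda>i. s i x * indicator (W i) x) \<longlonglongrightarrow> f x"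
        using U(3) AE_space
      proof eventually_elim
        case (elim x)
        then obtain k where k: "x \<in> U k" by blast
        have "\<forall>\<^sub>F i in sequentially. s i x * indicator (W i) x = s i x"
        proof (rule eventually_sequentiallyI)
          fix i assume "Suc k \<le> i"
          then have "x \<in> W i" unfolding W_def using k by (intro UN_I[of k]) auto
          then show "s i x * indicator (W i) x = s i x" by simp
        qed
        from iffD2[OF tendsto_cong[OF this] s(2)[OF elim(2)]] show ?case .
      qed
    qed
  qed
  then show "funs = sqint M" by (auto simp: funs_def)
  show "S = carr (l2 M)"
    using all closed_subspaceD(1)[OF S] by (auto simp: l2_carr funs_def)
qed

end

section \<open>Products of $L^2$ spaces\<close>

context product_sigma_finite begin

lemma prod_measurable:
  assumes "\<And>j. j \<in> I \<Longrightarrow> g j \<in> borel_measurable (M j)"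
  shows "(\<lambda>z. \<Prod>j\<in>I. g j (z j) :: real) \<in> borel_measurable (PiM I M)"
  using assms by (intro borel_measurable_prod) (auto intro: measurable_compose[OF measurable_component_singleton])

lemma prod_sqint:
  assumes "finite I" "\<And>j. j \<in> I \<Longrightarrow> g j \<in> sqint (M j)"
  shows "(\<lambda>z. \<Prod>j\<in>I. g j (z j)) \<in> sqint (PiM I M)"
proof -
  have "integrable (PiM I M) (\<lambda>z. \<Prod>j\<in>I. (g j (z j))\<^sup>2)"
    using assms by (intro product_integrable_prod sqint_integrable)
  then show ?thesis
    using prod_measurable[of I g] sqint_measurable[OF assms(2)] by (simp add: sqint_def prod_power_distrib)
qed

lemma prod_inner:
  assumes "finite I" "\<And>j. j \<in> I \<Longrightarrow> g j \<in> sqint (M j)" "\<And>j. j \<in> I \<Longrightarrow> h j \<in> sqint (M j)"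
  shows "(\<integral>z. (\<Prod>j\<in>I. g j (z j)) * (\<Prod>j\<in>I. h j (z j)) \<partial>PiM I M) = (\<Prod>j\<in>I. \<integral>x. g j x * h j x \<partial>M j)"
  unfolding prod.distrib[symmetric]
  by (rule product_integral_prod) (use assms in \<open>auto intro: sqint_mult_integrable\<close>)

lemma indicator_PiE_eq:
  assumes "finite I" "z \<in> space (PiM I M)"
  shows "indicator (PiE I A) z = (\<Prod>j\<in>I. indicator (A j) (z j) :: real)"
proof (cases "\<forall>j\<in>I. z j \<in> A j")
  case True
  then show ?thesis using assms by (auto simp: indicator_def space_PiM PiE_iff)
next
  case False
  then obtain j where j: "j \<in> I" "z j \<notin> A j" by blast
  then have "(\<Prod>j\<in>I. indicator (A j) (z j) :: real) = 0"
    using assms(1) by (intro prod_zero bexI[of _ j]) simp_all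
  then show ?thesis using j by (auto simp: indicator_def)
qed

text \<open>The generators of the product \<sigma>-algebra meet the fixed rectangle with sides U in
  smaller rectangles. The hypothesis speaks of these only, because later the available rectangles
  are those whose neighbouring sides are disjoint.\<close>

lemma rectangle_dynkin:
  assumes I: "finite I" and S: "l2_subspace (PiM I M) S"
    and U: "\<And>j. j \<in> I \<Longrightarrow> U j \<in> sets (M j)" "\<And>j. j \<in> I \<Longrightarrow> emeasure (M j) (U j) < \<infinity>"
    and rect: "\<And>A. (\<And>j. j \<in> I \<Longrightarrow> A j \<in> sets (M j)) \<Longrightarrow> (\<And>j. j \<in> I \<Longrightarrow> A j \<subseteq> U j) \<Longrightarrow>
      indicator (PiE I A) \<in> l2_subspace.funs (PiM I M) S"
    and B: "B \<in> sets (PiM I M)"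
  shows "indicator (B \<inter> PiE I U) \<in> l2_subspace.funs (PiM I M) S"
proof -
  interpret S: l2_subspace "PiM I M" S by (rule S)
  show ?thesis
  proof (rule S.funs_indicator_dynkin[OF Int_stable_prod_algebra[of I M]])
    show "prod_algebra I M \<subseteq> Pow (space (PiM I M))"
      using prod_algebra_sets_into_space by (simp add: space_PiM)
    show "sets (PiM I M) = sigma_sets (space (PiM I M)) (prod_algebra I M)"
      by (simp add: sets_PiM space_PiM)
    show "PiE I U \<in> sets (PiM I M)" using I U by (intro sets_PiM_I_finite)
    have "(\<Prod>j\<in>I. emeasure (M j) (U j)) \<noteq> \<infinity>"
      using I U(2) by (simp add: ennreal_prod_eq_top less_top)
    then show "emeasure (PiM I M) (PiE I U) < \<infinity>"
      using I U by (subst emeasure_PiM) (simp_all add: less_top)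
    show "indicator (PiE I U) \<in> S.funs" by (rule rect) (simp_all add: U)
    show "indicator (B \<inter> PiE I U) \<in> S.funs" if B: "B \<in> prod_algebra I M" for B
    proof -
      obtain X where X: "B = PiE I X" "X \<in> (\<Pi> j\<in>I. sets (M j))"
        using B unfolding prod_algebra_eq_finite[OF I] by blast
      have "B \<inter> PiE I U = PiE I (\<lambda>j. X j \<inter> U j)" unfolding X(1) by (rule PiE_Int)
      moreover have "indicator (\<Pi>\<^sub>E j\<in>I. X j \<inter> U j) \<in> S.funs"
      proof (rule rect)
        fix j assume "j \<in> I"
        then show "X j \<inter> U j \<in> sets (M j)" using X(2) U(1) by (intro sets.Int) auto
      qed simp
      ultimately show ?thesis by simp
    qed
  qed (rule B)
qed

text \<open>The indicator of a rectangle with sides of finite measure is a tensor of indicators, and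
  \<sigma>-finiteness supplies countably many such rectangles covering the space.\<close>

lemma tensors_total:
  assumes I: "finite I"
  shows "total (l2 (PiM I M))
    {ae_class (PiM I M) (\<lambda>z. \<Prod>j\<in>I. g j (z j)) | g. \<forall>j\<in>I. g j \<in> sqint (M j)}" (is "total _ ?T")
proof (rule totalI)
  show "?T \<subseteq> carr (l2 (PiM I M))" using prod_sqint[OF I] by auto
  fix S v assume "closed_subspace (l2 (PiM I M)) S" "?T \<subseteq> S" and v: "v \<in> carr (l2 (PiM I M))"
  then interpret S: l2_subspace "PiM I M" S by unfold_locales
  have tens: "(\<lambda>z. \<Prod>j\<in>I. g j (z j)) \<in> S.funs" if "\<forall>j\<in>I. g j \<in> sqint (M j)" for g
    using \<open>?T \<subseteq> S\<close> that prod_sqint[OF I] by (auto simp: S.funs_def)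
  interpret finite_product_sigma_finite M I by unfold_locales (rule I)
  obtain F :: "'i \<Rightarrow> nat \<Rightarrow> 'a set" where F: "\<forall>i\<in>I. range (F i) \<subseteq> sets (M i)"
    "\<forall>k. \<forall>i\<in>I. emeasure (M i) (F i k) \<noteq> \<infinity>" "(\<Union>k. \<Pi>\<^sub>E i\<in>I. F i k) = space (PiM I M)"
    using sigma_finite_pairs by blast
  have "S = carr (l2 (PiM I M))"
  proof (rule S.funs_eq_sqint(2)[of "\<lambda>k. \<Pi>\<^sub>E i\<in>I. F i k"])
    show "(\<Pi>\<^sub>E i\<in>I. F i k) \<in> sets (PiM I M)" for k
      using I F by (intro sets_PiM_I_finite) auto
    have "(\<Prod>j\<in>I. emeasure (M j) (F j k)) \<noteq> \<infinity>" for k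
      using I F(2) by (simp add: ennreal_prod_eq_top)
    then show "emeasure (PiM I M) (\<Pi>\<^sub>E i\<in>I. F i k) < \<infinity>" for k
      using I F(1) by (subst emeasure_PiM) (auto simp: less_top)
    show "AE x in PiM I M. x \<in> (\<Union>k. \<Pi>\<^sub>E i\<in>I. F i k)"
      unfolding F(3) by (rule AE_space)
    show "indicator (A \<inter> (\<Pi>\<^sub>E i\<in>I. F i k)) \<in> S.funs" if "A \<in> sets (PiM I M)" for A k
    proof (rule rectangle_dynkin[OF I S.l2_subspace_axioms _ _ _ that])
      show "F j k \<in> sets (M j)" "emeasure (M j) (F j k) < \<infinity>" if "j \<in> I" for j
        using F that by (auto simp: less_top)
      fix A assume A: "\<And>j. j \<in> I \<Longrightarrow> A j \<in> sets (M j)" "\<And>j. j \<in> I \<Longrightarrow> A j \<subseteq> F j k"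
      have "emeasure (M j) (A j) < \<infinity>" if "j \<in> I" for j
      proof -
        have "emeasure (M j) (A j) \<le> emeasure (M j) (F j k)"
          using A F that by (intro emeasure_mono) auto
        also have "\<dots> < \<infinity>" using F that by (auto simp: less_top)
        finally show ?thesis .
      qed
      then have "(\<lambda>z. \<Prod>j\<in>I. indicator (A j) (z j)) \<in> S.funs"
        using A by (intro tens ballI sqint_indicator) auto
      then show "indicator (PiE I A) \<in> S.funs"
      proof (rule S.funs_AE)
        show "indicator (PiE I A) \<in> borel_measurable (PiM I M)"
          using I A by (intro borel_measurable_indicator sets_PiM_I_finite)
        show "AE z in PiM I M. indicator (PiE I A) z = (\<Prod>j\<in>I. indicator (A j) (z j) :: real)"
          by (rule AE_I2) (rule indicator_PiE_eq[OF I])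
      qed
    qed
  qed
  then show "v \<in> S" using v by simp
qed

text \<open>The factors are replaced one at a time; the tensor is a bounded linear function of each.\<close>

lemma tensors_of_total:
  assumes I: "finite I" and G: "\<And>j. j \<in> I \<Longrightarrow> G j \<subseteq> sqint (M j)"
    and tot: "\<And>j. j \<in> I \<Longrightarrow> total (l2 (M j)) (ae_class (M j) ` G j)"
  shows "total (l2 (PiM I M)) {ae_class (PiM I M) (\<lambda>z. \<Prod>j\<in>I. g j (z j)) | g. \<forall>j\<in>I. g j \<in> G j}"
    (is "total _ ?T")
proof (rule total_trans[OF tensors_total[OF I]])
  show "?T \<subseteq> carr (l2 (PiM I M))"
  proof clarify
    fix g assume "\<forall>j\<in>I. g j \<in> G j"
    then show "ae_class (PiM I M) (\<lambda>z. \<Prod>j\<in>I. g j (z j)) \<in> carr (l2 (PiM I M))"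
      using G by (intro ae_class_closed prod_sqint[OF I]) auto
  qed
  fix S assume S: "closed_subspace (l2 (PiM I M)) S" and T: "?T \<subseteq> S"
  \<comment> \<open>Induction on the set J of coordinates whose factors are arbitrary; the factors
    at the other coordinates are still taken from G.\<close>
  have "ae_class (PiM I M) (\<lambda>z. \<Prod>j\<in>I. g j (z j)) \<in> S"
    if "J \<subseteq> I" "\<forall>j\<in>J. g j \<in> sqint (M j)" "\<forall>j\<in>I - J. g j \<in> G j" for J g
    using finite_subset[OF that(1) I] that
  proof (induction J arbitrary: g rule: finite_induct)
    case empty
    then show ?case using T by blast
  next
    case (insert i J)
    have i: "i \<in> I" using insert.prems by simp
    have g: "g j \<in> sqint (M j)" if "j \<in> I" for j
      using insert.prems that G by (cases "j \<in> insert i J") auto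
    let ?t = "\<lambda>f z. \<Prod>j\<in>I. (g(i := f)) j (z j)"
    have upd: "(g(i := f)) j \<in> sqint (M j)" if "f \<in> sqint (M i)" "j \<in> I" for f j
      using g that by auto
    have t: "?t f \<in> sqint (PiM I M)" if "f \<in> sqint (M i)" for f
      using upd[OF that] by (intro prod_sqint I)
    \<comment> \<open>Inserting a function into slot i multiplies inner products by the product of
      the squared norms of the other factors.\<close>
    define c where "c = (\<Prod>j\<in>I - {i}. \<integral>x. g j x * g j x \<partial>M j)"
    have c: "c \<ge> 0" unfolding c_def by (intro prod_nonneg) simp
    have inn: "vinner (l2 (PiM I M)) (ae_class (PiM I M) (?t f)) (ae_class (PiM I M) (?t h)) =
        c * vinner (l2 (M i)) (ae_class (M i) f) (ae_class (M i) h)"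
      if "f \<in> sqint (M i)" "h \<in> sqint (M i)" for f h
    proof -
      have "vinner (l2 (PiM I M)) (ae_class (PiM I M) (?t f)) (ae_class (PiM I M) (?t h)) =
          (\<Prod>j\<in>I. \<integral>x. (g(i := f)) j x * (g(i := h)) j x \<partial>M j)"
        using t that upd by (subst l2_inner) (auto intro!: prod_inner I)
      also have "\<dots> = (\<integral>x. f x * h x \<partial>M i) * c"
        unfolding c_def using I i by (subst prod.remove[of _ i]) (auto intro!: prod.cong)
      finally show ?thesis using that by (simp add: l2_inner)
    qed
    \<comment> \<open>A map on classes has to pick a representative; \<open>A_class\<close> shows
      that every function of the class gives the same value.\<close>
    define A where "A a = ae_class (PiM I M) (?t (rep a))" for a
    have A: "conformal (l2 (M i)) (l2 (PiM I M)) c A"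
      unfolding conformal_def A_def
    proof (intro conjI ballI funcsetI c)
      fix a b assume ab: "a \<in> carr (l2 (M i))" "b \<in> carr (l2 (M i))"
      show "vinner (l2 (PiM I M)) (ae_class (PiM I M) (?t (rep a))) (ae_class (PiM I M) (?t (rep b))) =
          c * vinner (l2 (M i)) a b"
        using inn[OF l2_rep(1)[OF ab(1)] l2_rep(1)[OF ab(2)]] l2_rep(2)[OF ab(1)] l2_rep(2)[OF ab(2)]
        by simp
    qed (intro ae_class_closed t l2_rep)
    have A_class: "A (ae_class (M i) f) = ae_class (PiM I M) (?t f)" if f: "f \<in> sqint (M i)" for f
    proof -
      interpret P: inner_product_space "l2 (PiM I M)" by (rule l2_inner_product_space)
      have r: "rep (ae_class (M i) f) \<in> sqint (M i)" "ae_class (M i) (rep (ae_class (M i) f)) = ae_class (M i) f"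
        using l2_rep[of "ae_class (M i) f"] f by auto
      have "(vdist (l2 (PiM I M)) (A (ae_class (M i) f)) (ae_class (PiM I M) (?t f)))\<^sup>2 = 0"
        unfolding A_def using t[OF r(1)] t[OF f] inn[OF r(1) r(1)] inn[OF r(1) f] inn[OF f f]
        by (simp add: P.dist_sq r(2))
      then show ?thesis
        using P.dist_0_imp_eq t[OF r(1)] t[OF f] by (simp add: A_def)
    qed
    have cl: "closed_subspace (l2 (M i)) {a \<in> carr (l2 (M i)). A a \<in> S}"
      by (rule closed_subspace_vimage[OF conformal_bounded[OF A] _ _ S]) (rule l2_inner_product_space)+
    have "ae_class (M i) (g i) \<in> {a \<in> carr (l2 (M i)). A a \<in> S}"
    proof (rule totalD[OF tot[OF i] cl])
      show "ae_class (M i) ` G i \<subseteq> {a \<in> carr (l2 (M i)). A a \<in> S}"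
      proof clarify
        fix f assume f: "f \<in> G i"
        then have fs: "f \<in> sqint (M i)" using G i by blast
        have "ae_class (PiM I M) (?t f) \<in> S"
          using insert.prems insert.hyps f by (intro insert.IH) (auto simp del: fun_upd_apply simp: fun_upd_def)
        then show "ae_class (M i) f \<in> carr (l2 (M i)) \<and> A (ae_class (M i) f) \<in> S"
          using fs by (simp only: A_class[OF fs]) simp
      qed
    qed (use g i in simp)
    then show ?case using A_class[OF g[OF i]] by simp
  qed
  from this[of I] show "{ae_class (PiM I M) (\<lambda>z. \<Prod>j\<in>I. g j (z j)) | g. \<forall>j\<in>I. g j \<in> sqint (M j)} \<subseteq> S"
    by auto
qed

end

section \<open>Operators on the full Fock space\<close>

lemma sqint_mult_measurable:
  "f \<in> sqint M \<Longrightarrow> g \<in> sqint M \<Longrightarrow> (\<lambda>x. f x * g x) \<in> borel_measurable M"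
  by (rule borel_measurable_integrable[OF sqint_mult_integrable])

lemma total_mono:
  assumes "total V T" "T \<subseteq> T'" "T' \<subseteq> carr V"
  shows "total V T'"
  by (rule total_trans[OF assms(1,3)]) (use assms(2) in blast)

text \<open>Evaluates the descriptions of the operators on the Fock space: Q is the prescribed
  action, which amounts to agreement with an already constructed A on a total set.\<close>

lemma bounded_ops_the:
  assumes A: "bounded_map V W A" and V: "inner_product_space V" and W: "inner_product_space W"
    and T: "total V T" and Q: "\<And>B. Q B \<longleftrightarrow> (\<forall>v\<in>T. B v = A v)"
  shows "(THE B. B \<in> bounded_ops V W \<and> Q B) = restrict A (carr V)"
proof (rule the_equality)
  have Tc: "T \<subseteq> carr V" using T by (simp add: total_def)
  have r: "restrict A (carr V) \<in> bounded_ops V W" by (rule bounded_map_restrict[OF A V])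
  then show "restrict A (carr V) \<in> bounded_ops V W \<and> Q (restrict A (carr V))"
    using Tc by (auto simp: Q)
  show "B = restrict A (carr V)" if "B \<in> bounded_ops V W \<and> Q B" for B
    by (rule bounded_ops_eqI[OF _ r V W T]) (use that Tc in \<open>auto simp: Q\<close>)
qed

text \<open>The Gram matrix of the elementary tensors. The recursion on lists lets simplification
  split off the first factor, on which all the operators act; tensors of different lengths are
  orthogonal.\<close>

fun tensor_inner :: "'z measure \<Rightarrow> ('z \<Rightarrow> real) list \<Rightarrow> ('z \<Rightarrow> real) list \<Rightarrow> real" where
  "tensor_inner N [] [] = 1"
| "tensor_inner N (g # gs) (h # hs) = (\<integral>z. g z * h z \<partial>N) * tensor_inner N gs hs"
| "tensor_inner N _ _ = 0"

lemma tensor_inner_prod: "length gs = length hs \<Longrightarrow>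
    tensor_inner N gs hs = (\<Prod>j<length gs. \<integral>z. (gs ! j) z * (hs ! j) z \<partial>N)"
  by (induction gs hs rule: list_induct2) (simp_all add: prod.lessThan_Suc_shift del: prod.lessThan_Suc)

lemma tensor_inner_length: "length gs \<noteq> length hs \<Longrightarrow> tensor_inner N gs hs = 0"
  by (induction N gs hs rule: tensor_inner.induct) auto

locale full_fock = sigma_finite_measure N for N :: "'z measure"
begin

declare One_nat_def [simp del]

sublocale P: product_sigma_finite "\<lambda>_::nat. N"
  by (rule product_sigma_finite.intro) (rule sigma_finite_measure_axioms)

sublocale D: direct_sum "{1..}" "\<lambda>n. l2 (power_measure n N)"
  by (rule direct_sum.intro) (rule l2_inner_product_space)

sublocale R: real_direct_sum "dsum {1..} (\<lambda>n. l2 (power_measure n N))"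
  by (rule real_direct_sum.intro) (rule D.dsum_inner_space)

abbreviation "F \<equiv> fock N"

sublocale F: hilbert_space F
  unfolding fock_def by (rule real_dsum_hilbert, rule dsum_hilbert, rule l2_hilbert)

lemmas F_ops = R.real_dsum_ops[folded fock_def]

lemma fock_embed_eq: "fock_embed N n v = (0, D.dembed n v)"
  by (simp add: fock_embed_def D.dembed_def)

lemma vacuum_eq: "vacuum N = (1, vzero (dsum {1..} (\<lambda>n. l2 (power_measure n N))))"
  by (simp add: vacuum_def D.dsum_ops)

lemma vacuum_closed [simp]: "vacuum N \<in> carr F"
  by (simp add: F_ops vacuum_eq)

lemma fock_embed_closed: "n \<ge> 1 \<Longrightarrow> v \<in> carr (l2 (power_measure n N)) \<Longrightarrow> fock_embed N n v \<in> carr F"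
  by (simp add: F_ops fock_embed_eq D.dembed_closed)

lemma inner_fock_embed:
  assumes "n \<ge> 1" "v \<in> carr (l2 (power_measure n N))" "m \<ge> 1" "w \<in> carr (l2 (power_measure m N))"
  shows "vinner F (fock_embed N n v) (fock_embed N m w) =
    (if n = m then vinner (l2 (power_measure n N)) v w else 0)"
  using assms
  by (auto simp: F_ops fock_embed_eq D.inner_dembed D.dembed_closed)
    (auto simp: D.dembed_def inner_product_space.inner_zero_right[OF l2_inner_product_space])

lemma inner_vacuum:
  "vinner F (vacuum N) (vacuum N) = 1"
  "n \<ge> 1 \<Longrightarrow> v \<in> carr (l2 (power_measure n N)) \<Longrightarrow> vinner F (vacuum N) (fock_embed N n v) = 0"
  "n \<ge> 1 \<Longrightarrow> v \<in> carr (l2 (power_measure n N)) \<Longrightarrow> vinner F (fock_embed N n v) (vacuum N) = 0"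
  by (simp_all add: F_ops vacuum_eq fock_embed_eq D.S.inner_zero_left D.S.inner_zero_right D.dembed_closed)

definition tens :: "('z \<Rightarrow> real) list \<Rightarrow> ((nat \<Rightarrow> 'z) \<Rightarrow> real)" where
  "tens gs = (\<lambda>z. \<Prod>j<length gs. (gs ! j) (z j))"

lemma tens_sqint: "gs \<in> lists (sqint N) \<Longrightarrow> tens gs \<in> sqint (power_measure (length gs) N)"
  unfolding tens_def power_measure_def by (intro P.prod_sqint) auto

lemma tensor_eq: "tensor N gs = (if gs = [] then vacuum N
    else fock_embed N (length gs) (ae_class (power_measure (length gs) N) (tens gs)))"
  by (simp add: tensor_def tens_def)

lemma length_ge_1: "gs \<noteq> [] \<Longrightarrow> length gs \<ge> 1"
  by (cases gs) simp_all

lemma tensor_closed [simp]: "gs \<in> lists (sqint N) \<Longrightarrow> tensor N gs \<in> carr F"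
  unfolding tensor_eq by (simp add: fock_embed_closed length_ge_1 tens_sqint)

lemma inner_tensor:
  assumes gs: "gs \<in> lists (sqint N)" and hs: "hs \<in> lists (sqint N)"
  shows "vinner F (tensor N gs) (tensor N hs) = tensor_inner N gs hs"
proof (cases "gs = [] \<or> hs = []")
  case True
  have "vinner F (vacuum N) (tensor N ks) = tensor_inner N [] ks"
    "vinner F (tensor N ks) (vacuum N) = tensor_inner N ks []" if ks: "ks \<in> lists (sqint N)" for ks
    using inner_vacuum(2,3)[OF length_ge_1 ae_class_closed[OF tens_sqint[OF ks]]]
    by (cases ks; simp add: tensor_eq inner_vacuum(1))+
  with gs hs True show ?thesis
    by (elim disjE) (simp_all only: tensor_eq[of "[]"] simp_thms if_True)
next
  case False
  then have ge: "length gs \<ge> 1" "length hs \<ge> 1" by (simp_all add: length_ge_1)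
  show ?thesis
  proof (cases "length gs = length hs")
    case True
    have "vinner F (tensor N gs) (tensor N hs) = (\<integral>z. tens gs z * tens hs z \<partial>power_measure (length gs) N)"
      using False ge True gs hs tens_sqint[OF gs] tens_sqint[OF hs]
      by (simp add: tensor_eq inner_fock_embed l2_inner)
    also have "\<dots> = (\<Prod>j<length gs. \<integral>z. (gs ! j) z * (hs ! j) z \<partial>N)"
      unfolding tens_def power_measure_def True[symmetric]
      by (rule P.prod_inner) (use gs hs True in auto)
    finally show ?thesis using True by (simp add: tensor_inner_prod)
  next
    case neq: False
    then show ?thesis
      using False ge tens_sqint[OF gs] tens_sqint[OF hs]
      by (simp add: tensor_eq inner_fock_embed tensor_inner_length)
  qed
qed

lemma tensors_total:
  assumes G: "G \<subseteq> sqint N" and tot: "total (l2 N) (ae_class N ` G)"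
  shows "total F (tensor N ` lists G)"
proof -
  let ?T = "\<lambda>n. {ae_class (power_measure n N) (\<lambda>z. \<Prod>j<n. g j (z j)) | g. \<forall>j<n. g j \<in> G}"
  have "total (l2 (power_measure n N)) (?T n)" for n
    using P.tensors_of_total[of "{..<n}" "\<lambda>_. G"] G tot
    unfolding power_measure_def Ball_def lessThan_iff by simp
  then have "total (dsum {1..} (\<lambda>n. l2 (power_measure n N))) (\<Union>n\<in>{1..}. D.dembed n ` ?T n)"
    by (intro D.dsum_total l2_hilbert)
  then have "total F (insert (1, vzero (dsum {1..} (\<lambda>n. l2 (power_measure n N))))
      (Pair 0 ` (\<Union>n\<in>{1..}. D.dembed n ` ?T n)))"
    unfolding fock_def by (rule real_dsum_total[OF D.dsum_inner_space])
  then show ?thesis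
  proof (rule total_mono)
    have "(0, D.dembed n (ae_class (power_measure n N) (\<lambda>z. \<Prod>j<n. g j (z j)))) \<in> tensor N ` lists G"
      if "n \<ge> 1" "\<forall>j<n. g j \<in> G" for n g
    proof (rule image_eqI)
      show "map g [0..<n] \<in> lists G" using that by auto
      have "tens (map g [0..<n]) = (\<lambda>z. \<Prod>j<n. g j (z j))"
        unfolding tens_def by (auto intro!: prod.cong)
      then show "(0, D.dembed n (ae_class (power_measure n N) (\<lambda>z. \<Prod>j<n. g j (z j)))) = tensor N (map g [0..<n])"
        using that by (simp add: tensor_eq fock_embed_eq)
    qed
    moreover have "(1, vzero (dsum {1..} (\<lambda>n. l2 (power_measure n N)))) \<in> tensor N ` lists G"
      by (rule image_eqI[of _ _ "[]"]) (simp_all add: tensor_eq vacuum_eq)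
    ultimately show "insert (1, vzero (dsum {1..} (\<lambda>n. l2 (power_measure n N))))
      (Pair 0 ` (\<Union>n\<in>{1..}. D.dembed n ` ?T n)) \<subseteq> tensor N ` lists G" by blast
    show "tensor N ` lists G \<subseteq> carr F"
      using lists_mono[OF G] by (intro image_subsetI tensor_closed) (rule subsetD)
  qed
qed

lemma sqint_total: "total (l2 N) (ae_class N ` sqint N)"
  by (rule totalI) (auto simp: l2_carr)

lemma all_tensors_total: "total F (tensor N ` lists (sqint N))"
  by (rule tensors_total[OF order_refl sqint_total])

lemma tensor_eqI:
  assumes "v \<in> carr F" "w \<in> carr F"
    and "\<And>gs. gs \<in> lists (sqint N) \<Longrightarrow> vinner F v (tensor N gs) = vinner F w (tensor N gs)"
  shows "v = w"
  by (rule F.total_eqI[OF all_tensors_total assms(1,2)]) (use assms(3) in blast)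

text \<open>Testing against elementary tensors reduces the claim to integrals over N and keeps null
  sets of the product measures out of the argument.\<close>

lemma tensor_Cons_cong:
  assumes "g \<in> sqint N" "g' \<in> sqint N" "gs \<in> lists (sqint N)" and ae: "AE z in N. g z = g' z"
  shows "tensor N (g # gs) = tensor N (g' # gs)"
proof (rule tensor_eqI)
  fix ks assume ks: "ks \<in> lists (sqint N)"
  have "(\<integral>z. g z * k z \<partial>N) = (\<integral>z. g' z * k z \<partial>N)" if k: "k \<in> sqint N" for k
  proof (rule integral_cong_AE)
    show "AE z in N. g z * k z = g' z * k z" using ae by eventually_elim simp
  qed (use assms k in \<open>auto intro: sqint_mult_measurable\<close>)
  then show "vinner F (tensor N (g # gs)) (tensor N ks) = vinner F (tensor N (g' # gs)) (tensor N ks)"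
    using assms ks by (cases ks) (simp_all add: inner_tensor)
qed (use assms in simp_all)

lemma tensor_Cons_zero:
  assumes "g \<in> sqint N" "gs \<in> lists (sqint N)" and ae: "AE z in N. g z = 0"
  shows "tensor N (g # gs) = vzero F"
proof (rule tensor_eqI)
  fix ks assume ks: "ks \<in> lists (sqint N)"
  have "tensor N (g # gs) = tensor N ((\<lambda>z. 0) # gs)"
    using assms by (intro tensor_Cons_cong) simp_all
  then show "vinner F (tensor N (g # gs)) (tensor N ks) = vinner F (vzero F) (tensor N ks)"
    using assms ks by (cases ks) (simp_all add: inner_tensor F.inner_simps)
qed (use assms in simp_all)

section \<open>Creation, annihilation and neutral operators\<close>

text \<open>Putting h in front of two tensors multiplies their inner product by ||h||^2, which is
  the constant of the extension.\<close>

lemma creation: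
  assumes h: "h \<in> sqint N"
  shows "bounded_map F F (creation N h)"
    and "\<And>gs. gs \<in> lists (sqint N) \<Longrightarrow> creation N h (tensor N gs) = tensor N (h # gs)"
proof -
  have "\<exists>A. conformal F F (\<integral>z. h z * h z \<partial>N) A \<and> (\<forall>gs\<in>lists (sqint N). A (tensor N gs) = tensor N (h # gs))"
    by (rule conformal_extension[OF F.inner_product_space_axioms F.hilbert_space_axioms all_tensors_total])
      (use h in \<open>simp_all add: inner_tensor\<close>)
  then obtain A where A: "conformal F F (\<integral>z. h z * h z \<partial>N) A"
    "\<And>gs. gs \<in> lists (sqint N) \<Longrightarrow> A (tensor N gs) = tensor N (h # gs)" by blast
  have bd: "bounded_map F F A"
    using A(1) by (rule conformal_bounded) (rule F.inner_product_space_axioms)+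
  have "creation N h = restrict A (carr F)"
    unfolding creation_def
    by (rule bounded_ops_the[OF bd F.inner_product_space_axioms F.inner_product_space_axioms all_tensors_total])
      (simp add: A(2))
  then show "bounded_map F F (creation N h)"
    "\<And>gs. gs \<in> lists (sqint N) \<Longrightarrow> creation N h (tensor N gs) = tensor N (h # gs)"
    using bounded_map_cong[OF bd F.inner_product_space_axioms, of "creation N h"] A(2) by simp_all
qed

text \<open>The operator is constructed as the adjoint of \<open>creation N h\<close>, and its
  action on tensors is read off by pairing with other tensors.\<close>

lemma annihilation:
  assumes h: "h \<in> sqint N"
  shows "bounded_map F F (annihilation N h)"
    and "annihilation N h (vacuum N) = vzero F"
    and "\<And>g gs. g \<in> sqint N \<Longrightarrow> gs \<in> lists (sqint N) \<Longrightarrow>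
      annihilation N h (tensor N (g # gs)) = vscale F (\<integral>z. h z * g z \<partial>N) (tensor N gs)"
proof -
  obtain B where bd: "bounded_map F F B"
    and B: "\<And>w v. w \<in> carr F \<Longrightarrow> v \<in> carr F \<Longrightarrow> vinner F (B w) v = vinner F w (creation N h v)"
    using adjoint_exists[OF creation(1)[OF h] F.hilbert_space_axioms F.inner_product_space_axioms] by blast
  have Bc: "v \<in> carr F \<Longrightarrow> B v \<in> carr F" for v
    by (rule linear_maps_closed[OF bounded_map_linear[OF bd]])
  have B_vac: "B (vacuum N) = vzero F"
  proof (rule tensor_eqI)
    fix gs assume gs: "gs \<in> lists (sqint N)"
    have "vinner F (tensor N []) (tensor N (h # gs)) = 0"
      using gs h by (subst inner_tensor) simp_all
    then show "vinner F (B (vacuum N)) (tensor N gs) = vinner F (vzero F) (tensor N gs)"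
      using gs h by (simp add: B creation(2) F.inner_simps tensor_eq[of "[]"])
  qed (simp_all add: Bc)
  have B_tens: "B (tensor N (g # gs)) = vscale F (\<integral>z. h z * g z \<partial>N) (tensor N gs)"
    if "g \<in> sqint N" "gs \<in> lists (sqint N)" for g gs
  proof (rule tensor_eqI)
    fix ks assume ks: "ks \<in> lists (sqint N)"
    show "vinner F (B (tensor N (g # gs))) (tensor N ks) =
        vinner F (vscale F (\<integral>z. h z * g z \<partial>N) (tensor N gs)) (tensor N ks)"
      using that ks h by (simp add: B creation(2) F.inner_simps inner_tensor mult.commute[of "g _"])
  qed (use that in \<open>simp_all add: Bc\<close>)
  let ?Q = "\<lambda>A. A (vacuum N) = vzero F \<and> (\<forall>g\<in>sqint N. \<forall>gs\<in>lists (sqint N).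
      A (tensor N (g # gs)) = vscale F (vinner (l2 N) (ae_class N h) (ae_class N g)) (tensor N gs))"
  have "?Q A \<longleftrightarrow> (\<forall>v\<in>tensor N ` lists (sqint N). A v = B v)" for A
  proof
    assume Q: "?Q A"
    have "A (tensor N gs) = B (tensor N gs)" if "gs \<in> lists (sqint N)" for gs
      using Q that h by (cases gs) (simp_all add: B_vac B_tens l2_inner tensor_eq[of "[]"])
    then show "\<forall>v\<in>tensor N ` lists (sqint N). A v = B v" by blast
  next
    assume "\<forall>v\<in>tensor N ` lists (sqint N). A v = B v"
    then have eq: "A (tensor N gs) = B (tensor N gs)" if "gs \<in> lists (sqint N)" for gs using that by blast
    show "?Q A"
      using eq[of "[]"] eq[of "_ # _"] h by (simp add: B_vac B_tens l2_inner tensor_eq[of "[]"])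
  qed
  then have "annihilation N h = restrict B (carr F)"
    unfolding annihilation_def
    by (intro bounded_ops_the[OF bd F.inner_product_space_axioms F.inner_product_space_axioms all_tensors_total])
  then show "bounded_map F F (annihilation N h)" "annihilation N h (vacuum N) = vzero F"
    "\<And>g gs. g \<in> sqint N \<Longrightarrow> gs \<in> lists (sqint N) \<Longrightarrow>
      annihilation N h (tensor N (g # gs)) = vscale F (\<integral>z. h z * g z \<partial>N) (tensor N gs)"
    using bounded_map_cong[OF bd F.inner_product_space_axioms, of "annihilation N h"] B_vac B_tens by simp_all
qed

text \<open>For \<open>\<bar>h\<bar> \<le> C\<close> and \<open>k = \<surd>(C\<^sup>2 - h\<^sup>2)\<close>, the pair of multiplications by \<open>h\<close> and by \<open>k\<close> in the
  first tensor factor is an isometry up to the factor \<open>C\<^sup>2\<close>; hence its first component is bounded.\<close>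

lemma neutral:
  assumes h: "h \<in> borel_measurable N" and C: "AE z in N. \<bar>h z\<bar> \<le> C" "C \<ge> 0"
  shows "bounded_map F F (neutral N h)"
    and "neutral N h (vacuum N) = vzero F"
    and "\<And>g gs. g \<in> sqint N \<Longrightarrow> gs \<in> lists (sqint N) \<Longrightarrow>
      neutral N h (tensor N (g # gs)) = tensor N ((\<lambda>z. h z * g z) # gs)"
proof -
  \<comment> \<open>The maximum with 0 keeps k bounded also on the null set where |h| exceeds
    C.\<close>
  define k where "k z = sqrt (max 0 (C\<^sup>2 - (h z)\<^sup>2))" for z
  note [measurable] = h
  have k [measurable]: "k \<in> borel_measurable N" unfolding k_def by measurable
  have hk: "AE z in N. h z * h z + k z * k z = C\<^sup>2"
    using C(1)
  proof eventually_elim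
    case (elim z)
    then have "\<bar>h z\<bar>\<^sup>2 \<le> C\<^sup>2" by (intro power_mono) auto
    then have "0 \<le> C\<^sup>2 - (h z)\<^sup>2" by simp
    then show ?case by (simp add: k_def power2_eq_square)
  qed
  have k_bd: "\<bar>k z\<bar> \<le> C" for z
    unfolding k_def using C(2) by (auto simp: max_def intro: real_le_lsqrt)
  have hg: "(\<lambda>z. h z * g z) \<in> sqint N" if "g \<in> sqint N" for g
  proof (rule sqint_bounded[OF that])
    show "AE z in N. \<bar>h z * g z\<bar> \<le> C * \<bar>g z\<bar>"
      using C(1) by eventually_elim (simp add: abs_mult mult_right_mono)
  qed (use sqint_measurable[OF that] in measurable)
  have kg: "(\<lambda>z. k z * g z) \<in> sqint N" if "g \<in> sqint N" for g
  proof (rule sqint_bounded[OF that])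
    show "AE z in N. \<bar>k z * g z\<bar> \<le> C * \<bar>g z\<bar>"
      using k_bd by (simp add: abs_mult mult_right_mono)
  qed (use sqint_measurable[OF that] in measurable)
  have sum: "(\<integral>z. h z * g z * (h z * g' z) \<partial>N) + (\<integral>z. k z * g z * (k z * g' z) \<partial>N) = C\<^sup>2 * (\<integral>z. g z * g' z \<partial>N)"
    if g: "g \<in> sqint N" "g' \<in> sqint N" for g g'
  proof -
    have "(\<integral>z. h z * g z * (h z * g' z) \<partial>N) + (\<integral>z. k z * g z * (k z * g' z) \<partial>N) =
        (\<integral>z. h z * g z * (h z * g' z) + k z * g z * (k z * g' z) \<partial>N)"
      using g by (intro Bochner_Integration.integral_add[symmetric] sqint_mult_integrable hg kg)
    also have "\<dots> = (\<integral>z. C\<^sup>2 * (g z * g' z) \<partial>N)"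
    proof (rule integral_cong_AE)
      show "AE z in N. h z * g z * (h z * g' z) + k z * g z * (k z * g' z) = C\<^sup>2 * (g z * g' z)"
        using hk
      proof eventually_elim
        case (elim z)
        have "h z * g z * (h z * g' z) + k z * g z * (k z * g' z) = (h z * h z + k z * k z) * (g z * g' z)"
          by (simp add: algebra_simps)
        then show ?case using elim by simp
      qed
    qed (use g[THEN sqint_measurable] in measurable)
    finally show ?thesis by simp
  qed
  \<comment> \<open>Two copies of the Fock space: the component at True receives the multiplication
    by h, the component at False the multiplication by k.\<close>
  interpret W: direct_sum "UNIV :: bool set" "\<lambda>_. F"
    by (rule direct_sum.intro) (rule F.inner_product_space_axioms)
  let ?W = "dsum (UNIV :: bool set) (\<lambda>_. F)"
  have W: "hilbert_space ?W" by (rule dsum_hilbert) (rule F.hilbert_space_axioms)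
  have Wc: "f \<in> carr ?W \<longleftrightarrow> f True \<in> carr F \<and> f False \<in> carr F" for f
    by (auto simp: W.dsum_carr_iff summable_on_finite) (metis (full_types))
  have Wi: "vinner ?W f g = vinner F (f True) (g True) + vinner F (f False) (g False)" for f g
    by (subst W.dsum_ops(4)) (simp add: UNIV_bool)
  \<comment> \<open>The vacuum is to be annihilated in the first copy. It is sent to C times itself
    in the second one, so that its norm, too, is multiplied by C.\<close>
  define eW where "eW gs = (\<lambda>b. case gs of [] \<Rightarrow> (if b then vzero F else vscale F C (vacuum N))
    | g # gs \<Rightarrow> tensor N ((\<lambda>z. (if b then h z else k z) * g z) # gs))" for gs
  have "\<exists>A. conformal F ?W (C\<^sup>2) A \<and> (\<forall>gs\<in>lists (sqint N). A (tensor N gs) = eW gs)"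
  proof (rule conformal_extension[OF F.inner_product_space_axioms W all_tensors_total])
    show "eW gs \<in> carr ?W" if "gs \<in> lists (sqint N)" for gs
      using that by (cases gs) (simp_all add: eW_def Wc hg kg)
    show "vinner ?W (eW gs) (eW ks) = C\<^sup>2 * vinner F (tensor N gs) (tensor N ks)"
      if gs: "gs \<in> lists (sqint N)" and ks: "ks \<in> lists (sqint N)" for gs ks
    proof (cases gs)
      case Nil
      show ?thesis
      proof (cases ks)
        case Nil': Nil
        then show ?thesis
          using Nil by (simp add: eW_def Wi F.inner_simps inner_vacuum tensor_eq power2_eq_square)
      next
        case (Cons k' ks')
        then have "vinner F (tensor N []) (tensor N ((\<lambda>z. k z * k' z) # ks')) = 0"
          "vinner F (tensor N []) (tensor N ks) = 0"
          using ks by (simp_all add: inner_tensor kg del: )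
        then show ?thesis
          using Nil Cons ks by (simp add: eW_def Wi F.inner_simps tensor_eq[of "[]"] hg kg)
      qed
    next
      case g: (Cons g gs')
      show ?thesis
      proof (cases ks)
        case Nil
        have "vinner F (tensor N ((\<lambda>z. k z * g z) # gs')) (tensor N []) = 0"
          "vinner F (tensor N gs) (tensor N []) = 0"
          using gs g by (simp_all add: inner_tensor kg)
        then show ?thesis
          using Nil g gs by (simp add: eW_def Wi F.inner_simps tensor_eq[of "[]"] hg kg)
      next
        case (Cons k' ks')
        have "vinner ?W (eW gs) (eW ks) =
            ((\<integral>z. h z * g z * (h z * k' z) \<partial>N) + (\<integral>z. k z * g z * (k z * k' z) \<partial>N)) * tensor_inner N gs' ks'"
          using Cons g gs ks by (simp add: eW_def Wi inner_tensor hg kg distrib_right)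
        also have "\<dots> = C\<^sup>2 * vinner F (tensor N gs) (tensor N ks)"
          using Cons g gs ks by (subst sum) (simp_all add: inner_tensor)
        finally show ?thesis .
      qed
    qed
  qed simp
  then obtain A where A: "conformal F ?W (C\<^sup>2) A"
    "\<And>gs. gs \<in> lists (sqint N) \<Longrightarrow> A (tensor N gs) = eW gs" by blast
  define B where "B v = A v True" for v
  have A_bd: "bounded_map F ?W A"
    using A(1) by (rule conformal_bounded) (intro F.inner_product_space_axioms W.dsum_inner_space)+
  have Ac: "A v True \<in> carr F" "A v False \<in> carr F" if "v \<in> carr F" for v
    using conformal_closed[OF A(1) that] by (simp_all add: Wc)
  have bd: "bounded_map F F B"
    unfolding bounded_map_def
  proof
    show "B \<in> linear_maps F F"
      using Ac linear_maps_add[OF bounded_map_linear[OF A_bd]] linear_maps_scale[OF bounded_map_linear[OF A_bd]]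
      by (auto simp: linear_maps_def B_def W.dsum_ops)
    have "vnorm F (B v) \<le> C * vnorm F v" if v: "v \<in> carr F" for v
    proof (rule power2_le_imp_le)
      have "vinner F (B v) (B v) \<le> vinner ?W (A v) (A v)"
        using F.inner_nonneg[OF Ac(2)[OF v]] by (simp add: Wi B_def)
      also have "\<dots> = C\<^sup>2 * vinner F v v" by (rule conformal_inner[OF A(1) v v])
      finally show "(vnorm F (B v))\<^sup>2 \<le> (C * vnorm F v)\<^sup>2"
        using Ac v by (simp add: F.norm_sq B_def power_mult_distrib)
    qed (use v C in simp)
    then show "\<exists>C. \<forall>v\<in>carr F. vnorm F (B v) \<le> C * vnorm F v" by blast
  qed
  have B_vac: "B (vacuum N) = vzero F"
    using A(2)[of "[]"] by (simp add: B_def eW_def tensor_eq[of "[]"])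
  have B_tens: "B (tensor N (g # gs)) = tensor N ((\<lambda>z. h z * g z) # gs)"
    if "g \<in> sqint N" "gs \<in> lists (sqint N)" for g gs
    using A(2)[of "g # gs"] that by (simp add: B_def eW_def)
  let ?Q = "\<lambda>A. A (vacuum N) = vzero F \<and> (\<forall>g\<in>sqint N. \<forall>gs\<in>lists (sqint N).
      A (tensor N (g # gs)) = tensor N ((\<lambda>z. h z * g z) # gs))"
  have "?Q A \<longleftrightarrow> (\<forall>v\<in>tensor N ` lists (sqint N). A v = B v)" for A
  proof
    assume Q: "?Q A"
    have "A (tensor N gs) = B (tensor N gs)" if "gs \<in> lists (sqint N)" for gs
      using Q that by (cases gs) (simp_all add: B_vac B_tens tensor_eq[of "[]"])
    then show "\<forall>v\<in>tensor N ` lists (sqint N). A v = B v" by blast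
  next
    assume "\<forall>v\<in>tensor N ` lists (sqint N). A v = B v"
    then have eq: "A (tensor N gs) = B (tensor N gs)" if "gs \<in> lists (sqint N)" for gs using that by blast
    show "?Q A"
      using eq[of "[]"] eq[of "_ # _"] by (simp add: B_vac B_tens tensor_eq[of "[]"])
  qed
  then have "neutral N h = restrict B (carr F)"
    unfolding neutral_def
    by (intro bounded_ops_the[OF bd F.inner_product_space_axioms F.inner_product_space_axioms all_tensors_total])
  then show "bounded_map F F (neutral N h)" "neutral N h (vacuum N) = vzero F"
    "\<And>g gs. g \<in> sqint N \<Longrightarrow> gs \<in> lists (sqint N) \<Longrightarrow>
      neutral N h (tensor N (g # gs)) = tensor N ((\<lambda>z. h z * g z) # gs)"
    using bounded_map_cong[OF bd F.inner_product_space_axioms, of "neutral N h"] B_vac B_tens by simp_all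
qed

text \<open>The operator \<open>x(h)\<close> is obtained for \<open>s\<close> the second coordinate.\<close>

definition field_op :: "('z \<Rightarrow> real) \<Rightarrow> ('z \<Rightarrow> real) \<Rightarrow> 'z fock_vec \<Rightarrow> 'z fock_vec" where
  "field_op s h = op_add F (op_add F (creation N h) (annihilation N h)) (neutral N (\<lambda>z. s z * h z))"

text \<open>Creation and annihilation require h to be square integrable; the neutral part requires s
  h to be essentially bounded.\<close>

definition admissible :: "('z \<Rightarrow> real) \<Rightarrow> ('z \<Rightarrow> real) \<Rightarrow> bool" where
  "admissible s h \<longleftrightarrow> h \<in> sqint N \<and> (\<lambda>z. s z * h z) \<in> borel_measurable N \<and>
    (\<exists>C\<ge>0. AE z in N. \<bar>s z * h z\<bar> \<le> C)"

lemma
  assumes "admissible s h"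
  shows field_op_closed: "v \<in> carr F \<Longrightarrow> field_op s h v \<in> carr F"
    and field_op_vacuum: "field_op s h (vacuum N) = tensor N [h]"
    and field_op_tensor: "\<And>g gs. g \<in> sqint N \<Longrightarrow> gs \<in> lists (sqint N) \<Longrightarrow> field_op s h (tensor N (g # gs)) =
      vadd F (vadd F (tensor N (h # g # gs)) (vscale F (\<integral>z. h z * g z \<partial>N) (tensor N gs)))
        (tensor N ((\<lambda>z. s z * h z * g z) # gs))"
    and admissible_mult: "\<And>g. g \<in> sqint N \<Longrightarrow> (\<lambda>z. s z * h z * g z) \<in> sqint N"
proof -
  obtain C where h: "h \<in> sqint N" and m: "(\<lambda>z. s z * h z) \<in> borel_measurable N"
    and C: "AE z in N. \<bar>s z * h z\<bar> \<le> C" "C \<ge> 0"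
    using assms by (auto simp: admissible_def)
  note ne = neutral[OF m C] and cr = creation[OF h] and an = annihilation[OF h]
  note cl = linear_maps_closed[OF bounded_map_linear]
  show "field_op s h v \<in> carr F" if "v \<in> carr F" for v
    using that cl[OF ne(1)] cl[OF cr(1)] cl[OF an(1)] by (simp add: field_op_def op_add_def)
  have "creation N h (vacuum N) = tensor N [h]"
    using cr(2)[of "[]"] by (simp add: tensor_eq[of "[]"])
  then have "field_op s h (vacuum N) = vadd F (vadd F (tensor N [h]) (vzero F)) (vzero F)"
    using ne an by (simp add: field_op_def op_add_def)
  also have "\<dots> = tensor N [h]"
    by (rule F.eqI) (simp_all add: h F.inner_simps)
  finally show "field_op s h (vacuum N) = tensor N [h]" .
  show "field_op s h (tensor N (g # gs)) =
      vadd F (vadd F (tensor N (h # g # gs)) (vscale F (\<integral>z. h z * g z \<partial>N) (tensor N gs)))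
        (tensor N ((\<lambda>z. s z * h z * g z) # gs))" if "g \<in> sqint N" "gs \<in> lists (sqint N)" for g gs
    using that ne an cr by (simp add: field_op_def op_add_def)
  show "(\<lambda>z. s z * h z * g z) \<in> sqint N" if g: "g \<in> sqint N" for g
  proof (rule sqint_bounded[OF g])
    show "(\<lambda>z. s z * h z * g z) \<in> borel_measurable N"
      by (rule borel_measurable_times[OF m sqint_measurable[OF g]])
    show "AE z in N. \<bar>s z * h z * g z\<bar> \<le> C * \<bar>g z\<bar>"
      using C(1) by eventually_elim (simp add: abs_mult mult_right_mono)
  qed
qed

lemma op_polynomials_closed:
  assumes "A \<in> op_polynomials F G" and G: "\<And>A v. A \<in> G \<Longrightarrow> v \<in> carr F \<Longrightarrow> A v \<in> carr F"
  shows "v \<in> carr F \<Longrightarrow> A v \<in> carr F"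
  using assms(1)
  by (induction arbitrary: v) (simp_all add: op_one_def op_scale_def op_add_def op_mult_def G)

text \<open>Solving the formula for \<open>x(h) (g \<otimes> \<dots>)\<close> for \<open>h \<otimes> g \<otimes> \<dots>\<close> shows that the vacuum is cyclic.\<close>

lemma vacuum_cyclic:
  assumes H: "\<And>h. h \<in> H \<Longrightarrow> admissible s h"
    and prod: "\<And>h g. h \<in> H \<Longrightarrow> g \<in> H \<Longrightarrow> \<exists>g'\<in>H. AE z in N. g' z = s z * h z * g z"
    and gs: "gs \<in> lists H"
  shows "\<exists>A\<in>op_polynomials F (field_op s ` H). A (vacuum N) = tensor N gs"
  using gs
proof (induction "length gs" arbitrary: gs rule: less_induct)
  case less
  let ?P = "op_polynomials F (field_op s ` H)"
  have Hs: "h \<in> sqint N" if "h \<in> H" for h using H[OF that] by (simp add: admissible_def)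
  have ls: "xs \<in> lists (sqint N)" if "xs \<in> lists H" for xs using that Hs by auto
  have cl: "A v \<in> carr F" if "A \<in> ?P" "v \<in> carr F" for A v
    by (rule op_polynomials_closed[OF that(1) _ that(2)]) (use H field_op_closed in blast)
  show ?case
  proof (cases gs)
    case Nil
    then show ?thesis
      by (intro bexI[OF _ op_polynomials.one]) (simp add: op_one_def tensor_eq)
  next
    case (Cons h hs)
    then have h: "h \<in> H" and hs: "hs \<in> lists H" using less.prems by auto
    have gen: "field_op s h \<in> ?P" using h by (intro op_polynomials.generator) blast
    obtain A where A: "A \<in> ?P" "A (vacuum N) = tensor N hs"
      using less.hyps[of hs] Cons hs by auto
    have xA: "op_mult F (field_op s h) A \<in> ?P" using gen A by (intro op_polynomials.mult)
    have xA_vac: "op_mult F (field_op s h) A (vacuum N) = field_op s h (tensor N hs)"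
      by (simp add: op_mult_def A)
    show ?thesis
    proof (cases hs)
      case Nil
      then show ?thesis
        using xA xA_vac Cons field_op_vacuum[OF H[OF h]] by (intro bexI[OF _ xA]) (simp add: tensor_eq[of "[]"])
    next
      case (Cons g ks)
      then have g: "g \<in> H" and ks: "ks \<in> lists H" using hs by auto
      obtain g' where g': "g' \<in> H" "AE z in N. g' z = s z * h z * g z" using prod[OF h g] by blast
      obtain B where B: "B \<in> ?P" "B (vacuum N) = tensor N ks"
        using less.hyps[of ks] \<open>gs = h # hs\<close> Cons ks by auto
      obtain D where D: "D \<in> ?P" "D (vacuum N) = tensor N (g' # ks)"
        using less.hyps[of "g' # ks"] \<open>gs = h # hs\<close> Cons ks g' by auto
      let ?c = "\<integral>z. h z * g z \<partial>N"
      \<comment> \<open>Applied to the tensor of hs, x(h) yields the tensor of gs, the multiple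
        \<open>?c\<close> of the tensor of ks, and the tensor of \<open>g' # ks\<close> from the
        neutral part. The last two are shorter than gs and can be subtracted by the induction
        hypothesis.\<close>
      define E where "E = op_add F (op_add F (op_mult F (field_op s h) A) (op_scale F (- ?c) B)) (op_scale F (-1) D)"
      have "E \<in> ?P"
        unfolding E_def using xA B D by (intro op_polynomials.add op_polynomials.scale)
      moreover have "E (vacuum N) = tensor N gs"
      proof -
        have t: "tensor N (g' # ks) = tensor N ((\<lambda>z. s z * h z * g z) # ks)"
          using g' g ks by (intro tensor_Cons_cong Hs admissible_mult[OF H[OF h]] ls) 
        have c: "tensor N (h # g # ks) \<in> carr F" "tensor N ks \<in> carr F"
          "tensor N ((\<lambda>z. s z * h z * g z) # ks) \<in> carr F"
          using Hs h g ls[OF ks] admissible_mult[OF H[OF h] Hs[OF g]] by (intro tensor_closed; simp)+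
        have "E (vacuum N) = vadd F (vadd F (field_op s h (tensor N hs)) (vscale F (- ?c) (tensor N ks)))
            (vscale F (-1) (tensor N (g' # ks)))"
          unfolding E_def using B D xA_vac by (simp add: op_add_def op_scale_def)
        also have "\<dots> = tensor N gs"
          unfolding Cons \<open>gs = h # hs\<close> t field_op_tensor[OF H[OF h] Hs[OF g] ls[OF ks]]
          by (rule F.eqI) (simp_all add: c F.inner_simps)
        finally show ?thesis .
      qed
      ultimately show ?thesis by blast
    qed
  qed
qed

lemma op_prod_tensor:
  assumes "\<And>h. h \<in> set hs \<Longrightarrow> admissible s h"
    and "\<And>j. Suc j < length hs \<Longrightarrow> AE z in N. (hs ! j) z * (hs ! Suc j) z = 0"
  shows "op_prod F (map (field_op s) hs) (vacuum N) = tensor N hs"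
  using assms
proof (induction hs)
  case Nil
  then show ?case by (simp add: op_prod_def op_one_def tensor_eq)
next
  case (Cons h hs)
  have h: "admissible s h" using Cons.prems by simp
  have "op_prod F (map (field_op s) hs) (vacuum N) = tensor N hs"
    using Cons.prems(2)[of "Suc _"] by (intro Cons.IH Cons.prems(1)) auto
  then have eq: "op_prod F (map (field_op s) (h # hs)) (vacuum N) = field_op s h (tensor N hs)"
    by (simp add: op_prod_def op_mult_def)
  show ?case
  proof (cases hs)
    case Nil
    then show ?thesis using eq field_op_vacuum[OF h] by (simp add: tensor_eq[of "[]"])
  next
    case hs: (Cons g ks)
    have g: "g \<in> sqint N" "ks \<in> lists (sqint N)" "h \<in> sqint N"
      using Cons.prems(1) hs by (auto simp: admissible_def)
    have z: "AE z in N. h z * g z = 0" using Cons.prems(2)[of 0] hs by simp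
    have "(\<integral>z. h z * g z \<partial>N) = (\<integral>z. 0 \<partial>N)"
      by (rule integral_cong_AE) (use z g in \<open>auto intro: sqint_mult_measurable\<close>)
    moreover have "tensor N ((\<lambda>z. s z * h z * g z) # ks) = vzero F"
    proof (rule tensor_Cons_zero[OF admissible_mult[OF h g(1)] g(2)])
      show "AE z in N. s z * h z * g z = 0" using z by eventually_elim (auto simp: mult.assoc)
    qed
    ultimately have "field_op s h (tensor N hs) =
        vadd F (vadd F (tensor N (h # g # ks)) (vscale F 0 (tensor N ks))) (vzero F)"
      using field_op_tensor[OF h g(1,2)] hs by simp
    also have "\<dots> = tensor N (h # hs)"
      unfolding hs by (rule F.eqI) (simp_all add: g F.inner_simps)
    finally show ?thesis using eq by simp
  qed
qed

end

section \<open>Orthogonal polynomials of compactly supported probability measures\<close>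

definition poly_ip :: "real measure \<Rightarrow> real poly \<Rightarrow> real poly \<Rightarrow> real" where
  "poly_ip \<nu> p q = (\<integral>s. poly p s * poly q s \<partial>\<nu>)"

text \<open>The pair \<open>(p\<^sub>n\<^sub>-\<^sub>1, p\<^sub>n)\<close>, by the three-term recurrence; \<open>p\<^sub>-\<^sub>1 = 0\<close>. Divisions by zero occur
  only after the first vanishing polynomial, where all terms vanish.\<close>

definition jacobi_a :: "real measure \<Rightarrow> real poly \<Rightarrow> real" where
  "jacobi_a \<nu> q = poly_ip \<nu> (pCons 0 q) q / poly_ip \<nu> q q"

definition jacobi_b :: "real measure \<Rightarrow> real poly \<Rightarrow> real poly \<Rightarrow> real" where
  "jacobi_b \<nu> p q = poly_ip \<nu> q q / poly_ip \<nu> p p"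

definition next_raw :: "real measure \<Rightarrow> real poly \<Rightarrow> real poly \<Rightarrow> real poly" where
  "next_raw \<nu> p q = pCons 0 q - smult (jacobi_a \<nu> q) q - smult (jacobi_b \<nu> p q) p"

text \<open>If \<nu> is carried by exactly N points, the raw polynomial of degree N is monic but
  vanishes almost everywhere. It is replaced by the zero polynomial, in accordance with the
  convention in \<open>orth_polys\<close>.\<close>

fun orth_pair :: "real measure \<Rightarrow> nat \<Rightarrow> real poly \<times> real poly" where
  "orth_pair \<nu> 0 = (0, 1)"
| "orth_pair \<nu> (Suc n) = (let (p, q) = orth_pair \<nu> n; r = next_raw \<nu> p q in
     (q, if poly_ip \<nu> r r = 0 then 0 else r))"

definition oprev :: "real measure \<Rightarrow> nat \<Rightarrow> real poly" where
  "oprev \<nu> n = fst (orth_pair \<nu> n)"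

definition oseq :: "real measure \<Rightarrow> nat \<Rightarrow> real poly" where
  "oseq \<nu> n = snd (orth_pair \<nu> n)"

abbreviation "oa \<nu> n \<equiv> jacobi_a \<nu> (oseq \<nu> n)"
abbreviation "ob \<nu> n \<equiv> jacobi_b \<nu> (oprev \<nu> n) (oseq \<nu> n)"
abbreviation "oraw \<nu> n \<equiv> next_raw \<nu> (oprev \<nu> n) (oseq \<nu> n)"

lemma oseq_simps:
  "oseq \<nu> 0 = 1" "oprev \<nu> 0 = 0" "oprev \<nu> (Suc n) = oseq \<nu> n"
  "oseq \<nu> (Suc n) = (if poly_ip \<nu> (oraw \<nu> n) (oraw \<nu> n) = 0 then 0 else oraw \<nu> n)"
  by (simp_all add: oseq_def oprev_def split_beta Let_def)

lemma poly_eq_sum: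
  fixes p :: "real poly"
  assumes "\<And>i. i > n \<Longrightarrow> coeff p i = 0"
  shows "poly p s = (\<Sum>i\<le>n. coeff p i * s ^ i)"
proof -
  have "degree p \<le> n" using assms by (auto intro: degree_le)
  then show ?thesis
    unfolding poly_altdef by (intro sum.mono_neutral_left) (auto simp: coeff_eq_0)
qed

locale compact_prob_space = prob_space \<nu> for \<nu> :: "real measure" +
  fixes R :: real
  assumes sets_eq: "sets \<nu> = sets borel" and R: "R > 0" and AE_R: "AE s in \<nu>. s \<in> {-R..R}"
begin

abbreviation "ip \<equiv> poly_ip \<nu>"

lemma poly_measurable [measurable]: "poly p \<in> borel_measurable \<nu>"
proof -
  have "poly p \<in> borel_measurable borel"
    by (intro borel_measurable_continuous_onI continuous_intros)
  then show ?thesis by (simp add: measurable_cong_sets[OF sets_eq refl])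
qed

lemma poly_integrable: "integrable \<nu> (poly p)"
proof -
  have "compact (poly p ` {-R..R})"
    by (intro compact_continuous_image continuous_intros) simp
  then obtain B where B: "\<forall>s\<in>{-R..R}. \<bar>poly p s\<bar> \<le> B"
    using compact_imp_bounded[of "poly p ` {-R..R}"] unfolding bounded_iff by auto
  show ?thesis
    by (rule integrable_const_bound[of _ B]) (use AE_R B in \<open>auto elim: AE_mp\<close>)
qed

lemma poly_mult_integrable: "integrable \<nu> (\<lambda>s. poly p s * poly q s)"
proof -
  have "(\<lambda>s. poly p s * poly q s) = poly (p * q)" by (simp add: fun_eq_iff)
  then show ?thesis using poly_integrable by simp
qed

lemma ip_sym: "ip p q = ip q p"
  by (simp add: poly_ip_def mult.commute)

lemma ip_add: "ip (p + q) r = ip p r + ip q r" "ip r (p + q) = ip r p + ip r q"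
  by (simp_all add: poly_ip_def distrib_left distrib_right poly_mult_integrable)

lemma ip_diff: "ip (p - q) r = ip p r - ip q r" "ip r (p - q) = ip r p - ip r q"
  by (simp_all add: poly_ip_def left_diff_distrib right_diff_distrib poly_mult_integrable)

lemma ip_smult: "ip (smult c p) r = c * ip p r" "ip r (smult c p) = c * ip r p"
  by (simp_all add: poly_ip_def mult.assoc mult.left_commute)

lemma ip_zero [simp]: "ip 0 r = 0" "ip r 0 = 0"
  by (simp_all add: poly_ip_def)

lemma ip_one: "ip 1 1 = 1"
  by (simp add: poly_ip_def prob_space)

lemma ip_nonneg: "0 \<le> ip p p"
  by (simp add: poly_ip_def)

lemma ip_shift: "ip (pCons 0 p) q = ip p (pCons 0 q)"
  by (simp add: poly_ip_def mult.assoc mult.left_commute)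

lemma ip_self_0_iff: "ip p p = 0 \<longleftrightarrow> (AE s in \<nu>. poly p s = 0)"
  unfolding poly_ip_def
  by (subst integral_nonneg_eq_0_iff_AE) (simp_all add: poly_mult_integrable)

lemma ip_AE_0: "AE s in \<nu>. poly p s = 0 \<Longrightarrow> ip p q = 0"
  unfolding poly_ip_def by (intro integral_eq_zero_AE) (auto elim: AE_mp)

abbreviation "q \<equiv> oseq \<nu>"
abbreviation "pre \<equiv> oprev \<nu>"

text \<open>Where the recursion replaces the raw polynomial by 0, this polynomial vanishes almost
  everywhere, so that the recurrence holds without a distinction of cases.\<close>

lemma recurrence_AE: "AE s in \<nu>. s * poly (q n) s =
    poly (q (Suc n)) s + oa \<nu> n * poly (q n) s + ob \<nu> n * poly (pre n) s"
proof -
  have "AE s in \<nu>. poly (q (Suc n)) s = poly (oraw \<nu> n) s"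
    using ip_self_0_iff[of "oraw \<nu> n"] by (auto simp: oseq_simps(4))
  then show ?thesis by eventually_elim (simp add: next_raw_def)
qed

lemma recurrence_ip: "ip (pCons 0 (q n)) p =
    ip (q (Suc n)) p + oa \<nu> n * ip (q n) p + ob \<nu> n * ip (pre n) p"
proof -
  let ?d = "pCons 0 (q n) - (q (Suc n) + smult (oa \<nu> n) (q n) + smult (ob \<nu> n) (pre n))"
  have "AE s in \<nu>. poly ?d s = 0" using recurrence_AE[of n] by eventually_elim simp
  then have "ip ?d p = 0" by (rule ip_AE_0)
  then show ?thesis by (simp add: ip_diff ip_add ip_smult)
qed

lemma ip_oseq_0: "ip (q n) (q n) = 0 \<Longrightarrow> q n = 0"
  by (cases n) (auto simp: oseq_simps(1,4) ip_one split: if_splits)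

text \<open>Both subtracted terms vanish with \<open>q n\<close>, the second because the numerator
  of its coefficient is the squared norm of \<open>q n\<close>.\<close>

lemma oseq_0_Suc: "q n = 0 \<Longrightarrow> q (Suc n) = 0"
  by (simp add: oseq_simps(4) next_raw_def jacobi_b_def)

lemma oseq_0_mono: "m \<le> n \<Longrightarrow> q m = 0 \<Longrightarrow> q n = 0"
  by (induction n rule: dec_induct) (auto intro: oseq_0_Suc)

text \<open>Multiplication by s is symmetric: (s q_m, q_i) = (q_m, s q_i), and the recurrence for
  q_i leaves (q_m, q_(i+1)) when i < m. This is 0 for i + 1 < m and is cancelled by the term with
  the coefficient b for i + 1 = m. For i = m the coefficient a is chosen to give 0.\<close>

lemma oseq_orthogonal_less: "i < n \<Longrightarrow> ip (q n) (q i) = 0"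
proof (induction n arbitrary: i rule: less_induct)
  case (less n)
  have IH: "ip (q j) (q k) = 0" if "j < n" "k < n" "j \<noteq> k" for j k
    using less.IH[of j k] less.IH[of k j] that by (cases j k rule: linorder_cases) (auto simp: ip_sym)
  obtain m where n: "n = Suc m" using less.prems by (cases n) auto
  show ?case
  proof (cases "q n = 0")
    case False
    then have qn: "q n = oraw \<nu> m" unfolding n oseq_simps(4) by presburger
    have qm: "q m \<noteq> 0" using False oseq_0_Suc n by blast
    then have wm: "ip (q m) (q m) \<noteq> 0" using ip_oseq_0 by blast
    have eq: "ip (q n) (q i) = ip (pCons 0 (q m)) (q i) - oa \<nu> m * ip (q m) (q i) - ob \<nu> m * ip (pre m) (q i)"
      unfolding qn next_raw_def by (simp add: ip_diff ip_smult)
    show ?thesis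
    proof (cases "i = m")
      case True
      have "ip (pre m) (q m) = 0"
        by (cases m) (auto simp: oseq_simps(2,3) n intro: IH)
      then show ?thesis
        unfolding eq unfolding True using wm by (simp add: jacobi_a_def)
    next
      case neq: False
      then have im: "i < m" using less.prems n by simp
      have "ip (pre i) (q m) = 0"
      proof (cases i)
        case (Suc j)
        then show ?thesis using im n by (simp add: oseq_simps(3)) (rule IH, auto)
      qed (simp add: oseq_simps)
      then have "ip (pCons 0 (q m)) (q i) = ip (q (Suc i)) (q m)"
        using recurrence_ip[of i "q m"] IH[of i m] im n by (simp add: ip_shift ip_sym[of "q m"])
      moreover have "ob \<nu> m * ip (pre m) (q i) = ip (q (Suc i)) (q m)"
      proof (cases "Suc i = m")
        case True
        have "q i \<noteq> 0" using qm oseq_0_Suc True by blast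
        then have "ip (q i) (q i) \<noteq> 0" using ip_oseq_0 by blast
        then show ?thesis unfolding True[symmetric] by (simp add: jacobi_b_def oseq_simps(3))
      next
        case False
        then obtain k where k: "m = Suc k" "i < k" using im by (cases m) auto
        then show ?thesis using IH[of k i] IH[of "Suc i" m] False im n by (simp add: oseq_simps(3))
      qed
      moreover have "ip (q m) (q i) = 0" using IH[of m i] im n by simp
      ultimately show ?thesis unfolding eq by simp
    qed
  qed simp
qed

lemma oseq_orthogonal: "i \<noteq> n \<Longrightarrow> ip (q n) (q i) = 0"
  using oseq_orthogonal_less[of i n] oseq_orthogonal_less[of n i] by (auto simp: ip_sym neq_iff)

text \<open>Coefficients express the bounds on the degrees uniformly. In the third claim i may equal
  n, which for n = 0 says that the predecessor is the zero polynomial.\<close>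

lemma oseq_coeff: "i > n \<Longrightarrow> coeff (q n) i = 0" "q n \<noteq> 0 \<Longrightarrow> coeff (q n) n = 1"
  "i \<ge> n \<Longrightarrow> coeff (pre n) i = 0"
proof (induction n arbitrary: i)
  case 0
  { case 1 then show ?case by (simp add: oseq_simps) }
  { case 2 then show ?case by (simp add: oseq_simps) }
  { case 3 then show ?case by (simp add: oseq_simps) }
next
  case (Suc n)
  have raw: "coeff (oraw \<nu> n) i = 0" if "i > Suc n" for i
    using that Suc.IH(1)[of i] Suc.IH(1)[of "i - 1"] Suc.IH(3)[of i]
    by (cases i) (simp_all add: next_raw_def)
  { case 1 then show ?case using raw by (simp add: oseq_simps(4)) }
  { case 2
    then have "q n \<noteq> 0" "q (Suc n) = oraw \<nu> n" using oseq_0_Suc by (auto simp: oseq_simps(4))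
    then show ?case using Suc.IH by (simp add: next_raw_def) }
  { case 3 then show ?case using Suc.IH(1)[of i] by (simp add: oseq_simps(3)) }
qed

lemma oseq_monic: "q n \<noteq> 0 \<Longrightarrow> degree (q n) = n \<and> lead_coeff (q n) = 1"
  using oseq_coeff(2)[of n] oseq_coeff(1)[of n]
  by (metis degree_le le_antisym le_degree one_neq_zero)

lemma oraw_monic: "q n \<noteq> 0 \<Longrightarrow> oraw \<nu> n \<noteq> 0 \<and> degree (oraw \<nu> n) \<le> Suc n"
proof -
  assume q: "q n \<noteq> 0"
  have "coeff (oraw \<nu> n) (Suc n) = 1"
    using oseq_coeff(1)[of n "Suc n"] oseq_coeff(2)[OF q] oseq_coeff(3)[of n "Suc n"]
    by (simp add: next_raw_def)
  moreover
  have "coeff (oraw \<nu> n) i = 0" if "i > Suc n" for i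
    using that oseq_coeff(1)[of n i] oseq_coeff(1)[of n "i - 1"] oseq_coeff(3)[of n i]
    by (cases i) (simp_all add: next_raw_def)
  then have "degree (oraw \<nu> n) \<le> Suc n" by (intro degree_le allI impI)
  ultimately show ?thesis by fastforce
qed

text \<open>Subtracting from d its top coefficient times \<open>p n\<close> removes that
  coefficient, since \<open>p n\<close> is monic.\<close>

lemma ip_monic_span:
  assumes "\<And>i. i \<ge> n \<Longrightarrow> coeff d i = 0" "\<And>m. m < n \<Longrightarrow> degree (p m) = m \<and> lead_coeff (p m) = 1"
    and "\<And>m. m < n \<Longrightarrow> ip (p m) f = 0"
  shows "ip d f = 0"
  using assms
proof (induction n arbitrary: d)
  case 0
  then have "d = 0" by (simp add: poly_eq_iff)
  then show ?case by simp
next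
  case (Suc n)
  have pn: "degree (p n) = n" "coeff (p n) n = 1" using Suc.prems(2)[of n] by auto
  have "coeff (d - smult (coeff d n) (p n)) i = 0" if "i \<ge> n" for i
    using that Suc.prems(1)[of i] pn by (cases "i = n") (auto simp: coeff_eq_0)
  then have "ip (d - smult (coeff d n) (p n)) f = 0"
    by (rule Suc.IH) (assumption | (rule Suc.prems, simp))+
  then show ?case using Suc.prems(3)[of n] by (simp add: ip_diff ip_smult)
qed

abbreviation "S \<equiv> topological_support \<nu>"

text \<open>The set where r is nonzero is open and null, hence disjoint from the support, whose
  points are therefore roots of r.\<close>

lemma support_roots:
  assumes r: "r \<noteq> 0" "ip r r = 0"
  shows "finite S" "card S \<le> degree r"
proof -
  have ae: "AE s in \<nu>. poly r s = 0" using r ip_self_0_iff by blast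
  have sub: "S \<subseteq> {s. poly r s = 0}"
  proof (rule subsetI, rule CollectI, rule ccontr)
    fix s assume s: "s \<in> S" "poly r s \<noteq> 0"
    let ?U = "{s. poly r s \<noteq> 0}"
    have U: "open ?U" by (intro open_Collect_neq continuous_intros)
    then have "emeasure \<nu> ?U > 0" using s unfolding topological_support_def by blast
    moreover have "emeasure \<nu> ?U = 0"
      using ae emeasure_eq_0_AE[of "\<lambda>s. poly r s \<noteq> 0" \<nu>] sets_eq_imp_space_eq[OF sets_eq] by simp
    ultimately show False by simp
  qed
  then show "finite S" using poly_roots_finite[OF r(1)] finite_subset by blast
  have "card S \<le> card {s. poly r s = 0}"
    using sub poly_roots_finite[OF r(1)] by (intro card_mono)
  also have "\<dots> \<le> degree r" using r(1) by (rule card_poly_roots_bound)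
  finally show "card S \<le> degree r" .
qed

text \<open>The complement of the support is a union of open null sets, and by Lindelof's theorem
  countably many of them have the same union.\<close>

lemma AE_support: "AE s in \<nu>. s \<in> S"
proof -
  let ?F = "{U. open U \<and> emeasure \<nu> U = 0}"
  obtain F' where F': "F' \<subseteq> ?F" "countable F'" "\<Union>F' = \<Union>?F"
    using Lindelof[of ?F] by blast
  have "- S = \<Union>?F"
    unfolding topological_support_def by (auto simp: not_gr_zero)
  then have eq: "- S = \<Union>F'" using F' by simp
  have "\<Union>F' \<in> null_sets \<nu>"
    using F' sets_eq by (intro null_sets_UN'[of F' "\<lambda>x. x", simplified]) (auto simp: null_sets_def)
  then show ?thesis unfolding eq[symmetric] by (rule AE_I') auto
qed

lemma monic_vanishing: "finite A \<Longrightarrow> \<exists>v::real poly. (\<forall>s\<in>A. poly v s = 0) \<and> degree v = card A \<and> lead_coeff v = 1"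
proof (induction A rule: finite_induct)
  case empty
  then show ?case by (intro exI[of _ 1]) simp
next
  case (insert a A)
  then obtain v :: "real poly" where v: "\<forall>s\<in>A. poly v s = 0" "degree v = card A" "lead_coeff v = 1" by blast
  then have "v \<noteq> 0" by auto
  then have "degree ([:- a, 1:] * v) = card (insert a A)"
    using v insert.hyps by (subst degree_mult_eq) simp_all
  moreover have "lead_coeff ([:- a, 1:] * v) = 1"
    using v(3) by (subst lead_coeff_mult) simp
  moreover have "\<forall>s\<in>insert a A. poly ([:- a, 1:] * v) s = 0"
    using v(1) by simp
  ultimately show ?case by blast
qed

text \<open>Matches the truncation in the recursion with the number of points used in
  \<open>orth_polys\<close>. A raw polynomial of norm zero has the whole support among its roots.
  Conversely, the monic polynomial v with the k points of the support as roots vanishes almost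
  everywhere, and v - q_k has degree below k; so q_k is orthogonal to both and hence to
  itself.\<close>

lemma oseq_0_iff: "q n = 0 \<longleftrightarrow> finite S \<and> card S \<le> n"
proof
  assume "q n = 0"
  then show "finite S \<and> card S \<le> n"
  proof (induction n)
    case 0
    then show ?case by (simp add: oseq_simps)
  next
    case (Suc n)
    show ?case
    proof (cases "q n = 0")
      case True
      then show ?thesis using Suc.IH by simp
    next
      case False
      note raw = oraw_monic[OF False]
      have "ip (oraw \<nu> n) (oraw \<nu> n) = 0"
        using Suc.prems raw by (auto simp: oseq_simps(4) split: if_splits)
      then show ?thesis using support_roots[of "oraw \<nu> n"] raw by auto
    qed
  qed
next
  assume fin: "finite S \<and> card S \<le> n"
  show "q n = 0"
  proof (rule ccontr)
    assume qn: "q n \<noteq> 0"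
    define k where "k = card S"
    have nz: "q m \<noteq> 0" if "m \<le> k" for m
      using qn oseq_0_mono[of m n] that fin by (auto simp: k_def)
    obtain v :: "real poly" where v: "\<forall>s\<in>S. poly v s = 0" "degree v = k" "lead_coeff v = 1"
      using monic_vanishing fin unfolding k_def by blast
    have "AE s in \<nu>. poly v s = 0" using AE_support by eventually_elim (use v in simp)
    then have "ip v (q k) = 0" by (rule ip_AE_0)
    moreover have "ip (v - q k) (q k) = 0"
    proof (rule ip_monic_span[of k _ q])
      fix i assume "i \<ge> k"
      then show "coeff (v - q k) i = 0"
        using v(2,3) oseq_coeff(1)[of k i] oseq_coeff(2)[OF nz[of k]]
        by (cases "i = k") (auto simp: coeff_eq_0)
    next
      fix m assume m: "m < k"
      then show "degree (q m) = m \<and> lead_coeff (q m) = 1" using nz by (intro oseq_monic) simp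
      show "ip (q m) (q k) = 0" using m by (intro oseq_orthogonal) simp
    qed
    ultimately have "ip (q k) (q k) = 0" by (simp add: ip_diff)
    then show False using ip_oseq_0 nz[of k] by blast
  qed
qed

text \<open>Two candidates for the polynomial with index n differ by a polynomial of lower degree
  that is orthogonal to itself. If the difference were nonzero, the support would have fewer than n
  points.\<close>

lemma orth_polys_eq: "orth_polys \<nu> = q"
  unfolding orth_polys_def
proof (rule the_equality)
  show "\<forall>n. if finite S \<and> card S \<le> n then q n = 0
     else degree (q n) = n \<and> lead_coeff (q n) = 1 \<and> (\<forall>m<n. (\<integral>s. poly (q m) s * poly (q n) s \<partial>\<nu>) = 0)"
  proof
    fix n
    show "if finite S \<and> card S \<le> n then q n = 0
     else degree (q n) = n \<and> lead_coeff (q n) = 1 \<and> (\<forall>m<n. (\<integral>s. poly (q m) s * poly (q n) s \<partial>\<nu>) = 0)"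
    proof (cases "finite S \<and> card S \<le> n")
      case True
      then show ?thesis using oseq_0_iff[of n] by presburger
    next
      case False
      then have "q n \<noteq> 0" using oseq_0_iff[of n] by blast
      then have "degree (q n) = n \<and> lead_coeff (q n) = 1" by (rule oseq_monic)
      moreover have "\<forall>m<n. (\<integral>s. poly (q m) s * poly (q n) s \<partial>\<nu>) = 0"
        using oseq_orthogonal[of n] by (simp add: poly_ip_def)
      ultimately show ?thesis unfolding if_not_P[OF False] by blast
    qed
  qed
  fix p assume "\<forall>n. if finite S \<and> card S \<le> n then p n = 0
     else degree (p n) = n \<and> lead_coeff (p n) = 1 \<and> (\<forall>m<n. (\<integral>s. poly (p m) s * poly (p n) s \<partial>\<nu>) = 0)"
  then have p0: "\<And>n. finite S \<and> card S \<le> n \<Longrightarrow> p n = 0"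
    and p1: "\<And>n. \<not> (finite S \<and> card S \<le> n) \<Longrightarrow> degree (p n) = n \<and> lead_coeff (p n) = 1"
    and p2: "\<And>m n. \<not> (finite S \<and> card S \<le> n) \<Longrightarrow> m < n \<Longrightarrow> ip (p m) (p n) = 0"
    unfolding poly_ip_def by metis+
  have "p n = q n" for n
  proof (induction n rule: less_induct)
    case (less n)
    show ?case
    proof (cases "finite S \<and> card S \<le> n")
      case True
      then show ?thesis using p0 oseq_0_iff by simp
    next
      case False
      have nz: "q m \<noteq> 0" if "m \<le> n" for m using False oseq_0_iff[of m] that by auto
      let ?d = "p n - q n"
      have d: "coeff ?d i = 0" if "i \<ge> n" for i
        using that p1[OF False] oseq_coeff(1)[of n i] oseq_coeff(2)[OF nz[of n]]
        by (cases "i = n") (auto simp: coeff_eq_0)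
      have "ip ?d ?d = 0"
      proof (rule ip_monic_span[OF d])
        fix m assume m: "m < n"
        then show "degree (q m) = m \<and> lead_coeff (q m) = 1" using nz by (intro oseq_monic) simp
        show "ip (q m) ?d = 0"
          using m p2[OF False m] less.IH[OF m] oseq_orthogonal[of n m] by (simp add: ip_diff)
      qed
      moreover have "degree ?d < n" if "?d \<noteq> 0"
        using d that by (metis leading_coeff_0_iff linorder_not_less)
      ultimately have "?d = 0" using support_roots[of ?d] False by force
      then show ?thesis by simp
    qed
  qed
  then show "p = q" by blast
qed

section \<open>Bounds in terms of R and the degree\<close>

lemma shift_ip_le: "ip (pCons 0 p) (pCons 0 p) \<le> R\<^sup>2 * ip p p"
proof -
  have "(\<integral>s. poly (pCons 0 p) s * poly (pCons 0 p) s \<partial>\<nu>) \<le> (\<integral>s. R\<^sup>2 * (poly p s * poly p s) \<partial>\<nu>)"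
  proof (rule integral_mono_AE)
    show "AE s in \<nu>. poly (pCons 0 p) s * poly (pCons 0 p) s \<le> R\<^sup>2 * (poly p s * poly p s)"
      using AE_R
    proof eventually_elim
      case (elim s)
      then have "\<bar>s\<bar>\<^sup>2 \<le> R\<^sup>2" by (intro power_mono) auto
      then have "s\<^sup>2 * (poly p s * poly p s) \<le> R\<^sup>2 * (poly p s * poly p s)"
        by (intro mult_right_mono) simp_all
      then show ?case by (simp add: power2_eq_square algebra_simps)
    qed
  qed (intro poly_mult_integrable integrable_mult_right)+
  then show ?thesis by (simp add: poly_ip_def)
qed

text \<open>The coefficient is the mean of s for the density proportional to the square of
  \<open>q n\<close>, hence lies in [-R, R]. If \<open>q n\<close> is 0, division by zero makes it
  0.\<close>

lemma oa_bound: "\<bar>oa \<nu> n\<bar> \<le> R"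
proof -
  have "\<bar>ip (pCons 0 (q n)) (q n)\<bar> \<le> (\<integral>s. \<bar>poly (pCons 0 (q n)) s * poly (q n) s\<bar> \<partial>\<nu>)"
    unfolding poly_ip_def by (rule integral_abs_bound)
  also have "\<dots> \<le> (\<integral>s. R * (poly (q n) s * poly (q n) s) \<partial>\<nu>)"
  proof (rule integral_mono_AE)
    show "AE s in \<nu>. \<bar>poly (pCons 0 (q n)) s * poly (q n) s\<bar> \<le> R * (poly (q n) s * poly (q n) s)"
      using AE_R
    proof eventually_elim
      case (elim s)
      have "\<bar>s\<bar> * (poly (q n) s * poly (q n) s) \<le> R * (poly (q n) s * poly (q n) s)"
        using elim by (intro mult_right_mono) auto
      then show ?case by (simp add: abs_mult mult.assoc)
    qed
  qed (intro integrable_abs poly_mult_integrable integrable_mult_right)+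
  finally have "\<bar>ip (pCons 0 (q n)) (q n)\<bar> \<le> R * ip (q n) (q n)" by (simp add: poly_ip_def)
  then show ?thesis
    using R ip_nonneg[of "q n"] by (cases "ip (q n) (q n) = 0") (auto simp: jacobi_a_def field_simps)
qed

text \<open>For n = m + 1 the polynomial \<open>q n\<close> is orthogonal to s \<open>q m\<close> -
  \<open>q n\<close>. Its norm is therefore at most that of s \<open>q m\<close>, and so at most R
  times that of \<open>q m\<close>.\<close>

lemma ob_bound: "0 \<le> ob \<nu> n" "ob \<nu> n \<le> R\<^sup>2"
proof -
  show "0 \<le> ob \<nu> n" by (simp add: jacobi_b_def ip_nonneg)
  show "ob \<nu> n \<le> R\<^sup>2"
  proof (cases n)
    \<comment> \<open>The predecessor is 0 here, and the quotient is 0 by division by zero.\<close>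
    case 0
    then show ?thesis by (simp add: jacobi_b_def oseq_simps)
  next
    case (Suc m)
    let ?w = "ip (q n) (q n)"
    have "ip (pCons 0 (q m)) (q n) = ?w"
    proof -
      have "ip (pre m) (q n) = 0"
        using Suc by (cases m) (auto simp: oseq_simps(2,3) intro: oseq_orthogonal)
      then show ?thesis using recurrence_ip[of m "q n"] oseq_orthogonal[of n m] Suc by simp
    qed
    then have "0 \<le> ip (pCons 0 (q m)) (pCons 0 (q m)) - ?w"
      using ip_nonneg[of "pCons 0 (q m) - q n"] by (simp add: ip_diff ip_sym[of "q n" "pCons 0 (q m)"])
    then have "?w \<le> R\<^sup>2 * ip (q m) (q m)" using shift_ip_le[of "q m"] by linarith
    then show ?thesis
      using ip_nonneg[of "q m"] Suc
      by (cases "ip (q m) (q m) = 0") (auto simp: jacobi_b_def oseq_simps(3) field_simps)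
  qed
qed

text \<open>R + R + R^2 comes from the three terms of the recurrence. The summand 1 makes the powers
  increase, so that the bound on \<open>q n\<close> still holds for it as the predecessor at the
  next index. The measure enters only through R.\<close>

lemma oseq_bound: "AE s in \<nu>. \<bar>poly (q n) s\<bar> \<le> (1 + 2 * R + R\<^sup>2) ^ n"
proof -
  let ?C = "1 + 2 * R + R\<^sup>2"
  have C: "?C \<ge> 1" using R by simp
  have "AE s in \<nu>. \<bar>poly (q n) s\<bar> \<le> ?C ^ n \<and> \<bar>poly (pre n) s\<bar> \<le> ?C ^ n"
  proof (induction n)
    case 0
    then show ?case by (simp add: oseq_simps)
  next
    case (Suc n)
    show ?case
      using Suc AE_R recurrence_AE[of n]
    proof eventually_elim
      case (elim s)
      have pw: "?C ^ n \<ge> 0" using C by simp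
      have "\<bar>s * poly (q n) s\<bar> \<le> R * ?C ^ n"
        unfolding abs_mult using elim R pw by (intro mult_mono) auto
      moreover have "\<bar>oa \<nu> n * poly (q n) s\<bar> \<le> R * ?C ^ n"
        unfolding abs_mult using elim oa_bound[of n] R pw by (intro mult_mono) auto
      moreover have "\<bar>ob \<nu> n * poly (pre n) s\<bar> \<le> R\<^sup>2 * ?C ^ n"
        unfolding abs_mult using elim ob_bound[of n] R pw by (intro mult_mono) auto
      moreover have "poly (q (Suc n)) s = s * poly (q n) s - oa \<nu> n * poly (q n) s - ob \<nu> n * poly (pre n) s"
        using elim(3) by simp
      ultimately have "\<bar>poly (q (Suc n)) s\<bar> \<le> R * ?C ^ n + R * ?C ^ n + R\<^sup>2 * ?C ^ n" by linarith
      also have "\<dots> \<le> ?C ^ Suc n" using pw by (simp add: algebra_simps)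
      finally have "\<bar>poly (q (Suc n)) s\<bar> \<le> ?C ^ Suc n" .
      moreover have "?C ^ n \<le> ?C ^ Suc n" using C by (intro power_increasing) simp_all
      ultimately show ?case using elim(1) by (simp add: oseq_simps(3) del: power_Suc)
    qed
  qed
  then show ?thesis by eventually_elim simp
qed

text \<open>Inner products become finite sums over moments. The numbers of terms are fixed by n and
  m, while the degrees themselves may vary with the measure; this prepares measurability in the
  parameter t.\<close>

lemma ip_moments:
  assumes "\<And>i. i > n \<Longrightarrow> coeff p i = 0" "\<And>i. i > m \<Longrightarrow> coeff r i = 0"
  shows "ip p r = (\<Sum>i\<le>n. \<Sum>j\<le>m. coeff p i * coeff r j * (\<integral>s. s ^ (i + j) \<partial>\<nu>))"
proof -
  have int: "integrable \<nu> (\<lambda>s. s ^ k)" for k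
  proof -
    have "(\<lambda>s. s ^ k) = poly (monom (1::real) k)" by (simp add: fun_eq_iff poly_monom)
    then show ?thesis using poly_integrable by simp
  qed
  have "poly p s * poly r s = (\<Sum>i\<le>n. \<Sum>j\<le>m. coeff p i * coeff r j * s ^ (i + j))" for s
  proof -
    have "poly p s = (\<Sum>i\<le>n. coeff p i * s ^ i)" "poly r s = (\<Sum>j\<le>m. coeff r j * s ^ j)"
      by (rule poly_eq_sum, erule assms)+
    then show ?thesis by (simp add: sum_product power_add mult_ac)
  qed
  then show ?thesis
    unfolding poly_ip_def by (simp add: int)
qed

end

section \<open>Locally compact second countable spaces\<close>

lemma Hausdorff_space_t2: "Hausdorff_space (euclidean :: 'a::t2_space topology)"
  unfolding Hausdorff_space_def disjnt_def
  by (metis hausdorff open_openin)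

locale locally_compact_type =
  fixes dummy :: "'a::{second_countable_topology, t2_space} itself"
  assumes lc: "locally_compact_space (euclidean :: 'a topology)"
begin

lemma completely_regular: "completely_regular_space (euclidean :: 'a topology)"
  by (rule locally_compact_regular_imp_completely_regular_space[OF lc]) (simp add: Hausdorff_space_t2)

lemma compact_neighbourhood:
  fixes x :: 'a
  assumes "open W" "x \<in> W"
  shows "\<exists>V K. open V \<and> compact K \<and> x \<in> V \<and> V \<subseteq> K \<and> K \<subseteq> W"
proof -
  have "neighbourhood_base_of (compactin euclidean) (euclidean :: 'a topology)"
    using lc by (subst locally_compact_space_neighbourhood_base[symmetric])
      (simp_all add: Hausdorff_space_t2)
  then show ?thesis
    using assms unfolding neighbourhood_base_of by (simp add: open_openin[symmetric])
qed

lemma relatively_compact_base: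
  "\<exists>B :: 'a set set. countable B \<and> (\<forall>U\<in>B. open U \<and> compact (closure U)) \<and>
    (\<forall>W x. open W \<longrightarrow> x \<in> W \<longrightarrow> (\<exists>U\<in>B. x \<in> U \<and> closure U \<subseteq> W))"
proof -
  obtain B :: "'a set set" where B: "countable B" "topological_basis B"
    using ex_countable_basis by blast
  have "\<exists>U\<in>{U\<in>B. compact (closure U)}. x \<in> U \<and> closure U \<subseteq> W" if W: "open W" "x \<in> W" for W x
  proof -
    obtain V K where VK: "open V" "compact K" "x \<in> V" "V \<subseteq> K" "K \<subseteq> W"
      using compact_neighbourhood[OF W] by blast
    obtain U where U: "U \<in> B" "x \<in> U" "U \<subseteq> V"
      using topological_basisE[OF B(2) VK(1,3)] by blast
    have "closure U \<subseteq> K"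
      using U VK compact_imp_closed[OF VK(2)] by (intro closure_minimal) auto
    moreover from this have "compact (closure U)"
      using compact_Int_closed[OF VK(2) closed_closure, of U] by (simp add: Int_absorb1)
    ultimately show ?thesis using U VK by blast
  qed
  moreover have "countable {U\<in>B. compact (closure U)}" using B(1) by simp
  ultimately show ?thesis
    using topological_basis_open[OF B(2)] by (intro exI[of _ "{U\<in>B. compact (closure U)}"]) auto
qed

definition base :: "'a set set" where
  "base = (SOME B. countable B \<and> (\<forall>U\<in>B. open U \<and> compact (closure U)) \<and>
    (\<forall>W x. open W \<longrightarrow> x \<in> W \<longrightarrow> (\<exists>U\<in>B. x \<in> U \<and> closure U \<subseteq> W)))"

lemma base:
  shows "countable base" "U \<in> base \<Longrightarrow> open U" "U \<in> base \<Longrightarrow> compact (closure U)"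
    and "open W \<Longrightarrow> x \<in> W \<Longrightarrow> \<exists>U\<in>base. x \<in> U \<and> closure U \<subseteq> W"
proof -
  have *: "countable base \<and> (\<forall>U\<in>base. open U \<and> compact (closure U)) \<and>
    (\<forall>W x. open W \<longrightarrow> x \<in> W \<longrightarrow> (\<exists>U\<in>base. x \<in> U \<and> closure U \<subseteq> W))"
    unfolding base_def by (rule someI_ex[OF relatively_compact_base])
  show "countable base" "U \<in> base \<Longrightarrow> open U" "U \<in> base \<Longrightarrow> compact (closure U)"
    "open W \<Longrightarrow> x \<in> W \<Longrightarrow> \<exists>U\<in>base. x \<in> U \<and> closure U \<subseteq> W"
    using * by simp_all
qed

lemma base_cover: "(\<Union>U\<in>base. U) = UNIV"
  using base(4)[of UNIV] by blast

lemma base_nonempty: "base \<noteq> {}"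
  using base(4)[of UNIV undefined] by blast

definition base_seq :: "nat \<Rightarrow> 'a set" where
  "base_seq = from_nat_into base"

lemma base_seq: "base_seq n \<in> base" "range base_seq = base"
  using base_nonempty base(1) by (simp_all add: base_seq_def from_nat_into range_from_nat_into)

lemma compact_closed: "compact (K :: 'a set) \<Longrightarrow> closed K"
  by (rule compact_imp_closed)

text \<open>A closed set is the countable union of its intersections with the compact closures of
  the sets in the base.\<close>

lemma sets_borel_compact: "sets (borel :: 'a measure) = sigma_sets UNIV {K. compact K}"
proof
  interpret sigma_algebra "UNIV :: 'a set" "sigma_sets UNIV {K. compact K}"
    by (rule sigma_algebra_sigma_sets) simp
  have "C \<in> sigma_sets UNIV {K. compact K}" if C: "closed C" for C :: "'a set"
  proof -
    have "\<exists>n. x \<in> closure (base_seq n)" for x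
    proof -
      obtain U where U: "U \<in> base" "x \<in> U" using base(4)[of UNIV x] by auto
      then obtain n where "U = base_seq n" using base_seq(2) by (metis imageE)
      then show ?thesis using U closure_subset[of U] by (intro exI[of _ n]) auto
    qed
    then have "C = (\<Union>n. C \<inter> closure (base_seq n))" by auto
    also have "\<dots> \<in> sigma_sets UNIV {K. compact K}"
    proof (intro countable_UN subsetI, clarify)
      fix n
      have "compact (C \<inter> closure (base_seq n))"
        using C base(3)[OF base_seq(1)] by (intro closed_Int_compact)
      then show "C \<inter> closure (base_seq n) \<in> sigma_sets UNIV {K. compact K}" by blast
    qed
    finally show ?thesis .
  qed
  then show "sets (borel :: 'a measure) \<subseteq> sigma_sets UNIV {K. compact K}"
    unfolding borel_eq_closed by (simp, intro sigma_sets_subset) auto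
  show "sigma_sets UNIV {K. compact K} \<subseteq> sets (borel :: 'a measure)"
    by (rule sets.sigma_sets_subset[of _ borel, simplified]) (auto intro: borel_closed compact_closed)
qed

text \<open>A point outside K lies in some \<open>closure (base_seq m)\<close> disjoint from K, on
  which a function equal to 1 on K can be made to vanish. The n-th approximation is the product of
  the first n of these functions with a cutoff that vanishes off W; at each point outside K it is
  eventually 0.\<close>

lemma urysohn_sequence:
  fixes K :: "'a set"
  assumes K: "compact K"
  shows "\<exists>f W. open W \<and> compact (closure W) \<and> (\<forall>n::nat. continuous_on UNIV (f n) \<and> range (f n) \<subseteq> {0..1} \<and>
      (\<forall>t. t \<notin> W \<longrightarrow> f n t = 0)) \<and> (\<forall>t. (\<lambda>n. f n t) \<longlonglongrightarrow> (indicator K t :: real))"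
proof -
  have "K \<subseteq> \<Union>base" using base_cover by auto
  then obtain D where D: "D \<subseteq> base" "finite D" "K \<subseteq> \<Union>D"
    using compactE[OF K, of base] base(2) by blast
  define W where "W = \<Union>D"
  have W: "open W" using D base(2) by (auto simp: W_def)
  have cW: "compact (closure W)"
  proof -
    have c: "compact (\<Union>U\<in>D. closure U)"
      by (rule compact_UN[OF D(2)]) (use D(1) base(3) in auto)
    have "W \<subseteq> (\<Union>U\<in>D. closure U)" unfolding W_def using closure_subset by blast
    then have "closure W \<subseteq> (\<Union>U\<in>D. closure U)"
      by (rule closure_minimal) (rule compact_closed[OF c])
    then show ?thesis
      using compact_Int_closed[OF c closed_closure, of W] by (simp add: Int_absorb1)
  qed
  have sep: "\<exists>g. continuous_on UNIV g \<and> range g \<subseteq> {0..1::real} \<and> (\<forall>t\<in>C. g t = 0) \<and> (\<forall>t\<in>K. g t = 1)"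
    if "closed C" "C \<inter> K = {}" for C
  proof -
    have CK: "closedin euclidean C" "compactin euclidean K" "disjnt C K"
      using that K by (auto simp: closed_closedin[symmetric] disjnt_def)
    obtain f :: "'a \<Rightarrow> real" where f: "continuous_map euclidean (subtopology euclidean {0..1}) f"
      "f ` K \<subseteq> {0}" "f ` C \<subseteq> {1}"
      by (rule Urysohn_completely_regular_closed_compact[OF zero_le_one completely_regular CK])
    then have f': "continuous_on UNIV f" "\<And>t. 0 \<le> f t \<and> f t \<le> 1"
      by (auto simp: continuous_map_in_subtopology image_subset_iff Pi_iff)
    have "continuous_on UNIV (\<lambda>t. 1 - f t)" by (intro continuous_intros f'(1))
    moreover have "range (\<lambda>t. 1 - f t) \<subseteq> {0..1}" using f'(2) by auto
    moreover have "\<forall>t\<in>C. 1 - f t = 0" "\<forall>t\<in>K. 1 - f t = 1" using f(2,3) by (auto simp: image_subset_iff)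
    ultimately show ?thesis by blast
  qed
  obtain g where g: "continuous_on UNIV g" "range g \<subseteq> {0..1::real}" "\<forall>t\<in>-W. g t = 0" "\<forall>t\<in>K. g t = 1"
  proof -
    have "- W \<inter> K = {}" using D(3) by (auto simp: W_def)
    from sep[OF closed_Compl[OF W] this] show thesis using that by blast
  qed
  \<comment> \<open>Closures that meet K are replaced by the empty set, for which the condition of
    vanishing is void.\<close>
  define C where "C n = (if closure (base_seq n) \<inter> K = {} then closure (base_seq n) else {})" for n
  have "\<exists>h. continuous_on UNIV h \<and> range h \<subseteq> {0..1::real} \<and> (\<forall>t\<in>C n. h t = 0) \<and> (\<forall>t\<in>K. h t = 1)" for n
    by (rule sep) (auto simp: C_def)
  then obtain h where h: "\<And>n. continuous_on UNIV (h n)" "\<And>n. range (h n) \<subseteq> {0..1::real}"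
    "\<And>n. \<forall>t\<in>C n. h n t = 0" "\<And>n. \<forall>t\<in>K. h n t = 1"
    by metis
  define f where "f n t = g t * (\<Prod>i<n. h i t)" for n t
  have h01: "0 \<le> h n t \<and> h n t \<le> 1" for n t using h(2)[of n] by (auto simp: image_subset_iff)
  have g01: "0 \<le> g t \<and> g t \<le> 1" for t using g(2) by (auto simp: image_subset_iff)
  have "continuous_on UNIV (f n)" for n
    unfolding f_def by (intro continuous_intros g(1) h(1))
  moreover have "range (f n) \<subseteq> {0..1}" for n
  proof -
    have "0 \<le> (\<Prod>i<n. h i t)" "(\<Prod>i<n. h i t) \<le> 1" for t
      using h01 by (auto intro: prod_nonneg prod_le_1)
    then show ?thesis
      using g01 unfolding f_def by (auto intro!: mult_nonneg_nonneg mult_le_one)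
  qed
  moreover have "\<forall>t. t \<notin> W \<longrightarrow> f n t = 0" for n
    using g(3) by (simp add: f_def)
  moreover have "(\<lambda>n. f n t) \<longlonglongrightarrow> indicator K t" for t
  proof (cases "t \<in> K")
    case True
    then have "f n t = 1" for n using g(4) h(4) by (simp add: f_def)
    then show ?thesis using True by simp
  next
    case False
    have "open (- K)" using K compact_closed by auto
    then obtain U where U: "U \<in> base" "t \<in> U" "closure U \<subseteq> - K"
      using base(4)[of "- K" t] False by blast
    then obtain m where m: "U = base_seq m" using base_seq(2) by (metis imageE)
    have "t \<in> C m" using U closure_subset[of U] unfolding C_def m by auto
    then have "h m t = 0" using h(3) by blast
    then have "f n t = 0" if "n \<ge> Suc m" for n
      unfolding f_def using that by (auto intro!: prod_zero)
    then have "\<forall>\<^sub>F n in sequentially. f n t = 0" by (auto simp: eventually_sequentially)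
    then have "(\<lambda>n. f n t) \<longlonglongrightarrow> 0" by (rule tendsto_eventually)
    then show ?thesis using False by simp
  qed
  ultimately show ?thesis using W cW by blast
qed

end

section \<open>The underlying measure\<close>

locale jacobi_field = locally_compact_type "TYPE('a)"
  for \<sigma> :: "'a::{second_countable_topology, t2_space} measure" and \<mu> :: "'a \<Rightarrow> real measure" +
  assumes radon: "radon_measure \<sigma>" and non_atomic: "non_atomic \<sigma>"
    and prob_\<mu>: "\<And>t. prob_space (\<mu> t)" and sets_\<mu> [measurable_cong]: "\<And>t. sets (\<mu> t) = sets borel"
    and meas_\<mu>: "\<And>A. A \<in> sets borel \<Longrightarrow> (\<lambda>t. measure (\<mu> t) A) \<in> borel_measurable borel"
    and bounded_\<mu>: "\<And>\<Delta>. \<Delta> \<in> rel_compact_borel \<Longrightarrow> \<exists>R>0. \<forall>t\<in>\<Delta>. AE s in \<mu> t. s \<in> {-R..R}"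
begin

lemma sets_\<sigma> [measurable_cong]: "sets \<sigma> = sets borel"
  using radon by (simp add: radon_measure_def)

lemma space_\<sigma> [simp]: "space \<sigma> = UNIV"
  using sets_eq_imp_space_eq[OF sets_\<sigma>] by simp

lemma space_\<mu> [simp]: "space (\<mu> t) = UNIV"
  using sets_eq_imp_space_eq[OF sets_\<mu>] by simp

lemma \<sigma>_compact: "compact K \<Longrightarrow> emeasure \<sigma> K < \<infinity>"
  using radon compact_closed[of K] by (auto simp: radon_measure_def)

lemma \<sigma>_rel_compact: "A \<subseteq> K \<Longrightarrow> compact K \<Longrightarrow> emeasure \<sigma> A < \<infinity>"
  using emeasure_mono[of A K \<sigma>] \<sigma>_compact[of K] compact_closed[of K] sets_\<sigma>
  by (auto intro: le_less_trans)

lemma \<sigma>_point: "emeasure \<sigma> {t} = 0"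
proof (rule ccontr)
  assume "emeasure \<sigma> {t} \<noteq> 0"
  then have "emeasure \<sigma> {t} > 0" "{t} \<in> sets \<sigma>" by (simp_all add: sets_\<sigma> zero_less_iff_neq_zero)
  then obtain B where "B \<subseteq> {t}" "0 < emeasure \<sigma> B" "emeasure \<sigma> B < emeasure \<sigma> {t}"
    using non_atomic unfolding non_atomic_def by blast
  then show False by (auto simp: subset_singleton_iff)
qed

lemma compact_rel_compact: "compact K \<Longrightarrow> K \<in> rel_compact_borel" for K :: "'a set"
  using compact_closed[of K] by (auto simp: rel_compact_borel_def)

lemma subset_rel_compact: "A \<in> sets borel \<Longrightarrow> A \<subseteq> K \<Longrightarrow> compact K \<Longrightarrow> A \<in> rel_compact_borel"
  for A :: "'a set"
  using closure_minimal[OF _ compact_closed, of A K] compact_Int_closed[of K "closure A"]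
  by (simp add: rel_compact_borel_def Int_absorb1)

lemma rel_compactD: "\<Delta> \<in> rel_compact_borel \<Longrightarrow> \<Delta> \<in> sets borel \<and> compact (closure \<Delta>)"
  by (simp add: rel_compact_borel_def)

lemma compact_prob_space_\<mu>:
  assumes "AE s in \<mu> t. s \<in> {-R..R}" "R > 0"
  shows "compact_prob_space (\<mu> t) R"
  by (rule compact_prob_space.intro[OF prob_\<mu>]) (unfold_locales, use assms sets_\<mu> in auto)

lemma compact_prob_space_ex: "\<exists>R. compact_prob_space (\<mu> t) R"
  using bounded_\<mu>[OF compact_rel_compact[of "{t}"]] compact_prob_space_\<mu> by auto

text \<open>Reads \<mu> as a kernel, so that measurability in t of integrals with respect to \<mu> t
  can be taken from the theory of the Giry monad.\<close>

lemma \<mu>_kernel [measurable]: "\<mu> \<in> measurable borel (subprob_algebra borel)"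
proof (rule measurable_subprob_algebra)
  fix t
  interpret prob_space "\<mu> t" by (rule prob_\<mu>)
  show "subprob_space (\<mu> t)" by unfold_locales
  show "sets (\<mu> t) = sets borel" by (rule sets_\<mu>)
next
  fix A :: "real set" assume A: "A \<in> sets borel"
  have "emeasure (\<mu> t) A = ennreal (measure (\<mu> t) A)" for t
  proof -
    interpret prob_space "\<mu> t" by (rule prob_\<mu>)
    show ?thesis by (rule emeasure_eq_measure)
  qed
  then show "(\<lambda>t. emeasure (\<mu> t) A) \<in> borel_measurable borel"
    using meas_\<mu>[OF A] by simp
qed

section \<open>The measure on pairs (t, s)\<close>

abbreviation "N \<equiv> kernel_measure \<sigma> \<mu>"

lemma sets_N [measurable_cong]: "sets N = sets (borel \<Otimes>\<^sub>M borel)"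
  unfolding kernel_measure_def
  using sets.sigma_sets_eq[of "borel \<Otimes>\<^sub>M borel :: ('a \<times> real) measure"]
    sets.space_closed[of "borel \<Otimes>\<^sub>M borel :: ('a \<times> real) measure"]
  by (simp add: space_pair_measure)

lemma space_N [simp]: "space N = UNIV"
  using sets_eq_imp_space_eq[OF sets_N] by (simp add: space_pair_measure)

lemma section_sets: "A \<in> sets (borel \<Otimes>\<^sub>M borel) \<Longrightarrow> {s. (t, s) \<in> A} \<in> sets (borel :: real measure)"
  for A :: "('a \<times> real) set"
  using sets_Pair1[of A borel borel t] by (simp add: vimage_def)

lemma nn_kernel_measurable:
  assumes "f \<in> borel_measurable (borel \<Otimes>\<^sub>M borel)"
  shows "(\<lambda>t. \<integral>\<^sup>+s. f (t, s) \<partial>\<mu> t) \<in> borel_measurable borel"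
  using assms by (intro nn_integral_measurable_subprob_algebra2[OF _ \<mu>_kernel]) simp

lemma nn_integral_section:
  assumes A: "A \<in> sets (borel \<Otimes>\<^sub>M borel)"
  shows "(\<integral>\<^sup>+s. indicator A (t, s) \<partial>\<mu> t) = emeasure (\<mu> t) {s. (t, s) \<in> A}"
proof -
  have eq: "(\<lambda>s. indicator A (t, s) :: ennreal) = indicator {s. (t, s) \<in> A}"
    by (auto simp: indicator_def fun_eq_iff)
  show ?thesis
    unfolding eq using section_sets[OF A, of t] sets_\<mu> by (intro nn_integral_indicator) simp
qed

lemma emeasure_\<mu>_section_measurable:
  assumes A: "A \<in> sets (borel \<Otimes>\<^sub>M borel)"
  shows "(\<lambda>t. emeasure (\<mu> t) {s. (t, s) \<in> A}) \<in> borel_measurable borel"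
proof -
  have "(\<lambda>t. \<integral>\<^sup>+s. indicator A (t, s) \<partial>\<mu> t) \<in> borel_measurable borel"
    using A by (intro nn_kernel_measurable) simp
  then show ?thesis by (simp add: nn_integral_section[OF A])
qed

lemma emeasure_N:
  assumes "A \<in> sets (borel \<Otimes>\<^sub>M borel)"
  shows "emeasure N A = (\<integral>\<^sup>+t. emeasure (\<mu> t) {s. (t, s) \<in> A} \<partial>\<sigma>)"
  unfolding kernel_measure_def
proof (rule emeasure_measure_of_sigma)
  let ?S = "sets (borel \<Otimes>\<^sub>M borel :: ('a \<times> real) measure)"
  let ?m = "\<lambda>A. \<integral>\<^sup>+t. emeasure (\<mu> t) {s. (t, s) \<in> A} \<partial>\<sigma>"
  show "sigma_algebra UNIV ?S"
    using sets.sigma_algebra_axioms[of "borel \<Otimes>\<^sub>M borel :: ('a \<times> real) measure"]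
    by (simp add: space_pair_measure)
  show "positive ?S ?m" by (simp add: positive_def)
  show "countably_additive ?S ?m"
  proof (rule countably_additiveI)
    fix A :: "nat \<Rightarrow> ('a \<times> real) set" assume A: "range A \<subseteq> ?S" "disjoint_family A"
    have "(\<Sum>i. ?m (A i)) = (\<integral>\<^sup>+t. (\<Sum>i. emeasure (\<mu> t) {s. (t, s) \<in> A i}) \<partial>\<sigma>)"
      using A(1) by (intro nn_integral_suminf[symmetric])
        (auto simp: measurable_cong_sets[OF sets_\<sigma> refl] intro: emeasure_\<mu>_section_measurable)
    also have "\<dots> = ?m (\<Union>i. A i)"
    proof (rule nn_integral_cong)
      fix t
      have "(\<Sum>i. emeasure (\<mu> t) {s. (t, s) \<in> A i}) = emeasure (\<mu> t) (\<Union>i. {s. (t, s) \<in> A i})"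
        using A section_sets sets_\<mu>
        by (intro suminf_emeasure) (auto simp: disjoint_family_on_def)
      also have "(\<Union>i. {s. (t, s) \<in> A i}) = {s. (t, s) \<in> (\<Union>i. A i)}" by auto
      finally show "(\<Sum>i. emeasure (\<mu> t) {s. (t, s) \<in> A i}) = emeasure (\<mu> t) {s. (t, s) \<in> (\<Union>i. A i)}" .
    qed
    finally show "(\<Sum>i. ?m (A i)) = ?m (\<Union>i. A i)" .
  qed
qed (rule assms)

text \<open>Iterated integration with an inner measure that depends on t, by induction over
  nonnegative measurable functions.\<close>

lemma nn_integral_N:
  assumes "f \<in> borel_measurable (borel \<Otimes>\<^sub>M borel)"
  shows "(\<integral>\<^sup>+z. f z \<partial>N) = (\<integral>\<^sup>+t. \<integral>\<^sup>+s. f (t, s) \<partial>\<mu> t \<partial>\<sigma>)"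
  using assms
proof (induction f rule: borel_measurable_induct)
  case (cong f g)
  then have "f = g" by (auto simp: space_pair_measure)
  then show ?case using cong by simp
next
  case (set A)
  then have "(\<integral>\<^sup>+z. indicator A z \<partial>N) = (\<integral>\<^sup>+t. emeasure (\<mu> t) {s. (t, s) \<in> A} \<partial>\<sigma>)"
    using sets_N by (simp add: emeasure_N)
  also have "\<dots> = (\<integral>\<^sup>+t. \<integral>\<^sup>+s. indicator A (t, s) \<partial>\<mu> t \<partial>\<sigma>)"
    by (simp add: nn_integral_section[OF set])
  finally show ?case .
next
  case (mult f c)
  have [measurable]: "(\<lambda>s. f (t, s)) \<in> borel_measurable borel" for t using mult(2) by measurable
  have "(\<lambda>t. \<integral>\<^sup>+s. f (t, s) \<partial>\<mu> t) \<in> borel_measurable \<sigma>"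
    using nn_kernel_measurable[OF mult(2)] measurable_cong_sets[OF sets_\<sigma> refl] by blast
  moreover have "f \<in> borel_measurable N" using mult(2) measurable_cong_sets[OF sets_N refl] by blast
  ultimately show ?case
    using mult.IH by (simp add: nn_integral_cmult)
next
  case (add f g)
  have [measurable]: "(\<lambda>s. f (t, s)) \<in> borel_measurable borel" "(\<lambda>s. g (t, s)) \<in> borel_measurable borel" for t
    using add by measurable
  have "(\<lambda>t. \<integral>\<^sup>+s. f (t, s) \<partial>\<mu> t) \<in> borel_measurable \<sigma>" "(\<lambda>t. \<integral>\<^sup>+s. g (t, s) \<partial>\<mu> t) \<in> borel_measurable \<sigma>"
    using nn_kernel_measurable add measurable_cong_sets[OF sets_\<sigma> refl] by blast+
  moreover have "f \<in> borel_measurable N" "g \<in> borel_measurable N"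
    using add measurable_cong_sets[OF sets_N refl] by blast+
  ultimately show ?case
    using add.IH by (simp add: nn_integral_add)
next
  case (seq U)
  have [measurable]: "(\<lambda>s. U i (t, s)) \<in> borel_measurable borel" for i t using seq(1) by measurable
  have m1: "(\<lambda>t. \<integral>\<^sup>+s. U i (t, s) \<partial>\<mu> t) \<in> borel_measurable \<sigma>" for i
    using nn_kernel_measurable[OF seq(1)] measurable_cong_sets[OF sets_\<sigma> refl] by blast
  have m2: "U i \<in> borel_measurable N" for i using seq(1) measurable_cong_sets[OF sets_N refl] by blast
  have inc: "incseq (\<lambda>i s. U i (t, s))" for t using seq(3) by (auto simp: incseq_def le_fun_def)
  have "(\<integral>\<^sup>+z. (SUP i. U i) z \<partial>N) = (SUP i. \<integral>\<^sup>+z. U i z \<partial>N)"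
    using seq(3) m2 by (simp add: image_comp nn_integral_monotone_convergence_SUP)
  also have "\<dots> = (SUP i. \<integral>\<^sup>+t. \<integral>\<^sup>+s. U i (t, s) \<partial>\<mu> t \<partial>\<sigma>)" by (simp add: seq.IH)
  also have "\<dots> = (\<integral>\<^sup>+t. (SUP i. \<integral>\<^sup>+s. U i (t, s) \<partial>\<mu> t) \<partial>\<sigma>)"
    using seq(3) m1
    by (intro nn_integral_monotone_convergence_SUP[symmetric])
      (auto simp: incseq_def le_fun_def intro!: nn_integral_mono)
  also have "\<dots> = (\<integral>\<^sup>+t. \<integral>\<^sup>+s. (SUP i. U i) (t, s) \<partial>\<mu> t \<partial>\<sigma>)"
    using inc by (intro nn_integral_cong) (simp add: image_comp nn_integral_monotone_convergence_SUP)
  finally show ?case .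
qed

text \<open>Carries statements proved on each fibre, where the bound R may depend on t, over to
  N.\<close>

lemma AE_N:
  assumes P: "{z. P z} \<in> sets (borel \<Otimes>\<^sub>M borel)" and ae: "\<And>t. AE s in \<mu> t. P (t, s)"
  shows "AE z in N. P z"
proof -
  let ?B = "{z. \<not> P z}"
  have B: "?B \<in> sets (borel \<Otimes>\<^sub>M borel)"
    using sets.compl_sets[OF P] by (simp add: space_pair_measure Collect_neg_eq Compl_eq_Diff_UNIV)
  have "emeasure (\<mu> t) {s. (t, s) \<in> ?B} = 0" for t
    using ae[of t] emeasure_eq_0_AE[of "\<lambda>s. \<not> P (t, s)" "\<mu> t"] by simp
  then have "emeasure N ?B = 0" by (simp add: emeasure_N[OF B])
  then show ?thesis
    using B by (intro AE_I[of _ _ ?B]) (simp_all add: sets_N)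
qed

lemma emeasure_N_cylinder:
  assumes "A \<in> sets borel"
  shows "emeasure N (A \<times> UNIV) = emeasure \<sigma> A"
proof -
  have "A \<times> (UNIV :: real set) \<in> sets (borel \<Otimes>\<^sub>M borel)" using assms by simp
  then have "emeasure N (A \<times> UNIV) = (\<integral>\<^sup>+t. emeasure (\<mu> t) {s. (t, s) \<in> A \<times> UNIV} \<partial>\<sigma>)"
    by (rule emeasure_N)
  also have "\<dots> = (\<integral>\<^sup>+t. indicator A t \<partial>\<sigma>)"
  proof (rule nn_integral_cong)
    fix t
    have "emeasure (\<mu> t) UNIV = 1" using prob_space.emeasure_space_1[OF prob_\<mu>, of t] by simp
    then show "emeasure (\<mu> t) {s. (t, s) \<in> A \<times> UNIV} = indicator A t" by (auto simp: indicator_def)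
  qed
  also have "\<dots> = emeasure \<sigma> A" using assms sets_\<sigma> by simp
  finally show ?thesis .
qed

lemma sigma_finite_\<sigma>: "sigma_finite_measure \<sigma>"
proof
  show "\<exists>A. countable A \<and> A \<subseteq> sets \<sigma> \<and> \<Union> A = space \<sigma> \<and> (\<forall>a\<in>A. emeasure \<sigma> a \<noteq> \<infinity>)"
  proof (intro exI[of _ base] conjI ballI)
    show "base \<subseteq> sets \<sigma>" using base(2) sets_\<sigma> by auto
    show "emeasure \<sigma> U \<noteq> \<infinity>" if "U \<in> base" for U
      using \<sigma>_rel_compact[OF closure_subset base(3)[OF that]] by simp
  qed (use base(1) base_cover in auto)
qed

lemma sigma_finite_N: "sigma_finite_measure N"
proof
  show "\<exists>A. countable A \<and> A \<subseteq> sets N \<and> \<Union> A = space N \<and> (\<forall>a\<in>A. emeasure N a \<noteq> \<infinity>)"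
  proof (intro exI[of _ "(\<lambda>U. U \<times> UNIV) ` base"] conjI ballI)
    show "(\<lambda>U. U \<times> UNIV) ` base \<subseteq> sets N" using base(2) sets_N by auto
    show "emeasure N A \<noteq> \<infinity>" if A: "A \<in> (\<lambda>U. U \<times> UNIV) ` base" for A
    proof -
      obtain U where U: "U \<in> base" "A = U \<times> UNIV" using A by blast
      have "emeasure \<sigma> U < \<infinity>" by (rule \<sigma>_rel_compact[OF closure_subset base(3)[OF U(1)]])
      then show ?thesis using U base(2)[OF U(1)] by (simp add: emeasure_N_cylinder)
    qed
    show "\<Union> ((\<lambda>U. U \<times> UNIV) ` base) = space N" using base(4)[of UNIV] by auto
  qed (use base(1) in simp)
qed

sublocale full_fock N
  by (rule full_fock.intro) (rule sigma_finite_N)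

end

section \<open>Square integrable functions of (t, s) and total families\<close>

context jacobi_field begin

lemma borel_measurable_N: "borel_measurable N = borel_measurable (borel \<Otimes>\<^sub>M borel)"
  by (rule measurable_cong_sets[OF sets_N refl])

lemma borel_measurable_\<sigma>: "borel_measurable \<sigma> = borel_measurable borel"
  by (rule measurable_cong_sets[OF sets_\<sigma> refl])

lemma sqint_cylinder:
  assumes "\<Delta> \<in> rel_compact_borel"
  shows "indicator (\<Delta> \<times> UNIV) \<in> sqint N"
proof (rule sqint_indicator)
  have "\<Delta> \<in> sets borel" "compact (closure \<Delta>)" using assms by (auto dest: rel_compactD)
  then show "\<Delta> \<times> UNIV \<in> sets N" "emeasure N (\<Delta> \<times> UNIV) < \<infinity>"
    using \<sigma>_rel_compact[OF closure_subset[of \<Delta>]] by (auto simp: sets_N emeasure_N_cylinder)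
qed

lemma sqint_bounded_support:
  assumes h: "h \<in> borel_measurable (borel \<Otimes>\<^sub>M borel)" and \<Delta>: "\<Delta> \<in> rel_compact_borel"
    and B: "\<And>t. AE s in \<mu> t. \<bar>h (t, s)\<bar> \<le> B" and supp: "\<And>t s. t \<notin> \<Delta> \<Longrightarrow> h (t, s) = 0"
  shows "h \<in> sqint N"
proof (rule sqint_bounded[OF sqint_cylinder[OF \<Delta>]])
  show "h \<in> borel_measurable N" using h by (simp add: borel_measurable_N)
  show "AE z in N. \<bar>h z\<bar> \<le> B * \<bar>indicator (\<Delta> \<times> UNIV) z\<bar>"
  proof (rule AE_N)
    have [measurable]: "\<Delta> \<times> (UNIV :: real set) \<in> sets (borel \<Otimes>\<^sub>M borel)"
      using rel_compactD[OF \<Delta>] by simp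
    note [measurable] = h
    have "{z \<in> space (borel \<Otimes>\<^sub>M borel). \<bar>h z\<bar> \<le> B * \<bar>indicator (\<Delta> \<times> UNIV) z\<bar>} \<in> sets (borel \<Otimes>\<^sub>M borel)"
      by measurable
    then show "{z. \<bar>h z\<bar> \<le> B * \<bar>indicator (\<Delta> \<times> UNIV) z\<bar>} \<in> sets (borel \<Otimes>\<^sub>M borel)"
      by (simp add: space_pair_measure)
    show "AE s in \<mu> t. \<bar>h (t, s)\<bar> \<le> B * \<bar>indicator (\<Delta> \<times> UNIV) (t, s)\<bar>" for t
      using B[of t]
      by (cases "t \<in> \<Delta>") (auto simp: indicator_def supp)
  qed
qed

lemma admissible_bounded_support:
  assumes h: "h \<in> borel_measurable (borel \<Otimes>\<^sub>M borel)" and \<Delta>: "\<Delta> \<in> rel_compact_borel"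
    and B: "\<And>t. AE s in \<mu> t. \<bar>h (t, s)\<bar> \<le> B" and supp: "\<And>t s. t \<notin> \<Delta> \<Longrightarrow> h (t, s) = 0"
  shows "admissible snd h"
proof -
  obtain R where R: "R > 0" "\<forall>t\<in>\<Delta>. AE s in \<mu> t. s \<in> {-R..R}" using bounded_\<mu>[OF \<Delta>] by blast
  note [measurable] = h
  have m: "(\<lambda>z. snd z * h z) \<in> borel_measurable (borel \<Otimes>\<^sub>M borel)" by measurable
  \<comment> \<open>R bounds s over the support of h. The absolute value is taken because the sign
    of B is not assumed.\<close>
  have "AE z in N. \<bar>snd z * h z\<bar> \<le> R * \<bar>B\<bar>"
  proof (rule AE_N)
    have "{z \<in> space (borel \<Otimes>\<^sub>M borel). \<bar>snd z * h z\<bar> \<le> R * \<bar>B\<bar>} \<in> sets (borel \<Otimes>\<^sub>M borel)"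
      using m by measurable
    then show "{z. \<bar>snd z * h z\<bar> \<le> R * \<bar>B\<bar>} \<in> sets (borel \<Otimes>\<^sub>M borel)"
      by (simp add: space_pair_measure)
    show "AE s in \<mu> t. \<bar>snd (t, s) * h (t, s)\<bar> \<le> R * \<bar>B\<bar>" for t
    proof (cases "t \<in> \<Delta>")
      case True
      then have "AE s in \<mu> t. s \<in> {-R..R}" using R by blast
      with B[of t] show ?thesis
      proof eventually_elim
        case (elim s)
        then have "\<bar>s\<bar> * \<bar>h (t, s)\<bar> \<le> R * \<bar>B\<bar>" by (intro mult_mono) auto
        then show ?case by (simp add: abs_mult)
      qed
    qed (use R supp in simp)
  qed
  moreover have "0 \<le> R * \<bar>B\<bar>" using R by simp
  ultimately show ?thesis
    using sqint_bounded_support[OF assms] m unfolding admissible_def borel_measurable_N by blast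
qed

lemma sets_N_rectangles: "sets N = sigma_sets (space N) {K \<times> L | K L. compact K \<and> closed L}"
proof -
  have "sets (borel \<Otimes>\<^sub>M borel :: ('a \<times> real) measure) =
      sets (sigma (space borel \<times> space borel) {a \<times> b | a b. a \<in> {K. compact K} \<and> b \<in> {L. closed L}})"
  proof (rule sets_pair_eq)
    show "{K. compact K} \<subseteq> Pow (space borel)" "{L. closed L} \<subseteq> Pow (space borel)" by auto
    show "sets (borel :: 'a measure) = sigma_sets (space borel) {K. compact K}"
      using sets_borel_compact by simp
    show "sets (borel :: real measure) = sigma_sets (space borel) {L. closed L}"
      by (subst borel_eq_closed) simp
    show "countable (closure ` base)" using base(1) by simp
    show "closure ` base \<subseteq> {K. compact K}" using base(3) by auto
    show "\<Union> (closure ` base) = space borel"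
      using base(4)[of UNIV] closure_subset by fastforce
    show "countable {UNIV :: real set}" "{UNIV} \<subseteq> {L :: real set. closed L}" "\<Union> {UNIV} = space (borel :: real measure)"
      by auto
  qed
  then show ?thesis
    unfolding sets_N by (simp add: sets_measure_of)
qed

text \<open>The common part of two totality proofs. The indicator of a closed set L is a limit of
  bounded continuous functions of the distance to L, and the products of compact with closed sets
  form a generator stable under intersection.\<close>

lemma l2_N_subspace_eq:
  assumes S: "closed_subspace (l2 N) S"
    and prod: "\<And>K \<phi> B. compact K \<Longrightarrow> continuous_on UNIV \<phi> \<Longrightarrow> (\<And>s. \<bar>\<phi> s\<bar> \<le> B) \<Longrightarrow>
      ae_class N (\<lambda>z. indicator K (fst z) * \<phi> (snd z)) \<in> S"
  shows "S = carr (l2 N)"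
proof -
  interpret W: l2_subspace N S by unfold_locales (rule S)
  have cyl: "indicator (K \<times> UNIV) \<in> sqint N" if "compact K" for K
    using that by (intro sqint_cylinder compact_rel_compact)
  have Ksets: "K \<in> sets borel" if "compact K" for K :: "'a set"
    using compact_closed[OF that] by (rule borel_closed)
  have mult: "(\<lambda>z. indicator K (fst z) * \<phi> (snd z)) \<in> W.funs"
    if "compact K" "continuous_on UNIV \<phi>" "\<And>s. \<bar>\<phi> s\<bar> \<le> B" for K \<phi> B
  proof -
    have "(\<lambda>z. indicator K (fst z) * \<phi> (snd z)) \<in> sqint N"
    proof (rule sqint_bounded[OF cyl[OF that(1)]])
      have [measurable]: "K \<in> sets borel" "\<phi> \<in> borel_measurable borel"
        using that Ksets by (auto intro: borel_measurable_continuous_onI)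
      show "(\<lambda>z. indicator K (fst z) * \<phi> (snd z)) \<in> borel_measurable N"
        unfolding borel_measurable_N by measurable
      show "AE z in N. \<bar>indicator K (fst z) * \<phi> (snd z)\<bar> \<le> B * \<bar>indicator (K \<times> UNIV) z\<bar>"
        using that(3) by (intro AE_I2) (auto simp: indicator_def)
    qed
    then show ?thesis using prod[OF that] by (simp add: W.funs_def)
  qed
  have rect: "indicator (K \<times> L) \<in> W.funs" if K: "compact K" and L: "closed L" for K L
  \<comment> \<open>\<open>infdist\<close> to the empty set is 0, so that the approximation used
    below would give 1 instead of 0.\<close>
  proof (cases "L = {}")
    case True
    moreover have "(indicator {} :: 'a \<times> real \<Rightarrow> real) = (\<lambda>z. 0)" by (simp add: fun_eq_iff)
    ultimately show ?thesis using W.funs_zero by simp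
  next
    case False
    define \<phi> where "\<phi> n s = max 0 (1 - real n * infdist s L)" for n s
    have pos: "0 \<le> real n * infdist s L" for n s by (intro mult_nonneg_nonneg) (auto intro: infdist_nonneg)
    have \<phi>1: "\<bar>\<phi> n s\<bar> \<le> 1" for n s using pos[of n s] by (simp add: \<phi>_def)
    show ?thesis
    proof (rule W.funs_dominated_limit[of "\<lambda>n z. indicator K (fst z) * \<phi> n (snd z)"])
      show "(\<lambda>z. indicator K (fst z) * \<phi> n (snd z)) \<in> W.funs" for n
        by (rule mult[OF K _ \<phi>1]) (unfold \<phi>_def, intro continuous_intros)
      show "indicator (K \<times> UNIV) \<in> sqint N" by (rule cyl[OF K])
      show "indicator (K \<times> L) \<in> borel_measurable N"
        using Ksets[OF K] borel_closed[OF L] by (auto simp: borel_measurable_N)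
      show "AE z in N. \<bar>indicator K (fst z) * \<phi> n (snd z)\<bar> \<le> \<bar>indicator (K \<times> UNIV) z\<bar>" for n
        using \<phi>1 by (intro AE_I2) (auto simp: indicator_def)
      have lim: "(\<lambda>n. \<phi> n s) \<longlonglongrightarrow> indicator L s" for s
      proof (cases "s \<in> L")
        case True
        then show ?thesis by (simp add: \<phi>_def)
      next
        case s: False
        then have d: "infdist s L > 0"
          using L False infdist_nonneg[of s L] in_closed_iff_infdist_zero[OF L False, of s] by simp
        obtain m :: nat where m: "1 / infdist s L < m" using reals_Archimedean2 by blast
        have "\<phi> n s = 0" if "n \<ge> m" for n
        proof -
          have "1 < real m * infdist s L" using m d by (simp add: field_simps)
          also have "\<dots> \<le> real n * infdist s L" using that d by (intro mult_right_mono) auto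
          finally show ?thesis by (simp add: \<phi>_def)
        qed
        then have "\<forall>\<^sub>F n in sequentially. \<phi> n s = 0" by (auto simp: eventually_sequentially)
        then show ?thesis using s by (simp add: tendsto_eventually)
      qed
      have "(\<lambda>n. indicator K (fst z) * \<phi> n (snd z)) \<longlonglongrightarrow> indicator (K \<times> L) z" for z
        using tendsto_mult_left[OF lim[of "snd z"], of "indicator K (fst z)"]
        by (simp add: indicator_times)
      then show "AE z in N. (\<lambda>n. indicator K (fst z) * \<phi> n (snd z)) \<longlonglongrightarrow> indicator (K \<times> L) z"
        by (intro AE_I2)
    qed
  qed
  let ?U = "\<lambda>k. closure (base_seq k) \<times> (UNIV :: real set)"
  let ?E = "{K \<times> L | K L. compact (K :: 'a set) \<and> closed (L :: real set)}"
  have Uc: "compact (closure (base_seq k))" for k using base(3)[OF base_seq(1)] .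
  have Uin: "?U k \<in> sets N" "emeasure N (?U k) < \<infinity>" for k
    using Ksets[OF Uc[of k]] \<sigma>_compact[OF Uc[of k]] by (auto simp: sets_N emeasure_N_cylinder)
  show ?thesis
  proof (rule W.funs_eq_sqint(2)[OF Uin])
    have "\<exists>k. fst z \<in> closure (base_seq k)" for z :: "'a \<times> real"
    proof -
      obtain U where U: "U \<in> base" "fst z \<in> U" using base(4)[of UNIV "fst z"] by auto
      then obtain n where "U = base_seq n" using base_seq(2) by (metis imageE)
      then show ?thesis using U closure_subset[of U] by (intro exI[of _ n]) auto
    qed
    then show "AE z in N. z \<in> (\<Union>k. ?U k)" by (intro AE_I2) (auto simp: mem_Times_iff)
    show "indicator (A \<inter> ?U k) \<in> W.funs" if "A \<in> sets N" for A k
    proof (rule W.funs_indicator_dynkin[of ?E, OF _ _ sets_N_rectangles Uin _ _ that])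
      show "Int_stable ?E"
      proof (rule Int_stableI)
        fix A B assume "A \<in> ?E" "B \<in> ?E"
        then obtain K L K' L' where *: "A = K \<times> L" "B = K' \<times> L'" "compact K" "compact K'" "closed L" "closed L'"
          by blast
        then have "A \<inter> B = (K \<inter> K') \<times> (L \<inter> L')" by auto
        moreover have "compact (K \<inter> K')" using * compact_closed by (intro compact_Int_closed)
        moreover have "closed (L \<inter> L')" using * by (intro closed_Int)
        ultimately show "A \<inter> B \<in> ?E" by blast
      qed
      show "?E \<subseteq> Pow (space N)" by simp
      show "indicator (?U k) \<in> W.funs" using rect[OF Uc closed_UNIV] .
      show "indicator (B \<inter> ?U k) \<in> W.funs" if B: "B \<in> ?E" for B
      proof -
        obtain K L where KL: "B = K \<times> L" "compact K" "closed L" using B by blast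
        have "B \<inter> ?U k = (K \<inter> closure (base_seq k)) \<times> L" using KL by auto
        moreover have "compact (K \<inter> closure (base_seq k))" using KL by (intro compact_Int_closed closed_closure)
        ultimately show ?thesis using rect[OF _ KL(3)] by simp
      qed
    qed
  qed
qed

lemma test_functions_admissible:
  assumes "h \<in> test_functions"
  shows "admissible snd h" "h \<in> sqint N"
proof -
  obtain \<Delta> where h: "continuous_on UNIV h" "bounded (range h)" and \<Delta>: "\<Delta> \<in> rel_compact_borel" "\<And>t s. t \<notin> \<Delta> \<Longrightarrow> h (t, s) = 0"
    using assms by (auto simp: test_functions_def)
  obtain B where B: "\<And>z. \<bar>h z\<bar> \<le> B" using h(2) by (auto simp: bounded_iff)
  have m: "h \<in> borel_measurable (borel \<Otimes>\<^sub>M borel)"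
    unfolding borel_prod using h(1) by (rule borel_measurable_continuous_onI)
  show "admissible snd h" by (rule admissible_bounded_support[OF m \<Delta>(1), of B]) (simp_all add: B \<Delta>(2))
  then show "h \<in> sqint N" by (simp add: admissible_def)
qed

text \<open>The indicator of K is approximated by Urysohn functions that all vanish off the same
  relatively compact set W; B times the indicator of the cylinder over W is then a square integrable
  majorant.\<close>

lemma test_functions_total: "total (l2 N) (ae_class N ` test_functions)"
proof (rule totalI)
  show "ae_class N ` test_functions \<subseteq> carr (l2 N)" using test_functions_admissible(2) by auto
  fix S v assume S: "closed_subspace (l2 N) S" "ae_class N ` test_functions \<subseteq> S" and v: "v \<in> carr (l2 N)"
  interpret W: l2_subspace N S by unfold_locales (rule S)
  have "S = carr (l2 N)"
  proof (rule l2_N_subspace_eq[OF S(1)])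
    fix K :: "'a set" and \<phi> :: "real \<Rightarrow> real" and B
    assume K: "compact K" and \<phi>: "continuous_on UNIV \<phi>" "\<And>s. \<bar>\<phi> s\<bar> \<le> B"
    obtain f W where W: "open W" "compact (closure W)"
      and f: "\<And>n::nat. continuous_on UNIV (f n)" "\<And>n. range (f n) \<subseteq> {0..1}" "\<And>n t. t \<notin> W \<Longrightarrow> f n t = 0"
      and lim: "\<And>t. (\<lambda>n. f n t) \<longlonglongrightarrow> (indicator K t :: real)"
      using urysohn_sequence[OF K] by metis
    have f01: "0 \<le> f n t" "f n t \<le> 1" for n t using f(2)[of n] by (auto simp: image_subset_iff)
    have Wr: "W \<in> rel_compact_borel" using W by (simp add: rel_compact_borel_def)
    have B0: "B \<ge> 0" using \<phi>(2)[of 0] by simp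
    have "(\<lambda>z. indicator K (fst z) * \<phi> (snd z)) \<in> W.funs"
    proof (rule W.funs_dominated_limit[of "\<lambda>n z. f n (fst z) * \<phi> (snd z)"])
      show "(\<lambda>z. f n (fst z) * \<phi> (snd z)) \<in> W.funs" for n
      proof -
        have "continuous_on UNIV (\<lambda>z::'a \<times> real. f n (fst z) * \<phi> (snd z))"
          using continuous_on_compose2[OF f(1)[of n] continuous_on_fst[OF continuous_on_id]]
            continuous_on_compose2[OF \<phi>(1) continuous_on_snd[OF continuous_on_id]]
          by (intro continuous_on_mult) auto
        moreover have "bounded (range (\<lambda>z::'a \<times> real. f n (fst z) * \<phi> (snd z)))"
          unfolding bounded_iff
        proof (intro exI[of _ B] ballI)
          fix y assume "y \<in> range (\<lambda>z::'a \<times> real. f n (fst z) * \<phi> (snd z))"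
          then obtain z :: "'a \<times> real" where "y = f n (fst z) * \<phi> (snd z)" by blast
          then have "norm y \<le> 1 * B"
            using f01[of n "fst z"] \<phi>(2)[of "snd z"] by (simp only: real_norm_def abs_mult) (intro mult_mono, auto)
          then show "norm y \<le> B" by simp
        qed
        ultimately have "(\<lambda>z. f n (fst z) * \<phi> (snd z)) \<in> test_functions"
          using Wr f(3) unfolding test_functions_def by auto
        then show ?thesis using S(2) test_functions_admissible(2) by (auto simp: W.funs_def)
      qed
      show "(\<lambda>z. B * indicator (W \<times> UNIV) z) \<in> sqint N"
        by (intro sqint_scale sqint_cylinder Wr)
      have [measurable]: "K \<in> sets borel" "\<phi> \<in> borel_measurable borel"
        using borel_closed[OF compact_closed[OF K]] \<phi>(1) by (auto intro: borel_measurable_continuous_onI)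
      show "(\<lambda>z. indicator K (fst z) * \<phi> (snd z)) \<in> borel_measurable N"
        unfolding borel_measurable_N by measurable
      have "\<bar>f n t * \<phi> s\<bar> \<le> \<bar>B * indicator (W \<times> UNIV) (t, s)\<bar>" for n t s
      proof (cases "t \<in> W")
        case True
        have "\<bar>f n t * \<phi> s\<bar> \<le> 1 * B"
          unfolding abs_mult using f01[of n t] \<phi>(2)[of s] by (intro mult_mono) auto
        then show ?thesis using True B0 by simp
      qed (simp add: f(3))
      then show "AE z in N. \<bar>f n (fst z) * \<phi> (snd z)\<bar> \<le> \<bar>B * indicator (W \<times> UNIV) z\<bar>" for n
        by (intro AE_I2) (metis prod.collapse)
      show "AE z in N. (\<lambda>n. f n (fst z) * \<phi> (snd z)) \<longlonglongrightarrow> indicator K (fst z) * \<phi> (snd z)"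
        by (intro AE_I2 tendsto_mult_right lim)
    qed
    then show "ae_class N (\<lambda>z. indicator K (fst z) * \<phi> (snd z)) \<in> S" by (simp add: W.funs_def)
  qed
  then show "v \<in> S" using v by simp
qed

text \<open>Keeps the neutral term in the proof of cyclicity within the test functions. As s is
  unbounded, it is truncated to [-R, R], which changes nothing almost everywhere over the support of
  h.\<close>

lemma test_functions_product:
  assumes h: "h \<in> test_functions" and g: "g \<in> test_functions"
  shows "\<exists>g'\<in>test_functions. AE z in N. g' z = snd z * h z * g z"
proof -
  obtain \<Delta> where hc: "continuous_on UNIV h" "bounded (range h)" and \<Delta>: "\<Delta> \<in> rel_compact_borel" "\<And>t s. t \<notin> \<Delta> \<Longrightarrow> h (t, s) = 0"
    using h by (auto simp: test_functions_def)
  have gc: "continuous_on UNIV g" "bounded (range g)" using g by (auto simp: test_functions_def)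
  obtain R where R: "R > 0" "\<forall>t\<in>\<Delta>. AE s in \<mu> t. s \<in> {-R..R}" using bounded_\<mu>[OF \<Delta>(1)] by blast
  obtain B where B: "\<And>z. \<bar>h z\<bar> \<le> B" using hc(2) by (auto simp: bounded_iff)
  obtain D where D: "\<And>z. \<bar>g z\<bar> \<le> D" using gc(2) by (auto simp: bounded_iff)
  define c where "c s = max (- R) (min R s)" for s
  have c: "\<bar>c s\<bar> \<le> R" for s using R(1) by (auto simp: c_def)
  let ?g = "\<lambda>z. c (snd z) * h z * g z"
  have "continuous_on UNIV ?g"
    unfolding c_def by (intro continuous_intros hc gc)
  moreover have "bounded (range ?g)"
    unfolding bounded_iff
  proof (intro exI[of _ "R * B * D"] ballI)
    fix y assume "y \<in> range ?g"
    then obtain z where y: "y = c (snd z) * h z * g z" by blast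
    have "0 \<le> B" "0 \<le> D" using B[of z] D[of z] by linarith+
    then show "norm y \<le> R * B * D"
      unfolding y real_norm_def abs_mult using c B D R(1)
      by (intro mult_mono mult_nonneg_nonneg) auto
  qed
  moreover have "\<forall>t s. t \<notin> \<Delta> \<longrightarrow> ?g (t, s) = 0" using \<Delta>(2) by simp
  ultimately have "?g \<in> test_functions" using \<Delta>(1) unfolding test_functions_def by blast
  moreover have "AE z in N. ?g z = snd z * h z * g z"
  proof (rule AE_N)
    have [measurable]: "h \<in> borel_measurable (borel \<Otimes>\<^sub>M borel)" "g \<in> borel_measurable (borel \<Otimes>\<^sub>M borel)"
      "c \<in> borel_measurable borel"
      unfolding borel_prod c_def using hc gc by (auto intro!: borel_measurable_continuous_onI continuous_intros)
    have "{z \<in> space (borel \<Otimes>\<^sub>M borel). ?g z = snd z * h z * g z} \<in> sets (borel \<Otimes>\<^sub>M borel)"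
      by measurable
    then show "{z. ?g z = snd z * h z * g z} \<in> sets (borel \<Otimes>\<^sub>M borel)" by (simp add: space_pair_measure)
    show "AE s in \<mu> t. ?g (t, s) = snd (t, s) * h (t, s) * g (t, s)" for t
    proof (cases "t \<in> \<Delta>")
      case True
      then have "AE s in \<mu> t. s \<in> {-R..R}" using R by blast
      then show ?thesis by eventually_elim (auto simp: c_def)
    qed (simp add: \<Delta>(2))
  qed
  ultimately show ?thesis by (intro bexI[of _ ?g])
qed

section \<open>Measurability of the orthogonal polynomials in the parameter\<close>

lemma orth_polys_oseq: "orth_polys (\<mu> t) = oseq (\<mu> t)"
  using compact_prob_space_ex[of t] compact_prob_space.orth_polys_eq by blast

lemma compact_prob_space_on:
  assumes "\<Delta> \<in> rel_compact_borel"
  shows "\<exists>R>0. \<forall>t\<in>\<Delta>. compact_prob_space (\<mu> t) R"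
  using bounded_\<mu>[OF assms] compact_prob_space_\<mu> by blast

text \<open>The positive and negative parts are integrals of nonnegative functions, for which
  \<open>nn_kernel_measurable\<close> is available.\<close>

lemma moment_measurable: "(\<lambda>t. \<integral>s. s ^ k \<partial>\<mu> t) \<in> borel_measurable borel"
proof -
  have eq: "(\<integral>s. s ^ k \<partial>\<mu> t) = enn2real (\<integral>\<^sup>+s. ennreal (s ^ k) \<partial>\<mu> t) - enn2real (\<integral>\<^sup>+s. ennreal (- (s ^ k)) \<partial>\<mu> t)" for t
  proof -
    obtain R where "compact_prob_space (\<mu> t) R" using compact_prob_space_ex by blast
    then interpret compact_prob_space "\<mu> t" R .
    have "(\<lambda>s. s ^ k) = poly (monom (1::real) k)" by (simp add: fun_eq_iff poly_monom)
    then have "integrable (\<mu> t) (\<lambda>s. s ^ k)" using poly_integrable by simp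
    then show ?thesis by (rule real_lebesgue_integral_def)
  qed
  have "(\<lambda>t. \<integral>\<^sup>+s. (\<lambda>z. ennreal (snd z ^ k)) (t, s) \<partial>\<mu> t) \<in> borel_measurable borel"
    "(\<lambda>t. \<integral>\<^sup>+s. (\<lambda>z. ennreal (- (snd z ^ k))) (t, s) \<partial>\<mu> t) \<in> borel_measurable borel"
    by (rule nn_kernel_measurable, measurable)+
  then show ?thesis unfolding eq by (simp del: ennreal_neg)
qed

lemma ip_measurable:
  assumes p: "\<And>i. (\<lambda>t. coeff (p t) i) \<in> borel_measurable borel" "\<And>t i. i > n \<Longrightarrow> coeff (p t) i = 0"
    and r: "\<And>i. (\<lambda>t. coeff (r t) i) \<in> borel_measurable borel" "\<And>t i. i > m \<Longrightarrow> coeff (r t) i = 0"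
  shows "(\<lambda>t. poly_ip (\<mu> t) (p t) (r t)) \<in> borel_measurable borel"
proof -
  have "poly_ip (\<mu> t) (p t) (r t) = (\<Sum>i\<le>n. \<Sum>j\<le>m. coeff (p t) i * coeff (r t) j * (\<integral>s. s ^ (i + j) \<partial>\<mu> t))" for t
  proof -
    obtain R where "compact_prob_space (\<mu> t) R" using compact_prob_space_ex by blast
    then interpret compact_prob_space "\<mu> t" R .
    show ?thesis by (rule ip_moments) (use p(2) r(2) in auto)
  qed
  then show ?thesis
    using p(1) r(1) moment_measurable by (simp add: borel_measurable_sum borel_measurable_times)
qed

lemma oseq_coeff_0: "i > n \<Longrightarrow> coeff (oseq (\<mu> t) n) i = 0" "i \<ge> n \<Longrightarrow> coeff (oprev (\<mu> t) n) i = 0"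
  using compact_prob_space_ex[of t] compact_prob_space.oseq_coeff(1,3) by blast+

text \<open>Each step of the recursion consists of arithmetic with earlier coefficients and moments,
  and of one case distinction on a measurable condition. The predecessor is carried along because
  the recursion uses both.\<close>

lemma oseq_coeff_measurable:
  "(\<lambda>t. coeff (oseq (\<mu> t) n) i) \<in> borel_measurable borel \<and> (\<lambda>t. coeff (oprev (\<mu> t) n) i) \<in> borel_measurable borel"
proof (induction n arbitrary: i)
  case 0
  then show ?case by (simp add: oseq_simps)
next
  case (Suc n)
  have [measurable]: "(\<lambda>t. coeff (oseq (\<mu> t) n) i) \<in> borel_measurable borel"
    "(\<lambda>t. coeff (oprev (\<mu> t) n) i) \<in> borel_measurable borel" for i
    using Suc.IH by auto
  have pc: "(\<lambda>t. coeff (pCons 0 (oseq (\<mu> t) n)) i) \<in> borel_measurable borel" for i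
    by (cases i) simp_all
  have pc0: "coeff (pCons 0 (oseq (\<mu> t) n)) i = 0" if "i > Suc n" for t i
    using that oseq_coeff_0(1)[of n "i - 1" t] by (cases i) auto
  have ww [measurable]: "(\<lambda>t. poly_ip (\<mu> t) (oseq (\<mu> t) n) (oseq (\<mu> t) n)) \<in> borel_measurable borel"
    by (rule ip_measurable[of _ n _ n]) (simp_all add: oseq_coeff_0)
  have pp [measurable]: "(\<lambda>t. poly_ip (\<mu> t) (oprev (\<mu> t) n) (oprev (\<mu> t) n)) \<in> borel_measurable borel"
    by (rule ip_measurable[of _ n _ n]) (simp_all add: oseq_coeff_0)
  have xw [measurable]: "(\<lambda>t. poly_ip (\<mu> t) (pCons 0 (oseq (\<mu> t) n)) (oseq (\<mu> t) n)) \<in> borel_measurable borel"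
    by (rule ip_measurable[of _ "Suc n" _ n]) (simp_all add: oseq_coeff_0 pc pc0)
  have a [measurable]: "(\<lambda>t. oa (\<mu> t) n) \<in> borel_measurable borel" unfolding jacobi_a_def by measurable
  have b [measurable]: "(\<lambda>t. ob (\<mu> t) n) \<in> borel_measurable borel" unfolding jacobi_b_def by measurable
  have raw [measurable]: "(\<lambda>t. coeff (oraw (\<mu> t) n) i) \<in> borel_measurable borel" for i
    using pc[of i] by (simp add: next_raw_def)
  have raw0: "coeff (oraw (\<mu> t) n) i = 0" if "i > Suc n" for t i
    using that pc0[OF that] by (simp add: next_raw_def oseq_coeff_0)
  have rr [measurable]: "(\<lambda>t. poly_ip (\<mu> t) (oraw (\<mu> t) n) (oraw (\<mu> t) n)) \<in> borel_measurable borel"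
    by (rule ip_measurable[of _ "Suc n" _ "Suc n"]) (simp_all add: raw raw0)
  have "(\<lambda>t. if poly_ip (\<mu> t) (oraw (\<mu> t) n) (oraw (\<mu> t) n) = 0 then 0 else coeff (oraw (\<mu> t) n) i)
      \<in> borel_measurable borel"
    by measurable
  also have "(\<lambda>t. if poly_ip (\<mu> t) (oraw (\<mu> t) n) (oraw (\<mu> t) n) = 0 then 0 else coeff (oraw (\<mu> t) n) i) =
      (\<lambda>t. coeff (oseq (\<mu> t) (Suc n)) i)"
    by (simp add: oseq_simps(4) fun_eq_iff)
  finally show ?case by (simp add: oseq_simps(3))
qed

lemma jacobi_measurable:
  shows oa_measurable: "(\<lambda>t. oa (\<mu> t) n) \<in> borel_measurable borel"
    and ob_measurable: "(\<lambda>t. ob (\<mu> t) n) \<in> borel_measurable borel"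
    and norm_measurable: "(\<lambda>t. poly_ip (\<mu> t) (oseq (\<mu> t) n) (oseq (\<mu> t) n)) \<in> borel_measurable borel"
proof -
  note c = oseq_coeff_measurable[THEN conjunct1] oseq_coeff_measurable[THEN conjunct2]
  show ww: "(\<lambda>t. poly_ip (\<mu> t) (oseq (\<mu> t) n) (oseq (\<mu> t) n)) \<in> borel_measurable borel"
    by (rule ip_measurable[of _ n _ n]) (simp_all add: oseq_coeff_0 c)
  have pp: "(\<lambda>t. poly_ip (\<mu> t) (oprev (\<mu> t) n) (oprev (\<mu> t) n)) \<in> borel_measurable borel"
    by (rule ip_measurable[of _ n _ n]) (simp_all add: oseq_coeff_0 c)
  have "(\<lambda>t. coeff (pCons 0 (oseq (\<mu> t) n)) i) \<in> borel_measurable borel" for i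
    by (cases i) (simp_all add: c)
  moreover have "coeff (pCons 0 (oseq (\<mu> t) n)) i = 0" if "i > Suc n" for t i
    using that oseq_coeff_0(1)[of n "i - 1" t] by (cases i) auto
  ultimately have xw: "(\<lambda>t. poly_ip (\<mu> t) (pCons 0 (oseq (\<mu> t) n)) (oseq (\<mu> t) n)) \<in> borel_measurable borel"
    by (intro ip_measurable[of _ "Suc n" _ n]) (simp_all add: oseq_coeff_0 c)
  show "(\<lambda>t. oa (\<mu> t) n) \<in> borel_measurable borel" "(\<lambda>t. ob (\<mu> t) n) \<in> borel_measurable borel"
    unfolding jacobi_a_def jacobi_b_def using ww pp xw by (auto intro: borel_measurable_divide)
qed

definition opoly :: "nat \<Rightarrow> 'a \<times> real \<Rightarrow> real" where
  "opoly l z = poly (oseq (\<mu> (fst z)) l) (snd z)"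

lemma opoly_measurable [measurable]: "opoly l \<in> borel_measurable (borel \<Otimes>\<^sub>M borel)"
proof -
  have "opoly l = (\<lambda>z. \<Sum>i\<le>l. coeff (oseq (\<mu> (fst z)) l) i * snd z ^ i)"
    unfolding opoly_def by (rule ext) (rule poly_eq_sum, rule oseq_coeff_0)
  moreover have [measurable]: "(\<lambda>t. coeff (oseq (\<mu> t) l) i) \<in> borel_measurable borel" for i
    using oseq_coeff_measurable by blast
  ultimately show ?thesis by simp
qed

lemma opoly_bound:
  assumes "\<Delta> \<in> rel_compact_borel"
  shows "\<exists>C\<ge>0. \<forall>t\<in>\<Delta>. AE s in \<mu> t. \<bar>opoly l (t, s)\<bar> \<le> C"
proof -
  obtain R where R: "R > 0" "\<forall>t\<in>\<Delta>. compact_prob_space (\<mu> t) R" using compact_prob_space_on[OF assms] by blast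
  then show ?thesis
    using compact_prob_space.oseq_bound
    by (intro exI[of _ "(1 + 2 * R + R\<^sup>2) ^ l"]) (auto simp: opoly_def)
qed

end

section \<open>The spaces indexed by multi-indices\<close>

text \<open>For orthogonality under iterated integrals: the two nonnegative integrals agree on each
  fibre, and this equality can be integrated over t without signed inner integrals.\<close>

lemma nn_integral_pos_eq_neg:
  fixes f :: "'x \<Rightarrow> real"
  assumes f: "integrable M f" "(\<integral>x. f x \<partial>M) = 0"
  shows "(\<integral>\<^sup>+x. ennreal (f x) \<partial>M) = (\<integral>\<^sup>+x. ennreal (- f x) \<partial>M)"
proof -
  have fin: "(\<integral>\<^sup>+x. ennreal (f x) \<partial>M) < \<infinity>" "(\<integral>\<^sup>+x. ennreal (- f x) \<partial>M) < \<infinity>"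
    using f(1) by (simp_all add: real_integrable_def less_top)
  have "enn2real (\<integral>\<^sup>+x. ennreal (f x) \<partial>M) = enn2real (\<integral>\<^sup>+x. ennreal (- f x) \<partial>M)"
    using real_lebesgue_integral_def[OF f(1)] f(2) by simp
  then have "ennreal (enn2real (\<integral>\<^sup>+x. ennreal (f x) \<partial>M)) = ennreal (enn2real (\<integral>\<^sup>+x. ennreal (- f x) \<partial>M))"
    by (rule arg_cong)
  then show ?thesis
    unfolding ennreal_enn2real[OF fin(1)[unfolded infinity_ennreal_def]]
      ennreal_enn2real[OF fin(2)[unfolded infinity_ennreal_def]] .
qed

context jacobi_field begin

abbreviation "wm \<equiv> weighted_measure \<sigma> \<mu>"

lemma weight_eq: "weight \<mu> l t = poly_ip (\<mu> t) (oseq (\<mu> t) l) (oseq (\<mu> t) l)"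
  by (simp add: weight_def poly_ip_def orth_polys_oseq power2_eq_square)

lemma weight_measurable [measurable]: "weight \<mu> l \<in> borel_measurable borel"
  using norm_measurable[of l] unfolding weight_eq[abs_def] .

lemma nn_opoly_sq: "(\<integral>\<^sup>+s. ennreal ((opoly l (t, s))\<^sup>2) \<partial>\<mu> t) = ennreal (weight \<mu> l t)"
proof -
  obtain R where "compact_prob_space (\<mu> t) R" using compact_prob_space_ex by blast
  then interpret compact_prob_space "\<mu> t" R .
  show ?thesis
    unfolding opoly_def weight_eq poly_ip_def power2_eq_square
    by (subst nn_integral_eq_integral) (simp_all add: poly_mult_integrable)
qed

lemma weight_bound:
  assumes "\<Delta> \<in> rel_compact_borel"
  shows "\<exists>C\<ge>0. \<forall>t\<in>\<Delta>. weight \<mu> l t \<le> C"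
proof -
  obtain C where C: "C \<ge> 0" "\<forall>t\<in>\<Delta>. AE s in \<mu> t. \<bar>opoly l (t, s)\<bar> \<le> C" using opoly_bound[OF assms] by blast
  have "weight \<mu> l t \<le> C\<^sup>2" if t: "t \<in> \<Delta>" for t
  proof -
    interpret prob_space "\<mu> t" by (rule prob_\<mu>)
    have "ennreal (weight \<mu> l t) \<le> (\<integral>\<^sup>+s. ennreal (C\<^sup>2) \<partial>\<mu> t)"
      unfolding nn_opoly_sq[symmetric]
    proof (rule nn_integral_mono_AE)
      have "AE s in \<mu> t. \<bar>opoly l (t, s)\<bar> \<le> C" using C t by blast
      then show "AE s in \<mu> t. ennreal ((opoly l (t, s))\<^sup>2) \<le> ennreal (C\<^sup>2)"
      proof eventually_elim
        case (elim s)
        then have "\<bar>opoly l (t, s)\<bar>\<^sup>2 \<le> C\<^sup>2" by (intro power_mono) auto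
        then show ?case by (simp add: ennreal_leI)
      qed
    qed
    also have "\<dots> = ennreal (C\<^sup>2)" using emeasure_space_1 by simp
    finally show ?thesis by (simp add: ennreal_le_iff)
  qed
  then show ?thesis by (intro exI[of _ "C\<^sup>2"]) simp
qed

lemma sets_wm [measurable_cong]: "sets (wm l) = sets borel"
  by (simp add: weighted_measure_def sets_\<sigma>)

lemma space_wm [simp]: "space (wm l) = UNIV"
  by (simp add: weighted_measure_def)

lemma borel_measurable_wm: "borel_measurable (wm l) = borel_measurable borel"
  by (rule measurable_cong_sets[OF sets_wm refl])

lemma nn_integral_wm:
  assumes "f \<in> borel_measurable borel"
  shows "(\<integral>\<^sup>+t. f t \<partial>wm l) = (\<integral>\<^sup>+t. f t * ennreal (weight \<mu> l t) \<partial>\<sigma>)"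
  unfolding weighted_measure_def
  by (subst nn_integral_density) (use assms in \<open>simp_all add: borel_measurable_\<sigma> mult.commute\<close>)

text \<open>Integrating out s turns the squared polynomial into the weight. This is the isometry for
  a single factor.\<close>

lemma nn_integral_opoly:
  assumes f: "f \<in> borel_measurable borel"
  shows "(\<integral>\<^sup>+z. f (fst z) * ennreal ((opoly l z)\<^sup>2) \<partial>N) = (\<integral>\<^sup>+t. f t \<partial>wm l)"
proof -
  note [measurable] = f
  have "(\<integral>\<^sup>+z. f (fst z) * ennreal ((opoly l z)\<^sup>2) \<partial>N) =
      (\<integral>\<^sup>+t. \<integral>\<^sup>+s. f t * ennreal ((opoly l (t, s))\<^sup>2) \<partial>\<mu> t \<partial>\<sigma>)"
    by (subst nn_integral_N) simp_all
  also have "\<dots> = (\<integral>\<^sup>+t. f t * ennreal (weight \<mu> l t) \<partial>\<sigma>)"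
    by (intro nn_integral_cong, subst nn_integral_cmult) (simp_all add: nn_opoly_sq)
  also have "\<dots> = (\<integral>\<^sup>+t. f t \<partial>wm l)"
    by (rule nn_integral_wm[OF f, symmetric])
  finally show ?thesis .
qed

lemma emeasure_wm_finite:
  assumes "\<Delta> \<in> rel_compact_borel"
  shows "emeasure (wm l) \<Delta> < \<infinity>"
proof -
  have d: "\<Delta> \<in> sets borel" "compact (closure \<Delta>)" using rel_compactD[OF assms] by auto
  obtain C where C: "C \<ge> 0" "\<forall>t\<in>\<Delta>. weight \<mu> l t \<le> C" using weight_bound[OF assms] by blast
  have "emeasure (wm l) \<Delta> = (\<integral>\<^sup>+t. indicator \<Delta> t \<partial>wm l)"
    using d by (subst nn_integral_indicator) (simp_all add: sets_wm)
  also have "\<dots> = (\<integral>\<^sup>+t. indicator \<Delta> t * ennreal (weight \<mu> l t) \<partial>\<sigma>)"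
    using d by (intro nn_integral_wm) simp
  also have "\<dots> \<le> (\<integral>\<^sup>+t. ennreal C * indicator \<Delta> t \<partial>\<sigma>)"
    using C by (intro nn_integral_mono) (auto simp: indicator_def ennreal_leI)
  also have "\<dots> = ennreal C * emeasure \<sigma> \<Delta>"
    using d sets_\<sigma> by (subst nn_integral_cmult_indicator) simp_all
  also have "\<dots> < \<infinity>"
    using \<sigma>_rel_compact[OF closure_subset d(2)] by (simp add: ennreal_mult_less_top)
  finally show ?thesis .
qed

lemma sigma_finite_wm: "sigma_finite_measure (wm l)"
proof -
  interpret sigma_finite_measure \<sigma> by (rule sigma_finite_\<sigma>)
  show ?thesis
    unfolding weighted_measure_def
    by (subst sigma_finite_iff_density_finite) (simp_all add: borel_measurable_\<sigma>)
qed

lemma emeasure_wm_point: "emeasure (wm l) {t} = 0"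
proof -
  have "emeasure (wm l) {t} = (\<integral>\<^sup>+u. indicator {t} u \<partial>wm l)"
    by (subst nn_integral_indicator) (simp_all add: sets_wm)
  also have "\<dots> = (\<integral>\<^sup>+u. indicator {t} u * ennreal (weight \<mu> l u) \<partial>\<sigma>)"
    by (intro nn_integral_wm) simp
  also have "\<dots> = (\<integral>\<^sup>+u. ennreal (weight \<mu> l t) * indicator {t} u \<partial>\<sigma>)"
    by (intro nn_integral_cong) (auto simp: indicator_def)
  also have "\<dots> = 0" using sets_\<sigma> by (subst nn_integral_cmult_indicator) (simp_all add: \<sigma>_point)
  finally show ?thesis .
qed

lemma slot_sqint:
  assumes f: "f \<in> sqint (wm l)"
  shows "(\<lambda>z. f (fst z) * opoly l z) \<in> sqint N"
proof -
  have [measurable]: "f \<in> borel_measurable borel"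
    using sqint_measurable[OF f] by (simp add: borel_measurable_wm)
  have "(\<integral>\<^sup>+z. ennreal ((f (fst z) * opoly l z)\<^sup>2) \<partial>N) = (\<integral>\<^sup>+z. ennreal ((f (fst z))\<^sup>2) * ennreal ((opoly l z)\<^sup>2) \<partial>N)"
    by (intro nn_integral_cong) (simp add: power_mult_distrib ennreal_mult)
  also have "\<dots> = (\<integral>\<^sup>+t. ennreal ((f t)\<^sup>2) \<partial>wm l)"
    by (rule nn_integral_opoly) measurable
  also have "\<dots> < \<infinity>"
    using sqint_integrable[OF f] by (simp add: integrable_iff_bounded)
  finally have "integrable N (\<lambda>z. (f (fst z) * opoly l z)\<^sup>2)"
    by (intro integrableI_nonneg) (simp_all add: borel_measurable_N)
  then show ?thesis by (simp add: sqint_def borel_measurable_N)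
qed

lemma slot_orthogonal:
  assumes f: "f \<in> sqint (wm l)" and g: "g \<in> sqint (wm m)" and lm: "l \<noteq> m"
  shows "(\<integral>z. (f (fst z) * opoly l z) * (g (fst z) * opoly m z) \<partial>N) = 0"
proof -
  have [measurable]: "f \<in> borel_measurable borel" "g \<in> borel_measurable borel"
    using sqint_measurable[OF f] sqint_measurable[OF g] by (simp_all add: borel_measurable_wm)
  let ?h = "\<lambda>z. (f (fst z) * opoly l z) * (g (fst z) * opoly m z)"
  have int: "integrable N ?h" by (intro sqint_mult_integrable slot_sqint f g)
  have "(\<integral>\<^sup>+z. ennreal (?h z) \<partial>N) = (\<integral>\<^sup>+t. \<integral>\<^sup>+s. ennreal (?h (t, s)) \<partial>\<mu> t \<partial>\<sigma>)"
    by (rule nn_integral_N) measurable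
  also have "\<dots> = (\<integral>\<^sup>+t. \<integral>\<^sup>+s. ennreal (- ?h (t, s)) \<partial>\<mu> t \<partial>\<sigma>)"
  proof (rule nn_integral_cong)
    fix t
    obtain R where "compact_prob_space (\<mu> t) R" using compact_prob_space_ex by blast
    then interpret compact_prob_space "\<mu> t" R .
    have h: "?h (t, s) = (f t * g t) * (poly (oseq (\<mu> t) l) s * poly (oseq (\<mu> t) m) s)" for s
      by (simp add: opoly_def)
    have "integrable (\<mu> t) (\<lambda>s. ?h (t, s))"
      unfolding h by (intro integrable_mult_right poly_mult_integrable)
    moreover have "(\<integral>s. ?h (t, s) \<partial>\<mu> t) = 0"
      unfolding h using oseq_orthogonal[of m l] lm by (simp add: poly_ip_def)
    ultimately show "(\<integral>\<^sup>+s. ennreal (?h (t, s)) \<partial>\<mu> t) = (\<integral>\<^sup>+s. ennreal (- ?h (t, s)) \<partial>\<mu> t)"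
      by (rule nn_integral_pos_eq_neg)
  qed
  also have "\<dots> = (\<integral>\<^sup>+z. ennreal (- ?h z) \<partial>N)"
    by (rule nn_integral_N[symmetric]) measurable
  finally show ?thesis
    using real_lebesgue_integral_def[OF int] by simp
qed

lemma slot_bounded_support:
  assumes [measurable]: "f \<in> borel_measurable borel" and K: "K \<in> rel_compact_borel"
    and B: "\<And>t. \<bar>f t\<bar> \<le> B" and supp: "\<And>t. t \<notin> K \<Longrightarrow> f t = 0"
  shows "f \<in> sqint (wm l)"
proof (rule sqint_bounded)
  show "indicator K \<in> sqint (wm l)"
    using rel_compactD[OF K] emeasure_wm_finite[OF K] by (intro sqint_indicator) (simp_all add: sets_wm)
  show "f \<in> borel_measurable (wm l)" by (simp add: borel_measurable_wm)
  show "AE t in wm l. \<bar>f t\<bar> \<le> B * \<bar>indicator K t\<bar>"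
    using B supp by (intro AE_I2) (auto simp: indicator_def)
qed

lemma slots_total:
  "total (l2 N) (ae_class N ` {\<lambda>z. f (fst z) * opoly l z | f l. f \<in> sqint (wm l)})"
  (is "total _ (_ ` ?G)")
proof (rule totalI)
  show "ae_class N ` ?G \<subseteq> carr (l2 N)" using slot_sqint by auto
  fix S v assume S: "closed_subspace (l2 N) S" "ae_class N ` ?G \<subseteq> S" and v: "v \<in> carr (l2 N)"
  interpret W: l2_subspace N S by unfold_locales (rule S)
  \<comment> \<open>The claim covers all f and l at once: the recurrence raises and lowers the
    degree and multiplies f by Jacobi coefficients, which are bounded over K.\<close>
  have pow: "(\<lambda>z. f (fst z) * snd z ^ k * opoly l z) \<in> W.funs"
    if f [measurable]: "f \<in> borel_measurable borel" and K: "K \<in> rel_compact_borel"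
      and B: "\<And>t. \<bar>f t\<bar> \<le> B" and supp: "\<And>t. t \<notin> K \<Longrightarrow> f t = 0" for f K B k l
    using f B supp
  proof (induction k arbitrary: f l B)
    case 0
    have "f \<in> sqint (wm l)" by (rule slot_bounded_support[OF 0(1) K 0(2,3)])
    then have "(\<lambda>z. f (fst z) * opoly l z) \<in> ?G" "(\<lambda>z. f (fst z) * opoly l z) \<in> sqint N"
      using slot_sqint by auto
    then show ?case using S(2) by (auto simp: W.funs_def)
  next
    case (Suc k)
    note [measurable] = Suc.prems(1)
    obtain R where R: "R > 0" "\<forall>t\<in>K. compact_prob_space (\<mu> t) R" using compact_prob_space_on[OF K] by blast
    have B0: "B \<ge> 0" using Suc.prems(2)[of undefined] by linarith
    have [measurable]: "(\<lambda>t. oa (\<mu> t) l) \<in> borel_measurable borel" "(\<lambda>t. ob (\<mu> t) l) \<in> borel_measurable borel"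
      using oa_measurable ob_measurable by auto
    have fa: "\<bar>f t * oa (\<mu> t) l\<bar> \<le> B * R" "\<bar>f t * ob (\<mu> t) l\<bar> \<le> B * R\<^sup>2" for t
    proof -
      have "\<bar>f t * oa (\<mu> t) l\<bar> \<le> B * R \<and> \<bar>f t * ob (\<mu> t) l\<bar> \<le> B * R\<^sup>2"
      proof (cases "t \<in> K")
        case True
        then interpret compact_prob_space "\<mu> t" R using R by blast
        show ?thesis
          unfolding abs_mult using Suc.prems(2)[of t] oa_bound[of l] ob_bound[of l] B0
          by (intro conjI mult_mono) auto
      qed (use Suc.prems(3) B0 R in simp)
      then show "\<bar>f t * oa (\<mu> t) l\<bar> \<le> B * R" "\<bar>f t * ob (\<mu> t) l\<bar> \<le> B * R\<^sup>2" by auto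
    qed
    have 1: "(\<lambda>z. f (fst z) * snd z ^ k * opoly (Suc l) z) \<in> W.funs"
      by (rule Suc.IH[OF Suc.prems])
    have 2: "(\<lambda>z. (f (fst z) * oa (\<mu> (fst z)) l) * snd z ^ k * opoly l z) \<in> W.funs"
      by (rule Suc.IH[of "\<lambda>t. f t * oa (\<mu> t) l", OF _ fa(1)]) (measurable, simp add: Suc.prems(3))
    \<comment> \<open>Written with \<open>oprev\<close> because for l = 0 there is no polynomial of
      degree l - 1.\<close>
    have 3: "(\<lambda>z. (f (fst z) * ob (\<mu> (fst z)) l) * snd z ^ k * poly (oprev (\<mu> (fst z)) l) (snd z)) \<in> W.funs"
    proof (cases l)
      case 0
      then show ?thesis using W.funs_zero by (simp add: oseq_simps(2))
    next
      case (Suc m)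
      have "(\<lambda>z. (f (fst z) * ob (\<mu> (fst z)) l) * snd z ^ k * opoly m z) \<in> W.funs"
        by (rule Suc.IH[of "\<lambda>t. f t * ob (\<mu> t) l", OF _ fa(2)]) (measurable, simp add: Suc.prems(3))
      then show ?thesis unfolding opoly_def Suc oseq_simps(3) .
    qed
    show ?case
    proof (rule W.funs_AE[OF W.funs_add[OF 1 W.funs_add[OF 2 3]]])
      show m: "(\<lambda>z. f (fst z) * snd z ^ Suc k * opoly l z) \<in> borel_measurable N"
        unfolding borel_measurable_N by measurable
      let ?r = "\<lambda>z. f (fst z) * snd z ^ k * opoly (Suc l) z + (f (fst z) * oa (\<mu> (fst z)) l * snd z ^ k * opoly l z +
        f (fst z) * ob (\<mu> (fst z)) l * snd z ^ k * poly (oprev (\<mu> (fst z)) l) (snd z))"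
      have r: "?r \<in> borel_measurable N"
        using W.funs_sqint[OF W.funs_add[OF 1 W.funs_add[OF 2 3]]] by (rule sqint_measurable)
      show "AE z in N. f (fst z) * snd z ^ Suc k * opoly l z = ?r z"
      proof (rule AE_N)
        have "{z \<in> space N. f (fst z) * snd z ^ Suc k * opoly l z = ?r z} \<in> sets N"
          by (rule measurable_equality_set[OF m r])
        then show "{z. f (fst z) * snd z ^ Suc k * opoly l z = ?r z} \<in> sets (borel \<Otimes>\<^sub>M borel)"
          by (simp add: sets_N)
        fix t
        show "AE s in \<mu> t. f (fst (t, s)) * snd (t, s) ^ Suc k * opoly l (t, s) = ?r (t, s)"
        proof -
          obtain R where "compact_prob_space (\<mu> t) R" using compact_prob_space_ex by blast
          then interpret compact_prob_space "\<mu> t" R .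
          show ?thesis
            using recurrence_AE[of l]
          proof eventually_elim
            case (elim s)
            have "f t * s ^ Suc k * poly (oseq (\<mu> t) l) s = f t * s ^ k * (s * poly (oseq (\<mu> t) l) s)"
              by simp
            also have "\<dots> = ?r (t, s)" unfolding elim by (simp add: opoly_def algebra_simps)
            finally show ?case by (simp add: opoly_def)
          qed
        qed
      qed
    qed
  qed
  have "S = carr (l2 N)"
  proof (rule l2_N_subspace_eq[OF S(1)])
    fix K :: "'a set" and \<phi> :: "real \<Rightarrow> real" and B
    assume K: "compact K" and \<phi>: "continuous_on UNIV \<phi>" "\<And>s. \<bar>\<phi> s\<bar> \<le> B"
    note Kr = compact_rel_compact[OF K]
    have Ks [measurable]: "K \<in> sets borel" using rel_compactD[OF Kr] by simp
    have [measurable]: "\<phi> \<in> borel_measurable borel" using \<phi>(1) by (rule borel_measurable_continuous_onI)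
    obtain R where R: "R > 0" "\<forall>t\<in>K. AE s in \<mu> t. s \<in> {-R..R}" using bounded_\<mu>[OF Kr] by blast
    \<comment> \<open>Weierstrass approximation on an interval that carries \<mu> t for all t in
      K.\<close>
    have "\<exists>a m. \<forall>s\<in>{-R..R}. \<bar>\<phi> s - (\<Sum>i\<le>m. a i * s ^ i)\<bar> < 1 / Suc n" for n :: nat
    proof -
      obtain g where "real_polynomial_function g" "\<And>s. s \<in> {-R..R} \<Longrightarrow> \<bar>\<phi> s - g s\<bar> < 1 / Suc n"
        using Stone_Weierstrass_real_polynomial_function[of "{-R..R}" \<phi> "1 / Suc n"]
          continuous_on_subset[OF \<phi>(1)] by auto
      then show ?thesis unfolding real_polynomial_function_iff_sum by blast
    qed
    then obtain a m where a: "\<And>n::nat. \<forall>s\<in>{-R..R}. \<bar>\<phi> s - (\<Sum>i\<le>m n. a n i * s ^ i)\<bar> < 1 / Suc n"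
      by metis
    define g where "g n s = (\<Sum>i\<le>m n. a n i * s ^ i)" for n s
    have aeR: "AE z in N. fst z \<in> K \<longrightarrow> snd z \<in> {-R..R}"
    proof (rule AE_N)
      have "{z \<in> space (borel \<Otimes>\<^sub>M borel). fst z \<in> K \<longrightarrow> snd z \<in> {-R..R}} \<in> sets (borel \<Otimes>\<^sub>M borel)"
        by measurable
      then show "{z. fst z \<in> K \<longrightarrow> snd z \<in> {-R..R}} \<in> sets (borel \<Otimes>\<^sub>M borel)"
        by (simp add: space_pair_measure)
      show "AE s in \<mu> t. fst (t, s) \<in> K \<longrightarrow> snd (t, s) \<in> {-R..R}" for t
        using R(2) by (cases "t \<in> K") auto
    qed
    have "(\<lambda>z. indicator K (fst z) * \<phi> (snd z)) \<in> W.funs"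
    proof (rule W.funs_dominated_limit[of "\<lambda>n z. indicator K (fst z) * g n (snd z)"])
      show "(\<lambda>z. indicator K (fst z) * g n (snd z)) \<in> W.funs" for n
      proof -
        \<comment> \<open>\<open>opoly 0\<close> is the constant 1, so \<open>pow\<close> provides
          the monomials in s themselves.\<close>
        have "(\<lambda>z. \<Sum>i\<le>m n. a n i * (indicator K (fst z) * snd z ^ i * opoly 0 z)) \<in> W.funs"
          by (intro W.funs_sum W.funs_scale pow[OF _ Kr, of _ 1]) (auto simp: indicator_def)
        also have "(\<lambda>z. \<Sum>i\<le>m n. a n i * (indicator K (fst z) * snd z ^ i * opoly 0 z)) =
            (\<lambda>z. indicator K (fst z) * g n (snd z))"
          by (simp add: g_def opoly_def oseq_simps(1) sum_distrib_left mult_ac)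
        finally show ?thesis .
      qed
      \<comment> \<open>Over K the approximating polynomials differ from \<phi> by less than 1
        almost everywhere, hence are bounded by B + 1.\<close>
      show "(\<lambda>z. (B + 1) * indicator (K \<times> UNIV) z) \<in> sqint N"
        by (intro sqint_scale sqint_cylinder Kr)
      show "(\<lambda>z. indicator K (fst z) * \<phi> (snd z)) \<in> borel_measurable N"
        unfolding borel_measurable_N by measurable
      show "AE z in N. \<bar>indicator K (fst z) * g n (snd z)\<bar> \<le> \<bar>(B + 1) * indicator (K \<times> UNIV) z\<bar>" for n
        using aeR
      proof eventually_elim
        case (elim z)
        show ?case
        proof (cases "fst z \<in> K")
          case True
          then have "\<bar>\<phi> (snd z) - g n (snd z)\<bar> < 1 / Suc n" using a[of n] elim by (simp add: g_def)
          moreover have "1 / real (Suc n) \<le> 1" by simp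
          ultimately have "\<bar>g n (snd z)\<bar> \<le> B + 1" using \<phi>(2)[of "snd z"] by linarith
          then show ?thesis using True by (simp add: indicator_def mem_Times_iff)
        qed simp
      qed
      show "AE z in N. (\<lambda>n. indicator K (fst z) * g n (snd z)) \<longlonglongrightarrow> indicator K (fst z) * \<phi> (snd z)"
        using aeR
      proof eventually_elim
        case (elim z)
        show ?case
        proof (cases "fst z \<in> K")
          case True
          have "(\<lambda>n. g n (snd z) - \<phi> (snd z)) \<longlonglongrightarrow> 0"
          proof (rule Lim_null_comparison)
            have "\<bar>g n (snd z) - \<phi> (snd z)\<bar> \<le> 1 / Suc n" for n
              using a[of n] elim True by (simp add: g_def abs_minus_commute less_imp_le)
            then show "\<forall>\<^sub>F n in sequentially. norm (g n (snd z) - \<phi> (snd z)) \<le> 1 / Suc n" by simp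
          qed (use LIMSEQ_inverse_real_of_nat in \<open>simp add: inverse_eq_divide\<close>)
          then have "(\<lambda>n. g n (snd z)) \<longlonglongrightarrow> \<phi> (snd z)" by (simp add: LIM_zero_iff)
          then show ?thesis by (intro tendsto_mult_left)
        qed simp
      qed
    qed
    then show "ae_class N (\<lambda>z. indicator K (fst z) * \<phi> (snd z)) \<in> S" by (simp add: W.funs_def)
  qed
  then show "v \<in> S" using v by simp
qed

section \<open>The isometries into the Fock space\<close>

definition slot_proj :: "nat \<Rightarrow> (nat \<Rightarrow> 'a \<times> real) \<Rightarrow> nat \<Rightarrow> 'a" where
  "slot_proj n z = (\<lambda>j\<in>{..<n}. fst (z j))"

definition slot_fun :: "nat list \<Rightarrow> ((nat \<Rightarrow> 'a) \<Rightarrow> real) \<Rightarrow> (nat \<Rightarrow> 'a \<times> real) \<Rightarrow> real" where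
  "slot_fun l f z = f (slot_proj (length l) z) * (\<Prod>j<length l. opoly (l ! j) (z j))"

abbreviation "im \<equiv> index_measure \<sigma> \<mu>"

lemma product_sigma_finite_wm: "product_sigma_finite (\<lambda>j. wm (l ! j))"
  by (rule product_sigma_finite.intro) (rule sigma_finite_wm)

lemma slot_proj_measurable:
  "slot_proj (length l) \<in> measurable (power_measure (length l) N) (im l)"
  unfolding slot_proj_def power_measure_def index_measure_def
proof (rule measurable_restrict)
  fix j assume "j \<in> {..<length l}"
  then have "(\<lambda>z. z j) \<in> measurable (PiM {..<length l} (\<lambda>_. N)) N" by (rule measurable_component_singleton)
  moreover have "fst \<in> measurable N (wm (l ! j))"
    using measurable_fst[of "borel :: 'a measure" "borel :: real measure"]
    by (simp add: measurable_cong_sets[OF sets_N sets_wm])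
  ultimately show "(\<lambda>z. fst (z j)) \<in> measurable (PiM {..<length l} (\<lambda>_. N)) (wm (l ! j))"
    by (rule measurable_compose)
qed

lemma opoly_prod_measurable [measurable]:
  "(\<lambda>z. \<Prod>j<length l. opoly (l ! j) (z j)) \<in> borel_measurable (power_measure (length l) N)"
  unfolding power_measure_def by (rule P.prod_measurable) measurable

text \<open>The weights in \<open>im l\<close> are what remains of the squared polynomials after the
  variables s are integrated out. Stated as an image of measures and checked on rectangles, this
  yields the isometry for all functions f at once and not only for products.\<close>

lemma index_measure_distr:
  "distr (density (power_measure (length l) N) (\<lambda>z. ennreal ((\<Prod>j<length l. opoly (l ! j) (z j))\<^sup>2)))
    (im l) (slot_proj (length l)) = im l" (is "distr ?D _ _ = _")
proof -
  interpret I: product_sigma_finite "\<lambda>j. wm (l ! j)" by (rule product_sigma_finite_wm)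
  have Tm: "slot_proj (length l) \<in> measurable ?D (im l)" using slot_proj_measurable by simp
  show ?thesis
    unfolding index_measure_def
  proof (rule I.PiM_eqI)
    fix A assume A: "\<And>j. j \<in> {..<length l} \<Longrightarrow> A j \<in> sets (wm (l ! j))"
    let ?A = "PiE {..<length l} A"
    have As: "?A \<in> sets (im l)" unfolding index_measure_def using A by (intro sets_PiM_I_finite) auto
    have sp: "slot_proj (length l) -` ?A \<inter> space (power_measure (length l) N) \<in> sets (power_measure (length l) N)"
      by (rule measurable_sets[OF slot_proj_measurable As])
    have "emeasure (distr ?D (im l) (slot_proj (length l))) ?A =
        emeasure ?D (slot_proj (length l) -` ?A \<inter> space (power_measure (length l) N))"
      using emeasure_distr[OF Tm As] by simp
    also have "\<dots> = (\<integral>\<^sup>+z. ennreal ((\<Prod>j<length l. opoly (l ! j) (z j))\<^sup>2) *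
        indicator (slot_proj (length l) -` ?A \<inter> space (power_measure (length l) N)) z \<partial>power_measure (length l) N)"
      using sp by (intro emeasure_density measurable_compose[OF borel_measurable_power[OF opoly_prod_measurable] measurable_ennreal])
    also have "\<dots> = (\<integral>\<^sup>+z. (\<Prod>j<length l. indicator (A j) (fst (z j)) * ennreal ((opoly (l ! j) (z j))\<^sup>2))
        \<partial>power_measure (length l) N)"
    proof (rule nn_integral_cong)
      fix z assume z: "z \<in> space (power_measure (length l) N)"
      have "(\<Prod>j<length l. indicator (A j) (fst (z j)) :: ennreal) =
          indicator (slot_proj (length l) -` ?A \<inter> space (power_measure (length l) N)) z"
      proof (cases "\<forall>j<length l. fst (z j) \<in> A j")
        case True
        then show ?thesis using z by (auto simp: slot_proj_def indicator_def)
      next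
        case False
        then obtain j where j: "j < length l" "fst (z j) \<notin> A j" by blast
        then have "(\<Prod>j<length l. indicator (A j) (fst (z j)) :: ennreal) = 0"
          by (intro prod_zero bexI[of _ j]) simp_all
        moreover have "slot_proj (length l) z \<notin> ?A"
          using j by (auto simp: slot_proj_def PiE_iff)
        ultimately show ?thesis by simp
      qed
      then show "ennreal ((\<Prod>j<length l. opoly (l ! j) (z j))\<^sup>2) *
          indicator (slot_proj (length l) -` ?A \<inter> space (power_measure (length l) N)) z =
          (\<Prod>j<length l. indicator (A j) (fst (z j)) * ennreal ((opoly (l ! j) (z j))\<^sup>2))"
        by (simp add: prod.distrib prod_ennreal prod_power_distrib mult.commute)
    qed
    also have "\<dots> = (\<Prod>j<length l. \<integral>\<^sup>+z. indicator (A j) (fst z) * ennreal ((opoly (l ! j) z)\<^sup>2) \<partial>N)"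
      unfolding power_measure_def
    proof (rule P.product_nn_integral_prod)
      fix j assume "j \<in> {..<length l}"
      then have [measurable]: "A j \<in> sets borel" using A by (auto simp: sets_wm)
      show "(\<lambda>z. indicator (A j) (fst z) * ennreal ((opoly (l ! j) z)\<^sup>2)) \<in> borel_measurable N"
        unfolding borel_measurable_N by measurable
    qed simp
    also have "\<dots> = (\<Prod>j<length l. emeasure (wm (l ! j)) (A j))"
    proof (rule prod.cong[OF refl])
      fix j assume "j \<in> {..<length l}"
      then have "A j \<in> sets borel" using A by (auto simp: sets_wm)
      then show "(\<integral>\<^sup>+z. indicator (A j) (fst z) * ennreal ((opoly (l ! j) z)\<^sup>2) \<partial>N) = emeasure (wm (l ! j)) (A j)"
        by (subst nn_integral_opoly) (simp_all add: sets_wm)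
    qed
    finally show "emeasure (distr ?D (PiM {..<length l} (\<lambda>j. wm (l ! j))) (slot_proj (length l))) ?A =
        (\<Prod>j\<in>{..<length l}. emeasure (wm (l ! j)) (A j))"
      by (simp add: index_measure_def)
  qed simp_all
qed

lemma slot_fun_integral:
  assumes h: "h \<in> borel_measurable (im l)"
  shows "integrable (power_measure (length l) N) (\<lambda>z. (\<Prod>j<length l. opoly (l ! j) (z j))\<^sup>2 * h (slot_proj (length l) z))
      \<longleftrightarrow> integrable (im l) h"
    and "(\<integral>z. (\<Prod>j<length l. opoly (l ! j) (z j))\<^sup>2 * h (slot_proj (length l) z) \<partial>power_measure (length l) N) =
      (\<integral>t. h t \<partial>im l)"
proof -
  let ?w = "\<lambda>z. (\<Prod>j<length l. opoly (l ! j) (z j))\<^sup>2"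
  let ?D = "density (power_measure (length l) N) (\<lambda>z. ennreal (?w z))"
  have Tm: "slot_proj (length l) \<in> measurable ?D (im l)" using slot_proj_measurable by simp
  have hT: "(\<lambda>z. h (slot_proj (length l) z)) \<in> borel_measurable (power_measure (length l) N)"
    by (rule measurable_compose[OF slot_proj_measurable h])
  have w: "?w \<in> borel_measurable (power_measure (length l) N)"
    by (rule borel_measurable_power[OF opoly_prod_measurable])
  show "integrable (power_measure (length l) N) (\<lambda>z. ?w z * h (slot_proj (length l) z)) \<longleftrightarrow> integrable (im l) h"
    using integrable_distr_eq[OF Tm h] integrable_density[OF hT w] unfolding index_measure_distr by simp
  show "(\<integral>z. ?w z * h (slot_proj (length l) z) \<partial>power_measure (length l) N) = (\<integral>t. h t \<partial>im l)"
    using integral_distr[OF Tm h] integral_density[OF hT w] unfolding index_measure_distr by simp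
qed

lemma slot_fun_sqint:
  assumes f: "f \<in> sqint (im l)"
  shows "slot_fun l f \<in> sqint (power_measure (length l) N)"
proof -
  have m: "f \<in> borel_measurable (im l)" by (rule sqint_measurable[OF f])
  then have "(\<lambda>t. (f t)\<^sup>2) \<in> borel_measurable (im l)" by measurable
  then have "integrable (power_measure (length l) N) (\<lambda>z. (slot_fun l f z)\<^sup>2)"
    using slot_fun_integral(1)[of "\<lambda>t. (f t)\<^sup>2" l] sqint_integrable[OF f]
    by (simp add: slot_fun_def power_mult_distrib mult.commute)
  moreover have "slot_fun l f \<in> borel_measurable (power_measure (length l) N)"
    unfolding slot_fun_def using measurable_compose[OF slot_proj_measurable m] by measurable
  ultimately show ?thesis by (simp add: sqint_def)
qed

lemma slot_fun_inner:
  assumes f: "f \<in> sqint (im l)" and g: "g \<in> sqint (im l)"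
  shows "(\<integral>z. slot_fun l f z * slot_fun l g z \<partial>power_measure (length l) N) = (\<integral>t. f t * g t \<partial>im l)"
  using slot_fun_integral(2)[OF sqint_mult_measurable[OF f g]]
  by (simp add: slot_fun_def power2_eq_square mult_ac)

definition slot_map :: "nat list \<Rightarrow> ((nat \<Rightarrow> 'a) \<Rightarrow> real) set \<Rightarrow> ('a \<times> real) fock_vec" where
  "slot_map l a = fock_embed N (length l) (ae_class (power_measure (length l) N) (slot_fun l (rep a)))"

lemma index_L2_eq: "index_L2 \<sigma> \<mu> l = l2 (im l)"
  by (simp add: index_L2_def)

lemma slot_map_conformal:
  assumes "l \<in> multi_indices"
  shows "conformal (index_L2 \<sigma> \<mu> l) F 1 (slot_map l)"
proof -
  have ge: "length l \<ge> 1" using assms by (intro length_ge_1) (simp add: multi_indices_def)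
  show ?thesis
    unfolding conformal_def index_L2_eq
  proof (intro conjI ballI funcsetI)
    fix a b assume ab: "a \<in> carr (l2 (im l))" "b \<in> carr (l2 (im l))"
    note r = l2_rep(1)[OF ab(1)] l2_rep(1)[OF ab(2)]
    have "vinner F (slot_map l a) (slot_map l b) = (\<integral>t. rep a t * rep b t \<partial>im l)"
      using ge slot_fun_sqint[OF r(1)] slot_fun_sqint[OF r(2)] slot_fun_inner[OF r]
      by (simp add: slot_map_def inner_fock_embed l2_inner)
    also have "\<dots> = vinner (l2 (im l)) a b"
      using l2_inner[OF r] l2_rep(2)[OF ab(1)] l2_rep(2)[OF ab(2)] by simp
    finally show "vinner F (slot_map l a) (slot_map l b) = 1 * vinner (l2 (im l)) a b" by simp
  next
    fix a assume a: "a \<in> carr (l2 (im l))"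
    show "slot_map l a \<in> carr F"
      unfolding slot_map_def using ge slot_fun_sqint[OF l2_rep(1)[OF a]] by (intro fock_embed_closed ae_class_closed)
  qed simp
qed

text \<open>\<open>slot_map\<close> picks a representative. By \<open>slot_fun_inner\<close> the
  distance between the images of two representatives equals the distance between their classes,
  which is 0.\<close>

lemma slot_map_class:
  assumes f: "f \<in> sqint (im l)" and l: "l \<in> multi_indices"
  shows "slot_map l (ae_class (im l) f) = fock_embed N (length l) (ae_class (power_measure (length l) N) (slot_fun l f))"
proof -
  let ?P = "power_measure (length l) N"
  have a: "ae_class (im l) f \<in> carr (l2 (im l))" using f by simp
  note r = l2_rep(1)[OF a] and rf = l2_rep(2)[OF a]
  interpret P: inner_product_space "l2 ?P" by (rule l2_inner_product_space)
  interpret I: inner_product_space "l2 (im l)" by (rule l2_inner_product_space)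
  have "(vdist (l2 ?P) (ae_class ?P (slot_fun l (rep (ae_class (im l) f)))) (ae_class ?P (slot_fun l f)))\<^sup>2 =
      (vdist (l2 (im l)) (ae_class (im l) (rep (ae_class (im l) f))) (ae_class (im l) f))\<^sup>2"
    using f r slot_fun_sqint[OF r] slot_fun_sqint[OF f]
    by (subst P.dist_sq, simp, simp, subst I.dist_sq, simp, simp) (simp add: l2_inner slot_fun_inner)
  also have "\<dots> = 0" using rf a by simp
  finally have "ae_class ?P (slot_fun l (rep (ae_class (im l) f))) = ae_class ?P (slot_fun l f)"
    using P.dist_0_imp_eq slot_fun_sqint[OF r] slot_fun_sqint[OF f] by simp
  then show ?thesis by (simp add: slot_map_def)
qed

lemma fock_subspace_eq:
  assumes l: "l \<in> multi_indices"
  shows "fock_subspace \<sigma> \<mu> l = slot_map l ` carr (index_L2 \<sigma> \<mu> l)"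
proof -
  have "(\<lambda>z. f (\<lambda>j\<in>{..<length l}. fst (z j)) * (\<Prod>j<length l. poly (orth_polys (\<mu> (fst (z j))) (l ! j)) (snd (z j)))) =
      slot_fun l f" for f
    by (simp add: slot_fun_def slot_proj_def opoly_def orth_polys_oseq fun_eq_iff)
  then have "fock_subspace \<sigma> \<mu> l = (\<lambda>f. fock_embed N (length l) (ae_class (power_measure (length l) N) (slot_fun l f)))
      ` sqint (im l)"
    unfolding fock_subspace_def by (simp add: Let_def)
  also have "\<dots> = (\<lambda>f. slot_map l (ae_class (im l) f)) ` sqint (im l)"
    by (rule image_cong[OF refl]) (simp add: slot_map_class l)
  also have "\<dots> = slot_map l ` carr (index_L2 \<sigma> \<mu> l)"
    by (simp add: index_L2_eq l2_def image_image)
  finally show ?thesis .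
qed

lemma slot_map_tensor:
  assumes l: "l \<in> multi_indices" and f: "\<And>j. j < length l \<Longrightarrow> f j \<in> sqint (wm (l ! j))"
  shows "slot_map l (ae_class (im l) (\<lambda>t. \<Prod>j<length l. f j (t j))) =
    tensor N (map (\<lambda>j z. f j (fst z) * opoly (l ! j) z) [0..<length l])"
proof -
  interpret I: product_sigma_finite "\<lambda>j. wm (l ! j)" by (rule product_sigma_finite_wm)
  have "(\<lambda>t. \<Prod>j<length l. f j (t j)) \<in> sqint (im l)"
    unfolding index_measure_def by (rule I.prod_sqint) (use f in auto)
  moreover have "slot_fun l (\<lambda>t. \<Prod>j<length l. f j (t j)) =
      tens (map (\<lambda>j z. f j (fst z) * opoly (l ! j) z) [0..<length l])"
    by (auto simp: slot_fun_def slot_proj_def tens_def prod.distrib[symmetric] fun_eq_iff intro!: prod.cong)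
  moreover have "l \<noteq> []" using l by (simp add: multi_indices_def)
  ultimately show ?thesis by (simp add: slot_map_class l tensor_eq)
qed

lemma slot_tensors_total:
  "total (l2 (im l)) {ae_class (im l) (\<lambda>t. \<Prod>j<length l. f j (t j)) | f. \<forall>j<length l. f j \<in> sqint (wm (l ! j))}"
proof -
  interpret I: product_sigma_finite "\<lambda>j. wm (l ! j)" by (rule product_sigma_finite_wm)
  show ?thesis
    using I.tensors_total[of "{..<length l}"] unfolding index_measure_def Ball_def lessThan_iff by simp
qed

text \<open>Multi-indices of different lengths belong to different levels of the Fock space. If the
  lengths agree, some coordinate j has different degrees, and its factor in the inner product of two
  tensors is 0. Totality of the tensors extends this in one argument and then in the other.\<close>

lemma slot_map_orthogonal:
  assumes l: "l \<in> multi_indices" and m: "m \<in> multi_indices" and lm: "l \<noteq> m"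
    and a: "a \<in> carr (index_L2 \<sigma> \<mu> l)" and b: "b \<in> carr (index_L2 \<sigma> \<mu> m)"
  shows "vinner F (slot_map l a) (slot_map m b) = 0"
proof (cases "length l = length m")
  case False
  have ge: "length l \<ge> 1" "length m \<ge> 1" using l m by (auto simp: multi_indices_def length_ge_1)
  then show ?thesis
    using False slot_fun_sqint[OF l2_rep(1), of a l] slot_fun_sqint[OF l2_rep(1), of b m] a b
    by (simp add: slot_map_def inner_fock_embed index_L2_eq)
next
  case True
  let ?T = "\<lambda>l. {ae_class (im l) (\<lambda>t. \<Prod>j<length l. f j (t j)) | f. \<forall>j<length l. f j \<in> sqint (wm (l ! j))}"
  have ips: "inner_product_space (index_L2 \<sigma> \<mu> k)" for k
    unfolding index_L2_eq by (rule l2_inner_product_space)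
  have Sc: "slot_map l a \<in> carr F" "slot_map m b \<in> carr F" if "a \<in> carr (index_L2 \<sigma> \<mu> l)" "b \<in> carr (index_L2 \<sigma> \<mu> m)" for a b
    using that conformal_closed[OF slot_map_conformal[OF l]] conformal_closed[OF slot_map_conformal[OF m]] by auto
  have tens: "vinner F (slot_map l u) (slot_map m v) = 0" if uv: "u \<in> ?T l" "v \<in> ?T m" for u v
  proof -
    obtain f where f: "u = ae_class (im l) (\<lambda>t. \<Prod>j<length l. f j (t j))" "\<forall>j<length l. f j \<in> sqint (wm (l ! j))"
      using uv(1) by blast
    obtain g where g: "v = ae_class (im m) (\<lambda>t. \<Prod>j<length m. g j (t j))" "\<forall>j<length m. g j \<in> sqint (wm (m ! j))"
      using uv(2) by blast
    obtain j where j: "j < length l" "l ! j \<noteq> m ! j" using lm True nth_equalityI by blast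
    let ?F = "map (\<lambda>j z. f j (fst z) * opoly (l ! j) z) [0..<length l]"
    let ?G = "map (\<lambda>j z. g j (fst z) * opoly (m ! j) z) [0..<length m]"
    have FG: "?F \<in> lists (sqint N)" "?G \<in> lists (sqint N)"
      using slot_sqint[of "f _" "l ! _"] slot_sqint[of "g _" "m ! _"] f(2) g(2) by auto
    have "vinner F (slot_map l u) (slot_map m v) = tensor_inner N ?F ?G"
      unfolding f(1) g(1) using slot_map_tensor[OF l, of f] slot_map_tensor[OF m, of g] f(2) g(2)
      by (simp only: inner_tensor[OF FG])
    also have "\<dots> = (\<Prod>j<length ?F. \<integral>z. (?F ! j) z * (?G ! j) z \<partial>N)"
      using True by (intro tensor_inner_prod) simp
    also have "\<dots> = 0"
    proof (rule prod_zero)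
      show "\<exists>j\<in>{..<length ?F}. (\<integral>z. (?F ! j) z * (?G ! j) z \<partial>N) = 0"
        using j True f(2) g(2) slot_orthogonal[of "f j" "l ! j" "g j" "m ! j"]
        by (intro bexI[of _ j]) simp_all
    qed simp
    finally show ?thesis .
  qed
  have step1: "vinner F (slot_map l a) (slot_map m v) = 0" if v: "v \<in> ?T m" and a: "a \<in> carr (index_L2 \<sigma> \<mu> l)" for a v
  proof -
    have vc: "v \<in> carr (index_L2 \<sigma> \<mu> m)" using v slot_tensors_total[of m] by (auto simp: total_def index_L2_eq)
    have "a \<in> {a \<in> carr (index_L2 \<sigma> \<mu> l). slot_map l a \<in> {w \<in> carr F. \<forall>z\<in>{slot_map m v}. vinner F w z = 0}}"
    proof (rule totalD[OF slot_tensors_total[of l, folded index_L2_eq] _ _ a])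
      show "closed_subspace (index_L2 \<sigma> \<mu> l) {a \<in> carr (index_L2 \<sigma> \<mu> l). slot_map l a \<in> {w \<in> carr F. \<forall>z\<in>{slot_map m v}. vinner F w z = 0}}"
        by (rule closed_subspace_vimage[OF conformal_bounded[OF slot_map_conformal[OF l] ips F.inner_product_space_axioms]
            ips F.inner_product_space_axioms F.closed_subspace_orthogonal]) (use Sc[OF a vc] in simp)
      show "?T l \<subseteq> {a \<in> carr (index_L2 \<sigma> \<mu> l). slot_map l a \<in> {w \<in> carr F. \<forall>z\<in>{slot_map m v}. vinner F w z = 0}}"
        using tens[OF _ v] Sc(1)[OF _ vc] slot_tensors_total[of l] by (auto simp: total_def index_L2_eq)
    qed
    then show ?thesis by simp
  qed
  have "b \<in> {b \<in> carr (index_L2 \<sigma> \<mu> m). slot_map m b \<in> {w \<in> carr F. \<forall>z\<in>{slot_map l a}. vinner F w z = 0}}"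
  proof (rule totalD[OF slot_tensors_total[of m, folded index_L2_eq] _ _ b])
    show "closed_subspace (index_L2 \<sigma> \<mu> m) {b \<in> carr (index_L2 \<sigma> \<mu> m). slot_map m b \<in> {w \<in> carr F. \<forall>z\<in>{slot_map l a}. vinner F w z = 0}}"
      by (rule closed_subspace_vimage[OF conformal_bounded[OF slot_map_conformal[OF m] ips F.inner_product_space_axioms]
          ips F.inner_product_space_axioms F.closed_subspace_orthogonal]) (use Sc[OF a b] in simp)
    show "?T m \<subseteq> {b \<in> carr (index_L2 \<sigma> \<mu> m). slot_map m b \<in> {w \<in> carr F. \<forall>z\<in>{slot_map l a}. vinner F w z = 0}}"
    proof
      fix v assume v: "v \<in> ?T m"
      have vc: "v \<in> carr (index_L2 \<sigma> \<mu> m)" using v slot_tensors_total[of m] by (auto simp: total_def index_L2_eq)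
      show "v \<in> {b \<in> carr (index_L2 \<sigma> \<mu> m). slot_map m b \<in> {w \<in> carr F. \<forall>z\<in>{slot_map l a}. vinner F w z = 0}}"
        using step1[OF v a] vc Sc[OF a vc] by (simp add: F.inner_sym[of "slot_map m v"])
    qed
  qed
  then show ?thesis using Sc[OF a b] by (simp add: F.inner_sym[of "slot_map l a"])
qed

text \<open>An elementary tensor of functions f(t) p(t, s), with p an orthogonal polynomial, lies in
  the range that belongs to the list of its degrees.\<close>

lemma slot_maps_total:
  "total F (insert (vacuum N) (\<Union>l\<in>multi_indices. slot_map l ` carr (index_L2 \<sigma> \<mu> l)))"
proof -
  let ?G = "{\<lambda>z. f (fst z) * opoly l z | f l. f \<in> sqint (wm l)}"
  have "total F (tensor N ` lists ?G)"
    by (rule tensors_total[OF _ slots_total]) (use slot_sqint in auto)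
  then show ?thesis
  proof (rule total_mono)
    show "tensor N ` lists ?G \<subseteq> insert (vacuum N) (\<Union>l\<in>multi_indices. slot_map l ` carr (index_L2 \<sigma> \<mu> l))"
    proof (rule image_subsetI)
      fix gs assume gs: "gs \<in> lists ?G"
      show "tensor N gs \<in> insert (vacuum N) (\<Union>l\<in>multi_indices. slot_map l ` carr (index_L2 \<sigma> \<mu> l))"
      proof (cases "gs = []")
        case False
        have "\<forall>j<length gs. \<exists>f l. gs ! j = (\<lambda>z. f (fst z) * opoly l z) \<and> f \<in> sqint (wm l)"
        proof (intro allI impI)
          fix j assume "j < length gs"
          then have "gs ! j \<in> ?G" using gs nth_mem by blast
          then show "\<exists>f l. gs ! j = (\<lambda>z. f (fst z) * opoly l z) \<and> f \<in> sqint (wm l)" by blast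
        qed
        then obtain f l where fl: "\<And>j. j < length gs \<Longrightarrow> gs ! j = (\<lambda>z. f j (fst z) * opoly (l j) z)"
          "\<And>j. j < length gs \<Longrightarrow> f j \<in> sqint (wm (l j))" by metis
        let ?l = "map l [0..<length gs]"
        have l: "?l \<in> multi_indices" using False by (simp add: multi_indices_def)
        have "tensor N gs = slot_map ?l (ae_class (im ?l) (\<lambda>t. \<Prod>j<length ?l. f j (t j)))"
        proof -
          have "gs = map (\<lambda>j z. f j (fst z) * opoly (?l ! j) z) [0..<length ?l]"
            by (rule nth_equalityI) (simp_all add: fl(1))
          then show ?thesis using slot_map_tensor[OF l, of f] fl(2) by simp
        qed
        moreover have "ae_class (im ?l) (\<lambda>t. \<Prod>j<length ?l. f j (t j)) \<in> carr (index_L2 \<sigma> \<mu> ?l)"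
        proof -
          interpret I: product_sigma_finite "\<lambda>j. wm (?l ! j)" by (rule product_sigma_finite_wm)
          show ?thesis
            unfolding index_L2_eq unfolding index_measure_def
            by (intro ae_class_closed I.prod_sqint) (use fl(2) in auto)
        qed
        ultimately show ?thesis using l by blast
      qed (simp add: tensor_eq)
    qed
    show "insert (vacuum N) (\<Union>l\<in>multi_indices. slot_map l ` carr (index_L2 \<sigma> \<mu> l)) \<subseteq> carr F"
      using conformal_closed[OF slot_map_conformal] by auto
  qed
qed

end

section \<open>Rectangles with disjoint neighbouring sides\<close>

lemma countable_neighbour_disjoint:
  assumes "countable B"
  shows "countable {us \<in> lists (insert {} B). length us = n \<and> (\<forall>j. Suc j < n \<longrightarrow> us ! j \<inter> us ! Suc j = {})}"
  by (rule countable_subset[of _ "lists (insert {} B)"]) (use assms in auto)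

context jacobi_field begin

lemma sqint_wm_indicator: "\<Delta> \<in> rel_compact_borel \<Longrightarrow> indicator \<Delta> \<in> sqint (wm l)"
  by (rule sqint_indicator) (simp_all only: sets_wm rel_compactD emeasure_wm_finite)

definition rect_indices :: "nat list \<Rightarrow> 'a set list set" where
  "rect_indices l = {\<Delta> \<in> lists rel_compact_borel. length \<Delta> = length l \<and>
    (\<forall>j. Suc j < length l \<longrightarrow> \<Delta> ! j \<inter> \<Delta> ! Suc j = {})}"

lemma component_measurable: "j < length l \<Longrightarrow> (\<lambda>t. t j) \<in> borel_measurable (im l)"
  using measurable_component_singleton[of j "{..<length l}" "\<lambda>j. wm (l ! j)"]
    measurable_cong_sets[OF refl sets_wm[of "l ! j"], of "PiM {..<length l} (\<lambda>j. wm (l ! j))"]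
  by (simp add: index_measure_def)

text \<open>With all other coordinates fixed, equality with the coordinate j confines the coordinate
  j + 1 to a single point, which has measure zero.\<close>

lemma AE_neighbours_distinct: "AE t in im l. \<forall>j. Suc j < length l \<longrightarrow> t j \<noteq> t (Suc j)"
proof (subst AE_all_countable, intro allI)
  fix j
  interpret I: product_sigma_finite "\<lambda>j. wm (l ! j)" by (rule product_sigma_finite_wm)
  show "AE t in im l. Suc j < length l \<longrightarrow> t j \<noteq> t (Suc j)"
  proof (cases "Suc j < length l")
    case True
    let ?D = "{t \<in> space (im l). t j = t (Suc j)}"
    let ?J = "{..<length l} - {Suc j}"
    have D: "?D \<in> sets (im l)"
      using True by (intro measurable_equality_set component_measurable) simp_all
    have ins: "insert (Suc j) ?J = {..<length l}" using True by auto
    have "emeasure (im l) ?D = (\<integral>\<^sup>+t. indicator ?D t \<partial>im l)" using D by simp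
    also have "\<dots> = (\<integral>\<^sup>+t. indicator ?D t \<partial>PiM (insert (Suc j) ?J) (\<lambda>j. wm (l ! j)))"
      unfolding ins index_measure_def ..
    also have "\<dots> = (\<integral>\<^sup>+x. \<integral>\<^sup>+y. indicator ?D (x(Suc j := y)) \<partial>wm (l ! Suc j) \<partial>PiM ?J (\<lambda>j. wm (l ! j)))"
    proof (rule I.product_nn_integral_insert)
      show "indicator ?D \<in> borel_measurable (PiM (insert (Suc j) ?J) (\<lambda>j. wm (l ! j)))"
        unfolding ins using D by (simp add: index_measure_def)
    qed simp_all
    also have "\<dots> = (\<integral>\<^sup>+x. 0 \<partial>PiM ?J (\<lambda>j. wm (l ! j)))"
    proof (rule nn_integral_cong)
      fix x
      have "(\<integral>\<^sup>+y. indicator ?D (x(Suc j := y)) \<partial>wm (l ! Suc j)) \<le> (\<integral>\<^sup>+y. indicator {x j} y \<partial>wm (l ! Suc j))"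
        by (intro nn_integral_mono) (auto simp: indicator_def)
      also have "\<dots> = 0" by (simp add: sets_wm emeasure_wm_point)
      finally show "(\<integral>\<^sup>+y. indicator ?D (x(Suc j := y)) \<partial>wm (l ! Suc j)) = 0" by simp
    qed
    also have "\<dots> = 0" by simp
    finally have "emeasure (im l) ?D = 0" .
    then show ?thesis
      using D by (intro AE_I[of _ _ ?D]) auto
  qed simp
qed

text \<open>The points without equal neighbouring coordinates form an open set, which is covered by
  countably many of the admissible rectangles; inside each of them all rectangles are admissible.\<close>

lemma rectangles_total:
  "total (l2 (im l)) ((\<lambda>\<Delta>. ae_class (im l) (\<lambda>t. \<Prod>j<length l. indicator (\<Delta> ! j) (t j))) ` rect_indices l)"
  (is "total _ (?c ` _)")
proof (rule totalI)
  interpret I: product_sigma_finite "\<lambda>j. wm (l ! j)" by (rule product_sigma_finite_wm)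
  let ?n = "length l"
  have sq: "(\<lambda>t. \<Prod>j<?n. indicator (A j) (t j)) \<in> sqint (im l)"
    if "\<And>j. j < ?n \<Longrightarrow> A j \<in> rel_compact_borel" for A
    unfolding index_measure_def
    by (rule I.prod_sqint) (use that in \<open>auto intro: sqint_wm_indicator\<close>)
  have \<Delta>c: "\<Delta> ! j \<in> rel_compact_borel" if "\<Delta> \<in> rect_indices l" "j < ?n" for \<Delta> j
    using that nth_mem[of j \<Delta>] by (auto simp: rect_indices_def)
  show "?c ` rect_indices l \<subseteq> carr (l2 (im l))"
    using sq \<Delta>c by auto
  fix S v assume S: "closed_subspace (l2 (im l)) S" "?c ` rect_indices l \<subseteq> S" and v: "v \<in> carr (l2 (im l))"
  interpret W: l2_subspace "im l" S by unfold_locales (rule S)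
  \<comment> \<open>The empty set is added to the sides so that \<open>Q\<close> contains a list of
    empty sets and can be enumerated by the natural numbers.\<close>
  define Q where "Q = {us \<in> lists (insert {} base). length us = ?n \<and> (\<forall>j. Suc j < ?n \<longrightarrow> us ! j \<inter> us ! Suc j = {})}"
  have Q: "countable Q" unfolding Q_def by (rule countable_neighbour_disjoint[OF base(1)])
  have "replicate ?n {} \<in> Q" by (auto simp: Q_def)
  then have Qne: "Q \<noteq> {}" by blast
  define R where "R k j = from_nat_into Q k ! j" for k j
  have RQ: "from_nat_into Q k \<in> Q" for k by (rule from_nat_into[OF Qne])
  have Rb: "R k j = {} \<or> R k j \<in> base" if "j < ?n" for k j
    using RQ[of k] nth_mem[of j "from_nat_into Q k"] that by (auto simp: Q_def R_def)
  have Rc: "compact (closure (R k j))" "R k j \<in> sets borel" if "j < ?n" for k j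
    using Rb[OF that, of k] base(2,3) by auto
  have Rd: "R k j \<inter> R k (Suc j) = {}" if "Suc j < ?n" for k j
    using RQ[of k] that by (auto simp: Q_def R_def)
  have Rr: "R k j \<in> rel_compact_borel" if "j < ?n" for k j
    using Rc[OF that] by (simp add: rel_compact_borel_def)
  have Rfin: "emeasure (wm (l ! j)) (R k j) < \<infinity>" if "j < ?n" for k j
    by (rule emeasure_wm_finite[OF Rr[OF that]])
  let ?U = "\<lambda>k. PiE {..<?n} (R k)"
  have "S = carr (l2 (im l))"
  proof (rule W.funs_eq_sqint(2)[of ?U])
    show "?U k \<in> sets (im l)" for k
      unfolding index_measure_def using Rc by (intro sets_PiM_I_finite) (auto simp: sets_wm)
    have "(\<Prod>j<?n. emeasure (wm (l ! j)) (R k j)) \<noteq> \<infinity>" for k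
      using Rfin by (simp add: ennreal_prod_eq_top less_top)
    then show "emeasure (im l) (?U k) < \<infinity>" for k
      unfolding index_measure_def using Rc by (subst I.emeasure_PiM) (auto simp: sets_wm less_top)
    show "AE t in im l. t \<in> (\<Union>k. ?U k)"
      using AE_neighbours_distinct AE_space
    proof eventually_elim
      case (elim t)
      have "\<forall>j. \<exists>V V'. open V \<and> open V' \<and> (Suc j < ?n \<longrightarrow> t j \<in> V \<and> t (Suc j) \<in> V' \<and> V \<inter> V' = {})"
      proof
        fix j
        show "\<exists>V V'. open V \<and> open V' \<and> (Suc j < ?n \<longrightarrow> t j \<in> V \<and> t (Suc j) \<in> V' \<and> V \<inter> V' = {})"
        proof (cases "Suc j < ?n")
          case True
          then have "t j \<noteq> t (Suc j)" using elim(1) by simp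
          from hausdorff[OF this] show ?thesis using True by simp
        qed auto
      qed
      then obtain V V' where VV: "\<And>j. open (V j)" "\<And>j. open (V' j)"
        "\<And>j. Suc j < ?n \<Longrightarrow> t j \<in> V j \<and> t (Suc j) \<in> V' j \<and> V j \<inter> V' j = {}"
        by metis
      \<comment> \<open>An open set that respects the separation of the coordinate j from both of
        its neighbours; the first and the last coordinate have a neighbour on one side only.\<close>
      define B where "B j = (if Suc j < ?n then V j else UNIV) \<inter> (if j > 0 then V' (j - 1) else UNIV)" for j
      have B: "open (B j)" for j using VV(1,2) by (auto simp: B_def)
      have tB: "t j \<in> B j" if "j < ?n" for j
        using VV(3)[of j] VV(3)[of "j - 1"] that by (auto simp: B_def)
      have "\<forall>j. \<exists>u. j < ?n \<longrightarrow> u \<in> base \<and> t j \<in> u \<and> closure u \<subseteq> B j"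
        using base(4)[OF B tB] by blast
      then obtain u where u: "\<And>j. j < ?n \<Longrightarrow> u j \<in> base \<and> t j \<in> u j \<and> closure (u j) \<subseteq> B j"
        by metis
      have uB: "u j \<subseteq> B j" if "j < ?n" for j using u[OF that] closure_subset[of "u j"] by blast
      have "map u [0..<?n] \<in> Q"
      proof -
        have "u j \<inter> u (Suc j) = {}" if "Suc j < ?n" for j
          using uB[of j] uB[of "Suc j"] VV(3)[OF that] that by (auto simp: B_def)
        then show ?thesis using u by (auto simp: Q_def)
      qed
      then obtain k where k: "from_nat_into Q k = map u [0..<?n]"
        using from_nat_into_surj[OF Q] by blast
      have "t \<in> ?U k"
      proof (rule PiE_I)
        show "t j \<in> R k j" if "j \<in> {..<?n}" for j using that u[of j] by (simp add: R_def k)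
        show "t j = undefined" if "j \<notin> {..<?n}" for j
          using elim(2) that by (auto simp: index_measure_def space_PiM PiE_def extensional_def)
      qed
      then show ?case by blast
    qed
    show "indicator (A \<inter> ?U k) \<in> W.funs" if A: "A \<in> sets (im l)" for A k
      unfolding index_measure_def
    proof (rule I.rectangle_dynkin[OF _ W.l2_subspace_axioms[unfolded index_measure_def]])
      show "R k j \<in> sets (wm (l ! j))" "emeasure (wm (l ! j)) (R k j) < \<infinity>" if "j \<in> {..<?n}" for j
        using that Rc Rfin by (auto simp: sets_wm)
      show "A \<in> sets (PiM {..<?n} (\<lambda>j. wm (l ! j)))" using A by (simp add: index_measure_def)
      fix A assume A: "\<And>j. j \<in> {..<?n} \<Longrightarrow> A j \<in> sets (wm (l ! j))" "\<And>j. j \<in> {..<?n} \<Longrightarrow> A j \<subseteq> R k j"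
      have Ar: "A j \<in> rel_compact_borel" if "j < ?n" for j
        using A[of j] that Rc(1)[OF that, of k] closure_subset[of "R k j"]
        by (intro subset_rel_compact[of "A j" "closure (R k j)"]) (auto simp: sets_wm)
      let ?\<Delta> = "map A [0..<?n]"
      \<comment> \<open>Disjointness of neighbouring sides passes to subsets, so every measurable
        rectangle inside \<open>?U k\<close> is available.\<close>
      have "?\<Delta> \<in> rect_indices l"
      proof -
        have "A j \<inter> A (Suc j) = {}" if "Suc j < ?n" for j
          using A(2)[of j] A(2)[of "Suc j"] Rd[OF that, of k] that by auto
        then show ?thesis using Ar by (auto simp: rect_indices_def)
      qed
      then have "?c ?\<Delta> \<in> S" using S(2) by blast
      also have "(\<lambda>t. \<Prod>j<?n. indicator (?\<Delta> ! j) (t j)) = (\<lambda>t. \<Prod>j<?n. indicator (A j) (t j) :: real)"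
        by simp
      finally have "(\<lambda>t. \<Prod>j<?n. indicator (A j) (t j)) \<in> W.funs"
        using sq[OF Ar] by (simp add: W.funs_def)
      then have "indicator (PiE {..<?n} A) \<in> W.funs"
      proof (rule W.funs_AE)
        show "indicator (PiE {..<?n} A) \<in> borel_measurable (im l)"
          unfolding index_measure_def using A(1) by (intro borel_measurable_indicator sets_PiM_I_finite) auto
        show "AE z in im l. indicator (PiE {..<?n} A) z = (\<Prod>j<?n. indicator (A j) (z j) :: real)"
          unfolding index_measure_def by (rule AE_I2) (rule I.indicator_PiE_eq, simp)
      qed
      then show "indicator (PiE {..<?n} A) \<in> l2_subspace.funs (PiM {..<?n} (\<lambda>j. wm (l ! j))) S"
        by (simp add: index_measure_def)
    qed simp
  qed
  then show "v \<in> S" using v by simp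
qed

section \<open>The space of square integrable functionals\<close>

lemma x_op_eq: "x_op \<sigma> \<mu> h = field_op snd h"
  by (simp add: x_op_def field_op_def Let_def case_prod_unfold)

abbreviation "poly_space \<equiv> polynomial_space \<sigma> \<mu>"
abbreviation "L \<equiv> L2_tau \<sigma> \<mu>"
abbreviation "Imap \<equiv> I_map \<sigma> \<mu>"

lemma poly_space_simps:
  "carr poly_space = op_polynomials F (field_op snd ` test_functions)"
  "vadd poly_space = op_add F" "vscale poly_space = op_scale F"
  "vzero poly_space = op_scale F 0 (op_one F)"
  "vinner poly_space P Q = vinner F (P (vacuum N)) (Q (vacuum N))"
  by (simp_all add: polynomial_space_def Let_def x_op_eq[abs_def])

lemma poly_space_vacuum_closed: "P \<in> carr poly_space \<Longrightarrow> P (vacuum N) \<in> carr F"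
  unfolding poly_space_simps
  by (rule op_polynomials_closed) (auto intro: field_op_closed test_functions_admissible(1))

text \<open>A polynomial P is realised by the vector P \<Omega>. Cyclicity puts the tensors of test
  functions into the image, which makes the image dense.\<close>

sublocale PH: pre_hilbert poly_space F "\<lambda>P. P (vacuum N)" "tensor N ` lists test_functions"
proof
  show "total F (tensor N ` lists test_functions)"
    by (rule tensors_total[OF _ test_functions_total]) (use test_functions_admissible(2) in blast)
  show "tensor N ` lists test_functions \<subseteq> (\<lambda>P. P (vacuum N)) ` carr poly_space"
  proof (rule image_subsetI)
    fix gs :: "('a \<times> real \<Rightarrow> real) list" assume "gs \<in> lists test_functions"
    then have "\<exists>A\<in>op_polynomials F (field_op snd ` test_functions). A (vacuum N) = tensor N gs"
      by (rule vacuum_cyclic[OF test_functions_admissible(1) test_functions_product, rotated -1])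
    then obtain A where A: "A \<in> op_polynomials F (field_op snd ` test_functions)" "A (vacuum N) = tensor N gs"
      by blast
    show "tensor N gs \<in> (\<lambda>P. P (vacuum N)) ` carr poly_space"
      unfolding poly_space_simps(1) using A by (intro image_eqI[where x = A]) simp_all
  qed
  have z: "vscale F 0 (vacuum N) = vzero F"
    by (rule F.eqI) (simp_all add: F.inner_simps)
  show "vzero poly_space (vacuum N) = vzero F"
    by (simp add: poly_space_simps op_scale_def op_one_def z)
  show "vzero poly_space \<in> carr poly_space"
    unfolding poly_space_simps by (intro op_polynomials.scale op_polynomials.one)
qed (auto simp: poly_space_simps op_add_def op_scale_def op_polynomials.add[unfolded op_add_def]
    op_polynomials.scale[unfolded op_scale_def] poly_space_vacuum_closed[unfolded poly_space_simps])

lemma L_eq: "L = completion poly_space"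
  by (simp add: L2_tau_def)

sublocale L: hilbert_space L
  unfolding L_eq by (rule PH.completion_hilbert)

lemma Imap_eq: "Imap = restrict PH.completion_map (carr L)"
  unfolding I_map_def L_eq by (rule PH.completion_unique)

lemma Imap_unitary: "unitary L F Imap"
proof -
  have "unitary L F PH.completion_map" unfolding L_eq by (rule PH.completion_unitary)
  then show ?thesis
    unfolding unitary_def linear_maps_def Imap_eq
    by (auto simp: Pi_iff inj_on_def bij_betw_def)
qed

abbreviation "Iinv \<equiv> inv_into (carr L) Imap"

lemma Iinv_unitary: "unitary F L Iinv"
  by (rule unitary_inv[OF Imap_unitary L.inner_product_space_axioms F.inner_product_space_axioms])

lemmas Iinv_apply = unitary_inv_apply[OF Imap_unitary]

lemma Iinv_linear: "Iinv \<in> linear_maps F L"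
  using Iinv_unitary by (simp add: unitary_def)

lemma const_element_eq: "const_element \<sigma> \<mu> c = Iinv (vscale F c (vacuum N))"
  by (simp add: const_element_def op_element_def op_scale_def op_one_def)

text \<open>The candidate for the stochastic integral, defined for every square integrable f through
  the Fock space.\<close>

definition stoch_map :: "nat list \<Rightarrow> ((nat \<Rightarrow> 'a) \<Rightarrow> real) set \<Rightarrow> (nat \<Rightarrow> 'a op) set" where
  "stoch_map l a = Iinv (slot_map l a)"

lemma index_L2_hilbert: "hilbert_space (index_L2 \<sigma> \<mu> l)"
  unfolding index_L2_eq by (rule l2_hilbert)

lemma index_L2_ips: "inner_product_space (index_L2 \<sigma> \<mu> l)"
  by (rule hilbert_space_inner[OF index_L2_hilbert])

lemma slot_map_closed: "l \<in> multi_indices \<Longrightarrow> a \<in> carr (index_L2 \<sigma> \<mu> l) \<Longrightarrow> slot_map l a \<in> carr F"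
  by (rule conformal_closed[OF slot_map_conformal])

lemma stoch_map_inner:
  assumes "l \<in> multi_indices" "m \<in> multi_indices" "a \<in> carr (index_L2 \<sigma> \<mu> l)" "b \<in> carr (index_L2 \<sigma> \<mu> m)"
  shows "vinner L (stoch_map l a) (stoch_map m b) = vinner F (slot_map l a) (slot_map m b)"
  unfolding stoch_map_def by (intro unitary_inner[OF Iinv_unitary] slot_map_closed assms)

lemma stoch_map_conformal:
  assumes l: "l \<in> multi_indices"
  shows "conformal (index_L2 \<sigma> \<mu> l) L 1 (stoch_map l)"
  unfolding conformal_def
  using stoch_map_inner[OF l l] conformal_inner[OF slot_map_conformal[OF l]]
    unitary_closed[OF Iinv_unitary slot_map_closed[OF l]]
  by (auto simp: stoch_map_def[abs_def])

lemma tau_subspace_eq: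
  assumes l: "l \<in> multi_indices"
  shows "tau_subspace \<sigma> \<mu> l = stoch_map l ` carr (index_L2 \<sigma> \<mu> l)"
proof
  show "tau_subspace \<sigma> \<mu> l \<subseteq> stoch_map l ` carr (index_L2 \<sigma> \<mu> l)"
  proof
    fix u assume "u \<in> tau_subspace \<sigma> \<mu> l"
    then have u: "u \<in> carr L" "Imap u \<in> slot_map l ` carr (index_L2 \<sigma> \<mu> l)"
      by (auto simp: tau_subspace_def fock_subspace_eq[OF l])
    then obtain a where a: "a \<in> carr (index_L2 \<sigma> \<mu> l)" "Imap u = slot_map l a" by blast
    then have "u = stoch_map l a" using Iinv_apply(1)[OF u(1)] by (simp add: stoch_map_def)
    then show "u \<in> stoch_map l ` carr (index_L2 \<sigma> \<mu> l)" using a by blast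
  qed
  show "stoch_map l ` carr (index_L2 \<sigma> \<mu> l) \<subseteq> tau_subspace \<sigma> \<mu> l"
    using Iinv_apply(2,3)[OF slot_map_closed[OF l]]
    by (auto simp: tau_subspace_def fock_subspace_eq[OF l] stoch_map_def)
qed

text \<open>Both sides come from the same elementary tensor: on the left because the isometry takes
  products to tensors, on the right because neighbouring factors have product 0.\<close>

lemma stoch_map_rectangle:
  assumes l: "l \<in> multi_indices" and \<Delta>: "\<Delta> \<in> rect_indices l"
  shows "stoch_map l (ae_class (im l) (\<lambda>t. \<Prod>j<length l. indicator (\<Delta> ! j) (t j))) =
    op_element \<sigma> \<mu> (op_prod F (map2 (X_op \<sigma> \<mu>) l \<Delta>))"
proof -
  have len: "length \<Delta> = length l" and dis: "\<And>j. Suc j < length l \<Longrightarrow> \<Delta> ! j \<inter> \<Delta> ! Suc j = {}"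
    using \<Delta> by (auto simp: rect_indices_def)
  have \<Delta>c: "\<Delta> ! j \<in> rel_compact_borel" if "j < length l" for j
    using \<Delta> that nth_mem[of j \<Delta>] by (auto simp: rect_indices_def)
  let ?h = "\<lambda>j z. indicator (\<Delta> ! j) (fst z) * opoly (l ! j) z"
  let ?hs = "map ?h [0..<length l]"
  have "map2 (X_op \<sigma> \<mu>) l \<Delta> = map (field_op snd) ?hs"
    by (rule nth_equalityI)
      (simp_all add: len X_op_def x_op_eq opoly_def orth_polys_oseq case_prod_unfold)
  moreover have "op_prod F (map (field_op snd) ?hs) (vacuum N) = tensor N ?hs"
  proof (rule op_prod_tensor)
    fix h assume "h \<in> set ?hs"
    then obtain j where j: "j < length l" "h = ?h j" by auto
    obtain C where C: "C \<ge> 0" "\<forall>t\<in>\<Delta> ! j. AE s in \<mu> t. \<bar>opoly (l ! j) (t, s)\<bar> \<le> C"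
      using opoly_bound[OF \<Delta>c[OF j(1)]] by blast
    show "admissible snd h"
      unfolding j(2)
    proof (rule admissible_bounded_support[OF _ \<Delta>c[OF j(1)], of _ C])
      have [measurable]: "\<Delta> ! j \<in> sets borel" using rel_compactD[OF \<Delta>c[OF j(1)]] by simp
      show "?h j \<in> borel_measurable (borel \<Otimes>\<^sub>M borel)" by measurable
      show "AE s in \<mu> t. \<bar>?h j (t, s)\<bar> \<le> C" for t
        using C by (cases "t \<in> \<Delta> ! j") auto
    qed simp
  next
    fix j assume "Suc j < length ?hs"
    then show "AE z in N. (?hs ! j) z * (?hs ! Suc j) z = 0"
      using dis[of j] by (intro AE_I2) (auto simp: indicator_def)
  qed
  moreover have "slot_map l (ae_class (im l) (\<lambda>t. \<Prod>j<length l. indicator (\<Delta> ! j) (t j))) = tensor N ?hs"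
    by (rule slot_map_tensor[OF l])
      (use \<Delta>c in \<open>auto intro: sqint_wm_indicator\<close>)
  ultimately show ?thesis by (simp add: stoch_map_def op_element_def)
qed

lemma stoch_integral_eq:
  assumes l: "l \<in> multi_indices"
  shows "stoch_integral \<sigma> \<mu> l = restrict (stoch_map l) (carr (index_L2 \<sigma> \<mu> l))"
  unfolding stoch_integral_def
proof (rule the_equality)
  let ?c = "\<lambda>\<Delta>. ae_class (im l) (\<lambda>t. \<Prod>j<length l. indicator (\<Delta> ! j) (t j))"
  let ?S = "restrict (stoch_map l) (carr (index_L2 \<sigma> \<mu> l))"
  note ips = index_L2_ips[of l] L.inner_product_space_axioms
  have cc: "?c \<Delta> \<in> carr (index_L2 \<sigma> \<mu> l)" if "\<Delta> \<in> rect_indices l" for \<Delta>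
    using rectangles_total[of l] that by (auto simp: total_def index_L2_eq)
  have bd: "?S \<in> bounded_ops (index_L2 \<sigma> \<mu> l) L"
    by (rule bounded_map_restrict[OF conformal_bounded[OF stoch_map_conformal[OF l] ips] ips(1)])
  have val: "?S (?c \<Delta>) = op_element \<sigma> \<mu> (op_prod F (map2 (X_op \<sigma> \<mu>) l \<Delta>))" if "\<Delta> \<in> rect_indices l" for \<Delta>
    using cc[OF that] stoch_map_rectangle[OF l that] by simp
  show "?S \<in> bounded_ops (index_L2 \<sigma> \<mu> l) L \<and> ?S ` carr (index_L2 \<sigma> \<mu> l) \<subseteq> tau_subspace \<sigma> \<mu> l \<and>
    (\<forall>\<Delta>\<in>lists rel_compact_borel. length \<Delta> = length l \<and> (\<forall>j. Suc j < length l \<longrightarrow> \<Delta> ! j \<inter> \<Delta> ! Suc j = {}) \<longrightarrow>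
        ?S (?c \<Delta>) = op_element \<sigma> \<mu> (op_prod F (map2 (X_op \<sigma> \<mu>) l \<Delta>)))"
    using bd val tau_subspace_eq[OF l] unfolding rect_indices_def by auto
  fix S assume S: "S \<in> bounded_ops (index_L2 \<sigma> \<mu> l) L \<and> S ` carr (index_L2 \<sigma> \<mu> l) \<subseteq> tau_subspace \<sigma> \<mu> l \<and>
    (\<forall>\<Delta>\<in>lists rel_compact_borel. length \<Delta> = length l \<and> (\<forall>j. Suc j < length l \<longrightarrow> \<Delta> ! j \<inter> \<Delta> ! Suc j = {}) \<longrightarrow>
        S (?c \<Delta>) = op_element \<sigma> \<mu> (op_prod F (map2 (X_op \<sigma> \<mu>) l \<Delta>)))"
  show "S = ?S"
  proof (rule bounded_ops_eqI[OF _ bd ips rectangles_total[of l, folded index_L2_eq]])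
    show "S \<in> bounded_ops (index_L2 \<sigma> \<mu> l) L" using S by blast
    fix v assume "v \<in> ?c ` rect_indices l"
    then obtain \<Delta> where \<Delta>: "\<Delta> \<in> rect_indices l" "v = ?c \<Delta>" by blast
    then have "S v = op_element \<sigma> \<mu> (op_prod F (map2 (X_op \<sigma> \<mu>) l \<Delta>))"
      using S unfolding rect_indices_def by simp
    then show "S v = ?S v" unfolding \<Delta>(2) using val[OF \<Delta>(1)] by simp
  qed
qed

section \<open>The orthogonal expansion\<close>

sublocale DX: direct_sum multi_indices "index_L2 \<sigma> \<mu>"
  by (rule direct_sum.intro) (rule index_L2_ips)

sublocale RX: real_direct_sum "dsum multi_indices (index_L2 \<sigma> \<mu>)"
  by (rule real_direct_sum.intro) (rule DX.dsum_inner_space)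

abbreviation "X \<equiv> expansion_space \<sigma> \<mu>"

sublocale X: hilbert_space X
  unfolding expansion_space_def by (rule real_dsum_hilbert, rule dsum_hilbert, rule index_L2_hilbert)

lemmas X_ops = RX.real_dsum_ops[folded expansion_space_def]

abbreviation "trm \<equiv> expansion_term \<sigma> \<mu>"

lemma X_comp: "f \<in> carr X \<Longrightarrow> l \<in> multi_indices \<Longrightarrow> snd f l \<in> carr (index_L2 \<sigma> \<mu> l)"
  by (rule DX.dsum_comp) (auto simp: X_ops)

lemma trm_None: "trm f None = Iinv (vscale F (fst f) (vacuum N))"
  by (simp add: expansion_term_def const_element_eq)

lemma trm_Some: "f \<in> carr X \<Longrightarrow> l \<in> multi_indices \<Longrightarrow> trm f (Some l) = stoch_map l (snd f l)"
  by (simp add: expansion_term_def stoch_integral_eq X_comp)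

lemma summand_cases:
  assumes "k \<in> summand_indices"
  obtains "k = None" | l where "l \<in> multi_indices" "k = Some l"
  using assms by (auto simp: summand_indices_def)

lemma trm_closed:
  assumes "f \<in> carr X" "k \<in> summand_indices"
  shows "trm f k \<in> carr L"
  using assms(2)
proof (cases k rule: summand_cases)
  case 1
  then show ?thesis by (simp add: trm_None Iinv_apply(3))
next
  case (2 l)
  then show ?thesis
    using conformal_closed[OF stoch_map_conformal[OF 2(1)] X_comp[OF assms(1) 2(1)]] by (simp add: trm_Some assms)
qed

lemma vacuum_slot_map:
  assumes l: "l \<in> multi_indices" and a: "a \<in> carr (index_L2 \<sigma> \<mu> l)"
  shows "vinner F (vacuum N) (slot_map l a) = 0"
  unfolding slot_map_def using l a slot_fun_sqint[OF l2_rep(1), of a l]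
  by (intro inner_vacuum(2) length_ge_1 ae_class_closed) (auto simp: multi_indices_def index_L2_eq)

text \<open>The properties of the expansion are read off from this table: orthogonality of the
  terms, convergence of the series and the isometry of \<open>J_map\<close>.\<close>

lemma trm_inner:
  assumes f: "f \<in> carr X" and g: "g \<in> carr X" and k: "k \<in> summand_indices" and m: "m \<in> summand_indices"
  shows "vinner L (trm f k) (trm g m) = (if k = m
    then (case k of None \<Rightarrow> fst f * fst g | Some l \<Rightarrow> vinner (index_L2 \<sigma> \<mu> l) (snd f l) (snd g l)) else 0)"
proof -
  have none: "vinner L (Iinv (vscale F c (vacuum N))) (stoch_map l a) = 0"
    if "l \<in> multi_indices" "a \<in> carr (index_L2 \<sigma> \<mu> l)" for c l a
    unfolding stoch_map_def using that
    by (subst unitary_inner[OF Iinv_unitary]) (simp_all add: slot_map_closed F.inner_simps vacuum_slot_map)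
  show ?thesis
    using k
  proof (cases k rule: summand_cases)
    case k: 1
    show ?thesis
      using m
    proof (cases m rule: summand_cases)
      case 1
      then show ?thesis
        unfolding k 1 trm_None by (subst unitary_inner[OF Iinv_unitary]) (simp_all add: F.inner_simps inner_vacuum)
    next
      case (2 l)
      then show ?thesis unfolding k using none[OF 2(1) X_comp[OF g 2(1)]] by (simp add: trm_None trm_Some g)
    qed
  next
    case k: (2 l)
    show ?thesis
      using m
    proof (cases m rule: summand_cases)
      case 1
      then show ?thesis
        using none[OF k(1) X_comp[OF f k(1)], of "fst g"] L.inner_sym[OF trm_closed[OF f \<open>k \<in> summand_indices\<close>] trm_closed[OF g m]]
        unfolding k by (simp add: trm_None trm_Some f k)
    next
      case (2 l')
      show ?thesis
      proof (cases "l = l'")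
        case True
        then show ?thesis
          unfolding k 2 using conformal_inner[OF stoch_map_conformal[OF 2(1)] X_comp[OF f 2(1)] X_comp[OF g 2(1)]]
          by (simp add: trm_Some f g 2)
      next
        case False
        then show ?thesis
          unfolding k 2 using stoch_map_inner[OF k(1) 2(1) X_comp[OF f k(1)] X_comp[OF g 2(1)]]
            slot_map_orthogonal[OF k(1) 2(1) False X_comp[OF f k(1)] X_comp[OF g 2(1)]]
          by (simp add: trm_Some f g 2 k)
      qed
    qed
  qed
qed

lemma has_sum_summands:
  fixes g :: "nat list \<Rightarrow> real"
  assumes "(g has_sum s) multi_indices" "\<And>l. l \<in> multi_indices \<Longrightarrow> h (Some l) = g l"
  shows "(h has_sum (h None + s)) summand_indices"
proof -
  have "((h \<circ> Some) has_sum s) multi_indices"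
    using assms by (simp cong: has_sum_cong)
  then have "(h has_sum s) (Some ` multi_indices)"
    by (subst has_sum_reindex) simp_all
  then show ?thesis
    unfolding summand_indices_def by (intro has_sum_insert) auto
qed

text \<open>\<open>J_map\<close> adds the constant to a sum over the multi-indices, and
  \<open>vsum\<close> can be evaluated only once convergence is shown. This sum and the one over all
  summands both exist by orthogonality, and inner products with arbitrary w identify the
  results.\<close>

lemma J_has_sum:
  assumes f: "f \<in> carr X"
  shows "vhas_sum L (trm f) summand_indices (J_map \<sigma> \<mu> f)"
proof -
  have fd: "snd f \<in> carr (dsum multi_indices (index_L2 \<sigma> \<mu>))" using f by (auto simp: X_ops)
  have sub: "Some l \<in> summand_indices" if "l \<in> multi_indices" for l
    using that by (simp add: summand_indices_def)
  have N: "None \<in> summand_indices" by (simp add: summand_indices_def)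
  have hs: "((\<lambda>l. vinner (index_L2 \<sigma> \<mu> l) (snd f l) (snd f l)) has_sum
      vinner (dsum multi_indices (index_L2 \<sigma> \<mu>)) (snd f) (snd f)) multi_indices"
    unfolding DX.dsum_ops(4) using DX.dsum_inner_summable[OF fd fd] by simp
  have "\<exists>v. vhas_sum L (\<lambda>l. trm f (Some l)) multi_indices v"
  proof (rule L.orthogonal_vhas_sum)
    show "(\<lambda>l. vinner L (trm f (Some l)) (trm f (Some l))) summable_on multi_indices"
      using has_sum_imp_summable[OF hs]
      by (rule iffD1[OF summable_on_cong, rotated]) (simp add: trm_inner f sub)
  qed (simp_all add: trm_closed trm_inner f sub)
  then obtain v1 where v1: "vhas_sum L (\<lambda>l. trm f (Some l)) multi_indices v1" by blast
  then have v1c: "v1 \<in> carr L" by (simp add: vhas_sum_def)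
  have "\<exists>v. vhas_sum L (trm f) summand_indices v"
  proof (rule L.orthogonal_vhas_sum)
    have "((\<lambda>k. vinner L (trm f k) (trm f k)) has_sum (vinner L (trm f None) (trm f None) +
        vinner (dsum multi_indices (index_L2 \<sigma> \<mu>)) (snd f) (snd f))) summand_indices"
      by (rule has_sum_summands[OF hs]) (simp add: trm_inner f sub)
    then show "(\<lambda>k. vinner L (trm f k) (trm f k)) summable_on summand_indices"
      by (rule has_sum_imp_summable)
  qed (simp_all add: trm_closed trm_inner f)
  then obtain v where v: "vhas_sum L (trm f) summand_indices v" by blast
  then have vc: "v \<in> carr L" by (simp add: vhas_sum_def)
  have "J_map \<sigma> \<mu> f = vadd L (trm f None) v1"
    unfolding J_map_def using L.vsum_eq[OF v1] by (simp add: expansion_term_def)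
  also have "\<dots> = v"
  proof (rule L.eqI[OF _ vc])
    show "vadd L (trm f None) v1 \<in> carr L" using trm_closed[OF f N] v1c by simp
    fix w assume w: "w \<in> carr L"
    have "((\<lambda>k. vinner L (trm f k) w) has_sum (vinner L (trm f None) w + vinner L v1 w)) summand_indices"
      by (rule has_sum_summands[OF L.vhas_sum_inner[OF v1 w]]) simp
    then have "vinner L v w = vinner L (trm f None) w + vinner L v1 w"
      using has_sum_unique[OF L.vhas_sum_inner[OF v w]] by blast
    then show "vinner L (vadd L (trm f None) v1) w = vinner L v w"
      using trm_closed[OF f N] v1c w by (simp add: L.inner_simps)
  qed
  finally show ?thesis using v by simp
qed

lemma J_conformal: "conformal X L 1 (J_map \<sigma> \<mu>)"
  unfolding conformal_def
proof (intro conjI ballI funcsetI)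
  fix f g assume f: "f \<in> carr X" and g: "g \<in> carr X"
  have fd: "snd f \<in> carr (dsum multi_indices (index_L2 \<sigma> \<mu>))" "snd g \<in> carr (dsum multi_indices (index_L2 \<sigma> \<mu>))"
    using f g by (auto simp: X_ops)
  have hs: "((\<lambda>l. vinner (index_L2 \<sigma> \<mu> l) (snd f l) (snd g l)) has_sum
      vinner (dsum multi_indices (index_L2 \<sigma> \<mu>)) (snd f) (snd g)) multi_indices"
    unfolding DX.dsum_ops(4) using DX.dsum_inner_summable[OF fd] by simp
  have N: "None \<in> summand_indices" by (simp add: summand_indices_def)
  have "((\<lambda>k. vinner L (trm f k) (trm g k)) has_sum (vinner L (trm f None) (trm g None) +
      vinner (dsum multi_indices (index_L2 \<sigma> \<mu>)) (snd f) (snd g))) summand_indices"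
    by (rule has_sum_summands[OF hs]) (simp add: trm_inner f g summand_indices_def)
  moreover have "((\<lambda>k. vinner L (trm f k) (trm g k)) has_sum vinner L (J_map \<sigma> \<mu> f) (J_map \<sigma> \<mu> g)) summand_indices"
    by (rule L.vhas_sum_inner_orthogonal[OF J_has_sum[OF f] J_has_sum[OF g]]) (simp add: trm_inner f g)
  ultimately have "vinner L (J_map \<sigma> \<mu> f) (J_map \<sigma> \<mu> g) = vinner L (trm f None) (trm g None) +
      vinner (dsum multi_indices (index_L2 \<sigma> \<mu>)) (snd f) (snd g)"
    using has_sum_unique by blast
  then show "vinner L (J_map \<sigma> \<mu> f) (J_map \<sigma> \<mu> g) = 1 * vinner X f g"
    by (simp add: trm_inner[OF f g N N] X_ops)
next
  fix f assume "f \<in> carr X"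
  then show "J_map \<sigma> \<mu> f \<in> carr L" using J_has_sum by (auto simp: vhas_sum_def)
qed simp

definition single :: "real \<Rightarrow> nat list \<Rightarrow> ((nat \<Rightarrow> 'a) \<Rightarrow> real) set \<Rightarrow>
    real \<times> (nat list \<Rightarrow> ((nat \<Rightarrow> 'a) \<Rightarrow> real) set)" where
  "single c l a = (c, DX.dembed l a)"

lemma single_closed: "l \<in> multi_indices \<Longrightarrow> a \<in> carr (index_L2 \<sigma> \<mu> l) \<Longrightarrow> single c l a \<in> carr X"
  by (simp add: single_def X_ops DX.dembed_closed)

lemma Iinv_zero: "Iinv (vzero F) = vzero L"
  by (rule linear_maps_zero[OF Iinv_linear F.inner_product_space_axioms L.inner_product_space_axioms])

lemma trm_single:
  assumes l: "l \<in> multi_indices" and a: "a \<in> carr (index_L2 \<sigma> \<mu> l)" and m: "m \<in> multi_indices"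
  shows "trm (single c l a) (Some m) = (if m = l then stoch_map l a else vzero L)"
proof (cases "m = l")
  case True
  then show ?thesis using trm_Some[OF single_closed[OF l a] l] l by (simp add: single_def DX.dembed_def)
next
  case False
  have "stoch_map m (vzero (index_L2 \<sigma> \<mu> m)) = vzero L"
    by (rule linear_maps_zero[OF bounded_map_linear[OF conformal_bounded[OF stoch_map_conformal[OF m] index_L2_ips
        L.inner_product_space_axioms]] index_L2_ips L.inner_product_space_axioms])
  then show ?thesis
    using False trm_Some[OF single_closed[OF l a] m] m by (simp add: single_def DX.dembed_def)
qed

lemma J_eq_trm:
  assumes f: "f \<in> carr X" and k: "k \<in> summand_indices"
    and zero: "\<And>m. m \<in> summand_indices \<Longrightarrow> m \<noteq> k \<Longrightarrow> trm f m = vzero L"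
  shows "J_map \<sigma> \<mu> f = trm f k"
proof (rule L.eqI)
  show "J_map \<sigma> \<mu> f \<in> carr L" using J_has_sum[OF f] by (simp add: vhas_sum_def)
  show "trm f k \<in> carr L" by (rule trm_closed[OF f k])
  fix w assume w: "w \<in> carr L"
  have "((\<lambda>m. vinner L (trm f m) w) has_sum vinner L (trm f k) w) summand_indices"
    using k zero w by (intro has_sum_finite_neutralI[of "{k}"]) (auto simp: L.inner_simps)
  then show "vinner L (J_map \<sigma> \<mu> f) w = vinner L (trm f k) w"
    using has_sum_unique[OF L.vhas_sum_inner[OF J_has_sum[OF f] w]] by blast
qed

lemma const_in_range: "Iinv (vacuum N) \<in> J_map \<sigma> \<mu> ` carr X"
proof -
  \<comment> \<open>Any multi-index would do; it serves to write the element with constant 1 and all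
    other components zero by means of \<open>single\<close>.\<close>
  have l: "[0] \<in> multi_indices" by (simp add: multi_indices_def)
  interpret Z: inner_product_space "index_L2 \<sigma> \<mu> [0]" by (rule index_L2_ips)
  let ?f = "single 1 [0] (vzero (index_L2 \<sigma> \<mu> [0]))"
  have f: "?f \<in> carr X" by (rule single_closed[OF l Z.zero_closed])
  have z: "stoch_map [0] (vzero (index_L2 \<sigma> \<mu> [0])) = vzero L"
    by (rule linear_maps_zero[OF bounded_map_linear[OF conformal_bounded[OF stoch_map_conformal[OF l] index_L2_ips
        L.inner_product_space_axioms]] index_L2_ips L.inner_product_space_axioms])
  have one: "vscale F 1 (vacuum N) = vacuum N"
    by (rule F.eqI) (simp_all add: F.inner_simps)
  have "J_map \<sigma> \<mu> ?f = trm ?f None"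
  proof (rule J_eq_trm[OF f])
    fix m assume "m \<in> summand_indices" "m \<noteq> None"
    then show "trm ?f m = vzero L"
      by (cases m rule: summand_cases) (simp_all add: trm_single[OF l Z.zero_closed] z)
  qed (simp add: summand_indices_def)
  also have "\<dots> = Iinv (vacuum N)" by (simp add: trm_None one) (simp add: single_def one)
  finally show ?thesis using f by (metis image_eqI)
qed

lemma stoch_in_range:
  assumes l: "l \<in> multi_indices" and a: "a \<in> carr (index_L2 \<sigma> \<mu> l)"
  shows "stoch_map l a \<in> J_map \<sigma> \<mu> ` carr X"
proof -
  let ?f = "single 0 l a"
  have f: "?f \<in> carr X" by (rule single_closed[OF l a])
  have z: "vscale F 0 (vacuum N) = vzero F"
    by (rule F.eqI) (simp_all add: F.inner_simps)
  have "J_map \<sigma> \<mu> ?f = trm ?f (Some l)"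
  proof (rule J_eq_trm[OF f])
    fix m assume "m \<in> summand_indices" "m \<noteq> Some l"
    then show "trm ?f m = vzero L"
      using trm_None[of "single 0 l a"]
      by (cases m rule: summand_cases) (simp_all add: trm_single[OF l a], simp add: single_def z Iinv_zero)
  qed (use l in \<open>simp add: summand_indices_def\<close>)
  also have "\<dots> = stoch_map l a" by (simp add: trm_single[OF l a l])
  finally show ?thesis using f by (metis image_eqI)
qed

text \<open>Elements of L whose images under I form a total set of the Fock space are themselves
  total; here they are the constant 1 and the stochastic integrals, all of which are values of
  \<open>J_map\<close>.\<close>

lemma J_unitary: "unitary X L (J_map \<sigma> \<mu>)"
proof (rule unitaryI[OF J_conformal X.hilbert_space_axioms L.inner_product_space_axioms])
  let ?T = "insert (vacuum N) (\<Union>l\<in>multi_indices. slot_map l ` carr (index_L2 \<sigma> \<mu> l))"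
  show "total L {a \<in> carr L. Imap a \<in> ?T}"
    by (rule total_vimage[OF Imap_unitary L.inner_product_space_axioms F.inner_product_space_axioms slot_maps_total])
  show "{a \<in> carr L. Imap a \<in> ?T} \<subseteq> J_map \<sigma> \<mu> ` carr X"
  proof clarify
    fix a assume a: "a \<in> carr L" "Imap a \<in> ?T"
    have "Iinv (Imap a) = a" by (rule Iinv_apply(1)[OF a(1)])
    moreover have "Iinv (Imap a) \<in> J_map \<sigma> \<mu> ` carr X"
      using a(2) const_in_range stoch_in_range unfolding stoch_map_def by auto
    ultimately show "a \<in> J_map \<sigma> \<mu> ` carr X" by simp
  qed
qed

section \<open>The orthogonal decomposition\<close>

lemma summand_closed:
  assumes "k \<in> summand_indices"
  shows "closed_subspace L (summand \<sigma> \<mu> k)"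
  using assms
proof (cases k rule: summand_cases)
  case 1
  \<comment> \<open>The projection onto the line of the vacuum. The constants correspond to its
    fixed vectors, which form a closed subspace as the equaliser of two bounded maps.\<close>
  define B where "B w = vscale F (vinner F w (vacuum N)) (vacuum N)" for w
  have A: "bounded_map F F (\<lambda>w. w)"
    unfolding bounded_map_def linear_maps_def by (auto intro!: exI[of _ 1])
  have B: "bounded_map F F B"
    unfolding bounded_map_def linear_maps_def
  proof (intro conjI CollectI funcsetI ballI allI)
    show "B w \<in> carr F" if "w \<in> carr F" for w by (simp add: B_def)
    show "B (vadd F u v) = vadd F (B u) (B v)" if "u \<in> carr F" "v \<in> carr F" for u v
      using that by (intro F.eqI) (simp_all add: B_def F.inner_simps distrib_right)
    show "B (vscale F c v) = vscale F c (B v)" if "v \<in> carr F" for c v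
      using that by (intro F.eqI) (simp_all add: B_def F.inner_simps)
    show "\<exists>C. \<forall>v\<in>carr F. vnorm F (B v) \<le> C * vnorm F v"
    proof (intro exI[of _ 1] ballI)
      fix v assume v: "v \<in> carr F"
      have "vnorm F (B v) = \<bar>vinner F v (vacuum N)\<bar>"
        by (simp add: vnorm_def B_def F.inner_simps inner_vacuum)
      also have "\<dots> \<le> 1 * vnorm F v"
        using F.abs_inner_le[OF v vacuum_closed] by (simp add: vnorm_def[of F "vacuum N"] inner_vacuum)
      finally show "vnorm F (B v) \<le> 1 * vnorm F v" .
    qed
  qed
  have "closed_subspace L {a \<in> carr L. Imap a \<in> {w \<in> carr F. w = B w}}"
    by (rule closed_subspace_vimage[OF conformal_bounded[OF unitary_conformal[OF Imap_unitary]]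
        _ _ closed_subspace_equalizer[OF A B]]) unfold_locales
  also have "{a \<in> carr L. Imap a \<in> {w \<in> carr F. w = B w}} = summand \<sigma> \<mu> k"
  proof
    show "{a \<in> carr L. Imap a \<in> {w \<in> carr F. w = B w}} \<subseteq> summand \<sigma> \<mu> k"
    proof clarify
      fix a assume a: "a \<in> carr L" "Imap a = B (Imap a)"
      then have "a = Iinv (B (Imap a))" using Iinv_apply(1)[OF a(1)] by simp
      then have "a = const_element \<sigma> \<mu> (vinner F (Imap a) (vacuum N))"
        by (simp add: const_element_eq B_def)
      then show "a \<in> summand \<sigma> \<mu> k" by (auto simp: summand_def 1)
    qed
    show "summand \<sigma> \<mu> k \<subseteq> {a \<in> carr L. Imap a \<in> {w \<in> carr F. w = B w}}"
    proof
      fix a assume "a \<in> summand \<sigma> \<mu> k"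
      then obtain c where c: "a = Iinv (vscale F c (vacuum N))"
        by (auto simp: summand_def 1 const_element_eq)
      have "vscale F c (vacuum N) = B (vscale F c (vacuum N))"
        by (simp add: B_def F.inner_simps inner_vacuum)
      then show "a \<in> {a \<in> carr L. Imap a \<in> {w \<in> carr F. w = B w}}"
        unfolding c by (simp add: Iinv_apply(2,3))
    qed
  qed
  finally show ?thesis .
next
  case (2 l)
  then show ?thesis
    using closed_subspace_range[OF stoch_map_conformal[OF 2(1)] zero_less_one index_L2_hilbert L.inner_product_space_axioms]
    by (simp add: summand_def tau_subspace_eq)
qed

lemma trm_in_summand: "f \<in> carr X \<Longrightarrow> k \<in> summand_indices \<Longrightarrow> trm f k \<in> summand \<sigma> \<mu> k"
  by (cases k rule: summand_cases)
    (auto simp: summand_def trm_Some tau_subspace_eq X_comp expansion_term_def[of _ _ _ None])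

text \<open>Reduces orthogonality of the summands to that of the terms of expansions.\<close>

lemma summand_trm:
  assumes "k \<in> summand_indices" "u \<in> summand \<sigma> \<mu> k"
  shows "\<exists>f\<in>carr X. u = trm f k"
  using assms(1)
proof (cases k rule: summand_cases)
  case 1
  then obtain c where c: "u = const_element \<sigma> \<mu> c" using assms(2) by (auto simp: summand_def)
  have l: "[0] \<in> multi_indices" by (simp add: multi_indices_def)
  interpret Z: inner_product_space "index_L2 \<sigma> \<mu> [0]" by (rule index_L2_ips)
  show ?thesis
    using 1 c by (intro bexI[OF _ single_closed[OF l Z.zero_closed, of c]]) (simp add: expansion_term_def single_def)
next
  case (2 l)
  then obtain a where a: "a \<in> carr (index_L2 \<sigma> \<mu> l)" "u = stoch_map l a"
    using assms(2) by (auto simp: summand_def tau_subspace_eq)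
  show ?thesis
    using 2 a by (intro bexI[OF _ single_closed[OF 2(1) a(1), of 0]]) (simp add: trm_single)
qed

lemma orthogonal_sum_summands: "orthogonal_sum L summand_indices (summand \<sigma> \<mu>)"
  unfolding orthogonal_sum_def
proof (intro conjI ballI impI)
  show "closed_subspace L (summand \<sigma> \<mu> k)" if "k \<in> summand_indices" for k by (rule summand_closed[OF that])
  fix k m u v assume km: "k \<in> summand_indices" "m \<in> summand_indices" "k \<noteq> m"
    "u \<in> summand \<sigma> \<mu> k" "v \<in> summand \<sigma> \<mu> m"
  obtain f g where "f \<in> carr X" "u = trm f k" "g \<in> carr X" "v = trm g m"
    using summand_trm km by blast
  then show "vinner L u v = 0" using km by (simp add: trm_inner)
next
  fix v assume "v \<in> carr L"
  moreover have "J_map \<sigma> \<mu> ` carr X = carr L"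
    using J_unitary by (simp add: unitary_def bij_betw_def)
  ultimately have "v \<in> J_map \<sigma> \<mu> ` carr X" by simp
  then obtain f where f: "f \<in> carr X" "v = J_map \<sigma> \<mu> f" by (rule imageE)
  then show "\<exists>x. (\<forall>k\<in>summand_indices. x k \<in> summand \<sigma> \<mu> k) \<and> vhas_sum L x summand_indices v"
    using J_has_sum[OF f(1)] trm_in_summand by (intro exI[of _ "trm f"]) simp
qed

lemma expansion_theorem:
  "unitary X L (J_map \<sigma> \<mu>) \<and>
    (\<forall>f\<in>carr X. vhas_sum L (trm f) summand_indices (J_map \<sigma> \<mu> f) \<and>
       (\<forall>k\<in>summand_indices. \<forall>m\<in>summand_indices. k \<noteq> m \<longrightarrow> vinner L (trm f k) (trm f m) = 0)) \<and>
    orthogonal_sum L summand_indices (summand \<sigma> \<mu>) \<and>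
    (\<forall>l\<in>multi_indices. stoch_integral \<sigma> \<mu> l ` carr (index_L2 \<sigma> \<mu> l) = tau_subspace \<sigma> \<mu> l)"
proof (intro conjI ballI impI)
  show "stoch_integral \<sigma> \<mu> l ` carr (index_L2 \<sigma> \<mu> l) = tau_subspace \<sigma> \<mu> l" if "l \<in> multi_indices" for l
    using that by (simp add: stoch_integral_eq tau_subspace_eq)
  show "unitary X L (J_map \<sigma> \<mu>)" by (rule J_unitary)
  show "orthogonal_sum L summand_indices (summand \<sigma> \<mu>)" by (rule orthogonal_sum_summands)
  show "vhas_sum L (trm f) summand_indices (J_map \<sigma> \<mu> f)" if "f \<in> carr X" for f
    by (rule J_has_sum[OF that])
  show "vinner L (trm f k) (trm f m) = 0"
    if "f \<in> carr X" "k \<in> summand_indices" "m \<in> summand_indices" "k \<noteq> m" for f k m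
    by (simp only: trm_inner[OF that(1,1,2,3)] that if_False)
qed

end

theorem theorem3p2:
  fixes \<sigma> :: "'a::{second_countable_topology, t2_space, perfect_space} measure"
    and \<mu> :: "'a \<Rightarrow> real measure"
  assumes "locally_compact_space (euclidean :: 'a topology)"
    and "radon_measure \<sigma>"
    and "non_atomic \<sigma>"
    and "\<And>U. open U \<Longrightarrow> U \<noteq> {} \<Longrightarrow> emeasure \<sigma> U > 0"
    and "\<And>t. prob_space (\<mu> t)"
    and "\<And>t. sets (\<mu> t) = sets borel"
    and "\<And>A. A \<in> sets borel \<Longrightarrow> (\<lambda>t. measure (\<mu> t) A) \<in> borel_measurable borel"
    and "\<And>\<Delta>. \<Delta> \<in> rel_compact_borel \<Longrightarrow> \<exists>R>0. \<forall>t\<in>\<Delta>. AE s in \<mu> t. s \<in> {-R..R}"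
  shows "unitary (expansion_space \<sigma> \<mu>) (L2_tau \<sigma> \<mu>) (J_map \<sigma> \<mu>) \<and>
    (\<forall>F\<in>carr (expansion_space \<sigma> \<mu>).
       vhas_sum (L2_tau \<sigma> \<mu>) (expansion_term \<sigma> \<mu> F) summand_indices (J_map \<sigma> \<mu> F) \<and>
       (\<forall>k\<in>summand_indices. \<forall>m\<in>summand_indices. k \<noteq> m \<longrightarrow>
          vinner (L2_tau \<sigma> \<mu>) (expansion_term \<sigma> \<mu> F k) (expansion_term \<sigma> \<mu> F m) = 0)) \<and>
    orthogonal_sum (L2_tau \<sigma> \<mu>) summand_indices (summand \<sigma> \<mu>) \<and>
    (\<forall>l\<in>multi_indices.
       stoch_integral \<sigma> \<mu> l ` carr (index_L2 \<sigma> \<mu> l) = tau_subspace \<sigma> \<mu> l)"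
proof -
  have a: "locally_compact_type TYPE('a)" by (rule locally_compact_type.intro) (rule assms(1))
  have b: "jacobi_field_axioms \<sigma> \<mu>" by (intro jacobi_field_axioms.intro) (fact assms)+
  have c: "jacobi_field \<sigma> \<mu>" by (rule jacobi_field.intro[OF a b])
  show ?thesis by (rule jacobi_field.expansion_theorem[OF c])
qed

end
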